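(* Let $(\Omega,\mathcal{A},\mathrm{P})$ be a complete probability space, $T=(0,1)^d$, and $X=(X_t)_{t\in T}$ be a centered Gaussian process over $(\Omega,\mathcal{A},\mathrm{P})$ whose covariance function is of the form $$k_X(t,t')=\prod_{i=1}^d k_0(t_i,t_i'),\qquad t,t'\in T,$$ where $k_0:(0,1)\times(0,1)\to\mathbb{R}$ is a kernel whose RKHS $H_0$ satisfies $H_0=H^s(0,1)$ as sets of functions for some $s>1/2$. Then the following statements are equivalent: (i) We have $s>1$. (ii) There exist an RKHS $H$ on $T$ with $H\subset\mathcal{L}_\infty(T)$ and a version $Y$ of $X$ such that $\mathrm{P}(\{Y_\bullet\in H\})=1$. In this case, for any $r\in(1/2,s-1/2)$, we may choose $H$ to be a Sobolev space of dominating mixed smoothness, namely an $H$ with $H\cong B^r_{2,2}(0,1)\otimes_2\cdots\otimes_2 B^r_{2,2}(0,1)$ ($d$ factors).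
   Context: All processes and functions are real-valued. An RKHS on $T$ is a reproducing kernel Hilbert space of functions $T\to\mathbb{R}$. For a centered Gaussian process $X$, the covariance function is $k_X(t,t')=\mathbb{E}(X_tX_{t'})$. A version $Y$ of $X$ is a process on the same probability space with $\mathrm{P}(X_t=Y_t)=1$ for all $t\in T$. $Y_\bullet(\omega)$ denotes the path $t\mapsto Y_t(\omega)$, and $\{Y_\bullet\in H\}=\{\omega: Y_\bullet(\omega)\in H\}$. $\mathcal{L}_\infty(T)$ is the space of bounded Borel measurable functions $T\to\mathbb{R}$. $E\cong F$ means that $E=F$ as sets and the norms are equivalent. For $s>1/2$, $H^s(\mathbb{R})=\{f\in L_2(\mathbb{R}):(1+|\cdot|^2)^{s/2}\hat f\in L_2(\mathbb{R})\}$ ($\hat f$ the Fourier transform) with norm $\|f\|_{H^s(\mathbb R)}=\|(1+|\cdot|^2)^{s/2}\hat f\|_{L_2(\mathbb{R})}$, viewed as a space of bounded continuous functions, and $H^s(0,1)=\{f_{|(0,1)}:f\in H^s(\mathbb{R})\}$ with the quotient norm $\|h\|=\inf\{\|f\|_{H^s(\mathbb{R})}:f_{|(0,1)}=h\}$. $B^r_{2,2}(0,1)$ is the Besov space on $(0,1)$, defined by restricting functions of the Besov space $B^r_{2,2}(\mathbb{R})$ to $(0,1)$ with the quotient norm; for $r>1/2$ one has $B^r_{2,2}(0,1)\cong H^r(0,1)$, so that it is an RKHS on $(0,1)$. $\otimes_2$ denotes the Hilbert space tensor product; the $d$-fold tensor product of an RKHS on $(0,1)$ with kernel $\kappa$ is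 identified with the RKHS on $(0,1)^d$ of the product kernel $(t,t')\mapsto\prod_{i=1}^d\kappa(t_i,t_i')$. *)

theory Defs
  imports "HOL-Probability.Probability"
begin

section \<open>Function spaces on a set and reproducing kernels\<close>

text \<open>A function on a set \<open>T\<close> is represented by its extension by zero to the whole type, so that
  the vector space operations on functions on \<open>T\<close> are the pointwise ones, and equality of functions
  on \<open>T\<close> is equality in HOL.\<close>

definition zero_ext :: "'a set \<Rightarrow> ('a \<Rightarrow> real) \<Rightarrow> 'a \<Rightarrow> real" where
  "zero_ext T f = (\<lambda>t. if t \<in> T then f t else 0)"

record 'a fun_space =
  fns :: "('a \<Rightarrow> real) set"
  ip :: "('a \<Rightarrow> real) \<Rightarrow> ('a \<Rightarrow> real) \<Rightarrow> real"

definition fnorm :: "'a fun_space \<Rightarrow> ('a \<Rightarrow> real) \<Rightarrow> real" where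
  "fnorm H f = sqrt (ip H f f)"

definition rkhs :: "'a set \<Rightarrow> 'a fun_space \<Rightarrow> bool" where
  "rkhs T H \<longleftrightarrow>
     \<comment> \<open>a vector space of functions on \<open>T\<close>\<close>
     (\<forall>f\<in>fns H. \<forall>t. t \<notin> T \<longrightarrow> f t = 0) \<and>
     (\<lambda>t. 0) \<in> fns H \<and>
     (\<forall>f\<in>fns H. \<forall>g\<in>fns H. (\<lambda>t. f t + g t) \<in> fns H) \<and>
     (\<forall>c. \<forall>f\<in>fns H. (\<lambda>t. c * f t) \<in> fns H) \<and>
     \<comment> \<open>an inner product on it\<close>
     (\<forall>f\<in>fns H. \<forall>g\<in>fns H. ip H f g = ip H g f) \<and>
     (\<forall>f\<in>fns H. \<forall>g\<in>fns H. \<forall>h\<in>fns H. ip H (\<lambda>t. f t + g t) h = ip H f h + ip H g h) \<and>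
     (\<forall>c. \<forall>f\<in>fns H. \<forall>g\<in>fns H. ip H (\<lambda>t. c * f t) g = c * ip H f g) \<and>
     (\<forall>f\<in>fns H. f \<noteq> (\<lambda>t. 0) \<longrightarrow> ip H f f > 0) \<and>
     \<comment> \<open>completeness\<close>
     (\<forall>u :: nat \<Rightarrow> 'a \<Rightarrow> real. range u \<subseteq> fns H \<and>
        (\<forall>e>0. \<exists>N. \<forall>m\<ge>N. \<forall>n\<ge>N. fnorm H (\<lambda>t. u m t - u n t) < e) \<longrightarrow>
        (\<exists>f\<in>fns H. (\<lambda>n. fnorm H (\<lambda>t. u n t - f t)) \<longlonglongrightarrow> 0)) \<and>
     \<comment> \<open>continuity of the point evaluations\<close>
     (\<forall>t\<in>T. \<exists>C. \<forall>f\<in>fns H. \<bar>f t\<bar> \<le> C * fnorm H f)"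

text \<open>\<open>H\<close> is the RKHS on \<open>T\<close> of the kernel \<open>k\<close>. The values of \<open>k\<close> outside \<open>T \<times> T\<close> are irrelevant.
  Symmetry and positive semi-definiteness of \<open>k\<close> on \<open>T\<close> are consequences.\<close>

definition rkhs_of_kernel :: "'a set \<Rightarrow> ('a \<Rightarrow> 'a \<Rightarrow> real) \<Rightarrow> 'a fun_space \<Rightarrow> bool" where
  "rkhs_of_kernel T k H \<longleftrightarrow> rkhs T H \<and>
     (\<forall>t\<in>T. zero_ext T (k t) \<in> fns H \<and> (\<forall>f\<in>fns H. ip H f (zero_ext T (k t)) = f t))"

definition norm_equivalent :: "'a fun_space \<Rightarrow> 'a fun_space \<Rightarrow> bool"  (infix "\<cong>\<^sub>n" 50) where
  "E \<cong>\<^sub>n F \<longleftrightarrow> fns E = fns F \<and>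
     (\<exists>c>0. \<exists>C>0. \<forall>f\<in>fns E. c * fnorm E f \<le> fnorm F f \<and> fnorm F f \<le> C * fnorm E f)"

definition bounded_borel_functions :: "'a::topological_space set \<Rightarrow> ('a \<Rightarrow> real) set" where
  "bounded_borel_functions T =
     {f. (\<forall>t. t \<notin> T \<longrightarrow> f t = 0) \<and> f \<in> borel_measurable (restrict_space borel T) \<and> bounded (f ` T)}"

abbreviation unit_interval :: "real set" where
  "unit_interval \<equiv> {0<..<1}"

definition unit_cube :: "(real ^ 'd) set" where
  "unit_cube = {t. \<forall>i. t $ i \<in> unit_interval}"

text \<open>\<open>F\<close> is the \<open>d\<close>-fold Hilbert space tensor product \<open>G \<otimes>\<^sub>2 \<dots> \<otimes>\<^sub>2 G\<close> of the RKHS \<open>G\<close> on \<open>(0,1)\<close>, where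
  \<open>d = CARD('d)\<close>, identified with the RKHS on \<open>(0,1)\<^sup>d\<close> of the product kernel.\<close>

definition tensor_power :: "real fun_space \<Rightarrow> (real ^ 'd) fun_space \<Rightarrow> bool" where
  "tensor_power G F \<longleftrightarrow>
     (\<exists>\<kappa>. rkhs_of_kernel unit_interval \<kappa> G \<and>
          rkhs_of_kernel unit_cube (\<lambda>t t'. \<Prod>i\<in>UNIV. \<kappa> (t $ i) (t' $ i)) F)"


section \<open>Sobolev and Besov spaces\<close>

definition square_integrable :: "(real \<Rightarrow> 'b::{real_normed_vector, second_countable_topology}) \<Rightarrow> bool" where
  "square_integrable g \<longleftrightarrow> g \<in> borel_measurable lborel \<and> integrable lborel (\<lambda>x. (norm (g x))\<^sup>2)"

definition truncated_fourier :: "(real \<Rightarrow> real) \<Rightarrow> real \<Rightarrow> real \<Rightarrow> complex" where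
  "truncated_fourier f R \<xi> =
     complex_of_real (1 / sqrt (2 * pi)) *
       (LINT x:{-R..R}|lborel. complex_of_real (f x) * cis (- (x * \<xi>)))"

text \<open>\<open>g\<close> is (a representative of) the Fourier transform of \<open>f \<in> L\<^sub>2(\<real>)\<close> in the sense of Plancherel, i.e. the
  \<open>L\<^sub>2\<close>-limit of the Fourier integrals of the truncations of \<open>f\<close>.\<close>

definition L2_fourier :: "(real \<Rightarrow> real) \<Rightarrow> (real \<Rightarrow> complex) \<Rightarrow> bool" where
  "L2_fourier f g \<longleftrightarrow> square_integrable f \<and> square_integrable g \<and>
     ((\<lambda>R. \<integral>\<^sup>+\<xi>. ennreal ((cmod (truncated_fourier f R \<xi> - g \<xi>))\<^sup>2) \<partial>lborel) \<longlongrightarrow> 0) at_top"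

text \<open>For \<open>s > 1/2\<close> every class in \<open>H\<^sup>s(\<real>)\<close> has exactly one continuous representative, and it is bounded;
  the space is the space of these representatives. The Besov spaces below are treated alike.\<close>

definition sobolev_R :: "real \<Rightarrow> (real \<Rightarrow> real) set" where
  "sobolev_R s = {f. continuous_on UNIV f \<and> bounded (range f) \<and> square_integrable f \<and>
     (\<exists>g. L2_fourier f g \<and> square_integrable (\<lambda>\<xi>. ((1 + \<xi>\<^sup>2) powr (s / 2)) *\<^sub>R g \<xi>))}"

definition sobolev_01 :: "real \<Rightarrow> (real \<Rightarrow> real) set" where
  "sobolev_01 s = zero_ext unit_interval ` sobolev_R s"

definition difference :: "nat \<Rightarrow> real \<Rightarrow> (real \<Rightarrow> real) \<Rightarrow> real \<Rightarrow> real" where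
  "difference m h = (\<lambda>f x. f (x + h) - f x) ^^ m"

text \<open>The squared norm of \<open>B\<^sup>r\<^sub>2\<^sub>,\<^sub>2(\<real>)\<close>, \<open>r > 0\<close>, in its description by differences of order \<open>m > r\<close>:
  \<open>\<parallel>f\<parallel>\<^sup>2 = \<parallel>f\<parallel>\<^sub>2\<^sup>2 + \<integral> \<bar>h\<bar>\<^sup>-\<^sup>2\<^sup>r \<parallel>\<Delta>\<^sub>h\<^sup>m f\<parallel>\<^sub>2\<^sup>2 dh/\<bar>h\<bar>\<close>, here with \<open>m = \<lfloor>r\<rfloor> + 1\<close>.
  The usual variants of the Besov norm are equivalent to it; this one comes from an inner product.\<close>

definition besov_energy :: "real \<Rightarrow> (real \<Rightarrow> real) \<Rightarrow> ennreal" where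
  "besov_energy r f =
     (\<integral>\<^sup>+x. ennreal ((f x)\<^sup>2) \<partial>lborel) +
     (\<integral>\<^sup>+h. ennreal (\<bar>h\<bar> powr (- 1 - 2 * r)) *
        (\<integral>\<^sup>+x. ennreal ((difference (nat \<lfloor>r\<rfloor> + 1) h f x)\<^sup>2) \<partial>lborel) \<partial>lborel)"

definition besov_R :: "real \<Rightarrow> (real \<Rightarrow> real) set" where
  "besov_R r = {f. continuous_on UNIV f \<and> bounded (range f) \<and> besov_energy r f < \<infinity>}"

definition besov_R_norm :: "real \<Rightarrow> (real \<Rightarrow> real) \<Rightarrow> real" where
  "besov_R_norm r f = sqrt (enn2real (besov_energy r f))"

definition besov_01_norm :: "real \<Rightarrow> (real \<Rightarrow> real) \<Rightarrow> real" where
  "besov_01_norm r h = Inf {besov_R_norm r f | f. f \<in> besov_R r \<and> zero_ext unit_interval f = h}"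

text \<open>\<open>B\<^sup>r\<^sub>2\<^sub>,\<^sub>2(0,1)\<close> for \<open>r > 1/2\<close>: restrictions with the quotient norm. That norm satisfies the
  parallelogram law, and the inner product is recovered from it by polarization.\<close>

definition besov_01 :: "real \<Rightarrow> real fun_space" where
  "besov_01 r = \<lparr>fns = zero_ext unit_interval ` besov_R r,
     ip = (\<lambda>f g. ((besov_01_norm r (\<lambda>t. f t + g t))\<^sup>2 - (besov_01_norm r (\<lambda>t. f t - g t))\<^sup>2) / 4)\<rparr>"


section \<open>Gaussian processes\<close>

text \<open>Centered Gaussian random variables may be degenerate.\<close>

definition centered_gaussian :: "'w measure \<Rightarrow> ('w \<Rightarrow> real) \<Rightarrow> bool" where
  "centered_gaussian M Z \<longleftrightarrow> Z \<in> borel_measurable M \<and>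
     ((AE \<omega> in M. Z \<omega> = 0) \<or> (\<exists>\<sigma>>0. distributed M lborel Z (normal_density 0 \<sigma>)))"

definition centered_gaussian_process :: "'w measure \<Rightarrow> 'a set \<Rightarrow> ('a \<Rightarrow> 'w \<Rightarrow> real) \<Rightarrow> bool" where
  "centered_gaussian_process M T X \<longleftrightarrow>
     (\<forall>t\<in>T. X t \<in> borel_measurable M) \<and>
     (\<forall>F a. finite F \<and> F \<subseteq> T \<longrightarrow> centered_gaussian M (\<lambda>\<omega>. \<Sum>t\<in>F. a t * X t \<omega>))"

definition version_of :: "'w measure \<Rightarrow> 'a set \<Rightarrow> ('a \<Rightarrow> 'w \<Rightarrow> real) \<Rightarrow> ('a \<Rightarrow> 'w \<Rightarrow> real) \<Rightarrow> bool" where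
  "version_of M T X Y \<longleftrightarrow>
     (\<forall>t\<in>T. Y t \<in> borel_measurable M) \<and> (\<forall>t\<in>T. measure M {\<omega> \<in> space M. X t \<omega> = Y t \<omega>} = 1)"

definition sample_path :: "'a set \<Rightarrow> ('a \<Rightarrow> 'w \<Rightarrow> real) \<Rightarrow> 'w \<Rightarrow> 'a \<Rightarrow> real" where
  "sample_path T Y \<omega> = zero_ext T (\<lambda>t. Y t \<omega>)"

text \<open>\<open>measure M\<close> is \<open>0\<close> on non-measurable sets, so \<open>measure M A = 1\<close> includes that \<open>A\<close> is an event.\<close>

definition paths_in :: "'w measure \<Rightarrow> 'a set \<Rightarrow> ('a \<Rightarrow> 'w \<Rightarrow> real) \<Rightarrow> 'a fun_space \<Rightarrow> bool" where
  "paths_in M T Y H \<longleftrightarrow> measure M {\<omega> \<in> space M. sample_path T Y \<omega> \<in> fns H} = 1"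

end

theory Submission
  imports Defs
begin

text \<open>Write \<open>h\<^sub>A = \<Sum>x\<in>A. c x * k(x, \<cdot>)\<close> for the finite combinations of sections of a kernel \<open>k\<close>. They are the point
at which function spaces and processes meet: the square of the norm of \<open>h\<^sub>A\<close> is the variance of \<open>\<Sum>x\<in>A. c x * X\<^sub>x\<close>, and
the inner product of \<open>f\<close> with \<open>h\<^sub>A\<close> is \<open>\<Sum>x\<in>A. c x * f x\<close>. The uniform boundedness principle turns an equality or
inclusion of sets of functions into inequalities between such norms, and only these are used.

Smooth case, \<open>1/2 < r < s - 1/2\<close>. Fourier inversion represents the values of \<open>f \<in> H\<^sup>s(\<real>)\<close> as superpositions of waves,
so that \<open>H\<^sub>0 = H\<^sup>s(0,1)\<close> gives \<open>\<parallel>h\<^sub>A\<parallel>\<^sup>2 \<le> C \<integral> \<bar>\<Sum>x\<in>A. c x * cis (\<xi>x)\<bar>\<^sup>2 (1 + \<xi>\<^sup>2)\<^sup>-\<^sup>s d\<xi>\<close> (\<open>sobolev_kernel_domination\<close>). On the other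
hand the waves have \<open>B\<^sup>r\<^sub>2\<^sub>,\<^sub>2(0,1)\<close> norms at most of order \<open>(1 + \<xi>\<^sup>2)\<^sup>r\<^sup>/\<^sup>2\<close> (\<open>besov_01_cos\<close>). Orthonormalise sections of the
kernel of \<open>B\<^sup>r\<^sub>2\<^sub>,\<^sub>2(0,1)\<close> at a dense set of points to a basis \<open>g\<^sub>n\<close>; its coefficient functionals are finite combinations
of point evaluations. Bessel's inequality for the waves and \<open>2(r - s) < -1\<close> show that the variances of these functionals are
summable (\<open>hilbert_schmidt_system\<close>), i.e. that the inclusion of \<open>H\<^sub>0\<close> is of Hilbert--Schmidt type. Both variances and
sums factorise over products, hence the coefficients of \<open>X\<close> with respect to the tensor basis are almost surely square summable, and the
resulting series is a version of \<open>X\<close> with paths in the tensor power (\<open>process_version\<close>).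

Rough case, \<open>s \<le> 1\<close>. Suppose the paths of a version lie in an RKHS \<open>H\<close> of bounded functions. Restrict the process to a line parallel
to an axis. By uniform boundedness the kernel sections of \<open>H\<close> have norms at most \<open>D\<close>. For the \<open>N - 1\<close> points
\<open>p\<^sub>i = (i+1)/N\<close> let \<open>z\<^sub>l\<close> be the Gram--Schmidt functionals of the corresponding sections, applied to \<open>X\<close>. Then \<open>\<Sum>l z\<^sub>l\<^sup>2\<close> is at most the square of the
norm of the path, for every \<open>N\<close>, and for Gaussian variables such a pathwise bound implies a bound of \<open>\<Sum>l E z\<^sub>l\<^sup>2\<close> that is
independent of \<open>N\<close> (\<open>expectation_le_of_small_tail\<close>). Since \<open>H\<^sup>s(0,1)\<close> contains all sine series \<open>\<Sum>k c\<^sub>k sin(\<pi>(k+1)x)/(k+1)\<close> with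
square summable \<open>c\<close>, the variances \<open>E z\<^sub>l\<^sup>2\<close> dominate the squares of the same functionals of the functions
\<open>\<psi>\<^sub>k(x) = sin(\<pi>(k+1)x)/(k+1)\<close> (\<open>sine_bessel\<close>). Thus the matrix \<open>\<psi>\<^sub>j(p\<^sub>i)\<close> is a product of two matrices with controlled
Hilbert--Schmidt norms, and its trace against the discrete sine transform is bounded (\<open>harmonic_factorization_bound\<close>). But
this trace is a multiple of the harmonic sum \<open>\<Sum>j<N-1. 1/(j+1)\<close>, which is unbounded.\<close>



section \<open>Hilbert spaces of functions\<close>

locale function_rkhs =
  fixes T :: "'a set" and H :: "'a fun_space"
  assumes rkhs: "rkhs T H"
begin

lemma outside: "f \<in> fns H \<Longrightarrow> t \<notin> T \<Longrightarrow> f t = 0"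
  and zero_in [simp]: "(\<lambda>t. 0) \<in> fns H"
  and add_in: "f \<in> fns H \<Longrightarrow> g \<in> fns H \<Longrightarrow> (\<lambda>t. f t + g t) \<in> fns H"
  and scale_in: "f \<in> fns H \<Longrightarrow> (\<lambda>t. c * f t) \<in> fns H"
  and ip_sym: "f \<in> fns H \<Longrightarrow> g \<in> fns H \<Longrightarrow> ip H f g = ip H g f"
  and ip_add: "f \<in> fns H \<Longrightarrow> g \<in> fns H \<Longrightarrow> h \<in> fns H \<Longrightarrow>
      ip H (\<lambda>t. f t + g t) h = ip H f h + ip H g h"
  and ip_scale: "f \<in> fns H \<Longrightarrow> g \<in> fns H \<Longrightarrow> ip H (\<lambda>t. c * f t) g = c * ip H f g"
  and ip_pos: "f \<in> fns H \<Longrightarrow> f \<noteq> (\<lambda>t. 0) \<Longrightarrow> ip H f f > 0"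
  and eval_bound: "t \<in> T \<Longrightarrow> \<exists>C. \<forall>f\<in>fns H. \<bar>f t\<bar> \<le> C * fnorm H f"
  and complete: "range u \<subseteq> fns H \<Longrightarrow>
      (\<And>e. e > 0 \<Longrightarrow> \<exists>N. \<forall>m\<ge>N. \<forall>n\<ge>N. fnorm H (\<lambda>t. u m t - u n t) < e) \<Longrightarrow>
      \<exists>f\<in>fns H. (\<lambda>n. fnorm H (\<lambda>t. u n t - f t)) \<longlonglongrightarrow> 0"
  using rkhs unfolding rkhs_def by blast+

lemma diff_in: "f \<in> fns H \<Longrightarrow> g \<in> fns H \<Longrightarrow> (\<lambda>t. f t - g t) \<in> fns H"
  using add_in[OF _ scale_in[of g "-1"], of f] by simp

lemma ip_diff: "f \<in> fns H \<Longrightarrow> g \<in> fns H \<Longrightarrow> h \<in> fns H \<Longrightarrow>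
      ip H (\<lambda>t. f t - g t) h = ip H f h - ip H g h"
  using ip_add[OF _ scale_in[of g "-1"], of f h] ip_scale[of g h "-1"] by simp

lemma ip_zero: "g \<in> fns H \<Longrightarrow> ip H (\<lambda>t. 0) g = 0"
  using ip_scale[of g g 0] by simp

lemma ip_zero_right: "g \<in> fns H \<Longrightarrow> ip H g (\<lambda>t. 0) = 0"
  using ip_sym[OF zero_in, of g] ip_zero by simp

lemma ip_nonneg: "f \<in> fns H \<Longrightarrow> 0 \<le> ip H f f"
  using ip_pos[of f] ip_zero[of f] by (cases "f = (\<lambda>t. 0)") auto

lemma fnorm_nonneg: "f \<in> fns H \<Longrightarrow> 0 \<le> fnorm H f"
  by (simp add: fnorm_def ip_nonneg)

lemma fnorm_sq: "f \<in> fns H \<Longrightarrow> (fnorm H f)\<^sup>2 = ip H f f"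
  by (simp add: fnorm_def ip_nonneg)

lemma sum_in: "(\<And>i. i \<in> A \<Longrightarrow> f i \<in> fns H) \<Longrightarrow> (\<lambda>t. \<Sum>i\<in>A. c i * f i t) \<in> fns H"
proof (induction A rule: infinite_finite_induct)
  case (insert x F)
  then show ?case using add_in[OF scale_in[of "f x" "c x"], of "\<lambda>t. \<Sum>i\<in>F. c i * f i t"] by simp
qed simp_all

lemma ip_sum: "(\<And>i. i \<in> A \<Longrightarrow> f i \<in> fns H) \<Longrightarrow> g \<in> fns H \<Longrightarrow>
    ip H (\<lambda>t. \<Sum>i\<in>A. c i * f i t) g = (\<Sum>i\<in>A. c i * ip H (f i) g)"
  by (induction A rule: infinite_finite_induct)
     (simp_all add: ip_zero ip_add ip_scale scale_in sum_in)

lemma ip_sum_sum: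
  assumes "\<And>i. i \<in> A \<Longrightarrow> f i \<in> fns H" "\<And>i. i \<in> B \<Longrightarrow> g i \<in> fns H"
  shows "ip H (\<lambda>t. \<Sum>i\<in>A. c i * f i t) (\<lambda>t. \<Sum>j\<in>B. d j * g j t)
         = (\<Sum>i\<in>A. \<Sum>j\<in>B. c i * d j * ip H (f i) (g j))"
proof -
  have "ip H (\<lambda>t. \<Sum>i\<in>A. c i * f i t) (\<lambda>t. \<Sum>j\<in>B. d j * g j t)
        = (\<Sum>i\<in>A. c i * ip H (f i) (\<lambda>t. \<Sum>j\<in>B. d j * g j t))"
    by (rule ip_sum) (auto intro: assms sum_in)
  also have "\<dots> = (\<Sum>i\<in>A. c i * (\<Sum>j\<in>B. d j * ip H (f i) (g j)))"
  proof (intro sum.cong refl arg_cong2[where f = "(*)"])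
    fix i assume i: "i \<in> A"
    have "ip H (f i) (\<lambda>t. \<Sum>j\<in>B. d j * g j t) = ip H (\<lambda>t. \<Sum>j\<in>B. d j * g j t) (f i)"
      by (intro ip_sym sum_in assms i)
    also have "\<dots> = (\<Sum>j\<in>B. d j * ip H (g j) (f i))"
      by (intro ip_sum assms i)
    also have "\<dots> = (\<Sum>j\<in>B. d j * ip H (f i) (g j))"
      by (intro sum.cong refl) (simp add: ip_sym assms i)
    finally show "ip H (f i) (\<lambda>t. \<Sum>j\<in>B. d j * g j t) = (\<Sum>j\<in>B. d j * ip H (f i) (g j))" .
  qed
  finally show ?thesis by (simp add: sum_distrib_left mult.assoc)
qed

lemma ip_lin2:
  assumes "f \<in> fns H" "g \<in> fns H"
  shows "ip H (\<lambda>t. f t + c * g t) (\<lambda>t. f t + c * g t) = ip H f f + 2 * c * ip H f g + c\<^sup>2 * ip H g g"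
proof -
  let ?F = "\<lambda>t. f t + c * g t"
  have F: "?F \<in> fns H" by (intro add_in scale_in assms)
  have lin: "ip H ?F h = ip H f h + c * ip H g h" if "h \<in> fns H" for h
    using ip_add[OF assms(1) scale_in[OF assms(2)] that] ip_scale[OF assms(2) that] by simp
  have "ip H ?F ?F = ip H ?F f + c * ip H ?F g"
    unfolding lin[OF F] ip_sym[OF assms(1) F] ip_sym[OF assms(2) F] ..
  also have "\<dots> = ip H f f + 2 * c * ip H f g + c\<^sup>2 * ip H g g"
    unfolding lin[OF assms(1)] lin[OF assms(2)] ip_sym[OF assms(2,1)]
    by (simp add: algebra_simps power2_eq_square)
  finally show ?thesis .
qed

lemma ip_diff_sq:
  assumes "f \<in> fns H" "g \<in> fns H"
  shows "ip H (\<lambda>t. f t - g t) (\<lambda>t. f t - g t) = ip H f f - 2 * ip H f g + ip H g g"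
  using ip_lin2[OF assms, of "-1"] by simp

lemma cauchy_schwarz: 
  assumes "f \<in> fns H" "g \<in> fns H"
  shows "\<bar>ip H f g\<bar> \<le> fnorm H f * fnorm H g"
proof -
  have "(ip H f g)\<^sup>2 \<le> ip H f f * ip H g g"
  proof (cases "g = (\<lambda>t. 0)")
    case True then show ?thesis using assms ip_sym[of f g] ip_zero[of f] ip_zero[of g] by simp
  next
    case False
    then have p: "ip H g g > 0" using ip_pos assms by blast
    have "0 \<le> ip H (\<lambda>t. f t + (- ip H f g / ip H g g) * g t) (\<lambda>t. f t + (- ip H f g / ip H g g) * g t)"
      by (intro ip_nonneg add_in scale_in assms)
    also have "\<dots> = ip H f f + 2 * (- ip H f g / ip H g g) * ip H f g + (- ip H f g / ip H g g)\<^sup>2 * ip H g g"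
      by (rule ip_lin2[OF assms])
    also have "\<dots> = ip H f f - (ip H f g)\<^sup>2 / ip H g g"
      using p by (simp add: field_simps power2_eq_square)
    finally show ?thesis using p by (simp add: field_simps)
  qed
  then have "sqrt ((ip H f g)\<^sup>2) \<le> sqrt (ip H f f * ip H g g)" by (rule real_sqrt_le_mono)
  then show ?thesis by (simp add: fnorm_def real_sqrt_mult)
qed

lemma fnorm_scale: "f \<in> fns H \<Longrightarrow> fnorm H (\<lambda>t. c * f t) = \<bar>c\<bar> * fnorm H f"
proof -
  assume f: "f \<in> fns H"
  have "ip H (\<lambda>t. c * f t) (\<lambda>t. c * f t) = c\<^sup>2 * ip H f f"
    using f by (simp add: ip_scale scale_in ip_sym[of f "\<lambda>t. c * f t"] power2_eq_square)
  then show ?thesis by (simp add: fnorm_def real_sqrt_mult)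
qed

lemma fnorm_triangle:
  assumes "f \<in> fns H" "g \<in> fns H"
  shows "fnorm H (\<lambda>t. f t + g t) \<le> fnorm H f + fnorm H g"
proof (rule power2_le_imp_le)
  have "(fnorm H (\<lambda>t. f t + g t))\<^sup>2 = ip H f f + 2 * ip H f g + ip H g g"
    using ip_lin2[OF assms, of 1] by (simp add: fnorm_sq add_in assms)
  also have "\<dots> \<le> (fnorm H f + fnorm H g)\<^sup>2"
    using cauchy_schwarz[OF assms] by (simp add: power2_sum fnorm_sq assms)
  finally show "(fnorm H (\<lambda>t. f t + g t))\<^sup>2 \<le> (fnorm H f + fnorm H g)\<^sup>2" .
qed (use fnorm_nonneg assms in simp)

lemma fnorm_minus_commute:
  assumes "f \<in> fns H" "g \<in> fns H"
  shows "fnorm H (\<lambda>t. f t - g t) = fnorm H (\<lambda>t. g t - f t)"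
  using fnorm_scale[OF diff_in[OF assms], of "-1"] by simp

lemma fnorm_triangle_diff:
  assumes "f \<in> fns H" "g \<in> fns H" "h \<in> fns H"
  shows "fnorm H (\<lambda>t. f t - h t) \<le> fnorm H (\<lambda>t. f t - g t) + fnorm H (\<lambda>t. g t - h t)"
  using fnorm_triangle[OF diff_in[OF assms(1,2)] diff_in[OF assms(2,3)]] by simp

lemma fnorm_zero_iff: "f \<in> fns H \<Longrightarrow> fnorm H f = 0 \<longleftrightarrow> f = (\<lambda>t. 0)"
  by (cases "f = (\<lambda>t. 0)") (use ip_pos[of f] ip_zero[of f] in \<open>simp_all add: fnorm_def\<close>)

lemma norm_limit_pointwise:
  assumes "\<And>n. u n \<in> fns H" "f \<in> fns H" "(\<lambda>n. fnorm H (\<lambda>t. u n t - f t)) \<longlonglongrightarrow> 0"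
  shows "(\<lambda>n. u n t) \<longlonglongrightarrow> f t"
proof (cases "t \<in> T")
  case False
  then show ?thesis by (simp add: outside[OF assms(1)] outside[OF assms(2)])
next
  case True
  then obtain C where C: "\<And>f. f \<in> fns H \<Longrightarrow> \<bar>f t\<bar> \<le> C * fnorm H f" using eval_bound by blast
  have "(\<lambda>n. u n t - f t) \<longlonglongrightarrow> 0"
  proof (rule Lim_null_comparison)
    show "\<forall>\<^sub>F n in sequentially. norm (u n t - f t) \<le> C * fnorm H (\<lambda>t. u n t - f t)"
      using C[OF diff_in[OF assms(1,2)]] by simp
    show "(\<lambda>n. C * fnorm H (\<lambda>t. u n t - f t)) \<longlonglongrightarrow> 0"
      using tendsto_mult_right_zero[OF assms(3)] by blast
  qed
  then show ?thesis by (simp add: LIM_zero_iff)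
qed

lemma cauchy_limit:
  assumes u: "\<And>n. u n \<in> fns H"
    and e: "e \<longlonglongrightarrow> 0" "\<And>m n. n \<le> m \<Longrightarrow> fnorm H (\<lambda>t. u m t - u n t) \<le> e n"
  shows "\<exists>f\<in>fns H. (\<forall>n. fnorm H (\<lambda>t. f t - u n t) \<le> e n) \<and>
    (\<lambda>n. fnorm H (\<lambda>t. u n t - f t)) \<longlonglongrightarrow> 0 \<and> (\<forall>t. (\<lambda>n. u n t) \<longlonglongrightarrow> f t)"
proof -
  have "\<exists>N. \<forall>m\<ge>N. \<forall>n\<ge>N. fnorm H (\<lambda>t. u m t - u n t) < r" if r: "r > 0" for r
  proof -
    obtain N where N: "\<And>n. n \<ge> N \<Longrightarrow> \<bar>e n\<bar> < r" 
      using LIMSEQ_D[OF e(1) r] by auto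
    have "fnorm H (\<lambda>t. u m t - u n t) < r" if "m \<ge> N" "n \<ge> N" for m n
    proof (cases "n \<le> m")
      case True then show ?thesis using e(2)[OF True] N[OF that(2)] by linarith
    next
      case False then show ?thesis
        using e(2)[of m n] N[OF that(1)] fnorm_minus_commute[OF u u, of m n] by simp
    qed
    then show ?thesis by blast
  qed
  then obtain f where f: "f \<in> fns H" and lim: "(\<lambda>n. fnorm H (\<lambda>t. u n t - f t)) \<longlonglongrightarrow> 0"
    using complete[of u] u by blast
  have "fnorm H (\<lambda>t. f t - u n t) \<le> e n" for n
  proof (rule Lim_bounded2)
    show "(\<lambda>m. fnorm H (\<lambda>t. u m t - f t) + e n) \<longlonglongrightarrow> e n"
      using tendsto_add[OF lim tendsto_const[of "e n"]] by simp
    have "fnorm H (\<lambda>t. f t - u n t) \<le> fnorm H (\<lambda>t. u m t - f t) + e n" if "m \<ge> n" for m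
      using fnorm_triangle_diff[OF f u[of m] u[of n]] e(2)[OF that] fnorm_minus_commute[OF f u, of m] by linarith
    then show "\<forall>m\<ge>n. fnorm H (\<lambda>t. f t - u n t) \<le> fnorm H (\<lambda>t. u m t - f t) + e n" by blast
  qed
  then show ?thesis using f lim norm_limit_pointwise[OF u f lim] by blast
qed

text \<open>The gliding hump: if \<open>\<parallel>h\<^sub>n\<parallel> > 4\<^sup>n\<close>, choose signs so that the partial sums of \<open>\<Sum>n \<plusminus> 3\<^sup>-\<^sup>n h\<^sub>n / \<parallel>h\<^sub>n\<parallel>\<close> have inner products of
modulus at least \<open>3\<^sup>-\<^sup>n \<parallel>h\<^sub>n\<parallel>\<close> with \<open>h\<^sub>n\<close>. The tails of the series cancel at most half of this, so that the inner products of the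
limit with the \<open>h\<^sub>n\<close> are unbounded.\<close>

lemma uniform_boundedness:
  assumes L: "L \<subseteq> fns H" and pb: "\<And>f. f \<in> fns H \<Longrightarrow> \<exists>C. \<forall>h\<in>L. \<bar>ip H f h\<bar> \<le> C"
  shows "\<exists>C. \<forall>h\<in>L. fnorm H h \<le> C"
proof (rule ccontr)
  assume "\<not> ?thesis"
  then have "\<forall>n. \<exists>h\<in>L. fnorm H h > 4 ^ n" by (meson not_le)
  then obtain h where h: "\<And>n::nat. h n \<in> L" "\<And>n. fnorm H (h n) > 4 ^ n" by metis
  have hH: "h n \<in> fns H" for n using h L by blast
  have hpos: "fnorm H (h n) > 0" for n
    using h(2)[of n] less_trans[of 0 "4 ^ n" "fnorm H (h n)"] by simp
  define e where "e n = (\<lambda>t. ((1/3) ^ n / fnorm H (h n)) * h n t)" for n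
  have eH: "e n \<in> fns H" for n unfolding e_def by (intro scale_in hH)
  have en: "fnorm H (e n) = (1/3)^n" for n
    unfolding e_def using hpos[of n] by (subst fnorm_scale[OF hH]) simp
  have eh: "ip H (e n) (h n) = (1/3)^n * fnorm H (h n)" for n
    unfolding e_def using hpos[of n]
    by (subst ip_scale[OF hH hH]) (simp add: fnorm_sq[symmetric] hH power2_eq_square)
  \<comment> \<open>one of \<open>F n + e n\<close> and \<open>F n - e n\<close> has a large inner product with \<open>h n\<close>, as the two differ by twice that of \<open>e n\<close>\<close>
  define F where "F = rec_nat (\<lambda>t. 0) (\<lambda>n f. if \<bar>ip H (\<lambda>t. f t + e n t) (h n)\<bar> \<ge> (1/3)^n * fnorm H (h n)
      then (\<lambda>t. f t + e n t) else (\<lambda>t. f t - e n t))"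
  have F0: "F 0 = (\<lambda>t. 0)" by (simp add: F_def)
  have FS: "F (Suc n) = (if \<bar>ip H (\<lambda>t. F n t + e n t) (h n)\<bar> \<ge> (1/3)^n * fnorm H (h n)
      then (\<lambda>t. F n t + e n t) else (\<lambda>t. F n t - e n t))" for n by (simp add: F_def)
  have FH: "F n \<in> fns H" for n
    by (induction n) (auto simp: F0 FS intro: add_in diff_in eH)
  have Fh: "\<bar>ip H (F (Suc n)) (h n)\<bar> \<ge> (1/3)^n * fnorm H (h n)" for n
  proof (cases "\<bar>ip H (\<lambda>t. F n t + e n t) (h n)\<bar> \<ge> (1/3)^n * fnorm H (h n)")
    case False
    then have "\<bar>ip H (F n) (h n) + (1/3)^n * fnorm H (h n)\<bar> < (1/3)^n * fnorm H (h n)"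
      by (simp add: ip_add[OF FH eH hH] eh)
    moreover have "ip H (F (Suc n)) (h n) = ip H (F n) (h n) - (1/3)^n * fnorm H (h n)"
      using False by (simp add: FS ip_diff[OF FH eH hH] eh)
    moreover have "(1/3)^n * fnorm H (h n) > 0" using hpos by simp
    ultimately show ?thesis by linarith
  qed (simp add: FS)
  have step: "fnorm H (\<lambda>t. F (Suc n) t - F n t) = (1/3)^n" for n
    using en[of n] fnorm_scale[OF eH, of "-1" n] by (auto simp: FS)
  have dist: "fnorm H (\<lambda>t. F (n + k) t - F n t) \<le> 3/2 * ((1/3)^n - (1/3)^(n+k))" for n k
  proof (induction k)
    case 0 then show ?case using ip_zero[OF zero_in] by (simp add: fnorm_def)
  next
    case (Suc k)
    have "fnorm H (\<lambda>t. F (Suc (n + k)) t - F n t) \<le> (1/3)^(n+k) + 3/2 * ((1/3)^n - (1/3)^(n+k))"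
      using fnorm_triangle_diff[OF FH[of "Suc (n+k)"] FH[of "n+k"] FH[of n]] step[of "n+k"] Suc by linarith
    then show ?case by (simp add: field_simps)
  qed
  have l0: "(\<lambda>n. 3/2 * (1/3::real)^n) \<longlonglongrightarrow> 0"
    by (intro tendsto_mult_right_zero LIMSEQ_realpow_zero) auto
  have d: "fnorm H (\<lambda>t. F m t - F n t) \<le> 3/2 * (1/3)^n" if "n \<le> m" for m n
  proof -
    have "fnorm H (\<lambda>t. F m t - F n t) \<le> 3/2 * ((1/3)^n - (1/3)^m)"
      using dist[of n "m - n"] that by simp
    also have "\<dots> \<le> 3/2 * (1/3)^n" by (intro mult_left_mono) simp_all
    finally show ?thesis .
  qed
  obtain f where f: "f \<in> fns H" "\<And>n. fnorm H (\<lambda>t. f t - F n t) \<le> 3/2 * (1/3)^n"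
    using cauchy_limit[of F, OF FH l0 d] by blast
  obtain C where C: "\<And>k. k \<in> L \<Longrightarrow> \<bar>ip H f k\<bar> \<le> C" using pb[OF f(1)] by blast
  have "(1/2) * (4/3)^n \<le> C" for n
  proof -
    have "ip H (\<lambda>t. f t - F (Suc n) t) (h n) = ip H f (h n) - ip H (F (Suc n)) (h n)"
      by (rule ip_diff[OF f(1) FH hH])
    moreover have "\<bar>ip H (\<lambda>t. f t - F (Suc n) t) (h n)\<bar> \<le> (1/2) * (1/3)^n * fnorm H (h n)"
    proof -
      have "fnorm H (\<lambda>t. f t - F (Suc n) t) * fnorm H (h n) \<le> (3/2 * (1/3)^(Suc n)) * fnorm H (h n)"
        by (rule mult_right_mono[OF f(2)]) (use hpos[of n] in simp)
      then show ?thesis using cauchy_schwarz[OF diff_in[OF f(1) FH] hH, of "Suc n" n] by simp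
    qed
    ultimately have "\<bar>ip H f (h n)\<bar> \<ge> (1/2) * (1/3)^n * fnorm H (h n)"
      using Fh[of n] by linarith
    moreover have "(1/2) * (1/3)^n * fnorm H (h n) \<ge> (1/2) * (1/3)^n * 4^n"
      using h(2)[of n] by (intro mult_left_mono) auto
    moreover have "(1/2) * (1/3)^n * 4^n = (1/2) * (4/3::real)^n"
      by (simp add: power_divide)
    ultimately show ?thesis using C[OF h(1)[of n]] by linarith
  qed
  then have le: "(1/2) * (4/3)^n \<le> C" for n .
  obtain n where "2 * C < (4/3::real)^n" using real_arch_pow[of "4/3" "2*C"] by auto
  then show False using le[of n] by linarith
qed

text \<open>The representer of \<open>L\<close> is the limit of a minimising sequence of the quadratic functional \<open>\<parallel>f\<parallel>\<^sup>2 - 2 L f\<close>, whose derivative at the minimum is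
\<open>2 \<langle>f, \<cdot>\<rangle> - 2 L\<close>. Testing the near minimality along \<open>f + c g\<close> shows that the sequence represents \<open>L\<close> up to small errors.\<close>

lemma riesz_representation:
  assumes add: "\<And>f g. f \<in> fns H \<Longrightarrow> g \<in> fns H \<Longrightarrow> L (\<lambda>t. f t + g t) = L f + L g"
    and scale: "\<And>f c. f \<in> fns H \<Longrightarrow> L (\<lambda>t. c * f t) = c * L f"
    and bound: "\<And>f. f \<in> fns H \<Longrightarrow> \<bar>L f\<bar> \<le> C * fnorm H f"
  obtains h where "h \<in> fns H" "\<And>f. f \<in> fns H \<Longrightarrow> ip H f h = L f"
proof -
  define Q where "Q f = ip H f f - 2 * L f" for f
  define m where "m = Inf (Q ` fns H)"
  have low: "Q f \<ge> - C\<^sup>2" if "f \<in> fns H" for f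
  proof -
    have "0 \<le> (fnorm H f - C)\<^sup>2" by simp
    also have "\<dots> = ip H f f - 2 * (C * fnorm H f) + C\<^sup>2" 
      by (simp add: power2_diff fnorm_sq that)
    finally show ?thesis using bound[OF that] unfolding Q_def by linarith
  qed
  then have bdd: "bdd_below (Q ` fns H)" by (auto intro!: bdd_belowI[of _ "- C\<^sup>2"])
  have mle: "m \<le> Q f" if "f \<in> fns H" for f
    unfolding m_def using that bdd by (intro cInf_lower) auto
  have "\<exists>f\<in>fns H. Q f < m + 1 / (real n + 1)" for n
  proof -
    have "\<exists>x\<in>Q ` fns H. x < m + 1 / (real n + 1)"
    proof (rule cInf_lessD)
      show "Q ` fns H \<noteq> {}" using zero_in by blast
      show "Inf (Q ` fns H) < m + 1 / (real n + 1)" unfolding m_def by simp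
    qed
    then show ?thesis by auto
  qed
  then obtain f where f: "\<And>n. f n \<in> fns H" "\<And>n. Q (f n) < m + 1 / (real n + 1)" by metis
  have key: "\<bar>ip H (f n) g - L g\<bar> \<le> sqrt (1 / (real n + 1)) * fnorm H g" if g: "g \<in> fns H" for n g
  proof (cases "g = (\<lambda>t. 0)")
    case True
    then show ?thesis using ip_zero[OF f(1)] ip_sym[OF zero_in f(1)] scale[OF zero_in, of 0] by (simp add: fnorm_def ip_zero)
  next
    case False
    then have p: "ip H g g > 0" using ip_pos g by blast
    define d where "d = ip H (f n) g - L g"
    define c where "c = - d / ip H g g"
    have "m \<le> Q (\<lambda>t. f n t + c * g t)" by (intro mle add_in scale_in f g)
    moreover have "Q (\<lambda>t. f n t + c * g t) = Q (f n) + 2 * c * d + c\<^sup>2 * ip H g g"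
      unfolding Q_def d_def by (subst ip_lin2[OF f(1) g]) (simp add: add[OF f(1) scale_in[OF g]] scale[OF g] algebra_simps)
    moreover have "2 * c * d + c\<^sup>2 * ip H g g = - (d\<^sup>2 / ip H g g)"
      using p unfolding c_def by (simp add: field_simps power2_eq_square)
    ultimately have "m \<le> Q (f n) - d\<^sup>2 / ip H g g" by linarith
    then have "d\<^sup>2 / ip H g g \<le> 1 / (real n + 1)" using f(2)[of n] by linarith
    then have "d\<^sup>2 \<le> 1 / (real n + 1) * ip H g g" using p by (simp add: field_simps)
    then have "sqrt (d\<^sup>2) \<le> sqrt (1 / (real n + 1) * ip H g g)" by (rule real_sqrt_le_mono)
    then show ?thesis by (simp add: d_def fnorm_def real_sqrt_mult real_sqrt_divide)
  qed
  have close: "fnorm H (\<lambda>t. f k t - f n t) \<le> 2 * sqrt (1 / (real n + 1))" if "n \<le> k" for k n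
  proof -
    let ?g = "\<lambda>t. f k t - f n t"
    have g: "?g \<in> fns H" by (intro diff_in f)
    have "(fnorm H ?g)\<^sup>2 = (ip H (f k) ?g - L ?g) - (ip H (f n) ?g - L ?g)"
      using ip_diff[OF f(1)[of k] f(1)[of n] g] by (simp add: fnorm_sq g)
    also have "\<dots> \<le> sqrt (1 / (real k + 1)) * fnorm H ?g + sqrt (1 / (real n + 1)) * fnorm H ?g"
      using key[OF g, of k] key[OF g, of n] by linarith
    also have "\<dots> \<le> 2 * sqrt (1 / (real n + 1)) * fnorm H ?g"
    proof -
      have "sqrt (1 / (real k + 1)) \<le> sqrt (1 / (real n + 1))"
        using that by (intro real_sqrt_le_mono) (simp add: frac_le)
      then have "sqrt (1 / (real k + 1)) * fnorm H ?g \<le> sqrt (1 / (real n + 1)) * fnorm H ?g"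
        using fnorm_nonneg[OF g] by (rule mult_right_mono)
      then show ?thesis by linarith
    qed
    finally show ?thesis
      using fnorm_nonneg[OF g] by (cases "fnorm H ?g = 0") (auto simp: power2_eq_square)
  qed
  have lim0: "(\<lambda>n. sqrt (1 / (real n + 1))) \<longlonglongrightarrow> 0"
    using tendsto_real_sqrt[OF LIMSEQ_inverse_real_of_nat] by (simp add: inverse_eq_divide add.commute)
  then have l2: "(\<lambda>n. 2 * sqrt (1 / (real n + 1))) \<longlonglongrightarrow> 0" by (rule tendsto_mult_right_zero)
  obtain h where h: "h \<in> fns H" "\<And>n. fnorm H (\<lambda>t. h t - f n t) \<le> 2 * sqrt (1 / (real n + 1))"
    using cauchy_limit[of f, OF f(1) l2 close] by blast
  have "ip H g h = L g" if g: "g \<in> fns H" for g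
  proof -
    have b: "\<bar>ip H h g - L g\<bar> \<le> 3 * sqrt (1 / (real n + 1)) * fnorm H g" for n
    proof -
      have "ip H h g - L g = ip H (\<lambda>t. h t - f n t) g + (ip H (f n) g - L g)"
        by (simp add: ip_diff[OF h(1) f(1) g])
      moreover have "\<bar>ip H (\<lambda>t. h t - f n t) g\<bar> \<le> 2 * sqrt (1 / (real n + 1)) * fnorm H g"
        using cauchy_schwarz[OF diff_in[OF h(1) f(1)] g, of n] mult_right_mono[OF h(2)[of n] fnorm_nonneg[OF g]]
        by linarith
      ultimately show ?thesis using key[OF g, of n] by (simp add: algebra_simps)
    qed
    have "(\<lambda>n. 3 * sqrt (1 / (real n + 1)) * fnorm H g) \<longlonglongrightarrow> 3 * 0 * fnorm H g"
      by (intro tendsto_intros lim0)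
    then have "\<bar>ip H h g - L g\<bar> \<le> 3 * 0 * fnorm H g"
      by (rule LIMSEQ_le_const) (use b in auto)
    then show ?thesis by (simp add: ip_sym[OF g h(1)])
  qed
  then show ?thesis using that h(1) by blast
qed

lemma kernel_exists:
  obtains k where "\<And>t. t \<in> T \<Longrightarrow> k t \<in> fns H" "\<And>t f. t \<in> T \<Longrightarrow> f \<in> fns H \<Longrightarrow> ip H f (k t) = f t"
    "rkhs_of_kernel T k H"
proof -
  have "\<exists>h\<in>fns H. \<forall>f\<in>fns H. ip H f h = f t" if t: "t \<in> T" for t
  proof -
    obtain C where C: "\<And>f. f \<in> fns H \<Longrightarrow> \<bar>f t\<bar> \<le> C * fnorm H f" using eval_bound[OF t] by blast
    obtain h where "h \<in> fns H" "\<And>f. f \<in> fns H \<Longrightarrow> ip H f h = f t"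
      by (rule riesz_representation[of "\<lambda>f. f t" C]) (auto simp: C)
    then show ?thesis by blast
  qed
  then obtain k where k: "\<And>t. t \<in> T \<Longrightarrow> k t \<in> fns H" "\<And>t f. t \<in> T \<Longrightarrow> f \<in> fns H \<Longrightarrow> ip H f (k t) = f t"
    by metis
  have "zero_ext T (k t) = k t" if "t \<in> T" for t
    using outside[OF k(1)[OF that]] by (auto simp: zero_ext_def)
  then have "rkhs_of_kernel T k H" using rkhs k by (auto simp: rkhs_of_kernel_def)
  then show ?thesis using k that by blast
qed

text \<open>Gram--Schmidt applied to linearly dependent vectors produces zero vectors. They are kept, so that the \<open>n\<close>-th output depends on
the first \<open>n + 1\<close> inputs only.\<close>

definition orthonormal_or_zero :: "(nat \<Rightarrow> 'a \<Rightarrow> real) \<Rightarrow> bool" where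
  "orthonormal_or_zero g \<longleftrightarrow> (\<forall>n. g n \<in> fns H) \<and>
     (\<forall>n m. ip H (g n) (g m) = (if n = m \<and> g n \<noteq> (\<lambda>t. 0) then 1 else 0))"

lemma orthonormal_or_zeroD:
  assumes "orthonormal_or_zero g"
  shows "g n \<in> fns H" "ip H (g n) (g m) = (if n = m \<and> g n \<noteq> (\<lambda>t. 0) then 1 else 0)"
  using assms by (auto simp: orthonormal_or_zero_def)

lemma ip_expansion_sq:
  assumes g: "orthonormal_or_zero g" and f: "f \<in> fns H" and A: "finite A"
  shows "ip H (\<lambda>t. f t - (\<Sum>i\<in>A. ip H f (g i) * g i t)) (\<lambda>t. f t - (\<Sum>i\<in>A. ip H f (g i) * g i t))
     = ip H f f - (\<Sum>i\<in>A. (ip H f (g i))\<^sup>2)"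
proof -
  let ?S = "\<lambda>t. \<Sum>i\<in>A. ip H f (g i) * g i t"
  have gH: "g i \<in> fns H" for i using orthonormal_or_zeroD(1)[OF g] .
  have S: "?S \<in> fns H" by (intro sum_in gH)
  have "ip H f ?S = (\<Sum>i\<in>A. ip H f (g i) * ip H (g i) f)"
    by (subst ip_sym[OF f S]) (intro ip_sum gH f)
  then have 1: "ip H f ?S = (\<Sum>i\<in>A. (ip H f (g i))\<^sup>2)"
    by (simp add: ip_sym[OF gH f] power2_eq_square)
  have "ip H ?S ?S = (\<Sum>i\<in>A. \<Sum>j\<in>A. ip H f (g i) * ip H f (g j) * ip H (g i) (g j))"
    by (intro ip_sum_sum gH)
  also have "\<dots> = (\<Sum>i\<in>A. \<Sum>j\<in>A. if i = j then (ip H f (g i))\<^sup>2 else 0)"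
    by (intro sum.cong refl) (auto simp: orthonormal_or_zeroD(2)[OF g] ip_zero_right f power2_eq_square)
  also have "\<dots> = (\<Sum>i\<in>A. (ip H f (g i))\<^sup>2)" using A by simp
  finally show ?thesis by (simp add: ip_diff_sq[OF f S] 1)
qed

lemma bessel:
  assumes g: "orthonormal_or_zero g" and f: "f \<in> fns H" and A: "finite A"
  shows "(\<Sum>i\<in>A. (ip H f (g i))\<^sup>2) \<le> ip H f f"
proof -
  have "0 \<le> ip H (\<lambda>t. f t - (\<Sum>i\<in>A. ip H f (g i) * g i t)) (\<lambda>t. f t - (\<Sum>i\<in>A. ip H f (g i) * g i t))"
    using orthonormal_or_zeroD(1)[OF g] by (intro ip_nonneg diff_in f sum_in) auto
  then show ?thesis using ip_expansion_sq[OF assms] by linarith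
qed

lemma parseval:
  assumes g: "orthonormal_or_zero g" and f: "f \<in> fns H"
    and tot: "\<And>h. h \<in> fns H \<Longrightarrow> (\<And>n. ip H h (g n) = 0) \<Longrightarrow> h = (\<lambda>t. 0)"
  shows "(\<lambda>N. fnorm H (\<lambda>t. (\<Sum>i<N. ip H f (g i) * g i t) - f t)) \<longlonglongrightarrow> 0"
proof -
  have gH: "g i \<in> fns H" for i using orthonormal_or_zeroD(1)[OF g] .
  define S where "S N = (\<lambda>t. \<Sum>i<N. ip H f (g i) * g i t)" for N :: nat
  have SH: "S N \<in> fns H" for N unfolding S_def by (intro sum_in gH)
  let ?a = "\<lambda>i. (ip H f (g i))\<^sup>2"
  have sm: "summable ?a"
    by (rule summableI_nonneg_bounded[where x = "ip H f f"]) (auto intro: bessel g f)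
  have nd: "fnorm H (\<lambda>t. S M t - S N t) \<le> sqrt (\<Sum>i. ?a (i + N))" if "N \<le> M" for M N
  proof -
    have eq: "(\<lambda>t. S M t - S N t) = (\<lambda>t. \<Sum>i=N..<M. ip H f (g i) * g i t)"
      unfolding S_def using that by (auto simp: fun_eq_iff lessThan_atLeast0 sum_diff_nat_ivl)
    have "ip H (\<lambda>t. S M t - S N t) (\<lambda>t. S M t - S N t) =
       (\<Sum>i=N..<M. \<Sum>j=N..<M. ip H f (g i) * ip H f (g j) * ip H (g i) (g j))"
      unfolding eq by (intro ip_sum_sum gH)
    also have "\<dots> = (\<Sum>i=N..<M. \<Sum>j=N..<M. if i = j then ?a i else 0)"
      by (intro sum.cong refl) (auto simp: orthonormal_or_zeroD(2)[OF g] ip_zero_right f power2_eq_square)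
    also have "\<dots> = (\<Sum>i=N..<M. ?a i)" by simp
    also have "\<dots> = (\<Sum>i<M-N. ?a (i + N))"
      using that by (intro sum.reindex_bij_witness[of _ "\<lambda>i. i + N" "\<lambda>i. i - N"]) auto
    also have "\<dots> \<le> (\<Sum>i. ?a (i + N))"
      by (intro sum_le_suminf summable_ignore_initial_segment sm) auto
    finally show ?thesis by (simp add: fnorm_def)
  qed
  have l0: "(\<lambda>N. sqrt (\<Sum>i. ?a (i + N))) \<longlonglongrightarrow> 0"
    using tendsto_real_sqrt[OF suminf_exist_split2[OF sm]] by simp
  obtain p where p: "p \<in> fns H" "(\<lambda>N. fnorm H (\<lambda>t. S N t - p t)) \<longlonglongrightarrow> 0"
    using cauchy_limit[of S, OF SH l0 nd] by blast
  have "(\<lambda>t. f t - p t) = (\<lambda>t. 0)"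
  proof (rule tot)
    show "(\<lambda>t. f t - p t) \<in> fns H" by (intro diff_in f p)
    fix n
    have "ip H (\<lambda>t. f t - p t) (g n) = ip H (\<lambda>t. S N t - p t) (g n)" if "N > n" for N
    proof -
      have "ip H (S N) (g n) = (\<Sum>i<N. ip H f (g i) * ip H (g i) (g n))"
        unfolding S_def by (intro ip_sum gH)
      also have "\<dots> = (\<Sum>i<N. if i = n then ip H f (g n) else 0)"
        by (intro sum.cong refl) (auto simp: orthonormal_or_zeroD(2)[OF g] ip_zero_right f)
      also have "\<dots> = ip H f (g n)" using that by simp
      finally show ?thesis by (simp add: ip_diff f p SH gH)
    qed
    then have "\<bar>ip H (\<lambda>t. f t - p t) (g n)\<bar> \<le> fnorm H (\<lambda>t. S N t - p t) * fnorm H (g n)" if "N > n" for N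
      using cauchy_schwarz[OF diff_in[OF SH p(1)] gH, of N n] that by simp
    moreover have "(\<lambda>N. fnorm H (\<lambda>t. S N t - p t) * fnorm H (g n)) \<longlonglongrightarrow> 0 * fnorm H (g n)"
      by (intro tendsto_intros p)
    ultimately have "\<bar>ip H (\<lambda>t. f t - p t) (g n)\<bar> \<le> 0 * fnorm H (g n)"
      by (intro LIMSEQ_le_const[of _ "0 * fnorm H (g n)"]) (auto intro!: exI[of _ "Suc n"])
    then show "ip H (\<lambda>t. f t - p t) (g n) = 0" by simp
  qed
  then have "f = p" by (auto simp: fun_eq_iff dest: fun_cong)
  then show ?thesis using p(2) unfolding S_def by simp
qed

context
  fixes v :: "nat \<Rightarrow> 'a \<Rightarrow> real"
  assumes v: "\<And>n. v n \<in> fns H"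
begin

fun gs :: "nat \<Rightarrow> 'a \<Rightarrow> real" where
  "gs n = (let r = (\<lambda>t. v n t - (\<Sum>i<n. ip H (v n) (gs i) * gs i t)) in (\<lambda>t. inverse (fnorm H r) * r t))"

declare gs.simps [simp del]

definition gs_residual :: "nat \<Rightarrow> 'a \<Rightarrow> real" where
  "gs_residual n = (\<lambda>t. v n t - (\<Sum>i<n. ip H (v n) (gs i) * gs i t))"

lemma gs_eq: "gs n = (\<lambda>t. inverse (fnorm H (gs_residual n)) * gs_residual n t)"
  by (subst gs.simps) (simp add: gs_residual_def Let_def)

lemma gs_in: "gs n \<in> fns H"
proof (induction n rule: less_induct)
  case (less n)
  then have "gs_residual n \<in> fns H" unfolding gs_residual_def by (intro diff_in v sum_in) auto
  then show ?case by (subst gs_eq) (rule scale_in)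
qed

lemma gs_residual_in: "gs_residual n \<in> fns H"
  unfolding gs_residual_def by (intro diff_in v sum_in gs_in)

lemma gs_residual_scale: "gs_residual n = (\<lambda>t. fnorm H (gs_residual n) * gs n t)"
  using fnorm_zero_iff[OF gs_residual_in, of n]
  by (cases "fnorm H (gs_residual n) = 0") (auto simp: gs_eq)

lemma gs_norm: "ip H (gs n) (gs n) = (if gs n \<noteq> (\<lambda>t. 0) then 1 else 0)"
proof (cases "fnorm H (gs_residual n) = 0")
  case True
  then have "gs n = (\<lambda>t. 0)" by (subst gs_eq) simp
  then show ?thesis using ip_zero zero_in by simp
next
  case False
  then have "fnorm H (gs n) = 1"
    using fnorm_nonneg[OF gs_residual_in, of n] by (subst gs_eq) (simp add: fnorm_scale gs_residual_in)
  then show ?thesis using fnorm_sq[OF gs_in, of n] fnorm_zero_iff[OF gs_in, of n] by auto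
qed

lemma gs_orthogonal: "m < n \<Longrightarrow> ip H (gs n) (gs m) = 0"
proof (induction n arbitrary: m rule: less_induct)
  case (less n)
  have orth: "ip H (gs i) (gs m) = 0" if "i < n" "i \<noteq> m" for i
    using less.IH[of i m] less.IH[of m i] less.prems that ip_sym[OF gs_in gs_in, of i m]
    by (cases "i < m") auto
  have "ip H (gs_residual n) (gs m) = ip H (v n) (gs m) - (\<Sum>i<n. ip H (v n) (gs i) * ip H (gs i) (gs m))"
    unfolding gs_residual_def by (subst ip_diff[OF v sum_in[OF gs_in] gs_in]) (simp add: ip_sum gs_in)
  also have "(\<Sum>i<n. ip H (v n) (gs i) * ip H (gs i) (gs m)) = (\<Sum>i<n. if i = m then ip H (v n) (gs m) else 0)"
  proof (intro sum.cong refl)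
    fix i assume "i \<in> {..<n}"
    then show "ip H (v n) (gs i) * ip H (gs i) (gs m) = (if i = m then ip H (v n) (gs m) else 0)"
      using orth[of i] gs_norm[of m] ip_zero[OF v, of n] ip_sym[OF v gs_in, of n m] by (auto split: if_splits)
  qed
  also have "\<dots> = ip H (v n) (gs m)" using less.prems by simp
  finally show ?case by (subst gs_eq) (simp add: ip_scale gs_residual_in gs_in)
qed

lemma gs_orthonormal: "orthonormal_or_zero gs"
  unfolding orthonormal_or_zero_def
proof (intro conjI allI)
  fix n m show "ip H (gs n) (gs m) = (if n = m \<and> gs n \<noteq> (\<lambda>t. 0) then 1 else 0)"
    using gs_norm[of n] gs_orthogonal[of m n] gs_orthogonal[of n m] ip_sym[OF gs_in gs_in, of n m]
    by (cases n m rule: linorder_cases) auto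
qed (rule gs_in)

lemma gs_expand: "v n = (\<lambda>t. \<Sum>i\<le>n. ip H (v n) (gs i) * gs i t)"
proof -
  have eq: "v n = (\<lambda>t. (\<Sum>i<n. ip H (v n) (gs i) * gs i t) + fnorm H (gs_residual n) * gs n t)"
  proof
    fix t
    have "gs_residual n t = fnorm H (gs_residual n) * gs n t"
      by (rule fun_cong[OF gs_residual_scale])
    moreover have "v n t = (\<Sum>i<n. ip H (v n) (gs i) * gs i t) + gs_residual n t"
      by (simp add: gs_residual_def)
    ultimately show "v n t = (\<Sum>i<n. ip H (v n) (gs i) * gs i t) + fnorm H (gs_residual n) * gs n t"
      by simp
  qed
  define a where "a i = ip H (v n) (gs i)" for i
  have "ip H (v n) (gs n) = ip H (\<lambda>t. (\<Sum>i<n. a i * gs i t) + fnorm H (gs_residual n) * gs n t) (gs n)"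
    using eq unfolding a_def by (rule arg_cong)
  also have "\<dots> = (\<Sum>i<n. a i * ip H (gs i) (gs n)) + fnorm H (gs_residual n) * ip H (gs n) (gs n)"
    by (subst ip_add[OF sum_in[OF gs_in] scale_in[OF gs_in] gs_in]) (simp add: ip_sum ip_scale gs_in)
  also have "\<dots> = fnorm H (gs_residual n) * ip H (gs n) (gs n)"
    by (simp add: orthonormal_or_zeroD(2)[OF gs_orthonormal])
  finally have last: "fnorm H (gs_residual n) * gs n t = ip H (v n) (gs n) * gs n t" for t
    using gs_norm[of n] by (auto split: if_splits)
  show ?thesis
    by (rule trans[OF eq]) (simp only: last lessThan_Suc_atMost[symmetric] sum.lessThan_Suc)
qed

lemma gs_span: "\<exists>\<beta>. gs n = (\<lambda>t. \<Sum>i\<le>n. \<beta> i * v i t)"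
proof (induction n rule: less_induct)
  case (less n)
  then have "\<forall>i. \<exists>\<beta>. i < n \<longrightarrow> gs i = (\<lambda>t. \<Sum>j\<le>i. \<beta> j * v j t)" by blast
  then obtain \<beta> where \<beta>: "\<And>i. i < n \<Longrightarrow> gs i = (\<lambda>t. \<Sum>j\<le>i. \<beta> i j * v j t)" by metis
  define b where "b i j = (if j \<le> i then \<beta> i j else 0)" for i j
  have gi: "gs i t = (\<Sum>j<n. b i j * v j t)" if "i < n" for i t
  proof -
    have "gs i t = (\<Sum>j\<le>i. b i j * v j t)" using \<beta>[OF that] by (simp add: b_def)
    also have "\<dots> = (\<Sum>j<n. b i j * v j t)"
      by (rule sum.mono_neutral_left) (use that in \<open>auto simp: b_def\<close>)
    finally show ?thesis .
  qed
  define c where "c = inverse (fnorm H (gs_residual n))"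
  define B where "B j = (\<Sum>i<n. ip H (v n) (gs i) * b i j)" for j
  have "gs n t = (\<Sum>j\<le>n. (if j = n then c else - c * B j) * v j t)" for t
  proof -
    have "(\<Sum>i<n. ip H (v n) (gs i) * gs i t) = (\<Sum>i<n. \<Sum>j<n. ip H (v n) (gs i) * b i j * v j t)"
      by (intro sum.cong refl) (simp add: gi sum_distrib_left mult.assoc)
    also have "\<dots> = (\<Sum>j<n. B j * v j t)"
      unfolding B_def by (subst sum.swap) (simp add: sum_distrib_right)
    finally have "gs n t = c * (v n t - (\<Sum>j<n. B j * v j t))"
      by (subst gs_eq) (simp add: gs_residual_def c_def)
    also have "\<dots> = c * v n t + (\<Sum>j<n. (- c * B j) * v j t)"
      by (simp add: right_diff_distrib sum_distrib_left sum_negf mult.assoc)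
    also have "\<dots> = (\<Sum>j\<le>n. (if j = n then c else - c * B j) * v j t)"
      unfolding lessThan_Suc_atMost[symmetric] by simp
    finally show ?thesis .
  qed
  then show ?case by (intro exI[of _ "\<lambda>j. if j = n then c else - c * B j"]) auto
qed

end

text \<open>The coefficients \<open>\<beta>\<close> matter: for kernel sections \<open>v i\<close> they make \<open>\<langle>f, g n\<rangle>\<close> a finite combination of values of \<open>f\<close>,
which is a random variable when \<open>f\<close> is the path of a process.\<close>

lemma gram_schmidt:
  assumes v: "\<And>n::nat. v n \<in> fns H"
  shows "\<exists>g \<beta>. orthonormal_or_zero g \<and> (\<forall>n. g n = (\<lambda>t. \<Sum>i\<le>n. \<beta> n i * v i t)) \<and>
    (\<forall>n. v n = (\<lambda>t. \<Sum>i\<le>n. ip H (v n) (g i) * g i t))"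
proof -
  have "\<forall>n. \<exists>\<beta>. gs v n = (\<lambda>t. \<Sum>i\<le>n. \<beta> i * v i t)" using gs_span[of v, OF v] by blast
  then obtain \<beta> where \<beta>: "\<And>n. gs v n = (\<lambda>t. \<Sum>i\<le>n. \<beta> n i * v i t)"
    using choice[of "\<lambda>n \<beta>. gs v n = (\<lambda>t. \<Sum>i\<le>n. \<beta> i * v i t)"] by blast
  show ?thesis
    by (intro exI[of _ "gs v"] exI[of _ \<beta>] conjI allI gs_orthonormal gs_expand v \<beta>)
qed

end


section \<open>Expansion spaces of biorthogonal systems\<close>

lemma square_sum_product_summable:
  fixes a b :: "'i \<Rightarrow> real"
  assumes "(\<lambda>i. (a i)\<^sup>2) summable_on I" "(\<lambda>i. (b i)\<^sup>2) summable_on I"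
  shows "(\<lambda>i. a i * b i) summable_on I"
proof (rule abs_summable_summable)
  have "(\<lambda>i. (a i)\<^sup>2 + (b i)\<^sup>2) summable_on I" by (intro summable_on_add assms)
  then show "(\<lambda>i. norm (a i * b i)) summable_on I"
  proof (rule summable_on_comparison_test)
    fix i
    have "0 \<le> (\<bar>a i\<bar> - \<bar>b i\<bar>)\<^sup>2" by simp
    then have "2 * (\<bar>a i\<bar> * \<bar>b i\<bar>) \<le> (a i)\<^sup>2 + (b i)\<^sup>2" by (simp add: power2_diff)
    moreover have "0 \<le> \<bar>a i\<bar> * \<bar>b i\<bar>" by simp
    ultimately show "norm (a i * b i) \<le> (a i)\<^sup>2 + (b i)\<^sup>2"
      unfolding real_norm_def abs_mult by linarith
  qed auto
qed

lemma square_sum_add_summable: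
  fixes a b :: "'i \<Rightarrow> real"
  assumes "(\<lambda>i. (a i)\<^sup>2) summable_on I" "(\<lambda>i. (b i)\<^sup>2) summable_on I"
  shows "(\<lambda>i. (a i + b i)\<^sup>2) summable_on I"
proof -
  have "(\<lambda>i. (a i)\<^sup>2 + (b i)\<^sup>2 + 2 * (a i * b i)) summable_on I"
    by (intro summable_on_add summable_on_cmult_right square_sum_product_summable assms)
  then show ?thesis by (simp add: power2_sum algebra_simps)
qed

lemma infsum_cauchy_schwarz:
  fixes a b :: "'i \<Rightarrow> real"
  assumes a: "(\<lambda>i. (a i)\<^sup>2) summable_on I" and b: "(\<lambda>i. (b i)\<^sup>2) summable_on I"
  shows "\<bar>\<Sum>\<^sub>\<infinity>i\<in>I. a i * b i\<bar> \<le> sqrt (\<Sum>\<^sub>\<infinity>i\<in>I. (a i)\<^sup>2) * sqrt (\<Sum>\<^sub>\<infinity>i\<in>I. (b i)\<^sup>2)"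
proof -
  have fin: "(\<Sum>i\<in>F. \<bar>a i * b i\<bar>) \<le> sqrt (\<Sum>\<^sub>\<infinity>i\<in>I. (a i)\<^sup>2) * sqrt (\<Sum>\<^sub>\<infinity>i\<in>I. (b i)\<^sup>2)"
    if F: "finite F" "F \<subseteq> I" for F
  proof -
    have "(\<Sum>i\<in>F. \<bar>a i * b i\<bar>) \<le> L2_set a F * L2_set b F"
      using L2_set_mult_ineq[of a b F] by (simp add: abs_mult)
    also have "\<dots> \<le> sqrt (\<Sum>\<^sub>\<infinity>i\<in>I. (a i)\<^sup>2) * sqrt (\<Sum>\<^sub>\<infinity>i\<in>I. (b i)\<^sup>2)"
      unfolding L2_set_def using F a b
      by (intro mult_mono real_sqrt_le_mono finite_sum_le_infsum) (auto intro!: infsum_nonneg sum_nonneg)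
    finally show ?thesis .
  qed
  have s: "(\<lambda>i. a i * b i) summable_on I" by (rule square_sum_product_summable[OF a b])
  have as: "(\<lambda>i. norm (a i * b i)) summable_on I"
    by (rule iffD1[OF summable_on_iff_abs_summable_on_real s])
  have "norm (\<Sum>\<^sub>\<infinity>i\<in>I. a i * b i) \<le> (\<Sum>\<^sub>\<infinity>i\<in>I. norm (a i * b i))"
    by (rule norm_infsum_bound[OF as])
  also have "\<dots> \<le> sqrt (\<Sum>\<^sub>\<infinity>i\<in>I. (a i)\<^sup>2) * sqrt (\<Sum>\<^sub>\<infinity>i\<in>I. (b i)\<^sup>2)"
    by (rule infsum_le_finite_sums[OF as]) (use fin in simp)
  finally show ?thesis by simp
qed

lemma has_sum_finite_sum:
  fixes f :: "'x \<Rightarrow> 'i \<Rightarrow> real"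
  assumes "finite B" "\<And>x. x \<in> B \<Longrightarrow> (f x has_sum s x) I"
  shows "((\<lambda>i. \<Sum>x\<in>B. f x i) has_sum (\<Sum>x\<in>B. s x)) I"
  using assms by (induction B rule: finite_induct) (auto intro!: has_sum_add)

text \<open>A system \<open>u\<close> whose coefficient functionals are finite combinations of point evaluations. The functions \<open>\<Sum>i a\<^sub>i u\<^sub>i\<close> with \<open>a \<in> \<ell>\<^sub>2\<close>
form an RKHS in which \<open>u\<close> is an orthonormal basis. Its elements are characterised by their values alone, so that tensor products
need no abstract construction.\<close>

locale biorthogonal_system =
  fixes T :: "'a set" and u :: "'i \<Rightarrow> 'a \<Rightarrow> real" and I :: "'i set"
    and A :: "'i \<Rightarrow> 'a set" and \<gamma> :: "'i \<Rightarrow> 'a \<Rightarrow> real"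
  assumes nodes: "i \<in> I \<Longrightarrow> finite (A i)" "i \<in> I \<Longrightarrow> A i \<subseteq> T"
    and square_summable: "t \<in> T \<Longrightarrow> (\<lambda>i. (u i t)\<^sup>2) summable_on I"
    and biorthogonal: "i \<in> I \<Longrightarrow> j \<in> I \<Longrightarrow> (\<Sum>x\<in>A i. \<gamma> i x * u j x) = (if i = j then 1 else 0)"
begin

definition coef :: "'i \<Rightarrow> ('a \<Rightarrow> real) \<Rightarrow> real" where
  "coef i f = (\<Sum>x\<in>A i. \<gamma> i x * f x)"

definition synthesis :: "('i \<Rightarrow> real) \<Rightarrow> 'a \<Rightarrow> real" where
  "synthesis a = zero_ext T (\<lambda>t. \<Sum>\<^sub>\<infinity>i\<in>I. a i * u i t)"

definition expansion_space :: "'a fun_space" where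
  "expansion_space = \<lparr>fns = {f. (\<lambda>i. (coef i f)\<^sup>2) summable_on I \<and> f = synthesis (\<lambda>i. coef i f)},
     ip = (\<lambda>f g. \<Sum>\<^sub>\<infinity>i\<in>I. coef i f * coef i g)\<rparr>"

lemma coef_add: "coef i (\<lambda>t. f t + g t) = coef i f + coef i g"
  and coef_scale: "coef i (\<lambda>t. c * f t) = c * coef i f"
  and coef_diff: "coef i (\<lambda>t. f t - g t) = coef i f - coef i g"
  by (simp_all add: coef_def sum.distrib sum_subtractf sum_distrib_left algebra_simps)

lemma expansion_summable:
  "t \<in> T \<Longrightarrow> (\<lambda>i. (a i)\<^sup>2) summable_on I \<Longrightarrow> (\<lambda>i. a i * u i t) summable_on I"
  by (intro square_sum_product_summable square_summable)

lemma coef_synthesis: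
  assumes a: "(\<lambda>i. (a i)\<^sup>2) summable_on I" and j: "j \<in> I"
  shows "coef j (synthesis a) = a j"
proof -
  have "((\<lambda>i. \<Sum>x\<in>A j. \<gamma> j x * (a i * u i x)) has_sum (\<Sum>x\<in>A j. \<gamma> j x * (\<Sum>\<^sub>\<infinity>i\<in>I. a i * u i x))) I"
    using nodes[OF j] a
    by (intro has_sum_finite_sum has_sum_cmult_right has_sum_infsum expansion_summable) auto
  moreover have "(\<Sum>x\<in>A j. \<gamma> j x * (a i * u i x)) = (if i = j then a j else 0)" if "i \<in> I" for i
  proof -
    have "(\<Sum>x\<in>A j. \<gamma> j x * (a i * u i x)) = a i * (\<Sum>x\<in>A j. \<gamma> j x * u i x)"
      by (simp add: sum_distrib_left mult.left_commute)
    then show ?thesis using biorthogonal[OF j that] by auto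
  qed
  ultimately have "((\<lambda>i. if i = j then a j else 0) has_sum (\<Sum>x\<in>A j. \<gamma> j x * (\<Sum>\<^sub>\<infinity>i\<in>I. a i * u i x))) I"
    by (simp cong: has_sum_cong)
  moreover have "((\<lambda>i. if i = j then a j else 0) has_sum a j) I"
    by (rule has_sum_finite_neutralI[of "{j}"]) (use j in auto)
  ultimately have "(\<Sum>x\<in>A j. \<gamma> j x * (\<Sum>\<^sub>\<infinity>i\<in>I. a i * u i x)) = a j" by (rule has_sum_unique)
  moreover have "coef j (synthesis a) = (\<Sum>x\<in>A j. \<gamma> j x * (\<Sum>\<^sub>\<infinity>i\<in>I. a i * u i x))"
    unfolding coef_def synthesis_def zero_ext_def using nodes(2)[OF j] by (intro sum.cong) auto
  ultimately show ?thesis by simp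
qed

lemma synthesis_cong: "(\<And>i. i \<in> I \<Longrightarrow> a i = b i) \<Longrightarrow> synthesis a = synthesis b"
  unfolding synthesis_def zero_ext_def by (auto intro!: ext infsum_cong)

lemma synthesis_in:
  assumes a: "(\<lambda>i. (a i)\<^sup>2) summable_on I"
  shows "synthesis a \<in> fns expansion_space"
proof -
  have "(\<lambda>i. (coef i (synthesis a))\<^sup>2) summable_on I"
    using a by (simp add: coef_synthesis[OF a] cong: summable_on_cong)
  moreover have "synthesis a = synthesis (\<lambda>i. coef i (synthesis a))"
    by (rule synthesis_cong) (simp add: coef_synthesis[OF a])
  ultimately show ?thesis by (simp add: expansion_space_def)
qed

lemma expansion_spaceD:
  assumes "f \<in> fns expansion_space"
  shows "(\<lambda>i. (coef i f)\<^sup>2) summable_on I" "t \<notin> T \<Longrightarrow> f t = 0"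
    "t \<in> T \<Longrightarrow> f t = (\<Sum>\<^sub>\<infinity>i\<in>I. coef i f * u i t)"
proof -
  show "(\<lambda>i. (coef i f)\<^sup>2) summable_on I" using assms by (simp add: expansion_space_def)
  have e: "f = synthesis (\<lambda>i. coef i f)" using assms by (simp add: expansion_space_def)
  show "f t = 0" if "t \<notin> T" using that by (subst e) (simp add: synthesis_def zero_ext_def)
  show "f t = (\<Sum>\<^sub>\<infinity>i\<in>I. coef i f * u i t)" if "t \<in> T" using that by (subst e) (simp add: synthesis_def zero_ext_def)
qed

lemma fnorm_expansion: "fnorm expansion_space f = sqrt (\<Sum>\<^sub>\<infinity>i\<in>I. (coef i f)\<^sup>2)"
  by (simp add: fnorm_def expansion_space_def power2_eq_square)

lemma expansion_space_eval_bound: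
  assumes t: "t \<in> T" and f: "f \<in> fns expansion_space"
  shows "\<bar>f t\<bar> \<le> sqrt (\<Sum>\<^sub>\<infinity>i\<in>I. (u i t)\<^sup>2) * fnorm expansion_space f"
  using infsum_cauchy_schwarz[OF expansion_spaceD(1)[OF f] square_summable[OF t]] expansion_spaceD(3)[OF f t]
  by (simp add: fnorm_expansion mult.commute)

lemma synthesis_add:
  assumes "(\<lambda>i. (a i)\<^sup>2) summable_on I" "(\<lambda>i. (b i)\<^sup>2) summable_on I"
  shows "synthesis (\<lambda>i. a i + b i) t = synthesis a t + synthesis b t"
  using infsum_add[OF expansion_summable[OF _ assms(1)] expansion_summable[OF _ assms(2)], of t]
  by (auto simp: synthesis_def zero_ext_def ring_distribs)

lemma synthesis_scale: "synthesis (\<lambda>i. c * a i) t = c * synthesis a t"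
  by (simp add: synthesis_def zero_ext_def mult.assoc infsum_cmult_right')

text \<open>For a Cauchy sequence the coefficients converge in \<open>\<ell>\<^sub>2\<close>, by the usual argument: finite parts of the sums pass to the limit.\<close>

lemma expansion_space_complete:
  assumes u: "range v \<subseteq> fns expansion_space"
    and cauchy: "\<And>e. e > 0 \<Longrightarrow> \<exists>N. \<forall>m\<ge>N. \<forall>n\<ge>N. fnorm expansion_space (\<lambda>t. v m t - v n t) < e"
  shows "\<exists>f\<in>fns expansion_space. (\<lambda>n. fnorm expansion_space (\<lambda>t. v n t - f t)) \<longlonglongrightarrow> 0"
proof -
  have vS: "(\<lambda>i. (coef i (v n))\<^sup>2) summable_on I" for n using u by (intro expansion_spaceD(1)) auto
  have vD: "(\<lambda>i. (coef i (v m) - coef i (v n))\<^sup>2) summable_on I" for m n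
    using square_sum_add_summable[OF vS[of m], of "\<lambda>i. - coef i (v n)"] vS[of n] by simp
  have fin: "(\<Sum>i\<in>F. (coef i (v m) - coef i (v n))\<^sup>2) \<le> (fnorm expansion_space (\<lambda>t. v m t - v n t))\<^sup>2"
    if "finite F" "F \<subseteq> I" for F m n
    using finite_sum_le_infsum[OF vD that] by (simp add: fnorm_expansion coef_diff infsum_nonneg)
  have conv: "convergent (\<lambda>n. coef i (v n))" if i: "i \<in> I" for i
  proof (rule Cauchy_convergent, rule CauchyI)
    fix e :: real assume e: "e > 0"
    obtain N where N: "\<And>m n. m \<ge> N \<Longrightarrow> n \<ge> N \<Longrightarrow> fnorm expansion_space (\<lambda>t. v m t - v n t) < e"
      using cauchy[OF e] by blast
    have "norm (coef i (v m) - coef i (v n)) < e" if "m \<ge> N" "n \<ge> N" for m n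
    proof -
      have "(coef i (v m) - coef i (v n))\<^sup>2 \<le> (fnorm expansion_space (\<lambda>t. v m t - v n t))\<^sup>2"
        using fin[of "{i}" m n] i by simp
      then have "\<bar>coef i (v m) - coef i (v n)\<bar> \<le> fnorm expansion_space (\<lambda>t. v m t - v n t)"
        unfolding fnorm_expansion by (intro real_le_rsqrt) (simp add: infsum_nonneg)
      then show ?thesis using N[OF that] by simp
    qed
    then show "\<exists>N. \<forall>m\<ge>N. \<forall>n\<ge>N. norm (coef i (v m) - coef i (v n)) < e" by blast
  qed
  then obtain a where a: "\<And>i. i \<in> I \<Longrightarrow> (\<lambda>n. coef i (v n)) \<longlonglongrightarrow> a i"
    unfolding convergent_def by metis
  have close: "\<exists>N. \<forall>n\<ge>N. \<forall>F. finite F \<and> F \<subseteq> I \<longrightarrow> (\<Sum>i\<in>F. (coef i (v n) - a i)\<^sup>2) \<le> e\<^sup>2" if e: "e > 0" for e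
  proof -
    obtain N where N: "\<And>m n. m \<ge> N \<Longrightarrow> n \<ge> N \<Longrightarrow> fnorm expansion_space (\<lambda>t. v m t - v n t) < e"
      using cauchy[OF e] by blast
    have "(\<Sum>i\<in>F. (coef i (v n) - a i)\<^sup>2) \<le> e\<^sup>2" if n: "n \<ge> N" and F: "finite F" "F \<subseteq> I" for n F
    proof (rule LIMSEQ_le_const2)
      show "(\<lambda>m. \<Sum>i\<in>F. (coef i (v n) - coef i (v m))\<^sup>2) \<longlonglongrightarrow> (\<Sum>i\<in>F. (coef i (v n) - a i)\<^sup>2)"
        using F a by (intro tendsto_intros) auto
      have "(\<Sum>i\<in>F. (coef i (v n) - coef i (v m))\<^sup>2) \<le> e\<^sup>2" if "m \<ge> N" for m
      proof -
        have "(fnorm expansion_space (\<lambda>t. v n t - v m t))\<^sup>2 \<le> e\<^sup>2"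
          using N[OF n that] by (intro power_mono) (auto simp: fnorm_expansion infsum_nonneg)
        then show ?thesis using fin[OF F, of n m] by linarith
      qed
      then show "\<exists>N. \<forall>m\<ge>N. (\<Sum>i\<in>F. (coef i (v n) - coef i (v m))\<^sup>2) \<le> e\<^sup>2" by blast
    qed
    then show ?thesis by blast
  qed
  have diffS: "\<exists>N. \<forall>n\<ge>N. (\<lambda>i. (coef i (v n) - a i)\<^sup>2) summable_on I \<and>
      (\<Sum>\<^sub>\<infinity>i\<in>I. (coef i (v n) - a i)\<^sup>2) \<le> e\<^sup>2" if e: "e > 0" for e
  proof -
    obtain N where N: "\<And>n F. n \<ge> N \<Longrightarrow> finite F \<Longrightarrow> F \<subseteq> I \<Longrightarrow> (\<Sum>i\<in>F. (coef i (v n) - a i)\<^sup>2) \<le> e\<^sup>2"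
      using close[OF e] by blast
    have "(\<lambda>i. (coef i (v n) - a i)\<^sup>2) summable_on I \<and> (\<Sum>\<^sub>\<infinity>i\<in>I. (coef i (v n) - a i)\<^sup>2) \<le> e\<^sup>2" if n: "n \<ge> N" for n
    proof -
      have s: "(\<lambda>i. (coef i (v n) - a i)\<^sup>2) summable_on I"
        by (rule nonneg_bdd_above_summable_on) (auto intro!: bdd_aboveI[of _ "e\<^sup>2"] N[OF n])
      then show ?thesis using infsum_le_finite_sums[OF s] N[OF n] by blast
    qed
    then show ?thesis by blast
  qed
  have aS: "(\<lambda>i. (a i)\<^sup>2) summable_on I"
  proof -
    obtain N where "(\<lambda>i. (coef i (v N) - a i)\<^sup>2) summable_on I" using diffS[of 1] by auto
    then have "(\<lambda>i. (a i - coef i (v N))\<^sup>2) summable_on I" by (simp add: power2_commute)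
    from square_sum_add_summable[OF this vS[of N]] show ?thesis by simp
  qed
  show ?thesis
  proof (intro bexI[of _ "synthesis a"] synthesis_in aS)
    have eq: "fnorm expansion_space (\<lambda>t. v n t - synthesis a t) = sqrt (\<Sum>\<^sub>\<infinity>i\<in>I. (coef i (v n) - a i)\<^sup>2)" for n
      unfolding fnorm_expansion coef_diff
      by (intro arg_cong[where f = sqrt] infsum_cong) (simp add: coef_synthesis[OF aS])
    show "(\<lambda>n. fnorm expansion_space (\<lambda>t. v n t - synthesis a t)) \<longlonglongrightarrow> 0"
    proof (rule LIMSEQ_I)
      fix e :: real assume e: "e > 0"
      obtain N where N: "\<And>n. n \<ge> N \<Longrightarrow> (\<Sum>\<^sub>\<infinity>i\<in>I. (coef i (v n) - a i)\<^sup>2) \<le> (e/2)\<^sup>2"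
        using diffS[of "e/2"] e by auto
      have "norm (fnorm expansion_space (\<lambda>t. v n t - synthesis a t) - 0) < e" if "n \<ge> N" for n
      proof -
        have "sqrt (\<Sum>\<^sub>\<infinity>i\<in>I. (coef i (v n) - a i)\<^sup>2) \<le> e/2"
          using real_sqrt_le_mono[OF N[OF that]] e by simp
        then show ?thesis using e by (simp add: eq infsum_nonneg)
      qed
      then show "\<exists>N. \<forall>n\<ge>N. norm (fnorm expansion_space (\<lambda>t. v n t - synthesis a t) - 0) < e" by blast
    qed
  qed
qed

lemma rkhs_expansion_space: "rkhs T expansion_space"
  unfolding rkhs_def
proof (intro conjI ballI allI impI)
  show "(\<lambda>t. 0) \<in> fns expansion_space"
    using synthesis_in[of "\<lambda>i. 0"] by (simp add: synthesis_def zero_ext_def)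
  fix f g assume f: "f \<in> fns expansion_space" and g: "g \<in> fns expansion_space"
  note fs = expansion_spaceD(1)[OF f] and gs = expansion_spaceD(1)[OF g]
  have fe: "f = synthesis (\<lambda>i. coef i f)" and ge: "g = synthesis (\<lambda>i. coef i g)"
    using f g by (simp_all add: expansion_space_def)
  have "(\<lambda>t. f t + g t) = synthesis (\<lambda>i. coef i f + coef i g)"
    using fe ge by (auto simp: fun_eq_iff synthesis_add[OF fs gs])
  then show "(\<lambda>t. f t + g t) \<in> fns expansion_space"
    using synthesis_in[OF square_sum_add_summable[OF fs gs]] by simp
  show "ip expansion_space f g = ip expansion_space g f"
    by (simp add: expansion_space_def mult.commute)
  show "ip expansion_space (\<lambda>t. c * f t) g = c * ip expansion_space f g" for c
    by (simp add: expansion_space_def coef_scale mult.assoc infsum_cmult_right')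
  fix h assume h: "h \<in> fns expansion_space"
  note hs = expansion_spaceD(1)[OF h]
  show "ip expansion_space (\<lambda>t. f t + g t) h = ip expansion_space f h + ip expansion_space g h"
    using infsum_add[OF square_sum_product_summable[OF fs hs] square_sum_product_summable[OF gs hs]]
    by (simp add: expansion_space_def coef_add ring_distribs)
next
  fix c f assume f: "f \<in> fns expansion_space"
  note fs = expansion_spaceD(1)[OF f]
  have fe: "f = synthesis (\<lambda>i. coef i f)" using f by (simp add: expansion_space_def)
  have "(\<lambda>t. c * f t) = synthesis (\<lambda>i. c * coef i f)"
    using fe by (auto simp: fun_eq_iff synthesis_scale)
  moreover have "(\<lambda>i. (c * coef i f)\<^sup>2) summable_on I"
    using summable_on_cmult_right[OF fs, of "c\<^sup>2"] by (simp add: power_mult_distrib)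
  ultimately show "(\<lambda>t. c * f t) \<in> fns expansion_space" using synthesis_in by simp
next
  fix f assume f: "f \<in> fns expansion_space" and nz: "f \<noteq> (\<lambda>t. 0)"
  note fs = expansion_spaceD(1)[OF f]
  have fe: "f = synthesis (\<lambda>i. coef i f)" using f by (simp add: expansion_space_def)
  have "\<exists>i\<in>I. coef i f \<noteq> 0"
  proof (rule ccontr)
    assume "\<not> ?thesis"
    then have "synthesis (\<lambda>i. coef i f) = synthesis (\<lambda>i. 0)" by (intro synthesis_cong) auto
    then show False using fe nz by (simp add: synthesis_def zero_ext_def)
  qed
  then obtain i where i: "i \<in> I" "coef i f \<noteq> 0" by blast
  have "0 < (coef i f)\<^sup>2" using i by simp
  also have "\<dots> \<le> (\<Sum>\<^sub>\<infinity>i\<in>I. (coef i f)\<^sup>2)" using finite_sum_le_infsum[OF fs, of "{i}"] i by simp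
  finally show "0 < ip expansion_space f f" by (simp add: expansion_space_def power2_eq_square)
next
  fix t assume "t \<in> T"
  then show "\<exists>C. \<forall>f\<in>fns expansion_space. \<bar>f t\<bar> \<le> C * fnorm expansion_space f"
    using expansion_space_eval_bound by blast
next
  fix v :: "nat \<Rightarrow> 'a \<Rightarrow> real" assume "range v \<subseteq> fns expansion_space \<and>
    (\<forall>e>0. \<exists>N. \<forall>m\<ge>N. \<forall>n\<ge>N. fnorm expansion_space (\<lambda>t. v m t - v n t) < e)"
  then show "\<exists>f\<in>fns expansion_space. (\<lambda>n. fnorm expansion_space (\<lambda>t. v n t - f t)) \<longlonglongrightarrow> 0"
    by (intro expansion_space_complete) auto
qed (use expansion_spaceD(2) in blast)

lemma rkhs_of_kernel_expansion_space:
  assumes k: "\<And>s t. s \<in> T \<Longrightarrow> t \<in> T \<Longrightarrow> k s t = (\<Sum>\<^sub>\<infinity>i\<in>I. u i s * u i t)"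
  shows "rkhs_of_kernel T k expansion_space"
  unfolding rkhs_of_kernel_def
proof (intro conjI ballI rkhs_expansion_space)
  fix t assume t: "t \<in> T"
  have eq: "zero_ext T (k t) = synthesis (\<lambda>i. u i t)"
    unfolding synthesis_def zero_ext_def using k[OF t] by auto
  show "zero_ext T (k t) \<in> fns expansion_space"
    unfolding eq by (intro synthesis_in square_summable t)
  fix f assume f: "f \<in> fns expansion_space"
  have "ip expansion_space f (zero_ext T (k t)) = (\<Sum>\<^sub>\<infinity>i\<in>I. coef i f * u i t)"
    unfolding eq by (simp add: expansion_space_def coef_synthesis[OF square_summable[OF t]] cong: infsum_cong)
  then show "ip expansion_space f (zero_ext T (k t)) = f t" using expansion_spaceD(3)[OF f t] by simp
qed

end

definition ell2 :: "nat fun_space" where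
  "ell2 = \<lparr>fns = {a. (\<lambda>i. (a i)\<^sup>2) summable_on UNIV}, ip = (\<lambda>a b. \<Sum>\<^sub>\<infinity>i. a i * b i)\<rparr>"

lemma rkhs_ell2: "rkhs UNIV ell2"
proof -
  let ?u = "\<lambda>(i::nat) t. if i = t then 1 else (0::real)"
  interpret biorthogonal_system UNIV ?u UNIV "\<lambda>i. {i}" "\<lambda>i x. 1"
  proof
    fix t :: nat
    have "((\<lambda>i. (?u i t)\<^sup>2) has_sum 1) UNIV" by (rule has_sum_finite_neutralI[of "{t}"]) auto
    then show "(\<lambda>i. (?u i t)\<^sup>2) summable_on UNIV" by (rule has_sum_imp_summable)
  qed auto
  have c: "coef i f = f i" for i f by (simp add: coef_def)
  have "synthesis f = f" for f
  proof
    fix t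
    have "((\<lambda>i. f i * ?u i t) has_sum f t) UNIV" by (rule has_sum_finite_neutralI[of "{t}"]) auto
    then show "synthesis f t = f t" by (simp add: synthesis_def zero_ext_def infsumI)
  qed
  then have "expansion_space = ell2" by (simp add: expansion_space_def ell2_def c)
  then show ?thesis using rkhs_expansion_space by simp
qed

text \<open>The defect \<open>\<phi> x - x \<phi> 1\<close> is additive, has period one, and is therefore bounded; an additive bounded function vanishes.\<close>

lemma additive_locally_bounded_linear:
  fixes \<phi> :: "real \<Rightarrow> real"
  assumes add: "\<And>x y. \<phi> (x + y) = \<phi> x + \<phi> y" and bd: "\<And>x. \<bar>x\<bar> \<le> 1 \<Longrightarrow> \<bar>\<phi> x\<bar> \<le> M"
  shows "\<phi> c = c * \<phi> 1"
proof -
  define \<psi> where "\<psi> x = \<phi> x - x * \<phi> 1" for x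
  have padd: "\<psi> (x + y) = \<psi> x + \<psi> y" for x y by (simp add: \<psi>_def add algebra_simps)
  have p0: "\<psi> 0 = 0" using padd[of 0 0] by simp
  have pmult: "\<psi> (real n * x) = real n * \<psi> x" for n x
    by (induction n) (simp_all add: p0 padd ring_distribs)
  have pneg: "\<psi> (- x) = - \<psi> x" for x using padd[of x "-x"] p0 by simp
  have p1: "\<psi> 1 = 0" by (simp add: \<psi>_def)
  have pint: "\<psi> (of_int k) = 0" for k :: int
  proof (cases "k \<ge> 0")
    case True then show ?thesis using pmult[of "nat k" 1] p1 by simp
  next
    case False then show ?thesis using pmult[of "nat (-k)" 1] p1 pneg[of "of_int k"] by simp
  qed
  have b: "\<bar>\<psi> x\<bar> \<le> M + \<bar>\<phi> 1\<bar>" for x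
  proof -
    have "\<psi> x = \<psi> (frac x)" using padd[of "of_int \<lfloor>x\<rfloor>" "frac x"] pint by (simp add: frac_def)
    moreover have f: "0 \<le> frac x" "frac x < 1" by (auto simp: frac_lt_1)
    moreover have "\<bar>\<phi> (frac x)\<bar> \<le> M" using f by (intro bd) auto
    moreover have "\<bar>frac x * \<phi> 1\<bar> \<le> 1 * \<bar>\<phi> 1\<bar>" unfolding abs_mult using f by (intro mult_right_mono) auto
    ultimately show ?thesis unfolding \<psi>_def by linarith
  qed
  have "\<psi> c = 0"
  proof (rule ccontr)
    assume "\<psi> c \<noteq> 0"
    then obtain n where "real n * \<bar>\<psi> c\<bar> > M + \<bar>\<phi> 1\<bar>" using reals_Archimedean3[of "\<bar>\<psi> c\<bar>"] by auto
    then show False using b[of "real n * c"] by (simp add: pmult abs_mult)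
  qed
  then show ?thesis by (simp add: \<psi>_def)
qed

text \<open>Besov norms on \<open>(0,1)\<close> are infima, and only the parallelogram law is visible for them. The theorem of Jordan and von Neumann
recovers the bilinearity of the polarised form; homogeneity over \<open>\<real>\<close> follows from additivity and local boundedness.\<close>

locale parallelogram_norm =
  fixes V :: "('a \<Rightarrow> real) set" and N :: "('a \<Rightarrow> real) \<Rightarrow> real"
  assumes V_add: "f \<in> V \<Longrightarrow> g \<in> V \<Longrightarrow> (\<lambda>t. f t + g t) \<in> V"
    and V_scale: "f \<in> V \<Longrightarrow> (\<lambda>t. c * f t) \<in> V"
    and N_scale: "f \<in> V \<Longrightarrow> N (\<lambda>t. c * f t) = \<bar>c\<bar> * N f"
    and parallelogram: "f \<in> V \<Longrightarrow> g \<in> V \<Longrightarrow>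
      (N (\<lambda>t. f t + g t))\<^sup>2 + (N (\<lambda>t. f t - g t))\<^sup>2 = 2 * (N f)\<^sup>2 + 2 * (N g)\<^sup>2"
begin

definition polar :: "('a \<Rightarrow> real) \<Rightarrow> ('a \<Rightarrow> real) \<Rightarrow> real" where
  "polar f g = ((N (\<lambda>t. f t + g t))\<^sup>2 - (N (\<lambda>t. f t - g t))\<^sup>2) / 4"

lemma V_diff: "f \<in> V \<Longrightarrow> g \<in> V \<Longrightarrow> (\<lambda>t. f t - g t) \<in> V"
  using V_add[OF _ V_scale[of g "-1"], of f] by simp

lemma N_minus: "f \<in> V \<Longrightarrow> g \<in> V \<Longrightarrow> N (\<lambda>t. f t - g t) = N (\<lambda>t. g t - f t)"
  using N_scale[OF V_diff[of f g], of "-1"] by simp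

lemma polar_sym: "f \<in> V \<Longrightarrow> g \<in> V \<Longrightarrow> polar f g = polar g f"
  using N_minus[of f g] by (simp add: polar_def add.commute)

lemma polar_self: assumes f: "f \<in> V" shows "polar f f = (N f)\<^sup>2"
  using N_scale[OF f, of 2] N_scale[OF f, of 0] by (simp add: polar_def power_mult_distrib)

lemma polar_add:
  assumes f: "f \<in> V" and g: "g \<in> V" and h: "h \<in> V"
  shows "polar (\<lambda>t. f t + g t) h = polar f h + polar g h"
proof -
  define q where "q f = (N f)\<^sup>2" for f
  have p: "q (\<lambda>t. f t + g t) + q (\<lambda>t. f t - g t) = 2 * q f + 2 * q g" if "f \<in> V" "g \<in> V" for f g
    using parallelogram[OF that] by (simp add: q_def)
  have e: "q (\<lambda>t. - f t) = q f" if "f \<in> V" for f using N_scale[OF that, of "-1"] by (simp add: q_def)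
  note cl = f g h V_add V_diff
  have 1: "q (\<lambda>t. f t + g t + h t) + q (\<lambda>t. f t - g t + h t) = 2 * q (\<lambda>t. f t + h t) + 2 * q g"
    using p[OF V_add[OF f h] g] by (simp add: algebra_simps)
  have 2: "q (\<lambda>t. f t + g t - h t) + q (\<lambda>t. f t - g t - h t) = 2 * q (\<lambda>t. f t - h t) + 2 * q g"
    using p[OF V_diff[OF f h] g] by (simp add: algebra_simps)
  have 3: "q (\<lambda>t. f t + g t + h t) + q (\<lambda>t. - (f t - g t - h t)) = 2 * q (\<lambda>t. g t + h t) + 2 * q f"
    using p[OF V_add[OF g h] f] by (simp add: algebra_simps)
  have 4: "q (\<lambda>t. f t + g t - h t) + q (\<lambda>t. - (f t - g t + h t)) = 2 * q (\<lambda>t. g t - h t) + 2 * q f"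
    using p[OF V_diff[OF g h] f] by (simp add: algebra_simps)
  have 5: "q (\<lambda>t. - (f t - g t - h t)) = q (\<lambda>t. f t - g t - h t)" by (intro e V_diff f g h)
  have 6: "q (\<lambda>t. - (f t - g t + h t)) = q (\<lambda>t. f t - g t + h t)" by (intro e V_add V_diff f g h)
  show ?thesis using 1 2 3 4 5 6 unfolding polar_def q_def[symmetric] by argo
qed

lemma polar_scale:
  assumes f: "f \<in> V" and g: "g \<in> V"
  shows "polar (\<lambda>t. c * f t) g = c * polar f g"
proof -
  have "polar (\<lambda>t. c * f t) g = c * polar (\<lambda>t. 1 * f t) g"
  proof (rule additive_locally_bounded_linear)
    fix x y
    show "polar (\<lambda>t. (x + y) * f t) g = polar (\<lambda>t. x * f t) g + polar (\<lambda>t. y * f t) g"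
      using polar_add[OF V_scale[OF f] V_scale[OF f] g] by (simp add: ring_distribs)
  next
    fix x :: real assume x: "\<bar>x\<bar> \<le> 1"
    have "(N (\<lambda>t. x * f t + g t))\<^sup>2 + (N (\<lambda>t. x * f t - g t))\<^sup>2 = 2 * (x\<^sup>2 * (N f)\<^sup>2) + 2 * (N g)\<^sup>2"
      using parallelogram[OF V_scale[OF f] g] by (simp add: N_scale[OF f] power_mult_distrib)
    moreover have "x\<^sup>2 * (N f)\<^sup>2 \<le> 1 * (N f)\<^sup>2"
      using x by (intro mult_right_mono) (auto simp: abs_square_le_1)
    moreover have "0 \<le> (N (\<lambda>t. x * f t + g t))\<^sup>2" "0 \<le> (N (\<lambda>t. x * f t - g t))\<^sup>2" by simp_all
    ultimately show "\<bar>polar (\<lambda>t. x * f t) g\<bar> \<le> ((N f)\<^sup>2 + (N g)\<^sup>2) / 2" unfolding polar_def by argo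
  qed
  then show ?thesis by simp
qed

end


section \<open>Fourier inversion and point evaluations in Sobolev spaces\<close>

lemma integral_cauchy_schwarz:
  fixes f g :: "'a \<Rightarrow> real"
  assumes [measurable]: "f \<in> borel_measurable M" "g \<in> borel_measurable M"
    and f: "integrable M (\<lambda>x. (f x)\<^sup>2)" and g: "integrable M (\<lambda>x. (g x)\<^sup>2)"
  shows "integrable M (\<lambda>x. f x * g x)"
    and "\<bar>\<integral>x. f x * g x \<partial>M\<bar> \<le> sqrt (\<integral>x. (f x)\<^sup>2 \<partial>M) * sqrt (\<integral>x. (g x)\<^sup>2 \<partial>M)"
proof -
  show i: "integrable M (\<lambda>x. f x * g x)"
  proof (rule Bochner_Integration.integrable_bound)
    show "integrable M (\<lambda>x. (f x)\<^sup>2 + (g x)\<^sup>2)" by (intro Bochner_Integration.integrable_add f g)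
    show "AE x in M. norm (f x * g x) \<le> norm ((f x)\<^sup>2 + (g x)\<^sup>2)"
    proof (rule AE_I2)
      fix x
      have "0 \<le> (\<bar>f x\<bar> - \<bar>g x\<bar>)\<^sup>2" by simp
      then have "2 * (\<bar>f x\<bar> * \<bar>g x\<bar>) \<le> (f x)\<^sup>2 + (g x)\<^sup>2" by (simp add: power2_diff)
      moreover have "0 \<le> \<bar>f x\<bar> * \<bar>g x\<bar>" by simp
      moreover have "0 \<le> (f x)\<^sup>2 + (g x)\<^sup>2" by simp
      ultimately show "norm (f x * g x) \<le> norm ((f x)\<^sup>2 + (g x)\<^sup>2)"
        unfolding real_norm_def abs_mult by linarith
    qed
  qed simp
  define A B C where "A = (\<integral>x. (f x)\<^sup>2 \<partial>M)" "B = (\<integral>x. f x * g x \<partial>M)" "C = (\<integral>x. (g x)\<^sup>2 \<partial>M)"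
  have q: "0 \<le> A + 2 * c * B + c\<^sup>2 * C" for c
  proof -
    have "0 \<le> (\<integral>x. (f x + c * g x)\<^sup>2 \<partial>M)" by simp
    also have "\<dots> = (\<integral>x. (f x)\<^sup>2 + 2 * c * (f x * g x) + c\<^sup>2 * (g x)\<^sup>2 \<partial>M)"
      by (intro Bochner_Integration.integral_cong) (auto simp: power2_sum power_mult_distrib algebra_simps)
    also have "\<dots> = A + 2 * c * B + c\<^sup>2 * C"
      unfolding A_B_C_def using f g i by simp
    finally show ?thesis .
  qed
  have C0: "0 \<le> C" and A0: "0 \<le> A" unfolding A_B_C_def by simp_all
  have "B\<^sup>2 \<le> A * C"
  proof (cases "C = 0")
    case True
    have "B = 0"
    proof (rule ccontr)
      assume "B \<noteq> 0"
      then show False using q[of "- (A + 1) / (2 * B)"] True by (simp add: field_simps)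
    qed
    then show ?thesis using True by simp
  next
    case False
    then have "0 \<le> A - B\<^sup>2 / C" using q[of "- B / C"] by (simp add: field_simps power2_eq_square)
    then show ?thesis using False C0 by (simp add: field_simps)
  qed
  then have "sqrt (B\<^sup>2) \<le> sqrt (A * C)" by (rule real_sqrt_le_mono)
  then show "\<bar>\<integral>x. f x * g x \<partial>M\<bar> \<le> sqrt (\<integral>x. (f x)\<^sup>2 \<partial>M) * sqrt (\<integral>x. (g x)\<^sup>2 \<partial>M)"
    by (simp add: A_B_C_def real_sqrt_mult)
qed

lemma integrable_bessel_weight:
  assumes p: "p > 1/2"
  shows "integrable lborel (\<lambda>\<xi>::real. (1 + \<xi>\<^sup>2) powr (- p))"
proof -
  have "(\<integral>\<^sup>+x. ennreal (x powr (- 2 * p)) * indicator {1..} x \<partial>lborel) = ennreal (0 - (1::real) powr (1 - 2 * p) / (1 - 2 * p))"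
  proof (rule nn_integral_FTC_atLeast[where F = "\<lambda>x. x powr (1 - 2 * p) / (1 - 2 * p)"])
    fix x :: real assume x: "1 \<le> x"
    show "((\<lambda>x. x powr (1 - 2 * p) / (1 - 2 * p)) has_real_derivative x powr (- 2 * p)) (at x)"
    proof -
      have "((\<lambda>x. x powr (1 - 2 * p) / (1 - 2 * p)) has_real_derivative ((1 - 2 * p) * x powr (1 - 2 * p - 1)) / (1 - 2 * p)) (at x)"
        using x by (intro DERIV_cdivide has_real_derivative_powr) simp
      then show ?thesis using p by simp
    qed
  next
    have "((\<lambda>x::real. x powr (1 - 2 * p)) \<longlongrightarrow> 0) at_top"
      using p by (intro tendsto_neg_powr) (auto intro: filterlim_ident)
    then show "((\<lambda>x::real. x powr (1 - 2 * p) / (1 - 2 * p)) \<longlongrightarrow> 0) at_top"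
      using tendsto_divide[OF _ tendsto_const, of "\<lambda>x. x powr (1 - 2 * p)" 0 at_top "1 - 2 * p"] p by simp
  qed auto
  then have i1: "integrable lborel (\<lambda>x::real. x powr (- 2 * p) * indicator {1..} x)"
    by (intro integrableI_nonneg) (auto simp: ennreal_mult' ennreal_indicator)
  have i2: "integrable lborel (\<lambda>x::real. (- x) powr (- 2 * p) * indicator {1..} (- x))"
    using lborel_integrable_real_affine[OF i1, of "-1" 0] by simp
  have i3: "integrable lborel (indicator {-1..1} :: real \<Rightarrow> real)" by simp
  have "integrable lborel (\<lambda>x::real. x powr (- 2 * p) * indicator {1..} x + (- x) powr (- 2 * p) * indicator {1..} (- x) + indicator {-1..1} x)"
    by (intro Bochner_Integration.integrable_add i1 i2 i3)
  then show ?thesis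
  proof (rule Bochner_Integration.integrable_bound)
    have one: "(1 + x\<^sup>2) powr (- p) \<le> 1" for x :: real
    proof -
      have "(1 + x\<^sup>2) powr (- p) \<le> 1 powr (- p)" using p by (intro powr_mono2') auto
      then show ?thesis by simp
    qed
    have big: "(1 + x\<^sup>2) powr (- p) \<le> y powr (- 2 * p)" if y: "y \<ge> 1" "x\<^sup>2 = y\<^sup>2" for x y :: real
    proof -
      have "(1 + x\<^sup>2) powr (- p) \<le> (y\<^sup>2) powr (- p)" using y p by (intro powr_mono2') auto
      also have "(y\<^sup>2) powr (- p) = y powr (- 2 * p)"
      proof -
        have "y\<^sup>2 = y powr 2" using y by simp
        then show ?thesis by (simp only: powr_powr) simp
      qed
      finally show ?thesis .
    qed
    show "AE x in lborel. norm ((1 + x\<^sup>2) powr (- p)) \<le> norm (x powr (- 2 * p) * indicator {1..} x + (- x) powr (- 2 * p) * indicator {1..} (- x) + indicator {-1..1} x :: real)"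
    proof (rule AE_I2)
      fix x :: real
      consider "x \<ge> 1" | "x \<le> -1" | "-1 < x" "x < 1" by linarith
      then show "norm ((1 + x\<^sup>2) powr (- p)) \<le> norm (x powr (- 2 * p) * indicator {1..} x + (- x) powr (- 2 * p) * indicator {1..} (- x) + indicator {-1..1} x :: real)"
        using one[of x] big[of x x] big[of "-x" x] 
        by cases (auto simp: indicator_def intro: order_trans)
    qed
  qed simp
qed

lemma gauss_fourier:
  "integrable lborel (\<lambda>x. complex_of_real (exp (- (x\<^sup>2) / 2)) * cis (t * x))"
  "(\<integral>x. complex_of_real (exp (- (x\<^sup>2) / 2)) * cis (t * x) \<partial>lborel) = complex_of_real (sqrt (2 * pi) * exp (- (t\<^sup>2) / 2))"
proof -
  have g: "exp (- (x\<^sup>2) / 2) = sqrt (2 * pi) * std_normal_density x" for x :: real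
    by (simp add: std_normal_density_def field_simps)
  have "integrable lborel (\<lambda>x. sqrt (2 * pi) * std_normal_density x)" by (intro integrable_mult_right integrable_normal_density) simp
  then have ge: "integrable lborel (\<lambda>x. exp (- ((x::real)\<^sup>2) / 2))" by (simp only: g)
  show "integrable lborel (\<lambda>x. complex_of_real (exp (- (x\<^sup>2) / 2)) * cis (t * x))"
    by (rule Bochner_Integration.integrable_bound[OF ge]) (auto simp: norm_mult cis_conv_exp)
  have "char std_normal_distribution t = (\<integral>x. std_normal_density x *\<^sub>R iexp (t * x) \<partial>lborel)"
    unfolding char_def by (subst integral_density) auto
  then have m1: "(\<integral>x. std_normal_density x *\<^sub>R cis (t * x) \<partial>lborel) = complex_of_real (exp (- (t\<^sup>2) / 2))"
    by (simp add: char_std_normal_distribution cis_conv_exp)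
  have m2: "(\<integral>x. complex_of_real (exp (- (x\<^sup>2) / 2)) * cis (t * x) \<partial>lborel) = (\<integral>x. complex_of_real (sqrt (2 * pi)) * (std_normal_density x *\<^sub>R cis (t * x)) \<partial>lborel)"
    by (intro Bochner_Integration.integral_cong refl) (simp only: g scaleR_conv_of_real of_real_mult mult.assoc)
  show "(\<integral>x. complex_of_real (exp (- (x\<^sup>2) / 2)) * cis (t * x) \<partial>lborel) = complex_of_real (sqrt (2 * pi) * exp (- (t\<^sup>2) / 2))"
    unfolding m2 integral_mult_right_zero m1 by simp
qed

lemma gauss_fourier_scaled:
  assumes e: "\<epsilon> > 0"
  shows "integrable lborel (\<lambda>\<xi>. complex_of_real (exp (- ((\<epsilon> * \<xi>)\<^sup>2) / 2)) * cis (z * \<xi>))"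
    and "(\<integral>\<xi>. complex_of_real (exp (- ((\<epsilon> * \<xi>)\<^sup>2) / 2)) * cis (z * \<xi>) \<partial>lborel)
      = complex_of_real (sqrt (2 * pi) / \<epsilon> * exp (- ((z / \<epsilon>)\<^sup>2) / 2))"
proof -
  show "integrable lborel (\<lambda>\<xi>. complex_of_real (exp (- ((\<epsilon> * \<xi>)\<^sup>2) / 2)) * cis (z * \<xi>))"
    using lborel_integrable_real_affine[OF gauss_fourier(1)[of "z / \<epsilon>"], of \<epsilon> 0] e by simp
  have "complex_of_real (sqrt (2 * pi) * exp (- ((z/\<epsilon>)\<^sup>2) / 2)) = 
     \<bar>\<epsilon>\<bar> *\<^sub>R (\<integral>\<xi>. complex_of_real (exp (- ((0 + \<epsilon> * \<xi>)\<^sup>2) / 2)) * cis (z / \<epsilon> * (0 + \<epsilon> * \<xi>)) \<partial>lborel)"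
    using lborel_integral_real_affine[of \<epsilon> "\<lambda>x. complex_of_real (exp (- (x\<^sup>2) / 2)) * cis (z / \<epsilon> * x)" 0] e
    by (simp only: gauss_fourier(2))
  then show "(\<integral>\<xi>. complex_of_real (exp (- ((\<epsilon> * \<xi>)\<^sup>2) / 2)) * cis (z * \<xi>) \<partial>lborel)
      = complex_of_real (sqrt (2 * pi) / \<epsilon> * exp (- ((z / \<epsilon>)\<^sup>2) / 2))"
    using e by (simp add: scaleR_conv_of_real field_simps)
qed

lemma norm_cis_mult [simp]: "cmod (a * cis x) = cmod a" "cmod (cis x * a) = cmod a"
  by (simp_all add: norm_mult)

lemma borel_measurable_cis [measurable]: "cis \<in> borel_measurable borel"
  by (intro borel_measurable_continuous_onI continuous_intros)

text \<open>Inversion with a Gaussian summability factor is Fubini's theorem and the Fourier transform of the Gaussian density.\<close>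

lemma smoothed_truncated_fourier:
  assumes f: "continuous_on UNIV f" and e: "\<epsilon> > 0"
  shows "(\<integral>\<xi>. complex_of_real (exp (- ((\<epsilon> * \<xi>)\<^sup>2) / 2)) * cis (x * \<xi>) * truncated_fourier f R \<xi> \<partial>lborel)
    = complex_of_real (\<integral>y. indicator {-R..R} y * f y * (exp (- (((x - y) / \<epsilon>)\<^sup>2) / 2) / \<epsilon>) \<partial>lborel)"
proof -
  have fm[measurable]: "f \<in> borel_measurable borel" by (rule borel_measurable_continuous_onI[OF f])
  have fi: "integrable lborel (\<lambda>y. indicator {-R..R} y * f y)"
    using borel_integrable_compact[of "{-R..R}" f] continuous_on_subset[OF f] by (auto simp: indicator_def if_distrib cong: if_cong)
  define G where "G \<xi> = complex_of_real (exp (- ((\<epsilon> * \<xi>)\<^sup>2) / 2)) * cis (x * \<xi>)" for \<xi>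
  define h where "h y = complex_of_real (indicator {-R..R} y * f y)" for y
  have [measurable]: "G \<in> borel_measurable borel" "h \<in> borel_measurable borel"
    unfolding G_def h_def by measurable
  have Gi: "integrable lborel G" unfolding G_def by (rule gauss_fourier_scaled(1)[OF e])
  have hi: "integrable lborel h" unfolding h_def by (rule integrable_of_real[OF fi])
  have tf: "truncated_fourier f R \<xi> = complex_of_real (1 / sqrt (2 * pi)) * (\<integral>y. h y * cis (- (y * \<xi>)) \<partial>lborel)" for \<xi>
    unfolding truncated_fourier_def set_lebesgue_integral_def h_def
    by (intro arg_cong2[where f = "(*)"] refl Bochner_Integration.integral_cong) (simp add: scaleR_conv_of_real)
  have int: "integrable (lborel \<Otimes>\<^sub>M lborel) (\<lambda>(\<xi>, y). G \<xi> * (h y * cis (- (y * \<xi>))))"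
  proof (rule lborel_pair.Fubini_integrable)
    show "integrable lborel (\<lambda>\<xi>. \<integral>y. norm (case (\<xi>, y) of (\<xi>, y) \<Rightarrow> G \<xi> * (h y * cis (- (y * \<xi>)))) \<partial>lborel)"
      using Gi by (simp add: norm_mult integrable_norm)
    show "AE \<xi> in lborel. integrable lborel (\<lambda>y. case (\<xi>, y) of (\<xi>, y) \<Rightarrow> G \<xi> * (h y * cis (- (y * \<xi>))))"
      by (intro AE_I2) (simp, intro integrable_mult_right Bochner_Integration.integrable_bound[OF hi], auto)
  qed measurable
  have "(\<integral>\<xi>. G \<xi> * truncated_fourier f R \<xi> \<partial>lborel) = complex_of_real (1 / sqrt (2 * pi)) * (\<integral>\<xi>. \<integral>y. G \<xi> * (h y * cis (- (y * \<xi>))) \<partial>lborel \<partial>lborel)"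
    unfolding tf by (simp add: mult.left_commute)
  also have "(\<integral>\<xi>. \<integral>y. G \<xi> * (h y * cis (- (y * \<xi>))) \<partial>lborel \<partial>lborel) = (\<integral>y. \<integral>\<xi>. G \<xi> * (h y * cis (- (y * \<xi>))) \<partial>lborel \<partial>lborel)"
    by (rule lborel_pair.Fubini_integral[symmetric]) (use int in simp)
  also have "\<dots> = (\<integral>y. h y * complex_of_real (sqrt (2 * pi) / \<epsilon> * exp (- (((x - y) / \<epsilon>)\<^sup>2) / 2)) \<partial>lborel)"
  proof (intro Bochner_Integration.integral_cong refl)
    fix y
    have "(\<integral>\<xi>. G \<xi> * (h y * cis (- (y * \<xi>))) \<partial>lborel) = h y * (\<integral>\<xi>. complex_of_real (exp (- ((\<epsilon> * \<xi>)\<^sup>2) / 2)) * cis ((x - y) * \<xi>) \<partial>lborel)"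
    proof -
      have eq: "cis ((x - y) * \<xi>) = cis (x * \<xi>) * cis (- (y * \<xi>))" for \<xi>
        by (simp add: cis_mult left_diff_distrib)
      show ?thesis
        unfolding G_def integral_mult_right_zero[symmetric] eq by (simp only: mult_ac)
    qed
    then show "(\<integral>\<xi>. G \<xi> * (h y * cis (- (y * \<xi>))) \<partial>lborel) = h y * complex_of_real (sqrt (2 * pi) / \<epsilon> * exp (- (((x - y) / \<epsilon>)\<^sup>2) / 2))"
      unfolding gauss_fourier_scaled(2)[OF e] .
  qed
  also have "complex_of_real (1 / sqrt (2 * pi)) * \<dots> = (\<integral>y. complex_of_real (indicator {-R..R} y * f y * (exp (- (((x - y) / \<epsilon>)\<^sup>2) / 2) / \<epsilon>)) \<partial>lborel)"
    unfolding integral_mult_right_zero[symmetric]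
    by (intro Bochner_Integration.integral_cong refl) (simp add: h_def field_simps)
  also have "\<dots> = complex_of_real (\<integral>y. indicator {-R..R} y * f y * (exp (- (((x - y) / \<epsilon>)\<^sup>2) / 2) / \<epsilon>) \<partial>lborel)"
    by (rule integral_complex_of_real)
  finally show ?thesis by (simp add: G_def)
qed

lemma truncated_fourier_measurable [measurable]:
  assumes [measurable]: "f \<in> borel_measurable borel"
  shows "truncated_fourier f R \<in> borel_measurable borel"
  unfolding truncated_fourier_def set_lebesgue_integral_def by measurable

text \<open>The Gaussian weight is square integrable, so both sides pass to the limit of the truncations: the left one by the \<open>L\<^sub>2\<close> convergence that defines the
Fourier transform, the right one by dominated convergence.\<close>

lemma smoothed_L2_fourier:
  assumes f: "continuous_on UNIV f" "bounded (range f)" and e: "\<epsilon> > 0" and F: "L2_fourier f g"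
  shows "(\<integral>\<xi>. complex_of_real (exp (- ((\<epsilon> * \<xi>)\<^sup>2) / 2)) * cis (x * \<xi>) * g \<xi> \<partial>lborel)
    = complex_of_real (\<integral>z. f (x + \<epsilon> * z) * exp (- (z\<^sup>2) / 2) \<partial>lborel)"
proof -
  have fm[measurable]: "f \<in> borel_measurable borel" by (rule borel_measurable_continuous_onI[OF f(1)])
  have gm[measurable]: "g \<in> borel_measurable borel"
    using F by (simp add: L2_fourier_def square_integrable_def)
  have g2: "integrable lborel (\<lambda>\<xi>. (cmod (g \<xi>))\<^sup>2)" using F by (simp add: L2_fourier_def square_integrable_def)
  obtain B where B: "\<And>y. \<bar>f y\<bar> \<le> B" using f(2) by (auto simp: bounded_iff)
  define w where "w \<xi> = exp (- ((\<epsilon> * \<xi>)\<^sup>2) / 2)" for \<xi>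
  have [measurable]: "w \<in> borel_measurable borel" unfolding w_def by measurable
  have w1: "0 \<le> w \<xi>" "w \<xi> \<le> 1" for \<xi> unfolding w_def by simp_all
  have wi: "integrable lborel w"
    using integrable_norm[OF gauss_fourier_scaled(1)[OF e, of 0]] by (simp add: w_def[abs_def])
  have w2: "integrable lborel (\<lambda>\<xi>. (w \<xi>)\<^sup>2)"
    by (rule Bochner_Integration.integrable_bound[OF wi]) (use w1 in \<open>auto simp: power2_eq_square mult_left_le\<close>)
  define t where "t n = truncated_fourier f (real n)" for n
  have [measurable]: "t n \<in> borel_measurable borel" for n unfolding t_def by measurable
  define D where "D n = (\<integral>\<^sup>+\<xi>. ennreal ((cmod (t n \<xi> - g \<xi>))\<^sup>2) \<partial>lborel)" for n
  have "(\<lambda>n. D n) \<longlonglongrightarrow> 0"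
    using filterlim_compose[OF _ filterlim_real_sequentially] F unfolding L2_fourier_def D_def t_def by blast
  then have D0: "(\<lambda>n. enn2real (D n)) \<longlonglongrightarrow> 0" and Dfin: "\<forall>\<^sub>F n in sequentially. D n < 1"
    using tendsto_enn2real[of D 0 sequentially] order_tendstoD(2)[of D 0 sequentially 1] by simp_all
  have lim0: "(\<lambda>n. sqrt (\<integral>\<xi>. (w \<xi>)\<^sup>2 \<partial>lborel) * sqrt (enn2real (D n))) \<longlonglongrightarrow> 0"
    using tendsto_mult_right_zero[OF tendsto_real_sqrt[OF D0, simplified]] by simp
  let ?c = "\<lambda>\<xi>. complex_of_real (w \<xi>) * cis (x * \<xi>)"
  have gi: "integrable lborel (\<lambda>\<xi>. ?c \<xi> * g \<xi>)"
  proof (rule Bochner_Integration.integrable_bound)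
    show "integrable lborel (\<lambda>\<xi>. w \<xi> * cmod (g \<xi>))"
      by (rule integral_cauchy_schwarz(1)) (use w2 g2 in auto)
  qed (use w1 in \<open>auto simp: norm_mult\<close>)
  have L1: "(\<lambda>n. \<integral>\<xi>. ?c \<xi> * t n \<xi> \<partial>lborel) \<longlonglongrightarrow> (\<integral>\<xi>. ?c \<xi> * g \<xi> \<partial>lborel)"
  proof (rule LIM_zero_cancel, rule Lim_null_comparison[OF _ lim0])
    show "\<forall>\<^sub>F n in sequentially. norm ((\<integral>\<xi>. ?c \<xi> * t n \<xi> \<partial>lborel) - (\<integral>\<xi>. ?c \<xi> * g \<xi> \<partial>lborel))
       \<le> sqrt (\<integral>\<xi>. (w \<xi>)\<^sup>2 \<partial>lborel) * sqrt (enn2real (D n))"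
      using Dfin
    proof eventually_elim
      case (elim n)
      have d2: "integrable lborel (\<lambda>\<xi>. (cmod (t n \<xi> - g \<xi>))\<^sup>2)"
        by (rule integrableI_nonneg) (use elim in \<open>auto simp: D_def less_top[symmetric] top_unique dest: order_less_trans\<close>)
      have cs: "integrable lborel (\<lambda>\<xi>. w \<xi> * cmod (t n \<xi> - g \<xi>))"
        "\<bar>\<integral>\<xi>. w \<xi> * cmod (t n \<xi> - g \<xi>) \<partial>lborel\<bar> \<le> sqrt (\<integral>\<xi>. (w \<xi>)\<^sup>2 \<partial>lborel) * sqrt (\<integral>\<xi>. (cmod (t n \<xi> - g \<xi>))\<^sup>2 \<partial>lborel)"
        by (rule integral_cauchy_schwarz; use w2 d2 in simp)+
      have di: "integrable lborel (\<lambda>\<xi>. ?c \<xi> * (t n \<xi> - g \<xi>))"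
        by (rule Bochner_Integration.integrable_bound[OF cs(1)]) (use w1 in \<open>auto simp: norm_mult\<close>)
      have ti: "integrable lborel (\<lambda>\<xi>. ?c \<xi> * t n \<xi>)"
        using Bochner_Integration.integrable_add[OF di gi] by (simp add: algebra_simps)
      have "(\<integral>\<xi>. ?c \<xi> * t n \<xi> \<partial>lborel) - (\<integral>\<xi>. ?c \<xi> * g \<xi> \<partial>lborel) = (\<integral>\<xi>. ?c \<xi> * (t n \<xi> - g \<xi>) \<partial>lborel)"
        using Bochner_Integration.integral_diff[OF ti gi] by (simp add: algebra_simps)
      also have "norm \<dots> \<le> (\<integral>\<xi>. norm (?c \<xi> * (t n \<xi> - g \<xi>)) \<partial>lborel)" by (rule integral_norm_bound)
      also have "\<dots> = (\<integral>\<xi>. w \<xi> * cmod (t n \<xi> - g \<xi>) \<partial>lborel)" using w1 by (simp add: norm_mult)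
      also have "\<dots> \<le> sqrt (\<integral>\<xi>. (w \<xi>)\<^sup>2 \<partial>lborel) * sqrt (\<integral>\<xi>. (cmod (t n \<xi> - g \<xi>))\<^sup>2 \<partial>lborel)"
        using cs(2) by linarith
      also have "(\<integral>\<xi>. (cmod (t n \<xi> - g \<xi>))\<^sup>2 \<partial>lborel) = enn2real (D n)"
        unfolding D_def by (rule integral_eq_nn_integral) auto
      finally show ?case .
    qed
  qed
  define k where "k y = exp (- (((x - y) / \<epsilon>)\<^sup>2) / 2) / \<epsilon>" for y
  have [measurable]: "k \<in> borel_measurable borel" unfolding k_def by measurable
  have ge: "integrable lborel (\<lambda>z. exp (- ((z::real)\<^sup>2) / 2))"
    using integrable_norm[OF gauss_fourier(1)[of 0]] by simp
  have kk: "k y = exp (- ((- x / \<epsilon> + (1 / \<epsilon>) * y)\<^sup>2) / 2) / \<epsilon>" for y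
    unfolding k_def using e by (simp add: field_simps power2_commute)
  have ki: "integrable lborel k"
    using integrable_divide[OF lborel_integrable_real_affine[OF ge, of "1/\<epsilon>" "- x/\<epsilon>"], of \<epsilon>] e
    by (simp add: kk[abs_def])
  have kpos: "0 \<le> k y" for y unfolding k_def using e by simp
  have L2: "(\<lambda>n. \<integral>y. indicator {-real n..real n} y * f y * k y \<partial>lborel) \<longlonglongrightarrow> (\<integral>y. f y * k y \<partial>lborel)"
  proof (rule integral_dominated_convergence)
    show "integrable lborel (\<lambda>y. B * k y)" using ki by simp
    show "AE y in lborel. (\<lambda>n. indicator {-real n..real n} y * f y * k y) \<longlonglongrightarrow> f y * k y"
    proof (rule AE_I2)
      fix y :: real
      obtain N where "\<bar>y\<bar> \<le> real N" using real_arch_simple by blast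
      then have "\<forall>n\<ge>N. indicator {-real n..real n} y * f y * k y = f y * k y"
        by (auto simp: indicator_def)
      then show "(\<lambda>n. indicator {-real n..real n} y * f y * k y) \<longlonglongrightarrow> f y * k y"
        by (intro tendsto_eventually) (auto simp: eventually_sequentially)
    qed
    show "AE y in lborel. norm (indicator {-real n..real n} y * f y * k y) \<le> B * k y" for n
      using B kpos by (intro AE_I2) (auto simp: indicator_def abs_mult intro!: mult_right_mono mult_nonneg_nonneg order_trans[OF abs_ge_zero B])
  qed (use fm in auto)
  have "(\<lambda>n. \<integral>\<xi>. ?c \<xi> * t n \<xi> \<partial>lborel) = (\<lambda>n. complex_of_real (\<integral>y. indicator {-real n..real n} y * f y * k y \<partial>lborel))"
    unfolding t_def w_def k_def using smoothed_truncated_fourier[OF f(1) e] by simp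
  then have "(\<lambda>n. \<integral>\<xi>. ?c \<xi> * t n \<xi> \<partial>lborel) \<longlonglongrightarrow> complex_of_real (\<integral>y. f y * k y \<partial>lborel)"
    using tendsto_of_real[OF L2] by simp
  with L1 have "(\<integral>\<xi>. ?c \<xi> * g \<xi> \<partial>lborel) = complex_of_real (\<integral>y. f y * k y \<partial>lborel)" by (rule LIMSEQ_unique)
  also have "(\<integral>y. f y * k y \<partial>lborel) = \<bar>\<epsilon>\<bar> *\<^sub>R (\<integral>z. f (x + \<epsilon> * z) * k (x + \<epsilon> * z) \<partial>lborel)"
    using e by (intro lborel_integral_real_affine) simp
  also have "\<dots> = (\<integral>z. f (x + \<epsilon> * z) * exp (- (z\<^sup>2) / 2) \<partial>lborel)"
    unfolding real_scaleR_def integral_mult_right_zero[symmetric]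
    using e by (intro Bochner_Integration.integral_cong refl) (simp add: k_def field_simps)
  finally show ?thesis by (simp add: w_def)
qed

lemma fourier_inversion:
  assumes f: "continuous_on UNIV f" "bounded (range f)" and F: "L2_fourier f g" and g: "integrable lborel g"
  shows "(\<integral>\<xi>. cis (x * \<xi>) * g \<xi> \<partial>lborel) = complex_of_real (sqrt (2 * pi) * f x)"
proof -
  have fm[measurable]: "f \<in> borel_measurable borel" by (rule borel_measurable_continuous_onI[OF f(1)])
  have gm[measurable]: "g \<in> borel_measurable borel" using g by simp
  obtain B where B: "\<And>y. \<bar>f y\<bar> \<le> B" using f(2) by (auto simp: bounded_iff)
  define e where "e n = inverse (real (Suc n))" for n
  have e0: "e \<longlonglongrightarrow> 0" unfolding e_def by (rule LIMSEQ_inverse_real_of_nat)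
  have epos: "e n > 0" for n by (simp add: e_def)
  have ge: "integrable lborel (\<lambda>z. exp (- ((z::real)\<^sup>2) / 2))"
    using integrable_norm[OF gauss_fourier(1)[of 0]] by simp
  have L1: "(\<lambda>n. \<integral>\<xi>. complex_of_real (exp (- ((e n * \<xi>)\<^sup>2) / 2)) * cis (x * \<xi>) * g \<xi> \<partial>lborel) \<longlonglongrightarrow> (\<integral>\<xi>. cis (x * \<xi>) * g \<xi> \<partial>lborel)"
  proof (rule integral_dominated_convergence)
    show "integrable lborel (\<lambda>\<xi>. norm (g \<xi>))" using g by simp
    show "AE \<xi> in lborel. (\<lambda>n. complex_of_real (exp (- ((e n * \<xi>)\<^sup>2) / 2)) * cis (x * \<xi>) * g \<xi>) \<longlonglongrightarrow> cis (x * \<xi>) * g \<xi>"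
    proof (rule AE_I2)
      fix \<xi>
      have "(\<lambda>n. complex_of_real (exp (- ((e n * \<xi>)\<^sup>2) / 2)) * cis (x * \<xi>) * g \<xi>) \<longlonglongrightarrow> complex_of_real (exp (- ((0 * \<xi>)\<^sup>2) / 2)) * cis (x * \<xi>) * g \<xi>"
        by (intro tendsto_intros e0) auto
      then show "(\<lambda>n. complex_of_real (exp (- ((e n * \<xi>)\<^sup>2) / 2)) * cis (x * \<xi>) * g \<xi>) \<longlonglongrightarrow> cis (x * \<xi>) * g \<xi>" by simp
    qed
    show "AE \<xi> in lborel. norm (complex_of_real (exp (- ((e n * \<xi>)\<^sup>2) / 2)) * cis (x * \<xi>) * g \<xi>) \<le> norm (g \<xi>)" for n
      by (intro AE_I2) (auto simp: norm_mult intro!: mult_left_le_one_le)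
  qed auto
  have L2: "(\<lambda>n. \<integral>z. f (x + e n * z) * exp (- (z\<^sup>2) / 2) \<partial>lborel) \<longlonglongrightarrow> (\<integral>z. f x * exp (- (z\<^sup>2) / 2) \<partial>lborel)"
  proof (rule integral_dominated_convergence)
    show "integrable lborel (\<lambda>z. B * exp (- ((z::real)\<^sup>2) / 2))" using ge by simp
    show "AE z in lborel. (\<lambda>n. f (x + e n * z) * exp (- (z\<^sup>2) / 2)) \<longlonglongrightarrow> f x * exp (- (z\<^sup>2) / 2)"
    proof (rule AE_I2)
      fix z
      have "isCont f x" using f(1) by (simp add: continuous_on_eq_continuous_at)
      moreover have "(\<lambda>n. x + e n * z) \<longlonglongrightarrow> x + 0 * z" by (intro tendsto_intros e0)
      ultimately have "(\<lambda>n. f (x + e n * z)) \<longlonglongrightarrow> f x" using isCont_tendsto_compose[of x f] by simp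
      then show "(\<lambda>n. f (x + e n * z) * exp (- (z\<^sup>2) / 2)) \<longlonglongrightarrow> f x * exp (- (z\<^sup>2) / 2)" by (intro tendsto_intros)
    qed
    show "AE z in lborel. norm (f (x + e n * z) * exp (- (z\<^sup>2) / 2)) \<le> B * exp (- (z\<^sup>2) / 2)" for n
      using B by (intro AE_I2) (simp add: abs_mult)
  qed auto
  have "(\<integral>z. exp (- ((z::real)\<^sup>2) / 2) \<partial>lborel) = sqrt (2 * pi)"
  proof -
    have "complex_of_real (\<integral>z. exp (- ((z::real)\<^sup>2) / 2) \<partial>lborel) = (\<integral>z. complex_of_real (exp (- ((z::real)\<^sup>2) / 2)) \<partial>lborel)"
      by (rule integral_complex_of_real[symmetric])
    also have "\<dots> = complex_of_real (sqrt (2 * pi))" using gauss_fourier(2)[of 0] by simp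
    finally show ?thesis by (simp only: of_real_eq_iff)
  qed
  then have L2': "(\<lambda>n. complex_of_real (\<integral>z. f (x + e n * z) * exp (- (z\<^sup>2) / 2) \<partial>lborel)) \<longlonglongrightarrow> complex_of_real (sqrt (2 * pi) * f x)"
    using tendsto_of_real[OF L2] by (simp add: mult.commute)
  show ?thesis
    using L1 L2' unfolding smoothed_L2_fourier[OF f epos F] by (rule LIMSEQ_unique)
qed

text \<open>The integrand of \<open>\<integral> \<bar>\<Sum>x\<in>A. c x * cis (\<xi>x)\<bar>\<^sup>2 (1 + \<xi>\<^sup>2)\<^sup>-\<^sup>s d\<xi>\<close>, the square of the dual Sobolev norm of \<open>\<Sum>x\<in>A. c x * \<delta>\<^sub>x\<close> up to a constant.\<close>

definition trig_weight :: "real \<Rightarrow> real set \<Rightarrow> (real \<Rightarrow> real) \<Rightarrow> real \<Rightarrow> real" where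
  "trig_weight s A c \<xi> = ((\<Sum>x\<in>A. c x * cos (\<xi> * x))\<^sup>2 + (\<Sum>x\<in>A. c x * sin (\<xi> * x))\<^sup>2) * (1 + \<xi>\<^sup>2) powr (- s)"

lemma trig_weight_nonneg: "0 \<le> trig_weight s A c \<xi>" by (simp add: trig_weight_def)

lemma integrable_trig_weight:
  assumes s: "s > 1/2"
  shows "integrable lborel (trig_weight s A c)"
proof (rule Bochner_Integration.integrable_bound)
  let ?S = "\<Sum>x\<in>A. \<bar>c x\<bar>"
  show "integrable lborel (\<lambda>\<xi>::real. (2 * ?S\<^sup>2) * (1 + \<xi>\<^sup>2) powr (- s))"
    by (intro integrable_mult_right integrable_bessel_weight s)
  have b: "(\<Sum>x\<in>A. c x * w x)\<^sup>2 \<le> ?S\<^sup>2" if "\<And>x. \<bar>w x\<bar> \<le> 1" for w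
  proof -
    have "\<bar>\<Sum>x\<in>A. c x * w x\<bar> \<le> (\<Sum>x\<in>A. \<bar>c x * w x\<bar>)" by (rule sum_abs)
    also have "\<dots> \<le> ?S" by (intro sum_mono) (simp add: abs_mult mult_left_le that)
    finally show ?thesis by (simp add: abs_le_square_iff[symmetric] sum_nonneg)
  qed
  have "trig_weight s A c \<xi> \<le> (2 * ?S\<^sup>2) * (1 + \<xi>\<^sup>2) powr (- s)" for \<xi>
    unfolding trig_weight_def using b[of "\<lambda>x. cos (\<xi> * x)"] b[of "\<lambda>x. sin (\<xi> * x)"]
    by (intro mult_right_mono) auto
  then show "AE \<xi> in lborel. norm (trig_weight s A c \<xi>) \<le> norm ((2 * ?S\<^sup>2) * (1 + \<xi>\<^sup>2) powr (- s))"
    using trig_weight_nonneg by (intro AE_I2) (auto intro: order_trans)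
qed (simp add: trig_weight_def[abs_def])

text \<open>A function in \<open>H\<^sup>s\<close> with \<open>s > 1/2\<close> has an integrable Fourier transform. Write its values by inversion and apply the
Cauchy--Schwarz inequality to \<open>(1 + \<xi>\<^sup>2)\<^sup>s\<^sup>/\<^sup>2 g(\<xi>)\<close> and the trigonometric sum with the inverse weight.\<close>

lemma sobolev_functional_bound:
  assumes s: "s > 1/2" and f: "f \<in> sobolev_R s"
  shows "\<exists>C. \<forall>A c. finite A \<longrightarrow> \<bar>\<Sum>x\<in>A. c x * f x\<bar> \<le> C * sqrt (\<integral>\<xi>. trig_weight s A c \<xi> \<partial>lborel)"
proof -
  obtain g where F: "L2_fourier f g" and sg: "square_integrable (\<lambda>\<xi>. ((1 + \<xi>\<^sup>2) powr (s / 2)) *\<^sub>R g \<xi>)"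
    and fc: "continuous_on UNIV f" "bounded (range f)"
    using f by (auto simp: sobolev_R_def)
  have gm[measurable]: "g \<in> borel_measurable borel"
    using F by (simp add: L2_fourier_def square_integrable_def)
  define G where "G \<xi> = (1 + \<xi>\<^sup>2) powr (s / 2) * cmod (g \<xi>)" for \<xi>
  have [measurable]: "G \<in> borel_measurable borel" unfolding G_def by measurable
  have G2: "integrable lborel (\<lambda>\<xi>. (G \<xi>)\<^sup>2)"
    using sg by (simp add: square_integrable_def G_def)
  have sq: "((1 + \<xi>\<^sup>2) powr (- (s / 2)))\<^sup>2 = (1 + \<xi>\<^sup>2) powr (- s)" for \<xi> :: real
    by (simp add: power2_eq_square[of "_ powr _"] powr_add[symmetric])
  have gG: "cmod (g \<xi>) = (1 + \<xi>\<^sup>2) powr (- (s / 2)) * G \<xi>" for \<xi>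
    unfolding G_def mult.assoc[symmetric] powr_add[symmetric] by (simp add: add_pos_nonneg less_imp_neq[THEN not_sym])
  have "integrable lborel (\<lambda>\<xi>. (1 + \<xi>\<^sup>2) powr (- (s / 2)) * G \<xi>)"
    by (rule integral_cauchy_schwarz(1)) (use G2 integrable_bessel_weight[OF s] in \<open>auto simp: sq\<close>)
  then have gi: "integrable lborel g"
    by (intro Bochner_Integration.integrable_bound[of _ _ g]) (auto simp: gG[symmetric])
  let ?I = "\<integral>\<xi>. (G \<xi>)\<^sup>2 \<partial>lborel"
  have "\<bar>\<Sum>x\<in>A. c x * f x\<bar> \<le> (sqrt ?I / sqrt (2 * pi)) * sqrt (\<integral>\<xi>. trig_weight s A c \<xi> \<partial>lborel)"
    if A: "finite A" for A c
  proof -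
    define p where "p \<xi> = (\<Sum>x\<in>A. complex_of_real (c x) * cis (x * \<xi>))" for \<xi>
    have [measurable]: "p \<in> borel_measurable borel" unfolding p_def by measurable
    have ci: "integrable lborel (\<lambda>\<xi>. cis (x * \<xi>) * g \<xi>)" for x
      by (rule Bochner_Integration.integrable_bound[OF gi]) auto
    have "complex_of_real (sqrt (2 * pi) * (\<Sum>x\<in>A. c x * f x)) = (\<Sum>x\<in>A. complex_of_real (c x) * complex_of_real (sqrt (2 * pi) * f x))"
      by (simp add: sum_distrib_left algebra_simps)
    also have "\<dots> = (\<Sum>x\<in>A. complex_of_real (c x) * (\<integral>\<xi>. cis (x * \<xi>) * g \<xi> \<partial>lborel))"
      unfolding fourier_inversion[OF fc F gi] ..
    also have "\<dots> = (\<integral>\<xi>. (\<Sum>x\<in>A. complex_of_real (c x) * (cis (x * \<xi>) * g \<xi>)) \<partial>lborel)"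
      using ci by (subst Bochner_Integration.integral_sum) auto
    also have "\<dots> = (\<integral>\<xi>. p \<xi> * g \<xi> \<partial>lborel)"
      by (simp add: p_def sum_distrib_right mult.assoc)
    finally have "sqrt (2 * pi) * \<bar>\<Sum>x\<in>A. c x * f x\<bar> = cmod (\<integral>\<xi>. p \<xi> * g \<xi> \<partial>lborel)"
      by (metis norm_of_real abs_mult abs_of_nonneg real_sqrt_ge_zero pi_ge_zero mult_nonneg_nonneg zero_le_numeral)
    also have "\<dots> \<le> (\<integral>\<xi>. cmod (p \<xi> * g \<xi>) \<partial>lborel)" by (rule integral_norm_bound)
    also have "\<dots> = (\<integral>\<xi>. (cmod (p \<xi>) * (1 + \<xi>\<^sup>2) powr (- (s / 2))) * G \<xi> \<partial>lborel)"
      by (simp add: norm_mult gG mult.assoc)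
    also have "\<dots> \<le> sqrt (\<integral>\<xi>. (cmod (p \<xi>) * (1 + \<xi>\<^sup>2) powr (- (s / 2)))\<^sup>2 \<partial>lborel) * sqrt ?I"
    proof -
      have tw: "(cmod (p \<xi>) * (1 + \<xi>\<^sup>2) powr (- (s / 2)))\<^sup>2 = trig_weight s A c \<xi>" for \<xi>
      proof -
        have "(cmod (p \<xi>))\<^sup>2 = (\<Sum>x\<in>A. c x * cos (\<xi> * x))\<^sup>2 + (\<Sum>x\<in>A. c x * sin (\<xi> * x))\<^sup>2"
          unfolding cmod_power2 p_def by (simp add: Re_sum Im_sum mult.commute)
        then show ?thesis by (simp add: power_mult_distrib sq trig_weight_def)
      qed
      have "\<bar>\<integral>\<xi>. (cmod (p \<xi>) * (1 + \<xi>\<^sup>2) powr (- (s / 2))) * G \<xi> \<partial>lborel\<bar> \<le> sqrt (\<integral>\<xi>. (cmod (p \<xi>) * (1 + \<xi>\<^sup>2) powr (- (s / 2)))\<^sup>2 \<partial>lborel) * sqrt ?I"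
        by (rule integral_cauchy_schwarz(2)) (use G2 integrable_trig_weight[OF s, of A c] in \<open>auto simp: tw\<close>)
      then show ?thesis by linarith
    qed
    also have "(\<lambda>\<xi>. (cmod (p \<xi>) * (1 + \<xi>\<^sup>2) powr (- (s / 2)))\<^sup>2) = trig_weight s A c"
    proof
      fix \<xi>
      have "(cmod (p \<xi>))\<^sup>2 = (\<Sum>x\<in>A. c x * cos (\<xi> * x))\<^sup>2 + (\<Sum>x\<in>A. c x * sin (\<xi> * x))\<^sup>2"
        unfolding cmod_power2 p_def by (simp add: Re_sum Im_sum mult.commute)
      then show "(cmod (p \<xi>) * (1 + \<xi>\<^sup>2) powr (- (s / 2)))\<^sup>2 = trig_weight s A c \<xi>"
        by (simp add: power_mult_distrib sq trig_weight_def)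
    qed
    finally show ?thesis by (simp add: field_simps)
  qed
  then show ?thesis by blast
qed


section \<open>The Besov norm controls the supremum\<close>

text \<open>The signed binomial coefficients in the expansion of the \<open>m\<close>-th difference.\<close>

primrec diff_coef :: "nat \<Rightarrow> nat \<Rightarrow> real" where
  "diff_coef 0 = (\<lambda>k. if k = 0 then 1 else 0)"
| "diff_coef (Suc m) = (\<lambda>k. (if k = 0 then 0 else diff_coef m (k - 1)) - diff_coef m k)"

lemma diff_coef_beyond: "m < k \<Longrightarrow> diff_coef m k = 0"
  by (induction m arbitrary: k) auto

lemma diff_coef_0_sq: "diff_coef m 0 * diff_coef m 0 = 1"
  by (induction m) auto

lemma difference_expand: "difference m h f x = (\<Sum>k\<le>m. diff_coef m k * f (x + real k * h))"
proof (induction m arbitrary: x)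
  case 0 then show ?case by (simp add: difference_def)
next
  case (Suc m)
  have "difference (Suc m) h f x = difference m h f (x + h) - difference m h f x"
    by (simp add: difference_def)
  also have "difference m h f (x + h) = (\<Sum>k\<le>m. diff_coef m k * f (x + real (Suc k) * h))"
    unfolding Suc by (simp add: algebra_simps)
  also have "\<dots> = (\<Sum>k\<le>Suc m. (if k = 0 then 0 else diff_coef m (k - 1)) * f (x + real k * h))"
    by (subst sum.atMost_Suc_shift) simp
  also have "difference m h f x = (\<Sum>k\<le>Suc m. diff_coef m k * f (x + real k * h))"
    unfolding Suc by (simp add: diff_coef_beyond)
  finally show ?case by (simp only: sum_subtractf[symmetric] left_diff_distrib[symmetric] diff_coef.simps)
qed

lemma sum_diff_coef: "m \<ge> 1 \<Longrightarrow> (\<Sum>k\<le>m. diff_coef m k) = 0"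
proof -
  assume "m \<ge> 1"
  then obtain n where "m = Suc n" by (cases m) auto
  moreover have "difference (Suc n) 0 (\<lambda>x. 1) 0 = 0" by (simp add: difference_def)
  ultimately show ?thesis using difference_expand[of "Suc n" 0 "\<lambda>x. 1" 0] by simp
qed

lemma difference_add: "difference m h (\<lambda>t. f t + g t) x = difference m h f x + difference m h g x"
  and difference_minus: "difference m h (\<lambda>t. f t - g t) x = difference m h f x - difference m h g x"
  and difference_scale: "difference m h (\<lambda>t. c * f t) x = c * difference m h f x"
  by (simp_all add: difference_expand sum.distrib sum_subtractf sum_distrib_left algebra_simps)

lemma difference_zero_step: "m \<ge> 1 \<Longrightarrow> difference m 0 f x = 0"
  by (simp add: difference_expand sum_distrib_right[symmetric] sum_diff_coef)

lemma difference_measurable [measurable]: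
  assumes [measurable]: "f \<in> borel_measurable borel" "a \<in> borel_measurable M" "b \<in> borel_measurable M"
  shows "(\<lambda>z. difference m (a z) f (b z)) \<in> borel_measurable M"
  unfolding difference_expand by measurable

definition avg :: "real \<Rightarrow> (real \<Rightarrow> real) \<Rightarrow> real \<Rightarrow> real" where
  "avg a g x = integral {0..1} (\<lambda>u. g (x + a * u))"

lemma avg_integrable:
  fixes g :: "real \<Rightarrow> real"
  assumes g: "continuous_on UNIV g"
  shows "(\<lambda>u. g (x + a * u)) integrable_on {0..1::real}"
  by (intro integrable_continuous_interval continuous_on_compose2[OF g] continuous_intros) auto

lemma avg_0: "avg 0 g = g"
  by (simp add: avg_def fun_eq_iff)

lemma avg_continuous: 
  assumes "continuous_on UNIV g" shows "continuous_on UNIV (avg a g)"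
proof -
  have "continuous_on (UNIV \<times> cbox 0 1) (\<lambda>(x, u). g (x + a * u))"
    unfolding case_prod_unfold by (intro continuous_on_compose2[OF assms] continuous_intros) auto
  from integral_continuous_on_param[OF this] show ?thesis by (simp add: avg_def[abs_def])
qed

lemma avg_commute:
  assumes "continuous_on UNIV g" shows "avg a (avg b g) x = avg b (avg a g) x"
proof -
  have "continuous_on (cbox (0,0) (1,1)) (\<lambda>(u, v). g (x + a * u + b * v))"
    unfolding case_prod_unfold
    by (intro continuous_on_compose2[OF assms] continuous_intros) auto
  from integral_swap_continuous[OF this] show ?thesis
    by (simp add: avg_def add.assoc add.commute add.left_commute)
qed

lemma avg_sum:
  assumes "\<And>k. k \<in> A \<Longrightarrow> continuous_on UNIV (g k)" "finite A"
  shows "avg a (\<lambda>x. \<Sum>k\<in>A. c k * g k x) x = (\<Sum>k\<in>A. c k * avg a (g k) x)"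
proof -
  have "avg a (\<lambda>x. \<Sum>k\<in>A. c k * g k x) x = (\<Sum>k\<in>A. integral {0..1} (\<lambda>u. c k * g k (x + a * u)))"
    unfolding avg_def using assms by (intro integral_sum integrable_on_mult_right avg_integrable) auto
  then show ?thesis by (simp add: avg_def)
qed

lemma avg_near:
  assumes g: "continuous_on UNIV g" and e: "\<And>u. 0 \<le> u \<Longrightarrow> u \<le> 1 \<Longrightarrow> \<bar>g (x + a * u) - v\<bar> \<le> e"
  shows "\<bar>avg a g x - v\<bar> \<le> e"
proof -
  have "avg a g x - v = integral {0..1} (\<lambda>u. g (x + a * u) - v)"
    unfolding avg_def by (subst integral_diff) (auto intro: avg_integrable g)
  also have "norm \<dots> \<le> integral {0..1} (\<lambda>u::real. e)"
    using e by (intro integral_norm_bound_integral integrable_diff avg_integrable g) auto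
  finally show ?thesis by simp
qed

lemma ennreal_unit_integral:
  fixes g :: "real \<Rightarrow> real"
  assumes g: "continuous_on {0..1} g" and pos: "\<And>u. 0 \<le> g u"
  shows "ennreal (integral {0..1} g) = (\<integral>\<^sup>+u. ennreal (indicator {0..1} u * g u) \<partial>lborel)"
proof -
  have i: "set_integrable lborel {0..1} g"
    unfolding set_integrable_def by (rule borel_integrable_compact) (use g in auto)
  have "integral {0..1} g = (\<integral>u. indicator {0..1} u * g u \<partial>lborel)"
    using set_borel_integral_eq_integral(2)[OF i] by (simp add: set_lebesgue_integral_def)
  moreover have "(\<integral>\<^sup>+u. ennreal (indicator {0..1} u * g u) \<partial>lborel) = ennreal (\<integral>u. indicator {0..1} u * g u \<partial>lborel)"
    using i pos by (intro nn_integral_eq_integral) (auto simp: set_integrable_def)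
  ultimately show ?thesis by simp
qed

lemma unit_integral_sq_le:
  fixes g :: "real \<Rightarrow> real"
  assumes g: "continuous_on {0..1} g"
  shows "(integral {0..1} g)\<^sup>2 \<le> integral {0..1} (\<lambda>u. (g u)\<^sup>2)"
proof -
  let ?I = "integral {0..1} g"
  have i: "g integrable_on {0..1}" "(\<lambda>u. (g u)\<^sup>2) integrable_on {0..1}"
    by (intro integrable_continuous_interval continuous_intros g)+
  have "0 \<le> integral {0..1} (\<lambda>u. (g u - ?I)\<^sup>2)"
    by (intro integral_nonneg integrable_continuous_interval continuous_intros g) auto
  also have "\<dots> = integral {0..1} (\<lambda>u. (g u)\<^sup>2 - (2 * ?I) * g u + ?I\<^sup>2)"
    by (intro integral_cong) (simp add: power2_diff algebra_simps)
  also have "\<dots> = integral {0..1} (\<lambda>u. (g u)\<^sup>2) - (2 * ?I) * ?I + ?I\<^sup>2"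
  proof -
    have j: "(\<lambda>u. (2 * ?I) * g u) integrable_on {0..1}" by (intro integrable_on_mult_right i)
    have k: "(\<lambda>u::real. ?I\<^sup>2) integrable_on {0..1}" by (rule integrable_const_ivl)
    show ?thesis
      unfolding integral_add[OF integrable_diff[OF i(2) j] k] integral_diff[OF i(2) j] by simp
  qed
  finally show ?thesis by (simp add: power2_eq_square)
qed

lemma avg_bound:
  assumes g: "continuous_on UNIV g" and a: "a > 0" and G: "(\<integral>\<^sup>+x. ennreal ((g x)\<^sup>2) \<partial>lborel) \<le> ennreal G" "G \<ge> 0"
  shows "\<bar>avg a g x\<bar> \<le> sqrt (G / a)"
proof -
  have gm[measurable]: "g \<in> borel_measurable borel" by (rule borel_measurable_continuous_onI[OF g])
  have c: "continuous_on {0..1} (\<lambda>u. g (x + a * u))" by (intro continuous_on_compose2[OF g] continuous_intros) auto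
  have "ennreal ((avg a g x)\<^sup>2) \<le> ennreal (integral {0..1} (\<lambda>u. (g (x + a * u))\<^sup>2))"
    unfolding avg_def by (intro ennreal_leI unit_integral_sq_le c)
  also have "\<dots> = (\<integral>\<^sup>+u. ennreal (indicator {0..1} u * (g (x + a * u))\<^sup>2) \<partial>lborel)"
    by (intro ennreal_unit_integral continuous_intros c) auto
  also have "\<dots> \<le> (\<integral>\<^sup>+u. ennreal ((g (x + a * u))\<^sup>2) \<partial>lborel)"
    by (intro nn_integral_mono ennreal_leI) (auto simp: indicator_def)
  finally have *: "ennreal ((avg a g x)\<^sup>2) \<le> (\<integral>\<^sup>+u. ennreal ((g (x + a * u))\<^sup>2) \<partial>lborel)" .
  have "ennreal (a * (avg a g x)\<^sup>2) = ennreal a * ennreal ((avg a g x)\<^sup>2)" using a by (simp add: ennreal_mult)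
  also have "\<dots> \<le> ennreal a * (\<integral>\<^sup>+u. ennreal ((g (x + a * u))\<^sup>2) \<partial>lborel)" by (intro mult_left_mono *) simp
  also have "\<dots> = (\<integral>\<^sup>+x. ennreal ((g x)\<^sup>2) \<partial>lborel)"
    using a by (subst nn_integral_real_affine[of "\<lambda>x. ennreal ((g x)\<^sup>2)" a x]) auto
  also note G(1)
  finally have "a * (avg a g x)\<^sup>2 \<le> G" using G(2) by simp
  then have "(avg a g x)\<^sup>2 \<le> G / a" using a by (simp add: field_simps)
  then have "\<bar>avg a g x\<bar>\<^sup>2 \<le> G / a" by simp
  then show ?thesis by (rule real_le_rsqrt)
qed

text \<open>The energy as a single double integral of a quadratic expression in \<open>f\<close>, which gives the parallelogram law and Fatou's lemma at once. The
indicator in \<open>h\<close> has integral one and accounts for the \<open>L\<^sub>2\<close> part.\<close>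

definition besov_integrand :: "real \<Rightarrow> (real \<Rightarrow> real) \<Rightarrow> real \<Rightarrow> real \<Rightarrow> real" where
  "besov_integrand r f h x = indicator {0..1} h * (f x)\<^sup>2
     + \<bar>h\<bar> powr (- 1 - 2 * r) * (difference (nat \<lfloor>r\<rfloor> + 1) h f x)\<^sup>2"

lemma besov_integrand_nonneg: "0 \<le> besov_integrand r f h x"
  by (simp add: besov_integrand_def)

lemma besov_integrand_measurable [measurable]:
  assumes [measurable]: "f \<in> borel_measurable borel"
  shows "(\<lambda>(h, x). besov_integrand r f h x) \<in> borel_measurable (borel \<Otimes>\<^sub>M borel)"
  unfolding besov_integrand_def by measurable

lemma besov_integrand_measurable_snd [measurable]:
  assumes [measurable]: "f \<in> borel_measurable borel"
  shows "besov_integrand r f h \<in> borel_measurable borel"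
  unfolding besov_integrand_def by measurable

lemma besov_energy_eq:
  assumes [measurable]: "f \<in> borel_measurable borel"
  shows "besov_energy r f = (\<integral>\<^sup>+h. \<integral>\<^sup>+x. ennreal (besov_integrand r f h x) \<partial>lborel \<partial>lborel)"
proof -
  let ?D = "\<lambda>h x. (difference (nat \<lfloor>r\<rfloor> + 1) h f x)\<^sup>2"
  let ?w = "\<lambda>h. \<bar>h\<bar> powr (- 1 - 2 * r)"
  let ?I = "\<integral>\<^sup>+x. ennreal ((f x)\<^sup>2) \<partial>lborel"
  have "(\<integral>\<^sup>+x. ennreal (besov_integrand r f h x) \<partial>lborel) = indicator {0..1} h * ?I + ennreal (?w h) * (\<integral>\<^sup>+x. ennreal (?D h x) \<partial>lborel)" for h :: real
  proof -
    have "(\<integral>\<^sup>+x. ennreal (besov_integrand r f h x) \<partial>lborel) = (\<integral>\<^sup>+x. indicator {0..1} h * ennreal ((f x)\<^sup>2) + ennreal (?w h) * ennreal (?D h x) \<partial>lborel)"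
      unfolding besov_integrand_def by (intro nn_integral_cong) (auto simp: ennreal_plus ennreal_mult' indicator_def)
    also have "\<dots> = indicator {0..1} h * ?I + ennreal (?w h) * (\<integral>\<^sup>+x. ennreal (?D h x) \<partial>lborel)"
      by (subst nn_integral_add) (auto simp: nn_integral_cmult)
    finally show ?thesis .
  qed
  then have "(\<integral>\<^sup>+h. \<integral>\<^sup>+x. ennreal (besov_integrand r f h x) \<partial>lborel \<partial>lborel)
     = (\<integral>\<^sup>+h. indicator {0..1} h * ?I + ennreal (?w h) * (\<integral>\<^sup>+x. ennreal (?D h x) \<partial>lborel) \<partial>lborel)" by simp
  also have "\<dots> = (\<integral>\<^sup>+h. indicator {0..1} (h::real) * ?I \<partial>lborel) + (\<integral>\<^sup>+h. ennreal (?w h) * (\<integral>\<^sup>+x. ennreal (?D h x) \<partial>lborel) \<partial>lborel)"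
    by (intro nn_integral_add) measurable
  also have "(\<integral>\<^sup>+h. indicator {0..1} (h::real) * ?I \<partial>lborel) = ?I"
    by (simp add: nn_integral_multc)
  finally show ?thesis by (simp add: besov_energy_def)
qed

lemma telescoping_bound:
  fixes a :: "nat \<Rightarrow> real"
  assumes a: "a \<longlonglongrightarrow> 0" and d: "\<And>n. \<bar>a n - a (Suc n)\<bar> \<le> B * \<rho> ^ n" and \<rho>: "0 \<le> \<rho>" "\<rho> < 1"
  shows "\<bar>a 0\<bar> \<le> B / (1 - \<rho>)"
proof -
  have B0: "0 \<le> B" using order_trans[OF abs_ge_zero d[of 0]] by simp
  have "\<bar>a 0 - a n\<bar> \<le> B / (1 - \<rho>)" for n
  proof -
    have "a 0 - a n = (\<Sum>i<n. a i - a (Suc i))" by (simp add: sum_lessThan_telescope')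
    also have "\<bar>\<dots>\<bar> \<le> (\<Sum>i<n. \<bar>a i - a (Suc i)\<bar>)" by (rule sum_abs)
    also have "\<dots> \<le> (\<Sum>i<n. B * \<rho> ^ i)" by (intro sum_mono d)
    also have "\<dots> = B * (\<Sum>i<n. \<rho> ^ i)" by (simp add: sum_distrib_left)
    also have "(\<Sum>i<n. \<rho> ^ i) \<le> 1 / (1 - \<rho>)"
      using \<rho> by (subst sum_gp_strict) (auto intro!: divide_right_mono)
    finally show ?thesis using B0 by (simp add: mult_left_mono)
  qed
  moreover have "(\<lambda>n. \<bar>a 0 - a n\<bar>) \<longlonglongrightarrow> \<bar>a 0 - 0\<bar>" by (intro tendsto_intros a)
  ultimately show ?thesis using LIMSEQ_le_const2[of "\<lambda>n. \<bar>a 0 - a n\<bar>" "\<bar>a 0\<bar>" "B / (1 - \<rho>)"] by auto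
qed

context
  fixes r :: real and m :: nat and f :: "real \<Rightarrow> real" and E :: real
  assumes r: "r > 1/2" and m_def: "m = nat \<lfloor>r\<rfloor> + 1"
    and f: "continuous_on UNIV f" and E: "besov_energy r f \<le> ennreal E" "E \<ge> 0"
begin

definition tail_avg :: "real \<Rightarrow> (real \<Rightarrow> real) \<Rightarrow> real \<Rightarrow> real" where
  "tail_avg \<delta> g x = (\<Sum>k=1..m. diff_coef m k * avg (real k * \<delta>) g x)"

text \<open>The average of \<open>\<Delta>\<^sup>m\<^bsub>\<delta>u\<^esub> g\<close> over \<open>u \<in> [0,1]\<close> equals \<open>\<plusminus>g\<close> plus a combination of averages of \<open>g\<close> over intervals of length comparable to \<open>\<delta>\<close>
(\<open>tail_avg\<close>). It is small in \<open>L\<^sub>2\<close> if \<open>g\<close> has finite Besov energy, and averages of an \<open>L\<^sub>2\<close> function are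
bounded pointwise.\<close>

definition diff_avg :: "real \<Rightarrow> (real \<Rightarrow> real) \<Rightarrow> real \<Rightarrow> real" where
  "diff_avg \<delta> g x = diff_coef m 0 * g x + tail_avg \<delta> g x"

lemma tail_avg_continuous: "continuous_on UNIV g \<Longrightarrow> continuous_on UNIV (tail_avg \<delta> g)"
  unfolding tail_avg_def by (intro continuous_intros avg_continuous)

lemma diff_avg_continuous: "continuous_on UNIV g \<Longrightarrow> continuous_on UNIV (diff_avg \<delta> g)"
  unfolding diff_avg_def by (intro continuous_intros tail_avg_continuous)

lemma tail_avg_commute:
  assumes g: "continuous_on UNIV g"
  shows "tail_avg a (tail_avg b g) x = tail_avg b (tail_avg a g) x"
proof -
  have *: "tail_avg a (tail_avg b g) x = (\<Sum>k=1..m. \<Sum>l=1..m. diff_coef m k * (diff_coef m l * avg (real k * a) (avg (real l * b) g) x))" for a b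
    unfolding tail_avg_def
    by (subst avg_sum) (auto intro: avg_continuous g simp: sum_distrib_left)
  show ?thesis
    unfolding *[of a b] *[of b a]
    by (subst sum.swap) (intro sum.cong refl, subst avg_commute[OF g], simp add: mult.left_commute)
qed

lemma tail_avg_diff_avg:
  assumes g: "continuous_on UNIV g"
  shows "tail_avg a (diff_avg b g) x = diff_coef m 0 * tail_avg a g x + tail_avg a (tail_avg b g) x"
proof -
  have "avg c (diff_avg b g) x = diff_coef m 0 * avg c g x + avg c (tail_avg b g) x" for c
    using avg_sum[of "{False, True}" "\<lambda>i. if i then tail_avg b g else g" c "\<lambda>i. if i then 1 else diff_coef m 0" x]
      tail_avg_continuous[OF g] g unfolding diff_avg_def[abs_def] by auto
  then show ?thesis
    unfolding tail_avg_def[of a] by (simp add: sum.distrib sum_distrib_left algebra_simps)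
qed

lemma diff_avg_eq: "continuous_on UNIV g \<Longrightarrow> diff_avg \<delta> g x = integral {0..1} (\<lambda>u. difference m (\<delta> * u) g x)"
proof -
  assume g: "continuous_on UNIV g"
  have "integral {0..1} (\<lambda>u. difference m (\<delta> * u) g x) = (\<Sum>k\<le>m. integral {0..1} (\<lambda>u. diff_coef m k * g (x + (real k * \<delta>) * u)))"
    unfolding difference_expand mult.assoc by (intro integral_sum integrable_on_mult_right) (auto intro: avg_integrable[OF g, of _ "real k * \<delta>" for k, unfolded mult.assoc])
  also have "\<dots> = (\<Sum>k\<le>m. diff_coef m k * avg (real k * \<delta>) g x)" by (simp add: avg_def)
  also have "{..m} = insert 0 {1..m}" by auto
  also have "(\<Sum>k\<in>insert 0 {1..m}. diff_coef m k * avg (real k * \<delta>) g x) = diff_avg \<delta> g x"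
    by (simp add: diff_avg_def tail_avg_def avg_0)
  finally show ?thesis by simp
qed

lemma tail_avg_bound:
  assumes g: "continuous_on UNIV g" and G: "(\<integral>\<^sup>+x. ennreal ((g x)\<^sup>2) \<partial>lborel) \<le> ennreal G" "G \<ge> 0" and \<delta>: "\<delta> > 0"
  shows "\<bar>tail_avg \<delta> g x\<bar> \<le> (\<Sum>k=1..m. \<bar>diff_coef m k\<bar>) * sqrt (G / \<delta>)"
proof -
  have "\<bar>tail_avg \<delta> g x\<bar> \<le> (\<Sum>k=1..m. \<bar>diff_coef m k * avg (real k * \<delta>) g x\<bar>)"
    unfolding tail_avg_def by (rule sum_abs)
  also have "\<dots> \<le> (\<Sum>k=1..m. \<bar>diff_coef m k\<bar> * sqrt (G / \<delta>))"
  proof (intro sum_mono)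
    fix k assume k: "k \<in> {1..m}"
    have "\<bar>avg (real k * \<delta>) g x\<bar> \<le> sqrt (G / (real k * \<delta>))"
      using k \<delta> by (intro avg_bound g G) auto
    also have "\<dots> \<le> sqrt (G / \<delta>)"
      using k \<delta> G(2) by (intro real_sqrt_le_mono divide_left_mono) (auto simp: mult_le_cancel_right1)
    finally show "\<bar>diff_coef m k * avg (real k * \<delta>) g x\<bar> \<le> \<bar>diff_coef m k\<bar> * sqrt (G / \<delta>)"
      by (simp add: abs_mult mult_left_mono)
  qed
  finally show ?thesis by (simp add: sum_distrib_right)
qed

lemma f_measurable: "f \<in> borel_measurable borel"
  by (rule borel_measurable_continuous_onI[OF f])

lemma f_L2: "(\<integral>\<^sup>+x. ennreal ((f x)\<^sup>2) \<partial>lborel) \<le> ennreal E"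
  using E(1) unfolding besov_energy_def by (meson add_increasing2 order_trans zero_le le_iff_add)

text \<open>Substitute \<open>h = \<delta>u\<close> in the averaged square of \<open>\<Delta>\<^sup>m\<^bsub>\<delta>u\<^esub> f\<close>; on \<open>0 < h \<le> \<delta>\<close> one has \<open>\<delta>\<^sup>-\<^sup>1 \<le> \<delta>\<^sup>2\<^sup>r h\<^sup>-\<^sup>1\<^sup>-\<^sup>2\<^sup>r\<close>.\<close>

lemma diff_avg_L2:
  assumes \<delta>: "0 < \<delta>"
  shows "(\<integral>\<^sup>+x. ennreal ((diff_avg \<delta> f x)\<^sup>2) \<partial>lborel) \<le> ennreal (\<delta> powr (2 * r) * E)"
proof -
  note f_measurable [measurable]
  let ?w = "\<lambda>h. \<bar>h\<bar> powr (- 1 - 2 * r)"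
  define D where "D h = (\<integral>\<^sup>+x. ennreal ((difference m h f x)\<^sup>2) \<partial>lborel)" for h
  have [measurable]: "D \<in> borel_measurable borel" unfolding D_def by measurable
  have wD: "(\<integral>\<^sup>+h. ennreal (?w h) * D h \<partial>lborel) \<le> ennreal E"
    using E(1) unfolding besov_energy_def D_def m_def by (meson add_increasing order_trans zero_le le_iff_add order_refl add_mono)
  have "(\<integral>\<^sup>+x. ennreal ((diff_avg \<delta> f x)\<^sup>2) \<partial>lborel) \<le> (\<integral>\<^sup>+x. \<integral>\<^sup>+u. ennreal (indicator {0..1} u * (difference m (\<delta> * u) f x)\<^sup>2) \<partial>lborel \<partial>lborel)"
  proof (intro nn_integral_mono)
    fix x
    have c: "continuous_on {0..1} (\<lambda>u. difference m (\<delta> * u) f x)"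
      unfolding difference_expand by (intro continuous_intros continuous_on_compose2[OF f]) auto
    have "ennreal ((diff_avg \<delta> f x)\<^sup>2) \<le> ennreal (integral {0..1} (\<lambda>u. (difference m (\<delta> * u) f x)\<^sup>2))"
      unfolding diff_avg_eq[OF f] by (intro ennreal_leI unit_integral_sq_le c)
    also have "\<dots> = (\<integral>\<^sup>+u. ennreal (indicator {0..1} u * (difference m (\<delta> * u) f x)\<^sup>2) \<partial>lborel)"
      by (intro ennreal_unit_integral continuous_intros c) auto
    finally show "ennreal ((diff_avg \<delta> f x)\<^sup>2) \<le> (\<integral>\<^sup>+u. ennreal (indicator {0..1} u * (difference m (\<delta> * u) f x)\<^sup>2) \<partial>lborel)" .
  qed
  also have "\<dots> = (\<integral>\<^sup>+u. \<integral>\<^sup>+x. ennreal (indicator {0..1} u * (difference m (\<delta> * u) f x)\<^sup>2) \<partial>lborel \<partial>lborel)"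
    by (rule lborel_pair.Fubini') measurable
  also have "\<dots> = (\<integral>\<^sup>+u. indicator {0..1} u * D (\<delta> * u) \<partial>lborel)"
    unfolding D_def by (intro nn_integral_cong) (auto simp: indicator_def)
  also have "\<dots> \<le> (\<integral>\<^sup>+u. ennreal (\<delta> powr (1 + 2 * r)) * (ennreal (?w (\<delta> * u)) * D (\<delta> * u)) \<partial>lborel)"
  proof (intro nn_integral_mono)
    fix u :: real
    show "indicator {0..1} u * D (\<delta> * u) \<le> ennreal (\<delta> powr (1 + 2 * r)) * (ennreal (?w (\<delta> * u)) * D (\<delta> * u))"
    proof (cases "0 < u \<and> u \<le> 1")
      case True
      have "1 = \<delta> powr (1 + 2 * r) * \<delta> powr (- 1 - 2 * r)" using \<delta> by (simp add: powr_add[symmetric])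
      also have "\<dots> \<le> \<delta> powr (1 + 2 * r) * ?w (\<delta> * u)"
        using True \<delta> r by (intro mult_left_mono powr_mono2') auto
      finally have "1 \<le> ennreal (\<delta> powr (1 + 2 * r) * ?w (\<delta> * u))" by simp
      then have "1 * D (\<delta> * u) \<le> ennreal (\<delta> powr (1 + 2 * r) * ?w (\<delta> * u)) * D (\<delta> * u)" by (rule mult_right_mono) simp
      then show ?thesis using True by (simp add: ennreal_mult mult.assoc)
    next
      case False
      have "D 0 = 0" by (simp add: D_def difference_zero_step m_def)
      with False show ?thesis by (cases "u = 0") (auto simp: indicator_def)
    qed
  qed
  also have "\<dots> = ennreal (\<delta> powr (1 + 2 * r)) * (\<integral>\<^sup>+u. ennreal (?w (\<delta> * u)) * D (\<delta> * u) \<partial>lborel)"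
    by (intro nn_integral_cmult) measurable
  also have "\<dots> = ennreal (\<delta> powr (2 * r)) * (ennreal \<delta> * (\<integral>\<^sup>+u. ennreal (?w (\<delta> * u)) * D (\<delta> * u) \<partial>lborel))"
  proof -
    have "\<delta> powr (1 + 2 * r) = \<delta> powr (2 * r) * \<delta>" using \<delta> by (simp add: powr_add)
    then show ?thesis using \<delta> by (simp add: ennreal_mult mult.assoc)
  qed
  also have "ennreal \<delta> * (\<integral>\<^sup>+u. ennreal (?w (\<delta> * u)) * D (\<delta> * u) \<partial>lborel) = (\<integral>\<^sup>+h. ennreal (?w h) * D h \<partial>lborel)"
    using \<delta> by (subst nn_integral_real_affine[of "\<lambda>h. ennreal (?w h) * D h" \<delta> 0]) auto
  also have "ennreal (\<delta> powr (2 * r)) * \<dots> \<le> ennreal (\<delta> powr (2 * r)) * ennreal E"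
    by (intro mult_left_mono wD) simp
  finally show ?thesis using E(2) by (simp add: ennreal_mult)
qed

lemma diff_avg_twice:
  "diff_avg a (diff_avg a f) x = f x + diff_coef m 0 * tail_avg a f x + tail_avg a (diff_avg a f) x"
  unfolding diff_avg_def[of a "diff_avg a f"] diff_avg_def[of a f x]
  by (simp add: algebra_simps diff_coef_0_sq mult.assoc[symmetric])

text \<open>Since averages at different scales commute, the change of the squared operator from scale \<open>b\<close> to scale \<open>a\<close> contains only terms in which a pointwise bounded
average is applied to a function that is small in \<open>L\<^sub>2\<close>. This is why the operator is iterated.\<close>

lemma diff_avg_twice_difference:
  "diff_avg a (diff_avg a f) x - diff_avg b (diff_avg b f) x =
     tail_avg a (diff_avg a f) x + tail_avg a (diff_avg b f) x - tail_avg b (diff_avg a f) x - tail_avg b (diff_avg b f) x"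
  unfolding diff_avg_twice tail_avg_diff_avg[OF f] tail_avg_commute[OF f, of b a] by simp

lemma diff_avg_twice_tendsto_0:
  assumes e0: "e \<longlonglongrightarrow> 0"
  shows "(\<lambda>n. diff_avg (e n) (diff_avg (e n) f) x) \<longlonglongrightarrow> 0"
proof -
  have avg_lim: "(\<lambda>n. avg (real k * e n) (avg (real l * e n) f) x) \<longlonglongrightarrow> f x" for k l
  proof (rule LIMSEQ_I)
    fix \<epsilon> :: real assume \<epsilon>: "\<epsilon> > 0"
    have "isCont f x" using f by (simp add: continuous_on_eq_continuous_at)
    then obtain d where d: "d > 0" "\<And>y. \<bar>y - x\<bar> < d \<Longrightarrow> \<bar>f y - f x\<bar> < \<epsilon> / 2"
      using \<epsilon> unfolding continuous_at_eps_delta dist_real_def by (metis half_gt_zero)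
    have "(\<lambda>n. real k * e n) \<longlonglongrightarrow> real k * 0" "(\<lambda>n. real l * e n) \<longlonglongrightarrow> real l * 0"
      by (intro tendsto_intros e0)+
    then have "\<forall>\<^sub>F n in sequentially. \<bar>real k * e n\<bar> < d/2" "\<forall>\<^sub>F n in sequentially. \<bar>real l * e n\<bar> < d/2"
      using d(1) by (auto simp: tendsto_iff dist_real_def elim!: allE[of _ "d/2"])
    then have "\<forall>\<^sub>F n in sequentially. \<bar>avg (real k * e n) (avg (real l * e n) f) x - f x\<bar> < \<epsilon>"
    proof eventually_elim
      case (elim n)
      have "\<bar>avg (real k * e n) (avg (real l * e n) f) x - f x\<bar> \<le> \<epsilon> / 2"
      proof (intro avg_near avg_continuous f)
        fix u v :: real assume u: "0 \<le> u" "u \<le> 1" and v: "0 \<le> v" "v \<le> 1"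
        have "\<bar>real k * e n * u\<bar> \<le> \<bar>real k * e n\<bar>" "\<bar>real l * e n * v\<bar> \<le> \<bar>real l * e n\<bar>"
          using u v by (simp_all add: abs_mult mult_left_le)
        then have "\<bar>x + real k * e n * u + real l * e n * v - x\<bar> < d" using elim by linarith
        then show "\<bar>f (x + real k * e n * u + real l * e n * v) - f x\<bar> \<le> \<epsilon> / 2" using d(2) less_imp_le by blast
      qed
      then show ?case using \<epsilon> by linarith
    qed
    then show "\<exists>no. \<forall>n\<ge>no. norm (avg (real k * e n) (avg (real l * e n) f) x - f x) < \<epsilon>"
      by (simp add: eventually_sequentially)
  qed
  have ins: "{..m} = insert 0 {1..m}" by auto
  have da: "diff_avg \<delta> g y = (\<Sum>k\<le>m. diff_coef m k * avg (real k * \<delta>) g y)" for \<delta> g y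
    unfolding ins by (simp add: diff_avg_def tail_avg_def avg_0)
  have "diff_avg \<delta> (diff_avg \<delta> f) x = (\<Sum>k\<le>m. \<Sum>l\<le>m. diff_coef m k * diff_coef m l * avg (real k * \<delta>) (avg (real l * \<delta>) f) x)" for \<delta>
    unfolding da[of \<delta> "diff_avg \<delta> f"] unfolding da[of \<delta> f, abs_def]
    by (subst avg_sum) (auto intro: avg_continuous f simp: sum_distrib_left mult.assoc)
  moreover have "(\<lambda>n. \<Sum>k\<le>m. \<Sum>l\<le>m. diff_coef m k * diff_coef m l * avg (real k * e n) (avg (real l * e n) f) x)
     \<longlonglongrightarrow> (\<Sum>k\<le>m. \<Sum>l\<le>m. diff_coef m k * diff_coef m l * f x)"
    by (intro tendsto_intros avg_lim)
  moreover have "(\<Sum>k\<le>m. \<Sum>l\<le>m. diff_coef m k * diff_coef m l * f x) = 0"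
  proof -
    have "(\<Sum>k\<le>m. diff_coef m k) = 0" by (rule sum_diff_coef) (simp add: m_def)
    then show ?thesis by (simp only: sum_distrib_left[symmetric] sum_distrib_right[symmetric] mult_zero_right mult_zero_left sum.neutral_const)
  qed
  ultimately show ?thesis by simp
qed

text \<open>At dyadic scales \<open>\<delta> = 2\<^sup>-\<^sup>n\<close> consecutive values of the squared operator differ by at most a multiple of \<open>\<delta>\<^sup>r / \<delta>\<^sup>1\<^sup>/\<^sup>2 = 2\<^sup>n\<^sup>(\<^sup>1\<^sup>/\<^sup>2\<^sup>-\<^sup>r\<^sup>)\<close>, which is summable
because \<open>r > 1/2\<close>; the values tend to \<open>0\<close> because \<open>f\<close> is continuous. At scale one the operator differs from the identity by bounded averages.\<close>

lemma besov_sup_bound_aux: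
  "\<bar>f x\<bar> \<le> (\<Sum>k=1..m. \<bar>diff_coef m k\<bar>) * (8 / (1 - 2 powr (1/2 - r)) + 2) * sqrt E"
proof -
  define K where "K = (\<Sum>k=1..m. \<bar>diff_coef m k\<bar>)"
  have K0: "0 \<le> K" unfolding K_def by (intro sum_nonneg) simp
  define e where "e n = (2::real) powr (- real n)" for n :: nat
  define \<rho> where "\<rho> = (2::real) powr (1/2 - r)"
  have \<rho>: "0 \<le> \<rho>" "\<rho> < 1" unfolding \<rho>_def using r by (auto simp: powr_less_one)
  have epos: "e n > 0" for n by (simp add: e_def)
  have e_pow: "e n = (1/2) ^ n" for n by (simp add: e_def powr_minus powr_realpow power_one_over inverse_eq_divide)
  have e0: "e \<longlonglongrightarrow> 0" unfolding e_pow[abs_def] by (rule LIMSEQ_realpow_zero) auto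
  have b: "\<bar>tail_avg (e i) (diff_avg (e j) f) x\<bar> \<le> K * (2 * sqrt E) * \<rho> ^ n" if "n \<le> j" "i \<le> Suc n" for i j n
  proof -
    have 1: "\<bar>tail_avg (e i) (diff_avg (e j) f) x\<bar> \<le> K * sqrt ((e j powr (2 * r) * E) / e i)"
      unfolding K_def using E(2) epos by (intro tail_avg_bound diff_avg_continuous f diff_avg_L2) auto
    have "(e j powr (2 * r) * E) / e i \<le> (e n powr (2 * r) * E) / e (Suc n)"
      using that r E(2) epos power_decreasing[of i "Suc n" "1/2::real"]
      by (intro frac_le mult_right_mono powr_mono2) (auto simp: e_pow intro: power_decreasing)
    also have "\<dots> = (2 * (\<rho> ^ n)\<^sup>2) * E"
    proof -
      have "e n powr (2 * r) / e (Suc n) = 2 powr (- real n * (2 * r) - (- real (Suc n)))"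
        unfolding e_def by (simp only: powr_powr powr_diff)
      also have "\<dots> = 2 powr (1 + (1/2 - r) * real (2 * n))" by (simp add: algebra_simps)
      also have "\<dots> = 2 * (\<rho> powr real (2 * n))" unfolding \<rho>_def by (simp only: powr_add powr_powr) simp
      also have "\<rho> powr real (2 * n) = (\<rho> ^ n)\<^sup>2"
        using r by (subst powr_realpow) (auto simp: \<rho>_def power_mult[symmetric] mult.commute)
      finally have q: "e n powr (2 * r) / e (Suc n) = 2 * (\<rho> ^ n)\<^sup>2" .
      have "(e n powr (2 * r) * E) / e (Suc n) = (e n powr (2 * r) / e (Suc n)) * E" by simp
      then show ?thesis by (simp only: q)
    qed
    finally have "sqrt ((e j powr (2 * r) * E) / e i) \<le> sqrt ((2 * (\<rho> ^ n)\<^sup>2) * E)" by (rule real_sqrt_le_mono)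
    also have "sqrt ((2 * (\<rho> ^ n)\<^sup>2) * E) = sqrt 2 * \<rho> ^ n * sqrt E" using \<rho> by (simp add: real_sqrt_mult)
    also have "\<dots> \<le> 2 * \<rho> ^ n * sqrt E"
      using \<rho> E(2) sqrt2_less_2 by (intro mult_right_mono) auto
    finally have 2: "sqrt ((e j powr (2 * r) * E) / e i) \<le> 2 * \<rho> ^ n * sqrt E" .
    show ?thesis using order_trans[OF 1 mult_left_mono[OF 2 K0]] by (simp add: mult_ac)
  qed
  define a where "a n = diff_avg (e n) (diff_avg (e n) f) x" for n
  have "\<bar>a 0\<bar> \<le> 4 * (K * (2 * sqrt E)) / (1 - \<rho>)"
  proof (rule telescoping_bound[OF _ _ \<rho>])
    show "a \<longlonglongrightarrow> 0" unfolding a_def by (rule diff_avg_twice_tendsto_0[OF e0])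
    show "\<bar>a n - a (Suc n)\<bar> \<le> 4 * (K * (2 * sqrt E)) * \<rho> ^ n" for n
      unfolding a_def diff_avg_twice_difference
      using b[of n n n] b[of n "Suc n" n] b[of n n "Suc n"] b[of n "Suc n" "Suc n"] by (simp add: abs_le_iff)
  qed
  moreover have "\<bar>tail_avg (e 0) f x\<bar> \<le> K * sqrt E"
    using tail_avg_bound[OF f f_L2 E(2), of 1 x] by (simp add: e_def K_def)
  moreover have "\<bar>tail_avg (e 0) (diff_avg (e 0) f) x\<bar> \<le> K * sqrt E"
    using tail_avg_bound[OF diff_avg_continuous[OF f] diff_avg_L2[of 1], of 1 x] E(2) by (simp add: e_def K_def)
  moreover have "\<bar>diff_coef m 0\<bar> = 1"
    using diff_coef_0_sq[of m] by (metis abs_mult abs_mult_self_eq abs_one power2_eq_square abs_square_eq_1)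
  then have "\<bar>diff_coef m 0 * tail_avg (e 0) f x\<bar> = \<bar>tail_avg (e 0) f x\<bar>" by (simp add: abs_mult)
  moreover have "f x = a 0 - diff_coef m 0 * tail_avg (e 0) f x - tail_avg (e 0) (diff_avg (e 0) f) x"
    unfolding a_def diff_avg_twice by simp
  ultimately have "\<bar>f x\<bar> \<le> 4 * (K * (2 * sqrt E)) / (1 - \<rho>) + K * sqrt E + K * sqrt E" by linarith
  also have "\<dots> = K * (8 / (1 - \<rho>) + 2) * sqrt E" by (simp add: algebra_simps)
  finally show ?thesis by (simp add: K_def \<rho>_def)
qed

end

lemma besov_sup_bound:
  assumes r: "r > 1/2"
  shows "\<exists>C\<ge>0. \<forall>f\<in>besov_R r. \<forall>x. \<bar>f x\<bar> \<le> C * besov_R_norm r f"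
proof (intro exI[of _ "(\<Sum>k=1..nat \<lfloor>r\<rfloor> + 1. \<bar>diff_coef (nat \<lfloor>r\<rfloor> + 1) k\<bar>) * (8 / (1 - 2 powr (1/2 - r)) + 2)"] conjI ballI allI)
  have "(2::real) powr (1/2 - r) < 1" using r by (simp add: powr_less_one)
  then show "0 \<le> (\<Sum>k=1..nat \<lfloor>r\<rfloor> + 1. \<bar>diff_coef (nat \<lfloor>r\<rfloor> + 1) k\<bar>) * (8 / (1 - 2 powr (1/2 - r)) + 2)"
    by (intro mult_nonneg_nonneg sum_nonneg add_nonneg_nonneg divide_nonneg_nonneg) auto
  fix f x assume "f \<in> besov_R r"
  then have f: "continuous_on UNIV f" "besov_energy r f < \<infinity>" by (auto simp: besov_R_def)
  have E: "besov_energy r f \<le> ennreal (enn2real (besov_energy r f))" "0 \<le> enn2real (besov_energy r f)" using f(2) by simp_all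
  show "\<bar>f x\<bar> \<le> (\<Sum>k=1..nat \<lfloor>r\<rfloor> + 1. \<bar>diff_coef (nat \<lfloor>r\<rfloor> + 1) k\<bar>) * (8 / (1 - 2 powr (1/2 - r)) + 2) * besov_R_norm r f"
    unfolding besov_R_norm_def by (rule besov_sup_bound_aux[OF r refl f(1) E])
qed


section \<open>Besov spaces on the line and on the interval\<close>

lemma besov_integrand_scale: "besov_integrand r (\<lambda>t. c * f t) h x = c\<^sup>2 * besov_integrand r f h x"
  by (simp add: besov_integrand_def difference_scale power_mult_distrib algebra_simps)

lemma besov_integrand_parallelogram:
  "besov_integrand r (\<lambda>t. f t + g t) h x + besov_integrand r (\<lambda>t. f t - g t) h x
    = 2 * besov_integrand r f h x + 2 * besov_integrand r g h x"
  by (simp add: besov_integrand_def difference_add difference_minus power2_sum power2_diff algebra_simps)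

lemma besov_energy_scale:
  assumes [measurable]: "f \<in> borel_measurable borel"
  shows "besov_energy r (\<lambda>t. c * f t) = ennreal (c\<^sup>2) * besov_energy r f"
  by (subst (1 2) besov_energy_eq)
     (simp_all add: besov_integrand_scale ennreal_mult besov_integrand_nonneg nn_integral_cmult)

lemma besov_energy_parallelogram:
  assumes [measurable]: "f \<in> borel_measurable borel" "g \<in> borel_measurable borel"
  shows "besov_energy r (\<lambda>t. f t + g t) + besov_energy r (\<lambda>t. f t - g t) = 2 * besov_energy r f + 2 * besov_energy r g"
proof -
  let ?e = "\<lambda>f h x. ennreal (besov_integrand r f h x)"
  have "besov_energy r (\<lambda>t. f t + g t) + besov_energy r (\<lambda>t. f t - g t)
     = (\<integral>\<^sup>+h. \<integral>\<^sup>+x. ?e (\<lambda>t. f t + g t) h x + ?e (\<lambda>t. f t - g t) h x \<partial>lborel \<partial>lborel)"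
    by (subst (1 2) besov_energy_eq) (simp_all add: nn_integral_add)
  also have "\<dots> = (\<integral>\<^sup>+h. \<integral>\<^sup>+x. 2 * ?e f h x + 2 * ?e g h x \<partial>lborel \<partial>lborel)"
  proof (intro nn_integral_cong)
    fix h x
    have "?e (\<lambda>t. f t + g t) h x + ?e (\<lambda>t. f t - g t) h x = ennreal (2 * besov_integrand r f h x + 2 * besov_integrand r g h x)"
      by (simp add: ennreal_plus[symmetric] besov_integrand_nonneg besov_integrand_parallelogram del: ennreal_plus)
    then show "?e (\<lambda>t. f t + g t) h x + ?e (\<lambda>t. f t - g t) h x = 2 * ?e f h x + 2 * ?e g h x"
      by (simp add: ennreal_plus besov_integrand_nonneg ennreal_mult)
  qed
  also have "\<dots> = 2 * besov_energy r f + 2 * besov_energy r g"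
    by (subst (1 2) besov_energy_eq) (simp_all add: nn_integral_add nn_integral_cmult)
  finally show ?thesis .
qed

lemma besov_energy_fatou:
  assumes [measurable]: "\<And>n. v n \<in> borel_measurable borel"
    and lim: "\<And>x. (\<lambda>n. v n x) \<longlonglongrightarrow> f x" and c: "\<forall>\<^sub>F n in sequentially. besov_energy r (v n) \<le> c"
  shows "besov_energy r f \<le> c"
proof -
  have [measurable]: "f \<in> borel_measurable borel" by (rule borel_measurable_LIMSEQ_real[OF lim]) simp
  let ?e = "\<lambda>f h x. ennreal (besov_integrand r f h x)"
  have "besov_energy r f = (\<integral>\<^sup>+h. \<integral>\<^sup>+x. liminf (\<lambda>n. ?e (v n) h x) \<partial>lborel \<partial>lborel)"
  proof (subst besov_energy_eq, simp, intro nn_integral_cong)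
    fix h x
    have "(\<lambda>n. ?e (v n) h x) \<longlonglongrightarrow> ?e f h x"
      unfolding besov_integrand_def difference_expand by (intro tendsto_intros lim)
    then show "?e f h x = liminf (\<lambda>n. ?e (v n) h x)" by (simp add: lim_imp_Liminf)
  qed
  also have "\<dots> \<le> (\<integral>\<^sup>+h. liminf (\<lambda>n. \<integral>\<^sup>+x. ?e (v n) h x \<partial>lborel) \<partial>lborel)"
    by (intro nn_integral_mono nn_integral_liminf) measurable
  also have "\<dots> \<le> liminf (\<lambda>n. \<integral>\<^sup>+h. \<integral>\<^sup>+x. ?e (v n) h x \<partial>lborel \<partial>lborel)"
    by (intro nn_integral_liminf) measurable
  also have "\<dots> = liminf (\<lambda>n. besov_energy r (v n))" by (subst besov_energy_eq) simp_all
  also have "\<dots> \<le> c" using c by (intro Liminf_le) auto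
  finally show ?thesis .
qed

lemma besov_R_measurable: "f \<in> besov_R r \<Longrightarrow> f \<in> borel_measurable borel"
  by (auto simp: besov_R_def intro: borel_measurable_continuous_onI)

lemma besov_R_norm_nonneg: "0 \<le> besov_R_norm r f"
  by (simp add: besov_R_norm_def)

lemma besov_R_norm_sq: "(besov_R_norm r f)\<^sup>2 = enn2real (besov_energy r f)"
  by (simp add: besov_R_norm_def)

lemma besov_R_add: 
  assumes f: "f \<in> besov_R r" and g: "g \<in> besov_R r"
  shows "(\<lambda>t. f t + g t) \<in> besov_R r"
proof -
  have "besov_energy r (\<lambda>t. f t + g t) \<le> 2 * besov_energy r f + 2 * besov_energy r g"
    unfolding besov_energy_parallelogram[OF besov_R_measurable[OF f] besov_R_measurable[OF g], symmetric] by simp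
  also have "\<dots> < \<infinity>" using f g by (simp add: besov_R_def ennreal_mult_less_top)
  finally have "besov_energy r (\<lambda>t. f t + g t) < \<infinity>" .
  moreover have "bounded (range (\<lambda>t. f t + g t))"
    using bounded_plus_comp[of f UNIV g] f g by (simp add: besov_R_def)
  ultimately show ?thesis using f g by (auto simp: besov_R_def intro: continuous_intros)
qed

lemma besov_R_scale: 
  assumes f: "f \<in> besov_R r"
  shows "(\<lambda>t. c * f t) \<in> besov_R r"
proof -
  have "besov_energy r (\<lambda>t. c * f t) < \<infinity>"
    using f by (simp add: besov_energy_scale[OF besov_R_measurable[OF f]] besov_R_def ennreal_mult_less_top)
  moreover have "bounded (range (\<lambda>t. c * f t))"
    using bounded_scaleR_comp[of f UNIV c] f by (simp add: besov_R_def)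
  ultimately show ?thesis using f by (auto simp: besov_R_def intro: continuous_intros)
qed

interpretation besov: parallelogram_norm "besov_R r" "besov_R_norm r" for r
proof
  fix f g c assume f: "f \<in> besov_R r"
  show "(\<lambda>t. c * f t) \<in> besov_R r" by (rule besov_R_scale[OF f])
  show "besov_R_norm r (\<lambda>t. c * f t) = \<bar>c\<bar> * besov_R_norm r f"
    by (simp add: besov_R_norm_def besov_energy_scale[OF besov_R_measurable[OF f]] enn2real_mult real_sqrt_mult)
  assume g: "g \<in> besov_R r"
  show "(\<lambda>t. f t + g t) \<in> besov_R r" by (rule besov_R_add[OF f g])
  have d: "(\<lambda>t. f t - g t) \<in> besov_R r" using besov_R_add[OF f besov_R_scale[OF g, of "-1"]] by simp
  have fin: "besov_energy r h < \<top>" if "h \<in> besov_R r" for h using that by (simp add: besov_R_def)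
  have "enn2real (besov_energy r (\<lambda>t. f t + g t) + besov_energy r (\<lambda>t. f t - g t)) = enn2real (2 * besov_energy r f + 2 * besov_energy r g)"
    unfolding besov_energy_parallelogram[OF besov_R_measurable[OF f] besov_R_measurable[OF g]] ..
  then show "(besov_R_norm r (\<lambda>t. f t + g t))\<^sup>2 + (besov_R_norm r (\<lambda>t. f t - g t))\<^sup>2 = 2 * (besov_R_norm r f)\<^sup>2 + 2 * (besov_R_norm r g)\<^sup>2"
    unfolding besov_R_norm_sq
    using fin[OF f] fin[OF g] fin[OF d] fin[OF besov_R_add[OF f g]]
    by (simp add: enn2real_plus enn2real_mult ennreal_mult_less_top)
qed

definition besov_line :: "real \<Rightarrow> real fun_space" where
  "besov_line r = \<lparr>fns = besov_R r, ip = besov.polar r\<rparr>"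

lemma fnorm_besov_line: "f \<in> besov_R r \<Longrightarrow> fnorm (besov_line r) f = besov_R_norm r f"
  by (simp add: fnorm_def besov_line_def besov.polar_self besov_R_norm_nonneg)

text \<open>A Cauchy sequence converges uniformly by the bound of the supremum, so the limit is continuous and bounded, and Fatou's lemma bounds the energy of the differences.\<close>

lemma besov_line_complete:
  assumes r: "r > 1/2" and u: "range u \<subseteq> besov_R r"
    and cauchy: "\<And>e. e > 0 \<Longrightarrow> \<exists>N. \<forall>m\<ge>N. \<forall>n\<ge>N. besov_R_norm r (\<lambda>t. u m t - u n t) < e"
  shows "\<exists>f\<in>besov_R r. (\<lambda>n. besov_R_norm r (\<lambda>t. u n t - f t)) \<longlonglongrightarrow> 0"
proof -
  obtain C where C: "C \<ge> 0" "\<And>f x. f \<in> besov_R r \<Longrightarrow> \<bar>f x\<bar> \<le> C * besov_R_norm r f"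
    using besov_sup_bound[OF r] by blast
  have uR: "u n \<in> besov_R r" for n using u by auto
  have dR: "(\<lambda>t. u m t - u n t) \<in> besov_R r" for m n by (rule besov.V_diff[OF uR uR])
  have "uniformly_Cauchy_on UNIV u"
  proof (rule uniformly_Cauchy_onI)
    fix e :: real assume e: "e > 0"
    then have "e / (C + 1) > 0" using C(1) by simp
    then obtain N where N: "\<And>m n. m \<ge> N \<Longrightarrow> n \<ge> N \<Longrightarrow> besov_R_norm r (\<lambda>t. u m t - u n t) < e / (C + 1)"
      using cauchy by blast
    have "dist (u m x) (u n x) < e" if "m \<ge> N" "n \<ge> N" for m n x
    proof -
      have "\<bar>u m x - u n x\<bar> \<le> C * besov_R_norm r (\<lambda>t. u m t - u n t)" using C(2)[OF dR] .
      also have "\<dots> \<le> C * (e / (C + 1))" using N[OF that] C(1) by (intro mult_left_mono) auto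
      also have "\<dots> < e" using e C(1) by (simp add: field_simps)
      finally show ?thesis by (simp add: dist_real_def)
    qed
    then show "\<exists>M. \<forall>x\<in>UNIV. \<forall>m\<ge>M. \<forall>n\<ge>M. dist (u m x) (u n x) < e" by blast
  qed
  then obtain f where f: "uniform_limit UNIV u f sequentially"
    using Cauchy_uniformly_convergent uniformly_convergent_on_def by metis
  have lim: "(\<lambda>n. u n x) \<longlonglongrightarrow> f x" for x using tendsto_uniform_limitI[OF f] by simp
  have cont: "continuous_on UNIV f"
    by (rule uniform_limit_theorem[OF _ f]) (use uR in \<open>auto simp: besov_R_def\<close>)
  have close: "\<exists>N. \<forall>n\<ge>N. besov_energy r (\<lambda>t. u n t - f t) \<le> ennreal (e\<^sup>2)" if e: "e > 0" for e
  proof -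
    obtain N where N: "\<And>m n. m \<ge> N \<Longrightarrow> n \<ge> N \<Longrightarrow> besov_R_norm r (\<lambda>t. u m t - u n t) < e"
      using cauchy[OF e] by blast
    have "besov_energy r (\<lambda>t. u n t - f t) \<le> ennreal (e\<^sup>2)" if n: "n \<ge> N" for n
    proof (rule besov_energy_fatou)
      show "(\<lambda>t. u n t - u m t) \<in> borel_measurable borel" for m by (rule besov_R_measurable[OF dR])
      show "(\<lambda>m. u n x - u m x) \<longlonglongrightarrow> u n x - f x" for x by (intro tendsto_intros lim)
      have "besov_energy r (\<lambda>t. u n t - u m t) \<le> ennreal (e\<^sup>2)" if "m \<ge> N" for m
      proof -
        have "(besov_R_norm r (\<lambda>t. u n t - u m t))\<^sup>2 \<le> e\<^sup>2"
          using N[OF n that] besov_R_norm_nonneg by (intro power_mono) auto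
        then have "ennreal (enn2real (besov_energy r (\<lambda>t. u n t - u m t))) \<le> ennreal (e\<^sup>2)"
          unfolding besov_R_norm_sq by (rule ennreal_leI)
        moreover have "ennreal (enn2real (besov_energy r (\<lambda>t. u n t - u m t))) = besov_energy r (\<lambda>t. u n t - u m t)"
          using dR[of n m] by (simp add: besov_R_def)
        ultimately show ?thesis by metis
      qed
      then show "\<forall>\<^sub>F m in sequentially. besov_energy r (\<lambda>t. u n t - u m t) \<le> ennreal (e\<^sup>2)"
        by (auto simp: eventually_sequentially)
    qed
    then show ?thesis by blast
  qed
  have unif: "\<exists>N. \<forall>x. \<bar>f x - u N x\<bar> \<le> 1"
  proof -
    have "\<forall>\<^sub>F n in sequentially. \<forall>x\<in>UNIV. dist (u n x) (f x) < 1"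
      using f by (auto simp: uniform_limit_iff)
    then obtain N where "\<forall>x\<in>UNIV. dist (u N x) (f x) < 1" by (auto simp: eventually_sequentially)
    then show ?thesis by (intro exI[of _ N]) (auto simp: dist_real_def abs_minus_commute less_imp_le)
  qed
  have fR: "f \<in> besov_R r"
  proof -
    obtain N where N: "besov_energy r (\<lambda>t. u N t - f t) \<le> ennreal (1\<^sup>2)" using close[of 1] by auto
    obtain K where K: "\<And>x. \<bar>f x - u K x\<bar> \<le> 1" using unif by blast
    obtain B where B: "\<And>x. \<bar>u K x\<bar> \<le> B" using uR[of K] by (auto simp: besov_R_def bounded_iff)
    have "\<bar>f x\<bar> \<le> B + 1" for x using K[of x] B[of x] by linarith
    then have fb: "bounded (range f)" by (auto simp: bounded_iff)
    obtain B' where B': "\<And>x. \<bar>u N x\<bar> \<le> B'" using uR[of N] by (auto simp: besov_R_def bounded_iff)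
    have "(\<lambda>t. u N t - f t) \<in> besov_R r"
    proof -
      have "\<bar>u N x - f x\<bar> \<le> B' + (B + 1)" for x using B'[of x] \<open>\<And>x. \<bar>f x\<bar> \<le> B + 1\<close>[of x] by linarith
      then have "bounded (range (\<lambda>t. u N t - f t))" by (auto simp: bounded_iff)
      moreover have "besov_energy r (\<lambda>t. u N t - f t) < \<infinity>" using N by (auto intro: le_less_trans)
      ultimately show ?thesis using cont uR[of N] by (auto simp: besov_R_def intro: continuous_intros)
    qed
    from besov.V_diff[OF uR[of N] this] show ?thesis by simp
  qed
  have "(\<lambda>n. besov_R_norm r (\<lambda>t. u n t - f t)) \<longlonglongrightarrow> 0"
  proof (rule LIMSEQ_I)
    fix e :: real assume e: "e > 0"
    obtain N where N: "\<And>n. n \<ge> N \<Longrightarrow> besov_energy r (\<lambda>t. u n t - f t) \<le> ennreal ((e/2)\<^sup>2)" using close[of "e/2"] e by auto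
    have "norm (besov_R_norm r (\<lambda>t. u n t - f t) - 0) < e" if "n \<ge> N" for n
    proof -
      have "enn2real (besov_energy r (\<lambda>t. u n t - f t)) \<le> (e/2)\<^sup>2"
        using enn2real_mono[OF N[OF that]] by simp
      then have "besov_R_norm r (\<lambda>t. u n t - f t) \<le> e/2"
        unfolding besov_R_norm_def using e by (intro real_le_lsqrt) auto
      then show ?thesis using e besov_R_norm_nonneg[of r "\<lambda>t. u n t - f t"] by simp
    qed
    then show "\<exists>no. \<forall>n\<ge>no. norm (besov_R_norm r (\<lambda>t. u n t - f t) - 0) < e" by blast
  qed
  then show ?thesis using fR by blast
qed

lemma besov_energy_zero: "besov_energy r (\<lambda>t. 0) = 0"
  by (simp add: besov_energy_def difference_expand)

lemma rkhs_besov_line: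
  assumes r: "r > 1/2"
  shows "rkhs UNIV (besov_line r)"
  unfolding rkhs_def
proof (intro conjI ballI allI impI)
  obtain C where C: "C \<ge> 0" "\<And>f x. f \<in> besov_R r \<Longrightarrow> \<bar>f x\<bar> \<le> C * besov_R_norm r f"
    using besov_sup_bound[OF r] by blast
  show "(\<lambda>t. 0) \<in> fns (besov_line r)" by (simp add: besov_line_def besov_R_def besov_energy_zero)
  fix f g assume f: "f \<in> fns (besov_line r)" and g: "g \<in> fns (besov_line r)"
  then have f': "f \<in> besov_R r" and g': "g \<in> besov_R r" by (simp_all add: besov_line_def)
  show "(\<lambda>t. f t + g t) \<in> fns (besov_line r)" using besov.V_add[OF f' g'] by (simp add: besov_line_def)
  show "ip (besov_line r) f g = ip (besov_line r) g f" using besov.polar_sym[OF f' g'] by (simp add: besov_line_def)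
  show "ip (besov_line r) (\<lambda>t. c * f t) g = c * ip (besov_line r) f g" for c
    using besov.polar_scale[OF f' g'] by (simp add: besov_line_def)
  show "ip (besov_line r) (\<lambda>t. f t + g t) h = ip (besov_line r) f h + ip (besov_line r) g h" if "h \<in> fns (besov_line r)" for h
    using besov.polar_add[OF f' g'] that by (simp add: besov_line_def)
next
  obtain C where C: "C \<ge> 0" "\<And>f x. f \<in> besov_R r \<Longrightarrow> \<bar>f x\<bar> \<le> C * besov_R_norm r f"
    using besov_sup_bound[OF r] by blast
  fix f assume f: "f \<in> fns (besov_line r)"
  then have f': "f \<in> besov_R r" by (simp add: besov_line_def)
  show "(\<lambda>t. c * f t) \<in> fns (besov_line r)" for c using besov.V_scale[OF f'] by (simp add: besov_line_def)
  show "0 < ip (besov_line r) f f" if "f \<noteq> (\<lambda>t. 0)"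
  proof -
    have "besov_R_norm r f \<noteq> 0"
    proof
      assume "besov_R_norm r f = 0"
      then have "f x = 0" for x using C(2)[OF f', of x] by simp
      then show False using that by auto
    qed
    then show ?thesis by (simp add: besov_line_def besov.polar_self[OF f'])
  qed
next
  obtain C where C: "C \<ge> 0" "\<And>f x. f \<in> besov_R r \<Longrightarrow> \<bar>f x\<bar> \<le> C * besov_R_norm r f"
    using besov_sup_bound[OF r] by blast
  show "\<exists>C. \<forall>f\<in>fns (besov_line r). \<bar>f t\<bar> \<le> C * fnorm (besov_line r) f" for t
    using C(2) fnorm_besov_line by (intro exI[of _ C]) (auto simp: besov_line_def)
next
  fix u :: "nat \<Rightarrow> real \<Rightarrow> real"
  assume a: "range u \<subseteq> fns (besov_line r) \<and> (\<forall>e>0. \<exists>N. \<forall>m\<ge>N. \<forall>n\<ge>N. fnorm (besov_line r) (\<lambda>t. u m t - u n t) < e)"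
  then have u: "range u \<subseteq> besov_R r" by (simp add: besov_line_def)
  then have uR: "u n \<in> besov_R r" for n by auto
  have "\<exists>f\<in>besov_R r. (\<lambda>n. besov_R_norm r (\<lambda>t. u n t - f t)) \<longlonglongrightarrow> 0"
    by (rule besov_line_complete[OF r u]) (use a in \<open>simp add: fnorm_besov_line besov.V_diff uR\<close>)
  then obtain f where f: "f \<in> besov_R r" "(\<lambda>n. besov_R_norm r (\<lambda>t. u n t - f t)) \<longlonglongrightarrow> 0" by blast
  show "\<exists>f\<in>fns (besov_line r). (\<lambda>n. fnorm (besov_line r) (\<lambda>t. u n t - f t)) \<longlonglongrightarrow> 0"
    using f by (intro bexI[of _ f]) (simp_all add: fnorm_besov_line besov.V_diff[OF uR f(1)], simp add: besov_line_def)
qed simp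

context function_rkhs
begin

context
  fixes S :: "'a set"
  assumes S: "S \<subseteq> T"
begin

text \<open>The restrictions of the functions of an RKHS on \<open>T\<close> to a subset \<open>S\<close>, with the quotient norm. The inner product is polarised, as in the definition of
\<open>besov_01\<close>, which is thereby an instance.\<close>

definition quot_norm :: "('a \<Rightarrow> real) \<Rightarrow> real" where
  "quot_norm h = Inf {fnorm H f | f. f \<in> fns H \<and> zero_ext S f = h}"

definition restriction :: "'a fun_space" where
  "restriction = \<lparr>fns = zero_ext S ` fns H,
     ip = (\<lambda>f g. ((quot_norm (\<lambda>t. f t + g t))\<^sup>2 - (quot_norm (\<lambda>t. f t - g t))\<^sup>2) / 4)\<rparr>"

lemma zero_ext_add: "zero_ext S (\<lambda>t. f t + g t) = (\<lambda>t. zero_ext S f t + zero_ext S g t)"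
  and zero_ext_diff: "zero_ext S (\<lambda>t. f t - g t) = (\<lambda>t. zero_ext S f t - zero_ext S g t)"
  and zero_ext_scale: "zero_ext S (\<lambda>t. c * f t) = (\<lambda>t. c * zero_ext S f t)"
  by (auto simp: zero_ext_def)

lemma quot_norm_le:
  assumes "f \<in> fns H" shows "quot_norm (zero_ext S f) \<le> fnorm H f"
  unfolding quot_norm_def using assms
  by (intro cInf_lower bdd_belowI[of _ 0]) (auto simp: fnorm_nonneg)

lemma quot_norm_nonneg: "h \<in> zero_ext S ` fns H \<Longrightarrow> 0 \<le> quot_norm h"
  unfolding quot_norm_def by (intro cInf_greatest) (auto simp: fnorm_nonneg)

lemma near_optimal_lift:
  assumes h: "h \<in> zero_ext S ` fns H" and e: "quot_norm h < e"
  shows "\<exists>f\<in>fns H. zero_ext S f = h \<and> fnorm H f < e"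
proof -
  have "\<exists>x\<in>{fnorm H f | f. f \<in> fns H \<and> zero_ext S f = h}. x < e"
    by (rule cInf_lessD) (use h e in \<open>auto simp: quot_norm_def\<close>)
  then show ?thesis by blast
qed

lemma near_optimal_lift_sq:
  assumes h: "h \<in> zero_ext S ` fns H" and e: "e > 0"
  shows "\<exists>f\<in>fns H. zero_ext S f = h \<and> ip H f f < (quot_norm h)\<^sup>2 + e"
proof -
  have "quot_norm h < sqrt ((quot_norm h)\<^sup>2 + e)"
    using quot_norm_nonneg[OF h] e by (intro real_less_rsqrt) simp
  then obtain f where f: "f \<in> fns H" "zero_ext S f = h" "fnorm H f < sqrt ((quot_norm h)\<^sup>2 + e)"
    using near_optimal_lift[OF h] by blast
  then have "ip H f f < (quot_norm h)\<^sup>2 + e" unfolding fnorm_def by simp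
  then show ?thesis using f by blast
qed

lemma quot_norm_scale_le:
  assumes h: "h \<in> zero_ext S ` fns H"
  shows "quot_norm (\<lambda>t. c * h t) \<le> \<bar>c\<bar> * quot_norm h"
proof (rule field_le_epsilon)
  fix e :: real assume e: "e > 0"
  have "quot_norm h < quot_norm h + e / (\<bar>c\<bar> + 1)" using e by (simp add: add_pos_nonneg)
  then obtain f where f: "f \<in> fns H" "zero_ext S f = h" "fnorm H f < quot_norm h + e / (\<bar>c\<bar> + 1)"
    using near_optimal_lift[OF h] by blast
  have "quot_norm (\<lambda>t. c * h t) \<le> fnorm H (\<lambda>t. c * f t)"
    using quot_norm_le[OF scale_in[OF f(1)]] f(2) by (simp add: zero_ext_scale)
  also have "\<dots> = \<bar>c\<bar> * fnorm H f" by (rule fnorm_scale[OF f(1)])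
  also have "\<dots> \<le> \<bar>c\<bar> * (quot_norm h + e / (\<bar>c\<bar> + 1))" using f(3) by (intro mult_left_mono) auto
  also have "\<dots> \<le> \<bar>c\<bar> * quot_norm h + e"
    using e by (simp add: distrib_left field_simps)
  finally show "quot_norm (\<lambda>t. c * h t) \<le> \<bar>c\<bar> * quot_norm h + e" .
qed

lemma image_add: "f \<in> zero_ext S ` fns H \<Longrightarrow> g \<in> zero_ext S ` fns H \<Longrightarrow> (\<lambda>t. f t + g t) \<in> zero_ext S ` fns H"
  using add_in by (auto simp: zero_ext_add[symmetric])

lemma image_diff: "f \<in> zero_ext S ` fns H \<Longrightarrow> g \<in> zero_ext S ` fns H \<Longrightarrow> (\<lambda>t. f t - g t) \<in> zero_ext S ` fns H"
  using diff_in by (auto simp: zero_ext_diff[symmetric])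

lemma image_scale: "f \<in> zero_ext S ` fns H \<Longrightarrow> (\<lambda>t. c * f t) \<in> zero_ext S ` fns H"
  using scale_in by (auto simp: zero_ext_scale[symmetric])

text \<open>Near optimal lifts \<open>F\<close>, \<open>G\<close> of \<open>f\<close>, \<open>g\<close> give lifts \<open>F + G\<close>, \<open>F - G\<close>. The reverse inequality is the same one for
\<open>f + g\<close> and \<open>f - g\<close>.\<close>

lemma quot_norm_parallelogram_le:
  assumes f: "f \<in> zero_ext S ` fns H" and g: "g \<in> zero_ext S ` fns H"
  shows "(quot_norm (\<lambda>t. f t + g t))\<^sup>2 + (quot_norm (\<lambda>t. f t - g t))\<^sup>2 \<le> 2 * (quot_norm f)\<^sup>2 + 2 * (quot_norm g)\<^sup>2"
proof (rule field_le_epsilon)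
  fix e :: real assume e: "e > 0"
  then have e4: "e/4 > 0" by simp
  obtain F where F: "F \<in> fns H" "zero_ext S F = f" "ip H F F < (quot_norm f)\<^sup>2 + e/4" using near_optimal_lift_sq[OF f e4] by blast
  obtain G where G: "G \<in> fns H" "zero_ext S G = g" "ip H G G < (quot_norm g)\<^sup>2 + e/4" using near_optimal_lift_sq[OF g e4] by blast
  have "quot_norm (\<lambda>t. f t + g t) \<le> fnorm H (\<lambda>t. F t + G t)" "quot_norm (\<lambda>t. f t - g t) \<le> fnorm H (\<lambda>t. F t - G t)"
    using quot_norm_le[OF add_in[OF F(1) G(1)]] quot_norm_le[OF diff_in[OF F(1) G(1)]] F(2) G(2) by (simp_all add: zero_ext_add zero_ext_diff)
  then have "(quot_norm (\<lambda>t. f t + g t))\<^sup>2 \<le> (fnorm H (\<lambda>t. F t + G t))\<^sup>2" "(quot_norm (\<lambda>t. f t - g t))\<^sup>2 \<le> (fnorm H (\<lambda>t. F t - G t))\<^sup>2"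
    using quot_norm_nonneg[OF image_add[OF f g]] quot_norm_nonneg[OF image_diff[OF f g]] by (auto intro: power_mono)
  moreover have "(fnorm H (\<lambda>t. F t + G t))\<^sup>2 + (fnorm H (\<lambda>t. F t - G t))\<^sup>2 = 2 * ip H F F + 2 * ip H G G"
    using ip_lin2[OF F(1) G(1), of 1] ip_lin2[OF F(1) G(1), of "-1"] by (simp add: fnorm_sq add_in diff_in F(1) G(1))
  ultimately show "(quot_norm (\<lambda>t. f t + g t))\<^sup>2 + (quot_norm (\<lambda>t. f t - g t))\<^sup>2 \<le> 2 * (quot_norm f)\<^sup>2 + 2 * (quot_norm g)\<^sup>2 + e"
    using F(3) G(3) by linarith
qed

lemma parallelogram_quot_norm: "parallelogram_norm (zero_ext S ` fns H) quot_norm"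
proof
  fix f g c assume f: "f \<in> zero_ext S ` fns H"
  show "(\<lambda>t. c * f t) \<in> zero_ext S ` fns H" by (rule image_scale[OF f])
  show scale: "quot_norm (\<lambda>t. c * f t) = \<bar>c\<bar> * quot_norm f" if f: "f \<in> zero_ext S ` fns H" for c f
  proof (cases "c = 0")
    case True
    then show ?thesis using quot_norm_scale_le[OF f, of 0] quot_norm_nonneg[OF image_scale[OF f, of 0]] by simp
  next
    case False
    have "quot_norm f \<le> \<bar>1 / c\<bar> * quot_norm (\<lambda>t. c * f t)"
      using quot_norm_scale_le[OF image_scale[OF f, of c], of "1/c"] False by simp
    then have "\<bar>c\<bar> * quot_norm f \<le> quot_norm (\<lambda>t. c * f t)" using False by (simp add: field_simps)
    then show ?thesis using quot_norm_scale_le[OF f, of c] by linarith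
  qed
  assume g: "g \<in> zero_ext S ` fns H"
  show "(\<lambda>t. f t + g t) \<in> zero_ext S ` fns H" by (rule image_add[OF f g])
  have "4 * ((quot_norm f)\<^sup>2 + (quot_norm g)\<^sup>2) = (quot_norm (\<lambda>t. 2 * f t))\<^sup>2 + (quot_norm (\<lambda>t. 2 * g t))\<^sup>2"
    by (simp add: scale f g power_mult_distrib)
  also have "(\<lambda>t. 2 * f t) = (\<lambda>t. (f t + g t) + (f t - g t))" by (simp add: fun_eq_iff)
  also have "(\<lambda>t. 2 * g t) = (\<lambda>t. (f t + g t) - (f t - g t))" by (simp add: fun_eq_iff)
  also have "(quot_norm (\<lambda>t. (f t + g t) + (f t - g t)))\<^sup>2 + (quot_norm (\<lambda>t. (f t + g t) - (f t - g t)))\<^sup>2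
      \<le> 2 * (quot_norm (\<lambda>t. f t + g t))\<^sup>2 + 2 * (quot_norm (\<lambda>t. f t - g t))\<^sup>2"
    by (rule quot_norm_parallelogram_le[OF image_add[OF f g] image_diff[OF f g]])
  finally have fin: "4 * ((quot_norm f)\<^sup>2 + (quot_norm g)\<^sup>2)
      \<le> 2 * (quot_norm (\<lambda>t. f t + g t))\<^sup>2 + 2 * (quot_norm (\<lambda>t. f t - g t))\<^sup>2" .
  show "(quot_norm (\<lambda>t. f t + g t))\<^sup>2 + (quot_norm (\<lambda>t. f t - g t))\<^sup>2 = 2 * (quot_norm f)\<^sup>2 + 2 * (quot_norm g)\<^sup>2"
  proof -
    have *: "4 * (a + b) \<le> 2 * X + 2 * Y \<Longrightarrow> X + Y \<le> 2 * a + 2 * b \<Longrightarrow> X + Y = 2 * a + 2 * b" for a b X Y :: real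
      by (rule antisym) simp_all
    from *[OF fin quot_norm_parallelogram_le[OF f g]] show ?thesis .
  qed
qed

lemma quot_norm_triangle:
  assumes f: "f \<in> zero_ext S ` fns H" and g: "g \<in> zero_ext S ` fns H"
  shows "quot_norm (\<lambda>t. f t + g t) \<le> quot_norm f + quot_norm g"
proof (rule field_le_epsilon)
  fix e :: real assume e: "e > 0"
  obtain F where F: "F \<in> fns H" "zero_ext S F = f" "fnorm H F < quot_norm f + e/2" using near_optimal_lift[OF f, of "quot_norm f + e/2"] e by auto
  obtain G where G: "G \<in> fns H" "zero_ext S G = g" "fnorm H G < quot_norm g + e/2" using near_optimal_lift[OF g, of "quot_norm g + e/2"] e by auto
  have "quot_norm (\<lambda>t. f t + g t) \<le> fnorm H (\<lambda>t. F t + G t)"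
    using quot_norm_le[OF add_in[OF F(1) G(1)]] F(2) G(2) by (simp add: zero_ext_add)
  also have "\<dots> \<le> fnorm H F + fnorm H G" by (rule fnorm_triangle[OF F(1) G(1)])
  finally show "quot_norm (\<lambda>t. f t + g t) \<le> quot_norm f + quot_norm g + e" using F(3) G(3) by simp
qed

lemma fnorm_restriction: "f \<in> zero_ext S ` fns H \<Longrightarrow> fnorm restriction f = quot_norm f"
  using parallelogram_norm.polar_self[OF parallelogram_quot_norm, of f] quot_norm_nonneg[of f]
  by (simp add: fnorm_def restriction_def parallelogram_norm.polar_def[OF parallelogram_quot_norm])

lemma quot_norm_eval_bound:
  assumes C: "\<And>f. f \<in> fns H \<Longrightarrow> \<bar>f t\<bar> \<le> C * fnorm H f" and C0: "C \<ge> 0" and t: "t \<in> S" and h: "h \<in> zero_ext S ` fns H"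
  shows "\<bar>h t\<bar> \<le> C * quot_norm h"
proof (rule field_le_epsilon)
  fix e :: real assume e: "e > 0"
  have "quot_norm h < quot_norm h + e / (C + 1)" using e C0 by simp
  then obtain f where f: "f \<in> fns H" "zero_ext S f = h" "fnorm H f < quot_norm h + e / (C + 1)"
    using near_optimal_lift[OF h] by blast
  have "\<bar>h t\<bar> = \<bar>f t\<bar>" using f(2) t by (auto simp: zero_ext_def)
  also have "\<dots> \<le> C * fnorm H f" by (rule C[OF f(1)])
  also have "\<dots> \<le> C * (quot_norm h + e / (C + 1))" using f(3) C0 by (intro mult_left_mono) auto
  also have "\<dots> \<le> C * quot_norm h + e" using e C0 by (simp add: distrib_left field_simps)
  finally show "\<bar>h t\<bar> \<le> C * quot_norm h + e" .
qed

text \<open>Pass to a subsequence with summable increments, lift the increments to functions of summable norm, and restrict the sum of the lifts.\<close>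

lemma quot_norm_complete:
  assumes u: "\<And>n. u n \<in> zero_ext S ` fns H"
    and cauchy: "\<And>e. e > 0 \<Longrightarrow> \<exists>N. \<forall>m\<ge>N. \<forall>n\<ge>N. quot_norm (\<lambda>t. u m t - u n t) < e"
  shows "\<exists>f\<in>zero_ext S ` fns H. (\<lambda>n. quot_norm (\<lambda>t. u n t - f t)) \<longlonglongrightarrow> 0"
proof -
  have "\<forall>k. \<exists>N. \<forall>m\<ge>N. \<forall>n\<ge>N. quot_norm (\<lambda>t. u m t - u n t) < (1/2) ^ k" using cauchy by simp
  then obtain M where M: "\<And>k m n. m \<ge> M k \<Longrightarrow> n \<ge> M k \<Longrightarrow> quot_norm (\<lambda>t. u m t - u n t) < (1/2) ^ k" by metis
  define \<phi> where "\<phi> k = (\<Sum>i\<le>k. M i)" for k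
  have \<phi>M: "M k \<le> \<phi> k" "M k \<le> \<phi> (Suc k)" for k
    unfolding \<phi>_def by (rule member_le_sum; simp)+
  have dI: "(\<lambda>t. u m t - u n t) \<in> zero_ext S ` fns H" for m n by (rule image_diff[OF u u])
  have "\<forall>k. \<exists>v\<in>fns H. zero_ext S v = (\<lambda>t. u (\<phi> (Suc k)) t - u (\<phi> k) t) \<and> fnorm H v < (1/2) ^ k"
    using near_optimal_lift[OF dI M[OF \<phi>M(2) \<phi>M(1)]] by blast
  then obtain v where v: "\<And>k. v k \<in> fns H" "\<And>k. zero_ext S (v k) = (\<lambda>t. u (\<phi> (Suc k)) t - u (\<phi> k) t)"
    "\<And>k. fnorm H (v k) < (1/2) ^ k" by metis
  obtain w where w: "w \<in> fns H" "zero_ext S w = u (\<phi> 0)" using u[of "\<phi> 0"] by auto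
  define W where "W = rec_nat w (\<lambda>k f t. f t + v k t)"
  have W0: "W 0 = w" and WS: "W (Suc k) = (\<lambda>t. W k t + v k t)" for k by (simp_all add: W_def)
  have WH: "W k \<in> fns H" for k by (induction k) (auto simp: W0 WS w intro: add_in v)
  have WU: "zero_ext S (W k) = u (\<phi> k)" for k
    by (induction k) (simp_all add: W0 WS w zero_ext_add v(2))
  have dist: "fnorm H (\<lambda>t. W (n + k) t - W n t) \<le> 2 * ((1/2)^n - (1/2)^(n+k))" for n k
  proof (induction k)
    case 0 then show ?case using ip_zero[OF zero_in] by (simp add: fnorm_def)
  next
    case (Suc k)
    have "(\<lambda>t. W (Suc (n + k)) t - W (n + k) t) = v (n + k)" by (simp add: WS)
    then have "fnorm H (\<lambda>t. W (Suc (n + k)) t - W (n + k) t) \<le> (1/2)^(n+k)" using v(3)[of "n+k"] by simp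
    then have "fnorm H (\<lambda>t. W (Suc (n + k)) t - W n t) \<le> (1/2)^(n+k) + 2 * ((1/2)^n - (1/2)^(n+k))"
      using fnorm_triangle_diff[OF WH[of "Suc (n+k)"] WH[of "n+k"] WH[of n]] Suc by linarith
    then show ?case by (simp add: field_simps)
  qed
  have l0: "(\<lambda>n. 2 * (1/2::real)^n) \<longlonglongrightarrow> 0"
    by (intro tendsto_mult_right_zero LIMSEQ_realpow_zero) auto
  have d: "fnorm H (\<lambda>t. W m t - W n t) \<le> 2 * (1/2)^n" if "n \<le> m" for m n
  proof -
    have "fnorm H (\<lambda>t. W m t - W n t) \<le> 2 * ((1/2)^n - (1/2)^m)"
      using dist[of n "m - n"] that by simp
    also have "\<dots> \<le> 2 * (1/2)^n" by (intro mult_left_mono) simp_all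
    finally show ?thesis .
  qed
  obtain f where f: "f \<in> fns H" "\<And>n. fnorm H (\<lambda>t. f t - W n t) \<le> 2 * (1/2)^n"
    using cauchy_limit[of W, OF WH l0 d] by blast
  have sub: "quot_norm (\<lambda>t. u (\<phi> k) t - zero_ext S f t) \<le> 2 * (1/2)^k" for k
    using quot_norm_le[OF diff_in[OF WH[of k] f(1)]] f(2)[of k] fnorm_minus_commute[OF f(1) WH[of k]]
    by (simp add: zero_ext_diff WU)
  have "(\<lambda>n. quot_norm (\<lambda>t. u n t - zero_ext S f t)) \<longlonglongrightarrow> 0"
  proof (rule LIMSEQ_I)
    fix e :: real assume e: "e > 0"
    obtain k where k: "(1/2::real)^k < e/3" using real_arch_pow_inv[of "e/3" "1/2"] e by auto
    have "norm (quot_norm (\<lambda>t. u n t - zero_ext S f t) - 0) < e" if n: "n \<ge> M k" for n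
    proof -
      have fi: "(\<lambda>t. u (\<phi> k) t - zero_ext S f t) \<in> zero_ext S ` fns H" "(\<lambda>t. u n t - zero_ext S f t) \<in> zero_ext S ` fns H"
        using f(1) by (auto intro!: image_diff u)
      have "quot_norm (\<lambda>t. u n t - zero_ext S f t) \<le> quot_norm (\<lambda>t. u n t - u (\<phi> k) t) + quot_norm (\<lambda>t. u (\<phi> k) t - zero_ext S f t)"
        using quot_norm_triangle[OF dI[of n "\<phi> k"] fi(1)] by simp
      then have "quot_norm (\<lambda>t. u n t - zero_ext S f t) < e"
        using M[OF n \<phi>M(1)] sub[of k] k by linarith
      then show ?thesis using quot_norm_nonneg[OF fi(2)] by simp
    qed
    then show "\<exists>no. \<forall>n\<ge>no. norm (quot_norm (\<lambda>t. u n t - zero_ext S f t) - 0) < e" by blast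
  qed
  then show ?thesis using f(1) by blast
qed

lemma rkhs_restriction: "rkhs S restriction"
proof -
  interpret q: parallelogram_norm "zero_ext S ` fns H" quot_norm by (rule parallelogram_quot_norm)
  have R: "fns restriction = zero_ext S ` fns H" "ip restriction = q.polar"
    by (simp_all add: restriction_def q.polar_def fun_eq_iff)
  have ev: "\<exists>C\<ge>0. \<forall>f\<in>zero_ext S ` fns H. \<bar>f t\<bar> \<le> C * quot_norm f" if t: "t \<in> S" for t
  proof -
    obtain C where C: "\<And>f. f \<in> fns H \<Longrightarrow> \<bar>f t\<bar> \<le> C * fnorm H f" using eval_bound t S by blast
    have "\<bar>f t\<bar> \<le> max C 0 * fnorm H f" if "f \<in> fns H" for f
      using C[OF that] mult_right_mono[of C "max C 0" "fnorm H f"] fnorm_nonneg[OF that] by simp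
    then show ?thesis using quot_norm_eval_bound[of t "max C 0"] t by (intro exI[of _ "max C 0"]) auto
  qed
  show ?thesis
    unfolding rkhs_def R
  proof (intro conjI ballI allI impI)
    have "zero_ext S (\<lambda>t. 0) = (\<lambda>t. 0)" by (simp add: zero_ext_def)
    then show "(\<lambda>t. 0) \<in> zero_ext S ` fns H" using zero_in by (metis imageI)
    fix f assume f: "f \<in> zero_ext S ` fns H"
    show "f t = 0" if "t \<notin> S" for t using f that by (auto simp: zero_ext_def)
    show "(\<lambda>t. c * f t) \<in> zero_ext S ` fns H" for c by (rule image_scale[OF f])
    show "0 < q.polar f f" if "f \<noteq> (\<lambda>t. 0)"
    proof -
      have "quot_norm f \<noteq> 0"
      proof
        assume z: "quot_norm f = 0"
        have "f t = 0" for t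
        proof (cases "t \<in> S")
          case True then show ?thesis using ev[OF True] f z by fastforce
        next
          case False then show ?thesis using f by (auto simp: zero_ext_def)
        qed
        then show False using that by auto
      qed
      then show ?thesis by (simp add: q.polar_self[OF f])
    qed
    fix g assume g: "g \<in> zero_ext S ` fns H"
    show "(\<lambda>t. f t + g t) \<in> zero_ext S ` fns H" by (rule image_add[OF f g])
    show "q.polar f g = q.polar g f" by (rule q.polar_sym[OF f g])
    show "q.polar (\<lambda>t. c * f t) g = c * q.polar f g" for c by (rule q.polar_scale[OF f g])
    show "q.polar (\<lambda>t. f t + g t) h = q.polar f h + q.polar g h" if "h \<in> zero_ext S ` fns H" for h
      by (rule q.polar_add[OF f g that])
  next
    fix t assume "t \<in> S"
    then show "\<exists>C. \<forall>f\<in>zero_ext S ` fns H. \<bar>f t\<bar> \<le> C * fnorm restriction f"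
      using ev by (force simp: fnorm_restriction)
  next
    fix u :: "nat \<Rightarrow> 'a \<Rightarrow> real"
    assume a: "range u \<subseteq> zero_ext S ` fns H \<and> (\<forall>e>0. \<exists>N. \<forall>m\<ge>N. \<forall>n\<ge>N. fnorm restriction (\<lambda>t. u m t - u n t) < e)"
    then have u: "u n \<in> zero_ext S ` fns H" for n by auto
    have c: "\<exists>N. \<forall>m\<ge>N. \<forall>n\<ge>N. quot_norm (\<lambda>t. u m t - u n t) < e" if "e > 0" for e
      using a that by (simp add: fnorm_restriction image_diff[OF u u])
    obtain f where f: "f \<in> zero_ext S ` fns H" "(\<lambda>n. quot_norm (\<lambda>t. u n t - f t)) \<longlonglongrightarrow> 0"
      using quot_norm_complete[OF u c] by blast
    then show "\<exists>f\<in>zero_ext S ` fns H. (\<lambda>n. fnorm restriction (\<lambda>t. u n t - f t)) \<longlonglongrightarrow> 0"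
      by (intro bexI[of _ f]) (simp_all add: fnorm_restriction image_diff[OF u f(1)])
  qed
qed

end

end

lemma besov_01_rkhs:
  assumes r: "r > 1/2"
  shows "rkhs unit_interval (besov_01 r)"
    and "\<exists>C\<ge>0. \<forall>h\<in>fns (besov_01 r). \<forall>t\<in>unit_interval. \<bar>h t\<bar> \<le> C * fnorm (besov_01 r) h"
    and "f \<in> besov_R r \<Longrightarrow> zero_ext unit_interval f \<in> fns (besov_01 r) \<and>
       fnorm (besov_01 r) (zero_ext unit_interval f) \<le> besov_R_norm r f"
proof -
  interpret B: function_rkhs UNIV "besov_line r" by (rule function_rkhs.intro[OF rkhs_besov_line[OF r]])
  have fl: "fns (besov_line r) = besov_R r" by (simp add: besov_line_def)
  have qn: "B.quot_norm unit_interval h = besov_01_norm r h" for h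
    unfolding B.quot_norm_def[OF subset_UNIV] besov_01_norm_def fl
    by (intro arg_cong[where f = Inf] Collect_cong ex_cong1) (auto simp: fnorm_besov_line)
  have R: "B.restriction unit_interval = besov_01 r"
    unfolding B.restriction_def[OF subset_UNIV] besov_01_def qn by (simp add: besov_line_def)
  show "rkhs unit_interval (besov_01 r)" using B.rkhs_restriction[OF subset_UNIV, of unit_interval] unfolding R .
  have fb: "fns (besov_01 r) = zero_ext unit_interval ` besov_R r" by (simp add: besov_01_def)
  have nrm: "fnorm (besov_01 r) h = B.quot_norm unit_interval h" if "h \<in> zero_ext unit_interval ` besov_R r" for h
    using B.fnorm_restriction[OF subset_UNIV, of h unit_interval] that unfolding R fl by blast
  obtain C where C: "C \<ge> 0" "\<And>f x. f \<in> besov_R r \<Longrightarrow> \<bar>f x\<bar> \<le> C * besov_R_norm r f"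
    using besov_sup_bound[OF r] by blast
  have "\<bar>h t\<bar> \<le> C * fnorm (besov_01 r) h" if "h \<in> fns (besov_01 r)" "t \<in> unit_interval" for h t
  proof -
    have h: "h \<in> zero_ext unit_interval ` fns (besov_line r)" using that(1) unfolding fb fl .
    have c: "\<bar>f t\<bar> \<le> C * fnorm (besov_line r) f" if "f \<in> fns (besov_line r)" for f
      using C(2)[of f t] that fnorm_besov_line[of f r] unfolding fl by simp
    show ?thesis
      using B.quot_norm_eval_bound[OF subset_UNIV c C(1) that(2) h] nrm h unfolding fl by simp
  qed
  then show "\<exists>C\<ge>0. \<forall>h\<in>fns (besov_01 r). \<forall>t\<in>unit_interval. \<bar>h t\<bar> \<le> C * fnorm (besov_01 r) h"
    using C(1) by blast
  show "zero_ext unit_interval f \<in> fns (besov_01 r) \<and> fnorm (besov_01 r) (zero_ext unit_interval f) \<le> besov_R_norm r f"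
    if f: "f \<in> besov_R r"
  proof
    show "zero_ext unit_interval f \<in> fns (besov_01 r)" using f unfolding fb by blast
    show "fnorm (besov_01 r) (zero_ext unit_interval f) \<le> besov_R_norm r f"
      using B.quot_norm_le[OF subset_UNIV, of f unit_interval] nrm[of "zero_ext unit_interval f"] f fnorm_besov_line[OF f]
      unfolding fl by simp
  qed
qed


section \<open>Waves in Besov spaces\<close>

lemma difference_Suc: "difference (Suc n) h f x = difference n h (\<lambda>x. f (x + h) - f x) x"
  unfolding difference_def funpow_Suc_right by simp

lemma difference_Suc': "difference (Suc n) h f x = difference n h f (x + h) - difference n h f x"
  by (simp add: difference_def)

lemma difference_shift: "difference n h (\<lambda>x. f (x + c)) x = difference n h f (x + c)"
  by (simp add: difference_expand add_ac)

text \<open>The Leibniz rule for differences, in the form of the binomial theorem for geometric bounds: differences of order \<open>i\<close> of size \<open>A a\<^sup>i\<close> and \<open>B b\<^sup>i\<close>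
combine to size \<open>A B (a + b)\<^sup>n\<close>. Shifts of one factor do not affect the bounds.\<close>

lemma difference_leibniz_bound:
  assumes "\<And>i x. i \<le> n \<Longrightarrow> \<bar>difference i h \<phi> x\<bar> \<le> A * a ^ i"
    and "\<And>i x. i \<le> n \<Longrightarrow> \<bar>difference i h \<psi> x\<bar> \<le> B * b ^ i"
    and "0 \<le> a" "0 \<le> b" "0 \<le> A" "0 \<le> B"
  shows "\<bar>difference n h (\<lambda>x. \<phi> x * \<psi> x) x\<bar> \<le> A * B * (a + b) ^ n"
  using assms
proof (induction n arbitrary: \<phi> \<psi> A B x)
  case 0
  have "\<bar>\<phi> x\<bar> \<le> A" "\<bar>\<psi> x\<bar> \<le> B" using 0(1)[of 0 x] 0(2)[of 0 x] by (simp_all add: difference_def)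
  then show ?case using 0(5) by (simp add: difference_def abs_mult mult_mono)
next
  case (Suc n)
  let ?d\<phi> = "\<lambda>x. \<phi> (x + h) - \<phi> x" and ?d\<psi> = "\<lambda>x. \<psi> (x + h) - \<psi> x"
  have eq: "(\<lambda>x. \<phi> (x + h) * \<psi> (x + h) - \<phi> x * \<psi> x) = (\<lambda>x. ?d\<phi> x * \<psi> (x + h) + \<phi> x * ?d\<psi> x)"
    by (simp add: fun_eq_iff algebra_simps)
  have 1: "\<bar>difference n h (\<lambda>x. ?d\<phi> x * \<psi> (x + h)) x\<bar> \<le> (A * a) * B * (a + b) ^ n"
  proof (rule Suc.IH)
    show "\<bar>difference i h ?d\<phi> x\<bar> \<le> A * a * a ^ i" if "i \<le> n" for i x
      using Suc.prems(1)[of "Suc i" x] that by (simp add: difference_Suc mult.assoc)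
    show "\<bar>difference i h (\<lambda>x. \<psi> (x + h)) x\<bar> \<le> B * b ^ i" if "i \<le> n" for i x
      using Suc.prems(2)[of i "x + h"] that by (simp add: difference_shift)
  qed (use Suc.prems in auto)
  have 2: "\<bar>difference n h (\<lambda>x. \<phi> x * ?d\<psi> x) x\<bar> \<le> A * (B * b) * (a + b) ^ n"
  proof (rule Suc.IH)
    show "\<bar>difference i h \<phi> x\<bar> \<le> A * a ^ i" if "i \<le> n" for i x
      using Suc.prems(1)[of i x] that by simp
    show "\<bar>difference i h ?d\<psi> x\<bar> \<le> B * b * b ^ i" if "i \<le> n" for i x
      using Suc.prems(2)[of "Suc i" x] that by (simp add: difference_Suc mult.assoc)
  qed (use Suc.prems in auto)
  have "difference (Suc n) h (\<lambda>x. \<phi> x * \<psi> x) x = difference n h (\<lambda>x. ?d\<phi> x * \<psi> (x + h)) x + difference n h (\<lambda>x. \<phi> x * ?d\<psi> x) x"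
    unfolding difference_Suc eq by (rule difference_add)
  also have "\<bar>\<dots>\<bar> \<le> (A * a) * B * (a + b) ^ n + A * (B * b) * (a + b) ^ n"
    using 1 2 by linarith
  also have "\<dots> = A * B * (a + b) ^ Suc n" by (simp add: algebra_simps)
  finally show ?case .
qed

lemma difference_cos:
  "\<exists>\<phi>'. \<forall>x. difference n h (\<lambda>x. cos (\<xi> * x + \<phi>)) x = (2 * sin (\<xi> * h / 2)) ^ n * cos (\<xi> * x + \<phi>')"
proof (induction n arbitrary: \<phi>)
  case 0 show ?case by (intro exI[of _ \<phi>]) (simp add: difference_def)
next
  case (Suc n)
  define \<phi>1 where "\<phi>1 = \<phi> + \<xi> * h / 2 + pi / 2"
  have "cos (\<xi> * (x + h) + \<phi>) - cos (\<xi> * x + \<phi>) = (2 * sin (\<xi> * h / 2)) * cos (\<xi> * x + \<phi>1)" for x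
  proof -
    have "cos (\<xi> * (x + h) + \<phi>) - cos (\<xi> * x + \<phi>) = 2 * sin ((\<xi> * (x + h) + \<phi> + (\<xi> * x + \<phi>)) / 2) * sin ((\<xi> * x + \<phi> - (\<xi> * (x + h) + \<phi>)) / 2)"
      by (rule cos_diff_cos)
    also have "(\<xi> * (x + h) + \<phi> + (\<xi> * x + \<phi>)) / 2 = \<xi> * x + \<phi> + \<xi> * h / 2" by (simp add: field_simps)
    also have "(\<xi> * x + \<phi> - (\<xi> * (x + h) + \<phi>)) / 2 = - (\<xi> * h / 2)" by (simp add: field_simps)
    also have "sin (\<xi> * x + \<phi> + \<xi> * h / 2) = - cos (\<xi> * x + \<phi>1)"
      unfolding \<phi>1_def by (simp add: cos_add add.assoc[symmetric] sin_add)
    finally show ?thesis by simp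
  qed
  then have "difference (Suc n) h (\<lambda>x. cos (\<xi> * x + \<phi>)) x = (2 * sin (\<xi> * h / 2)) * difference n h (\<lambda>x. cos (\<xi> * x + \<phi>1)) x" for x
    by (simp add: difference_Suc difference_scale)
  moreover obtain \<phi>' where "\<And>x. difference n h (\<lambda>x. cos (\<xi> * x + \<phi>1)) x = (2 * sin (\<xi> * h / 2)) ^ n * cos (\<xi> * x + \<phi>')"
    using Suc[of \<phi>1] by blast
  ultimately show ?case by (intro exI[of _ \<phi>']) simp
qed

lemma difference_cos_bound: "\<bar>difference n h (\<lambda>x. cos (\<xi> * x + \<phi>)) x\<bar> \<le> 1 * (\<bar>\<xi>\<bar> * \<bar>h\<bar>) ^ n"
proof -
  obtain \<phi>' where "difference n h (\<lambda>x. cos (\<xi> * x + \<phi>)) x = (2 * sin (\<xi> * h / 2)) ^ n * cos (\<xi> * x + \<phi>')"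
    using difference_cos by blast
  then have "\<bar>difference n h (\<lambda>x. cos (\<xi> * x + \<phi>)) x\<bar> = \<bar>2 * sin (\<xi> * h / 2)\<bar> ^ n * \<bar>cos (\<xi> * x + \<phi>')\<bar>"
    by (simp add: abs_mult power_abs)
  also have "\<dots> \<le> (\<bar>\<xi>\<bar> * \<bar>h\<bar>) ^ n * 1"
  proof (intro mult_mono power_mono)
    show "\<bar>2 * sin (\<xi> * h / 2)\<bar> \<le> \<bar>\<xi>\<bar> * \<bar>h\<bar>" using abs_sin_x_le_abs_x[of "\<xi> * h / 2"] by (simp add: abs_mult)
  qed auto
  finally show ?thesis by simp
qed

lemma avg_1_interval:
  assumes g: "continuous_on UNIV g"
  shows "avg 1 g x = integral {x..x+1} g"
proof -
  have "integral {0..1} (g \<circ> ((+) x)) = integral {0+x..1+x} g" by (rule integral_shift_Icc_real)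
  then show ?thesis by (simp add: avg_def o_def add.commute)
qed

lemma avg_1_lipschitz:
  assumes g: "continuous_on UNIV g" and B: "\<And>x. \<bar>g x\<bar> \<le> B"
  shows "\<bar>avg 1 g (x + h) - avg 1 g x\<bar> \<le> 2 * B * \<bar>h\<bar>"
proof -
  have i: "g integrable_on {a..b}" for a b
    by (intro integrable_continuous_interval continuous_on_subset[OF g]) auto
  have bd: "\<bar>integral {a..a+h} g\<bar> \<le> B * h" if "h \<ge> 0" for a h
    using integral_bound[of a "a+h" g B] that B continuous_on_subset[OF g] by auto
  have *: "\<bar>avg 1 g (x + h) - avg 1 g x\<bar> \<le> 2 * B * h" if h: "h \<ge> 0" for x h
  proof -
    have "integral {x..x+h} g + integral {x+h..x+h+1} g = integral {x..x+h+1} g"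
      "integral {x..x+1} g + integral {x+1..x+h+1} g = integral {x..x+h+1} g"
      by (intro Henstock_Kurzweil_Integration.integral_combine i; use h in simp)+
    then have "avg 1 g (x + h) - avg 1 g x = integral {x+1..x+1+h} g - integral {x..x+h} g"
      unfolding avg_1_interval[OF g] by (simp add: add_ac)
    then show ?thesis using bd[OF h, of "x+1"] bd[OF h, of x] by linarith
  qed
  show ?thesis
    using *[of h x] *[of "-h" "x + h"] by (cases "h \<ge> 0") (auto simp: abs_minus_commute)
qed

lemma difference_avg: 
  assumes g: "continuous_on UNIV g"
  shows "difference n h (avg a g) x = avg a (difference n h g) x"
proof -
  have c: "continuous_on UNIV (\<lambda>x. g (x + d))" for d by (intro continuous_on_compose2[OF g] continuous_intros) auto
  have "avg a (difference n h g) x = avg a (\<lambda>x. \<Sum>k\<le>n. diff_coef n k * g (x + real k * h)) x"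
    by (simp add: avg_def difference_expand)
  also have "\<dots> = (\<Sum>k\<le>n. diff_coef n k * avg a (\<lambda>x. g (x + real k * h)) x)"
    by (rule avg_sum[OF c]) simp
  also have "\<dots> = difference n h (avg a g) x"
    by (simp add: difference_expand avg_def add_ac)
  finally show ?thesis by simp
qed

lemma difference_continuous:
  assumes g: "continuous_on UNIV g"
  shows "continuous_on UNIV (difference n h g)"
proof -
  have "continuous_on UNIV (\<lambda>x. \<Sum>k\<le>n. diff_coef n k * g (x + real k * h))"
    by (intro continuous_intros continuous_on_compose2[OF g]) auto
  then show ?thesis by (simp add: difference_expand[symmetric])
qed

lemma iterated_avg_continuous: "continuous_on UNIV g \<Longrightarrow> continuous_on UNIV ((avg 1 ^^ i) g)"
  by (induction i) (auto intro: avg_continuous)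

lemma difference_iterated_avg_bound:
  assumes g: "continuous_on UNIV g" and b: "\<And>x. \<bar>g x\<bar> \<le> 1"
  shows "\<bar>difference i h ((avg 1 ^^ i) g) x\<bar> \<le> (2 * \<bar>h\<bar>) ^ i"
proof (induction i arbitrary: x)
  case 0 show ?case using b by (simp add: difference_def)
next
  case (Suc i)
  let ?g = "(avg 1 ^^ i) g"
  have c: "continuous_on UNIV ?g" by (rule iterated_avg_continuous[OF g])
  have "difference (Suc i) h ((avg 1 ^^ Suc i) g) x = avg 1 (difference i h ?g) (x + h) - avg 1 (difference i h ?g) x"
    unfolding difference_Suc' funpow.simps o_def difference_avg[OF c, of i] ..
  also have "\<bar>\<dots>\<bar> \<le> 2 * (2 * \<bar>h\<bar>) ^ i * \<bar>h\<bar>"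
    by (rule avg_1_lipschitz[OF difference_continuous[OF c] Suc])
  finally show ?case by (simp add: mult_ac)
qed

text \<open>Each unit average gains one order of differentiability and enlarges the region of influence to the right by one. The trapezoid is wide enough to remain \<open>1\<close> near
\<open>(0,1)\<close> after \<open>m\<close> averages.\<close>

definition trapezoid :: "nat \<Rightarrow> real \<Rightarrow> real" where
  "trapezoid m x = max 0 (min 1 (real m + 3 - \<bar>x\<bar>))"

definition cutoff :: "nat \<Rightarrow> real \<Rightarrow> real" where
  "cutoff m = (avg 1 ^^ m) (trapezoid m)"

lemma trapezoid_continuous: "continuous_on UNIV (trapezoid m)"
  unfolding trapezoid_def[abs_def] by (intro continuous_intros)

lemma iterated_avg_near:
  assumes g: "continuous_on UNIV g" and "\<And>u. 0 \<le> u \<Longrightarrow> u \<le> real i \<Longrightarrow> \<bar>g (x + u) - v\<bar> \<le> e"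
  shows "\<bar>(avg 1 ^^ i) g x - v\<bar> \<le> e"
  using assms(2)
proof (induction i arbitrary: x)
  case 0 then show ?case by simp
next
  case (Suc i)
  show ?case unfolding funpow.simps o_def
  proof (rule avg_near[OF iterated_avg_continuous[OF g]])
    fix u :: real assume u: "0 \<le> u" "u \<le> 1"
    show "\<bar>(avg 1 ^^ i) g (x + 1 * u) - v\<bar> \<le> e"
    proof (rule Suc.IH)
      fix w :: real assume "0 \<le> w" "w \<le> real i"
      then show "\<bar>g (x + 1 * u + w) - v\<bar> \<le> e" using Suc.prems[of "u + w"] u by (simp add: add.assoc)
    qed
  qed
qed

lemma cutoff_eq_1: "x \<in> {0<..<1} \<Longrightarrow> cutoff m x = 1"
  using iterated_avg_near[where g = "trapezoid m" and i = m and x = x and v = 1 and e = 0, OF trapezoid_continuous] by (auto simp: cutoff_def trapezoid_def)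

lemma cutoff_eq_0: "\<bar>x\<bar> > 2 * real m + 3 \<Longrightarrow> cutoff m x = 0"
  using iterated_avg_near[where g = "trapezoid m" and i = m and x = x and v = 0 and e = 0, OF trapezoid_continuous] by (auto simp: cutoff_def trapezoid_def)

lemma cutoff_continuous: "continuous_on UNIV (cutoff m)"
  unfolding cutoff_def by (rule iterated_avg_continuous[OF trapezoid_continuous])

lemma iterated_trapezoid_bound: "\<bar>(avg 1 ^^ i) (trapezoid m) x\<bar> \<le> 1"
  using iterated_avg_near[where g = "trapezoid m" and i = i and x = x and v = 0 and e = 1, OF trapezoid_continuous] by (auto simp: trapezoid_def)

lemma difference_cutoff_bound:
  assumes "i \<le> m" shows "\<bar>difference i h (cutoff m) x\<bar> \<le> 1 * (2 * \<bar>h\<bar>) ^ i"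
proof -
  have "cutoff m = (avg 1 ^^ i) ((avg 1 ^^ (m - i)) (trapezoid m))"
    unfolding cutoff_def using assms by (simp add: funpow_add[symmetric, unfolded o_def fun_eq_iff, rule_format])
  then show ?thesis
    using difference_iterated_avg_bound[OF iterated_avg_continuous[OF trapezoid_continuous] iterated_trapezoid_bound] by simp
qed

text \<open>The singularity of \<open>\<bar>y\<bar>\<^sup>-\<^sup>1\<^sup>-\<^sup>2\<^sup>r\<close> at \<open>0\<close> is compensated by the difference of order \<open>m > r\<close>; at infinity it is integrable since \<open>r > 0\<close>.\<close>

lemma besov_radial_integral_finite:
  assumes r: "r > 0" and m: "real m > r"
  shows "(\<integral>\<^sup>+y. ennreal (\<bar>y\<bar> powr (- 1 - 2 * r) * min 1 ((\<bar>y\<bar> ^ m)\<^sup>2)) \<partial>lborel) < \<infinity>"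
proof -
  define p where "p y = indicator {0..1} y * y powr (2 * real m - 1 - 2 * r)" for y :: real
  define q where "q y = indicator {1..} y * y powr (- 1 - 2 * r)" for y :: real
  have [measurable]: "p \<in> borel_measurable borel" "q \<in> borel_measurable borel" unfolding p_def q_def by measurable
  have "((\<lambda>y. y powr (2 * real m - 1 - 2 * r)) has_integral 1 powr (2 * real m - 1 - 2 * r + 1) / (2 * real m - 1 - 2 * r + 1)) {0..1::real}"
    using m by (intro has_integral_powr_from_0) auto
  from nn_integral_has_integral_lebesgue[OF _ this]
  have p: "(\<integral>\<^sup>+y. ennreal (p y) \<partial>lborel) < \<infinity>"
    by (simp add: p_def)
  have "(\<integral>\<^sup>+x. ennreal (x powr (- 1 - 2 * r)) * indicator {1..} x \<partial>lborel) = ennreal (0 - (1::real) powr (- 2 * r) / (- 2 * r))"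
  proof (rule nn_integral_FTC_atLeast[where F = "\<lambda>x. x powr (- 2 * r) / (- 2 * r)"])
    fix x :: real assume x: "1 \<le> x"
    have "((\<lambda>x. x powr (- 2 * r) / (- 2 * r)) has_real_derivative ((- 2 * r) * x powr (- 2 * r - 1)) / (- 2 * r)) (at x)"
      using x by (intro DERIV_cdivide has_real_derivative_powr) simp
    moreover have e: "- 2 * r - 1 = - 1 - 2 * r" by simp
    have "((- 2 * r) * x powr (- 2 * r - 1)) / (- 2 * r) = x powr (- 1 - 2 * r)" unfolding e using r by simp
    ultimately show "((\<lambda>x. x powr (- 2 * r) / (- 2 * r)) has_real_derivative x powr (- 1 - 2 * r)) (at x)"
      by metis
  next
    have "((\<lambda>x::real. x powr (- 2 * r)) \<longlongrightarrow> 0) at_top"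
      using r by (intro tendsto_neg_powr) (auto intro: filterlim_ident)
    then show "((\<lambda>x::real. x powr (- 2 * r) / (- 2 * r)) \<longlongrightarrow> 0) at_top"
      using tendsto_divide[OF _ tendsto_const, of "\<lambda>x. x powr (- 2 * r)" 0 at_top "- 2 * r"] r by simp
  qed auto
  then have q: "(\<integral>\<^sup>+y. ennreal (q y) \<partial>lborel) < \<infinity>"
    by (simp add: q_def ennreal_mult' ennreal_indicator mult.commute)
  have refl: "(\<integral>\<^sup>+y. ennreal (f (- y)) \<partial>lborel) = (\<integral>\<^sup>+y. ennreal (f y) \<partial>lborel)"
    if [measurable]: "f \<in> borel_measurable borel" for f :: "real \<Rightarrow> real"
    using nn_integral_real_affine[of "\<lambda>y. ennreal (f y)" "-1" 0] by simp
  have "(\<integral>\<^sup>+y. ennreal (\<bar>y\<bar> powr (- 1 - 2 * r) * min 1 ((\<bar>y\<bar> ^ m)\<^sup>2)) \<partial>lborel)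
     \<le> (\<integral>\<^sup>+y. ennreal (p y) + ennreal (p (- y)) + ennreal (q y) + ennreal (q (- y)) \<partial>lborel)"
  proof (intro nn_integral_mono)
    fix y :: real
    have pos: "0 \<le> p y" "0 \<le> p (- y)" "0 \<le> q y" "0 \<le> q (- y)" by (auto simp: p_def q_def)
    have small: "\<bar>y\<bar> powr (- 1 - 2 * r) * min 1 ((\<bar>y\<bar> ^ m)\<^sup>2) \<le> \<bar>y\<bar> powr (2 * real m - 1 - 2 * r)"
    proof (cases "y = 0")
      case False
      have "(\<bar>y\<bar> ^ m)\<^sup>2 = \<bar>y\<bar> powr (2 * real m)"
        using False powr_realpow[of "\<bar>y\<bar>" "m * 2"] by (simp add: power_mult[symmetric] mult.commute)
      then have "\<bar>y\<bar> powr (- 1 - 2 * r) * (\<bar>y\<bar> ^ m)\<^sup>2 = \<bar>y\<bar> powr (2 * real m - 1 - 2 * r)"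
        by (simp add: powr_add[symmetric] algebra_simps)
      moreover have "\<bar>y\<bar> powr (- 1 - 2 * r) * min 1 ((\<bar>y\<bar> ^ m)\<^sup>2) \<le> \<bar>y\<bar> powr (- 1 - 2 * r) * (\<bar>y\<bar> ^ m)\<^sup>2"
        by (intro mult_left_mono) auto
      ultimately show ?thesis by simp
    qed simp
    have big: "\<bar>y\<bar> powr (- 1 - 2 * r) * min 1 ((\<bar>y\<bar> ^ m)\<^sup>2) \<le> \<bar>y\<bar> powr (- 1 - 2 * r)"
      by (simp add: mult_left_le)
    have "\<bar>y\<bar> powr (- 1 - 2 * r) * min 1 ((\<bar>y\<bar> ^ m)\<^sup>2) \<le> p y + p (- y) + q y + q (- y)"
    proof -
      consider "0 \<le> y" "y \<le> 1" | "1 \<le> y" | "y \<le> 0" "-1 \<le> y" | "y \<le> -1" by linarith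
      then show ?thesis
      proof cases
        case 1 then have "\<bar>y\<bar> powr (2 * real m - 1 - 2 * r) = p y" by (simp add: p_def)
        then show ?thesis using small pos by linarith
      next
        case 2 then have "\<bar>y\<bar> powr (- 1 - 2 * r) = q y" by (simp add: q_def)
        then show ?thesis using big pos by linarith
      next
        case 3 then have "\<bar>y\<bar> powr (2 * real m - 1 - 2 * r) = p (- y)" by (simp add: p_def)
        then show ?thesis using small pos by linarith
      next
        case 4 then have "\<bar>y\<bar> powr (- 1 - 2 * r) = q (- y)" by (simp add: q_def)
        then show ?thesis using big pos by linarith
      qed
    qed
    then show "ennreal (\<bar>y\<bar> powr (- 1 - 2 * r) * min 1 ((\<bar>y\<bar> ^ m)\<^sup>2)) \<le> ennreal (p y) + ennreal (p (- y)) + ennreal (q y) + ennreal (q (- y))"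
      using pos by (simp add: ennreal_plus[symmetric] del: ennreal_plus)
  qed
  also have "\<dots> = (\<integral>\<^sup>+y. ennreal (p y) \<partial>lborel) + (\<integral>\<^sup>+y. ennreal (p y) \<partial>lborel) + (\<integral>\<^sup>+y. ennreal (q y) \<partial>lborel) + (\<integral>\<^sup>+y. ennreal (q y) \<partial>lborel)"
    by (simp add: nn_integral_add refl)
  also have "\<dots> < \<infinity>" using p q by simp
  finally show ?thesis .
qed

text \<open>The difference of order \<open>m\<close> of the localised wave is bounded by a constant and by a multiple of \<open>((1 + \<bar>\<xi>\<bar>)\<bar>h\<bar>)\<^sup>m\<close>, on a set of finite measure. Scaling
\<open>h\<close> by \<open>1 + \<bar>\<xi>\<bar>\<close> in the radial integral produces the factor \<open>(1 + \<bar>\<xi>\<bar>)\<^sup>2\<^sup>r\<close>.\<close>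

lemma besov_norm_localized_cos:
  assumes r: "r > 1/2"
  shows "\<exists>K\<ge>0. \<forall>\<xi> \<phi>. (\<lambda>x. cutoff (nat \<lfloor>r\<rfloor> + 1) x * cos (\<xi> * x + \<phi>)) \<in> besov_R r \<and>
     (besov_R_norm r (\<lambda>x. cutoff (nat \<lfloor>r\<rfloor> + 1) x * cos (\<xi> * x + \<phi>)))\<^sup>2 \<le> K * (1 + \<xi>\<^sup>2) powr r"
proof -
  define m where "m = nat \<lfloor>r\<rfloor> + 1"
  have m: "real m > r" using r unfolding m_def by linarith
  define L where "L = 2 * real m + 3"
  have L0: "L > 0" unfolding L_def by simp
  define c2 where "c2 = (\<Sum>k\<le>m. (diff_coef m k)\<^sup>2)"
  have c2: "0 \<le> c2" unfolding c2_def by (intro sum_nonneg) simp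
  define K1 where "K1 = c2 * (real m + 1) * (2 * L) + 2 * (L + real m) * (2 ^ m)\<^sup>2"
  have K1: "0 \<le> K1" unfolding K1_def using c2 L0 by simp
  define J where "J = enn2real (\<integral>\<^sup>+y. ennreal (\<bar>y\<bar> powr (- 1 - 2 * r) * min 1 ((\<bar>y\<bar> ^ m)\<^sup>2)) \<partial>lborel)"
  have J: "(\<integral>\<^sup>+y. ennreal (\<bar>y\<bar> powr (- 1 - 2 * r) * min 1 ((\<bar>y\<bar> ^ m)\<^sup>2)) \<partial>lborel) = ennreal J" "0 \<le> J"
    using besov_radial_integral_finite[of r m] r m unfolding J_def by (simp_all add: less_top[symmetric])
  define K where "K = (2 * L + K1 * J) * 2 powr r"
  have K0: "0 \<le> K" unfolding K_def using L0 K1 J by simp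
  have "(\<lambda>x. cutoff m x * cos (\<xi> * x + \<phi>)) \<in> besov_R r \<and>
     (besov_R_norm r (\<lambda>x. cutoff m x * cos (\<xi> * x + \<phi>)))\<^sup>2 \<le> K * (1 + \<xi>\<^sup>2) powr r" for \<xi> \<phi>
  proof -
    define f where "f x = cutoff m x * cos (\<xi> * x + \<phi>)" for x
    define \<Theta> where "\<Theta> = 1 + \<bar>\<xi>\<bar>"
    have \<Theta>: "\<Theta> \<ge> 1" unfolding \<Theta>_def by simp
    have fc: "continuous_on UNIV f" unfolding f_def by (intro continuous_intros cutoff_continuous)
    have [measurable]: "f \<in> borel_measurable borel" by (rule borel_measurable_continuous_onI[OF fc])
    have c1: "\<bar>cutoff m x\<bar> \<le> 1" for x unfolding cutoff_def by (rule iterated_trapezoid_bound)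
    have fb: "\<bar>f x\<bar> \<le> 1" for x unfolding f_def abs_mult using c1[of x] by (simp add: mult_le_one)
    have f0: "f x = 0" if "\<bar>x\<bar> > L" for x using cutoff_eq_0[of m x] that by (simp add: f_def L_def)
    have f2: "(\<integral>\<^sup>+x. ennreal ((f (x + a))\<^sup>2) \<partial>lborel) \<le> ennreal (2 * L)" for a
    proof -
      have "(\<integral>\<^sup>+x. ennreal ((f (x + a))\<^sup>2) \<partial>lborel) \<le> (\<integral>\<^sup>+x. indicator {-L - a..L - a} x \<partial>lborel)"
      proof (intro nn_integral_mono)
        fix x
        have "(f (x + a))\<^sup>2 \<le> 1" using fb by (simp add: abs_square_le_1)
        moreover have "f (x + a) = 0" if "x \<notin> {-L - a..L - a}" using that by (intro f0) (auto simp: abs_if)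
        ultimately show "ennreal ((f (x + a))\<^sup>2) \<le> indicator {-L - a..L - a} x" by (auto simp: indicator_def)
      qed
      also have "\<dots> = ennreal (2 * L)" using L0 by simp
      finally show ?thesis .
    qed
    define D where "D h = (\<integral>\<^sup>+x. ennreal ((difference m h f x)\<^sup>2) \<partial>lborel)" for h
    have D1: "D h \<le> ennreal (c2 * (real m + 1) * (2 * L))" for h
    proof -
      have "D h \<le> (\<integral>\<^sup>+x. (\<Sum>k\<le>m. ennreal c2 * ennreal ((f (x + real k * h))\<^sup>2)) \<partial>lborel)"
        unfolding D_def
      proof (intro nn_integral_mono)
        fix x
        have "(difference m h f x)\<^sup>2 \<le> c2 * (\<Sum>k\<le>m. (f (x + real k * h))\<^sup>2)"
          unfolding difference_expand c2_def by (rule Cauchy_Schwarz_ineq_sum)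
        then have "ennreal ((difference m h f x)\<^sup>2) \<le> ennreal (\<Sum>k\<le>m. c2 * (f (x + real k * h))\<^sup>2)"
          by (intro ennreal_leI) (simp add: sum_distrib_left)
        also have "\<dots> = (\<Sum>k\<le>m. ennreal c2 * ennreal ((f (x + real k * h))\<^sup>2))"
          using c2 by (subst sum_ennreal[symmetric]) (auto simp: ennreal_mult)
        finally show "ennreal ((difference m h f x)\<^sup>2) \<le> (\<Sum>k\<le>m. ennreal c2 * ennreal ((f (x + real k * h))\<^sup>2))" .
      qed
      also have "\<dots> = (\<Sum>k\<le>m. ennreal c2 * (\<integral>\<^sup>+x. ennreal ((f (x + real k * h))\<^sup>2) \<partial>lborel))"
        by (simp add: nn_integral_sum nn_integral_cmult)
      also have "\<dots> \<le> (\<Sum>k\<le>m. ennreal c2 * ennreal (2 * L))"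
        by (intro sum_mono mult_left_mono f2) simp
      also have "\<dots> = ennreal (c2 * (real m + 1) * (2 * L))"
      proof -
        have "(\<Sum>k\<le>m. ennreal c2 * ennreal (2 * L)) = (\<Sum>k\<le>m. ennreal (c2 * (2 * L)))"
          using c2 L0 by (simp add: ennreal_mult)
        also have "\<dots> = ennreal (\<Sum>k\<le>m. c2 * (2 * L))" using c2 L0 by (subst sum_ennreal) auto
        also have "(\<Sum>k\<le>m. c2 * (2 * L)) = c2 * (real m + 1) * (2 * L)" by (simp add: algebra_simps)
        finally show ?thesis .
      qed
      finally show ?thesis .
    qed
    have D2: "D h \<le> ennreal (2 * (L + real m) * (2 ^ m)\<^sup>2 * ((\<Theta> * \<bar>h\<bar>) ^ m)\<^sup>2)" if h: "\<bar>h\<bar> \<le> 1" for h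
    proof -
      have "D h \<le> (\<integral>\<^sup>+x. ennreal ((2 ^ m)\<^sup>2 * ((\<Theta> * \<bar>h\<bar>) ^ m)\<^sup>2) * indicator {-(L + real m)..L + real m} x \<partial>lborel)"
        unfolding D_def
      proof (intro nn_integral_mono)
        fix x
        have "\<bar>difference m h f x\<bar> \<le> 1 * 1 * (2 * \<bar>h\<bar> + \<bar>\<xi>\<bar> * \<bar>h\<bar>) ^ m"
          unfolding f_def by (rule difference_leibniz_bound[OF difference_cutoff_bound difference_cos_bound]) auto
        also have "\<dots> \<le> (2 * (\<Theta> * \<bar>h\<bar>)) ^ m"
        proof -
          have "2 * \<bar>h\<bar> + \<bar>\<xi>\<bar> * \<bar>h\<bar> \<le> 2 * (\<Theta> * \<bar>h\<bar>)" unfolding \<Theta>_def by (simp add: algebra_simps)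
          then have "(2 * \<bar>h\<bar> + \<bar>\<xi>\<bar> * \<bar>h\<bar>) ^ m \<le> (2 * (\<Theta> * \<bar>h\<bar>)) ^ m" by (intro power_mono) simp_all
          then show ?thesis by simp
        qed
        finally have "\<bar>difference m h f x\<bar> \<le> 2 ^ m * (\<Theta> * \<bar>h\<bar>) ^ m" by (simp add: power_mult_distrib)
        then have "\<bar>difference m h f x\<bar>\<^sup>2 \<le> (2 ^ m * (\<Theta> * \<bar>h\<bar>) ^ m)\<^sup>2" by (rule power_mono) simp
        then have b: "(difference m h f x)\<^sup>2 \<le> (2 ^ m)\<^sup>2 * ((\<Theta> * \<bar>h\<bar>) ^ m)\<^sup>2"
          by (simp add: power_mult_distrib)
        have "difference m h f x = 0" if x: "x \<notin> {-(L + real m)..L + real m}"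
        proof -
          have "f (x + real k * h) = 0" if k: "k \<le> m" for k
          proof (rule f0)
            have "\<bar>real k * h\<bar> \<le> real m * 1" unfolding abs_mult using k h by (intro mult_mono) auto
            moreover have "\<bar>x\<bar> > L + real m" using x by (auto simp: abs_if)
            ultimately show "\<bar>x + real k * h\<bar> > L" by linarith
          qed
          then show ?thesis by (simp add: difference_expand)
        qed
        then show "ennreal ((difference m h f x)\<^sup>2) \<le> ennreal ((2 ^ m)\<^sup>2 * ((\<Theta> * \<bar>h\<bar>) ^ m)\<^sup>2) * indicator {-(L + real m)..L + real m} x"
          using b by (auto simp: indicator_def intro: ennreal_leI)
      qed
      also have "\<dots> = ennreal ((2 ^ m)\<^sup>2 * ((\<Theta> * \<bar>h\<bar>) ^ m)\<^sup>2) * ennreal (2 * (L + real m))"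
        using L0 by (simp add: nn_integral_cmult)
      also have "\<dots> = ennreal (2 * (L + real m) * (2 ^ m)\<^sup>2 * ((\<Theta> * \<bar>h\<bar>) ^ m)\<^sup>2)"
        using L0 by (subst ennreal_mult[symmetric]) (auto simp: mult_ac)
      finally show ?thesis .
    qed
    have D: "D h \<le> ennreal (K1 * min 1 (((\<Theta> * \<bar>h\<bar>) ^ m)\<^sup>2))" for h
    proof (cases "((\<Theta> * \<bar>h\<bar>) ^ m)\<^sup>2 \<le> 1 \<and> \<bar>h\<bar> \<le> 1")
      case True
      have "D h \<le> ennreal (2 * (L + real m) * (2 ^ m)\<^sup>2 * ((\<Theta> * \<bar>h\<bar>) ^ m)\<^sup>2)" using D2 True by blast
      also have "\<dots> \<le> ennreal (K1 * ((\<Theta> * \<bar>h\<bar>) ^ m)\<^sup>2)"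
        unfolding K1_def using c2 L0 by (intro ennreal_leI mult_right_mono) auto
      finally show ?thesis using True by (simp add: min_absorb2)
    next
      case False
      have "1 \<le> ((\<Theta> * \<bar>h\<bar>) ^ m)\<^sup>2"
      proof (cases "\<bar>h\<bar> \<le> 1")
        case False
        then have "1 \<le> \<Theta> * \<bar>h\<bar>" using \<Theta> mult_mono[of 1 \<Theta> 1 "\<bar>h\<bar>"] by simp
        then show ?thesis by (simp add: one_le_power)
      qed (use False in simp)
      then have "K1 * min 1 (((\<Theta> * \<bar>h\<bar>) ^ m)\<^sup>2) = K1" by (simp add: min_absorb1)
      moreover have "D h \<le> ennreal K1"
        by (rule order_trans[OF D1 ennreal_leI]) (use L0 in \<open>simp add: K1_def\<close>)
      ultimately show ?thesis by (simp only:)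
    qed
    have "(\<integral>\<^sup>+h. ennreal (\<bar>h\<bar> powr (- 1 - 2 * r)) * D h \<partial>lborel) \<le> (\<integral>\<^sup>+h. ennreal K1 * ennreal (\<bar>h\<bar> powr (- 1 - 2 * r) * min 1 (((\<Theta> * \<bar>h\<bar>) ^ m)\<^sup>2)) \<partial>lborel)"
    proof (intro nn_integral_mono)
      fix h
      have "ennreal (\<bar>h\<bar> powr (- 1 - 2 * r)) * D h \<le> ennreal (\<bar>h\<bar> powr (- 1 - 2 * r)) * ennreal (K1 * min 1 (((\<Theta> * \<bar>h\<bar>) ^ m)\<^sup>2))"
        by (intro mult_left_mono D) simp
      then show "ennreal (\<bar>h\<bar> powr (- 1 - 2 * r)) * D h \<le> ennreal K1 * ennreal (\<bar>h\<bar> powr (- 1 - 2 * r) * min 1 (((\<Theta> * \<bar>h\<bar>) ^ m)\<^sup>2))"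
        using K1 by (simp add: ennreal_mult[symmetric] mult.left_commute)
    qed
    also have "\<dots> = ennreal K1 * (\<integral>\<^sup>+h. ennreal (\<bar>h\<bar> powr (- 1 - 2 * r) * min 1 (((\<Theta> * \<bar>h\<bar>) ^ m)\<^sup>2)) \<partial>lborel)"
      by (rule nn_integral_cmult) measurable
    also have "(\<integral>\<^sup>+h. ennreal (\<bar>h\<bar> powr (- 1 - 2 * r) * min 1 (((\<Theta> * \<bar>h\<bar>) ^ m)\<^sup>2)) \<partial>lborel) = ennreal (\<Theta> powr (2 * r)) * ennreal J"
    proof -
      have "(\<integral>\<^sup>+h. ennreal (\<bar>h\<bar> powr (- 1 - 2 * r) * min 1 (((\<Theta> * \<bar>h\<bar>) ^ m)\<^sup>2)) \<partial>lborel)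
        = ennreal \<bar>1 / \<Theta>\<bar> * (\<integral>\<^sup>+y. ennreal (\<bar>0 + 1 / \<Theta> * y\<bar> powr (- 1 - 2 * r) * min 1 (((\<Theta> * \<bar>0 + 1 / \<Theta> * y\<bar>) ^ m)\<^sup>2)) \<partial>lborel)"
        using \<Theta> by (intro nn_integral_real_affine) auto
      also have "\<dots> = ennreal \<bar>1 / \<Theta>\<bar> * (\<integral>\<^sup>+y. ennreal (\<Theta> powr (1 + 2 * r)) * ennreal (\<bar>y\<bar> powr (- 1 - 2 * r) * min 1 ((\<bar>y\<bar> ^ m)\<^sup>2)) \<partial>lborel)"
      proof (intro arg_cong2[where f = "(*)"] refl nn_integral_cong)
        fix y :: real
        have e1: "\<bar>0 + 1 / \<Theta> * y\<bar> = \<bar>y\<bar> / \<Theta>" using \<Theta> by (simp add: abs_mult)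
        have e2: "(\<bar>y\<bar> / \<Theta>) powr (- 1 - 2 * r) = \<Theta> powr (1 + 2 * r) * \<bar>y\<bar> powr (- 1 - 2 * r)"
        proof -
          have "\<Theta> powr (- 1 - 2 * r) = inverse (\<Theta> powr (1 + 2 * r))" by (simp add: powr_minus[symmetric])
          moreover have "(\<bar>y\<bar> / \<Theta>) powr (- 1 - 2 * r) = \<bar>y\<bar> powr (- 1 - 2 * r) / \<Theta> powr (- 1 - 2 * r)"
            using \<Theta> by (simp add: powr_divide)
          ultimately show ?thesis by (simp only: divide_inverse inverse_inverse_eq mult.commute)
        qed
        have e3: "\<Theta> * (\<bar>y\<bar> / \<Theta>) = \<bar>y\<bar>" using \<Theta> by simp
        show "ennreal (\<bar>0 + 1 / \<Theta> * y\<bar> powr (- 1 - 2 * r) * min 1 (((\<Theta> * \<bar>0 + 1 / \<Theta> * y\<bar>) ^ m)\<^sup>2)) = ennreal (\<Theta> powr (1 + 2 * r)) * ennreal (\<bar>y\<bar> powr (- 1 - 2 * r) * min 1 ((\<bar>y\<bar> ^ m)\<^sup>2))"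
          unfolding e1 e2 e3 by (simp add: ennreal_mult[symmetric] mult.assoc)
      qed
      also have "\<dots> = ennreal \<bar>1 / \<Theta>\<bar> * (ennreal (\<Theta> powr (1 + 2 * r)) * ennreal J)"
        by (subst nn_integral_cmult) (auto simp: J(1))
      also have "\<dots> = ennreal (\<Theta> powr (2 * r)) * ennreal J"
      proof -
        have "\<bar>1 / \<Theta>\<bar> * \<Theta> powr (1 + 2 * r) = \<Theta> powr (2 * r)" using \<Theta> by (simp add: powr_add)
        then show ?thesis by (simp add: mult.assoc[symmetric] ennreal_mult[symmetric])
      qed
      finally show ?thesis .
    qed
    finally have E2: "(\<integral>\<^sup>+h. ennreal (\<bar>h\<bar> powr (- 1 - 2 * r)) * D h \<partial>lborel) \<le> ennreal (K1 * (\<Theta> powr (2 * r) * J))"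
      using K1 J(2) by (simp add: ennreal_mult)
    have "besov_energy r f \<le> ennreal (2 * L) + ennreal (K1 * (\<Theta> powr (2 * r) * J))"
      unfolding besov_energy_def using f2[of 0] E2 by (intro add_mono) (simp_all add: D_def m_def)
    also have "\<dots> \<le> ennreal ((2 * L + K1 * J) * \<Theta> powr (2 * r))"
    proof -
      have "1 \<le> \<Theta> powr (2 * r)" using \<Theta> r by (intro ge_one_powr_ge_zero) auto
      then have "2 * L * 1 \<le> 2 * L * \<Theta> powr (2 * r)" using L0 by (intro mult_left_mono) auto
      then have le: "2 * L + K1 * (\<Theta> powr (2 * r) * J) \<le> (2 * L + K1 * J) * \<Theta> powr (2 * r)" by (simp add: algebra_simps)
      have "ennreal (2 * L) + ennreal (K1 * (\<Theta> powr (2 * r) * J)) = ennreal (2 * L + K1 * (\<Theta> powr (2 * r) * J))"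
        by (rule ennreal_plus[symmetric]) (use L0 K1 J(2) in auto)
      then show ?thesis using ennreal_leI[OF le] by (simp only:)
    qed
    also have "\<dots> \<le> ennreal (K * (1 + \<xi>\<^sup>2) powr r)"
    proof (rule ennreal_leI)
      have "0 \<le> (1 - \<bar>\<xi>\<bar>)\<^sup>2" by simp
      then have "\<Theta>\<^sup>2 \<le> 2 * (1 + \<xi>\<^sup>2)" unfolding \<Theta>_def by (simp add: power2_sum power2_diff)
      then have "(\<Theta>\<^sup>2) powr r \<le> (2 * (1 + \<xi>\<^sup>2)) powr r" using r \<Theta> by (intro powr_mono2) auto
      also have "(2 * (1 + \<xi>\<^sup>2)) powr r = 2 powr r * (1 + \<xi>\<^sup>2) powr r" by (subst powr_mult) simp_all
      also have "(\<Theta>\<^sup>2) powr r = \<Theta> powr (2 * r)"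
      proof -
        have "\<Theta>\<^sup>2 = \<Theta> powr 2" using \<Theta> by simp
        then show ?thesis by (simp only: powr_powr)
      qed
      finally show "(2 * L + K1 * J) * \<Theta> powr (2 * r) \<le> K * (1 + \<xi>\<^sup>2) powr r"
        unfolding K_def mult.assoc using L0 K1 J(2) by (intro mult_left_mono) auto
    qed
    finally have E: "besov_energy r f \<le> ennreal (K * (1 + \<xi>\<^sup>2) powr r)" .
    have "besov_energy r f < \<infinity>" by (rule le_less_trans[OF E]) simp
    moreover have "bounded (range f)" using fb by (auto simp: bounded_iff)
    moreover have "(besov_R_norm r f)\<^sup>2 \<le> K * (1 + \<xi>\<^sup>2) powr r"
      unfolding besov_R_norm_sq using enn2real_mono[OF E] K0 by simp
    ultimately show ?thesis using fc unfolding f_def[abs_def] by (simp add: besov_R_def)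
  qed
  then show ?thesis using K0 unfolding m_def by blast
qed

text \<open>On \<open>(0,1)\<close> the cutoff is invisible, so the localised waves are extensions of the waves.\<close>

lemma besov_01_cos:
  assumes r: "r > 1/2"
  shows "\<exists>K\<ge>0. \<forall>\<xi> \<phi>. zero_ext unit_interval (\<lambda>x. cos (\<xi> * x + \<phi>)) \<in> fns (besov_01 r) \<and>
     (fnorm (besov_01 r) (zero_ext unit_interval (\<lambda>x. cos (\<xi> * x + \<phi>))))\<^sup>2 \<le> K * (1 + \<xi>\<^sup>2) powr r"
proof -
  let ?m = "nat \<lfloor>r\<rfloor> + 1"
  obtain K where K: "K \<ge> 0" "\<And>\<xi> \<phi>. (\<lambda>x. cutoff ?m x * cos (\<xi> * x + \<phi>)) \<in> besov_R r"
    "\<And>\<xi> \<phi>. (besov_R_norm r (\<lambda>x. cutoff ?m x * cos (\<xi> * x + \<phi>)))\<^sup>2 \<le> K * (1 + \<xi>\<^sup>2) powr r"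
    using besov_norm_localized_cos[OF r] by blast
  interpret G: function_rkhs unit_interval "besov_01 r" by (rule function_rkhs.intro[OF besov_01_rkhs(1)[OF r]])
  have "zero_ext unit_interval (\<lambda>x. cos (\<xi> * x + \<phi>)) \<in> fns (besov_01 r) \<and>
     (fnorm (besov_01 r) (zero_ext unit_interval (\<lambda>x. cos (\<xi> * x + \<phi>))))\<^sup>2 \<le> K * (1 + \<xi>\<^sup>2) powr r" for \<xi> \<phi>
  proof -
    have eq: "zero_ext unit_interval (\<lambda>x. cutoff ?m x * cos (\<xi> * x + \<phi>)) = zero_ext unit_interval (\<lambda>x. cos (\<xi> * x + \<phi>))"
      using cutoff_eq_1 by (auto simp: zero_ext_def)
    note b = besov_01_rkhs(3)[OF r K(2)[of \<xi> \<phi>], unfolded eq]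
    then have "(fnorm (besov_01 r) (zero_ext unit_interval (\<lambda>x. cos (\<xi> * x + \<phi>))))\<^sup>2 \<le> (besov_R_norm r (\<lambda>x. cutoff ?m x * cos (\<xi> * x + \<phi>)))\<^sup>2"
      using G.fnorm_nonneg by (intro power_mono) auto
    then show ?thesis using b K(3)[of \<xi> \<phi>] by auto
  qed
  then show ?thesis using K(1) by blast
qed


section \<open>The Hilbert--Schmidt property for smooth kernels\<close>

abbreviation kernel_section :: "'a set \<Rightarrow> ('a \<Rightarrow> 'a \<Rightarrow> real) \<Rightarrow> 'a \<Rightarrow> 'a \<Rightarrow> real" where
  "kernel_section T k x \<equiv> zero_ext T (k x)"

lemma rkhs_of_kernelD:
  assumes "rkhs_of_kernel T k H"
  shows "function_rkhs T H" "t \<in> T \<Longrightarrow> kernel_section T k t \<in> fns H"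
    "t \<in> T \<Longrightarrow> f \<in> fns H \<Longrightarrow> ip H f (kernel_section T k t) = f t"
  using assms by (auto simp: rkhs_of_kernel_def intro: function_rkhs.intro)

lemma ip_kernel_combination:
  assumes k: "rkhs_of_kernel T k H" and A: "A \<subseteq> T" and f: "f \<in> fns H"
  shows "ip H f (\<lambda>y. \<Sum>x\<in>A. c x * kernel_section T k x y) = (\<Sum>x\<in>A. c x * f x)"
proof -
  interpret function_rkhs T H by (rule rkhs_of_kernelD(1)[OF k])
  have kin: "x \<in> A \<Longrightarrow> kernel_section T k x \<in> fns H" for x using rkhs_of_kernelD(2)[OF k] A by blast
  have "ip H f (\<lambda>y. \<Sum>x\<in>A. c x * kernel_section T k x y) = ip H (\<lambda>y. \<Sum>x\<in>A. c x * kernel_section T k x y) f"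
    by (rule ip_sym[OF f sum_in[OF kin]])
  also have "\<dots> = (\<Sum>x\<in>A. c x * ip H (kernel_section T k x) f)" by (rule ip_sum[OF kin f])
  also have "\<dots> = (\<Sum>x\<in>A. c x * f x)"
  proof (intro sum.cong refl)
    fix x assume x: "x \<in> A"
    then show "c x * ip H (kernel_section T k x) f = c x * f x"
      using ip_sym[OF kin[OF x] f] rkhs_of_kernelD(3)[OF k _ f, of x] A by auto
  qed
  finally show ?thesis .
qed

text \<open>Combinations of kernel sections are the functionals \<open>f \<mapsto> \<Sum>x\<in>A. c x * f x\<close>. Those whose trigonometric weight has integral at most one are bounded on each
element of \<open>H\<^sub>0 = H\<^sup>s(0,1)\<close>, hence uniformly bounded. In this way the equality of sets replaces an equivalence of norms.\<close>

lemma sobolev_kernel_domination: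
  assumes s: "s > 1/2" and k: "rkhs_of_kernel unit_interval k0 H0" and H0: "fns H0 = sobolev_01 s"
  shows "\<exists>C\<ge>0. \<forall>A c. finite A \<longrightarrow> A \<subseteq> unit_interval \<longrightarrow>
     fnorm H0 (\<lambda>y. \<Sum>x\<in>A. c x * kernel_section unit_interval k0 x y)
       \<le> C * sqrt (\<integral>\<xi>. trig_weight s A c \<xi> \<partial>lborel)"
proof -
  interpret H: function_rkhs unit_interval H0 by (rule rkhs_of_kernelD(1)[OF k])
  let ?h = "\<lambda>A c y. \<Sum>x\<in>A. c x * kernel_section unit_interval k0 x y"
  let ?W = "\<lambda>A c. \<integral>\<xi>. trig_weight s A c \<xi> \<partial>lborel"
  have W0: "0 \<le> ?W A c" for A c by (simp add: trig_weight_nonneg)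
  have hin: "?h A c \<in> fns H0" if "A \<subseteq> unit_interval" for A c
    by (intro H.sum_in rkhs_of_kernelD(2)[OF k]) (use that in auto)
  define L where "L = {?h A c | A c. finite A \<and> A \<subseteq> unit_interval \<and> ?W A c \<le> 1}"
  have "\<exists>C. \<forall>h\<in>L. fnorm H0 h \<le> C"
  proof (rule H.uniform_boundedness)
    show "L \<subseteq> fns H0" unfolding L_def using hin by blast
    fix f assume f: "f \<in> fns H0"
    then obtain F where F: "F \<in> sobolev_R s" "f = zero_ext unit_interval F"
      unfolding H0 sobolev_01_def by blast
    obtain C where C: "\<And>A c. finite A \<Longrightarrow> \<bar>\<Sum>x\<in>A. c x * F x\<bar> \<le> C * sqrt (?W A c)"
      using sobolev_functional_bound[OF s F(1)] by blast
    have "\<bar>ip H0 f (?h A c)\<bar> \<le> max C 0" if A: "finite A" "A \<subseteq> unit_interval" "?W A c \<le> 1" for A c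
    proof -
      have "ip H0 f (?h A c) = (\<Sum>x\<in>A. c x * F x)"
        unfolding ip_kernel_combination[OF k A(2) f]
        by (intro sum.cong refl) (use A(2) in \<open>auto simp: F(2) zero_ext_def\<close>)
      also have "\<bar>\<dots>\<bar> \<le> C * sqrt (?W A c)" by (rule C[OF A(1)])
      also have "\<dots> \<le> max C 0 * sqrt (?W A c)" using W0 by (intro mult_right_mono) auto
      also have "\<dots> \<le> max C 0 * 1" using A(3) by (intro mult_left_mono) auto
      finally show ?thesis by simp
    qed
    then show "\<exists>C. \<forall>h\<in>L. \<bar>ip H0 f h\<bar> \<le> C" unfolding L_def by blast
  qed
  then obtain C where CL: "\<forall>h\<in>L. fnorm H0 h \<le> C" by (rule exE)
  have C: "fnorm H0 (?h A c) \<le> C" if "finite A" "A \<subseteq> unit_interval" "?W A c \<le> 1" for A c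
    by (rule bspec[OF CL]) (unfold L_def, use that in blast)
  have C0: "0 \<le> C"
    using C[of "{}" "\<lambda>x. 0"] H.fnorm_nonneg[OF H.zero_in] by (simp add: trig_weight_def)
  have scale: "?W A (\<lambda>x. a * c x) = a\<^sup>2 * ?W A c" for a A c
  proof -
    have "trig_weight s A (\<lambda>x. a * c x) \<xi> = a\<^sup>2 * trig_weight s A c \<xi>" for \<xi>
      by (simp add: trig_weight_def mult.assoc sum_distrib_left[symmetric] power_mult_distrib ring_distribs)
    then show ?thesis by simp
  qed
  have hscale: "fnorm H0 (?h A (\<lambda>x. a * c x)) = \<bar>a\<bar> * fnorm H0 (?h A c)" if "A \<subseteq> unit_interval" for a A c
    using H.fnorm_scale[OF hin[OF that], of a c] by (simp add: sum_distrib_left mult.assoc)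
  have "fnorm H0 (?h A c) \<le> C * sqrt (?W A c)" if A: "finite A" "A \<subseteq> unit_interval" for A c
  proof (cases "?W A c = 0")
    case True
    have "fnorm H0 (?h A c) = 0"
    proof (rule ccontr)
      assume "fnorm H0 (?h A c) \<noteq> 0"
      then have p: "fnorm H0 (?h A c) > 0" using H.fnorm_nonneg[OF hin[OF A(2)], of c] by simp
      obtain n where n: "real n * fnorm H0 (?h A c) > C" using reals_Archimedean3[OF p] by blast
      have "?W A (\<lambda>x. real n * c x) \<le> 1" unfolding scale True by simp
      from C[OF A this] show False using n hscale[OF A(2), of "real n" c] by simp
    qed
    then show ?thesis using C0 W0 by simp
  next
    case False
    then have W: "?W A c > 0" using W0[of A c] by simp
    let ?a = "1 / sqrt (?W A c)"
    have "?W A (\<lambda>x. ?a * c x) \<le> 1" unfolding scale using W by (simp add: power_divide)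
    from C[OF A this] have "?a * fnorm H0 (?h A c) \<le> C" using hscale[OF A(2), of ?a c] W by simp
    then show ?thesis using W by (simp add: field_simps)
  qed
  then show ?thesis using C0 by blast
qed

lemma besov_01_continuous:
  "f \<in> fns (besov_01 r) \<Longrightarrow> continuous_on unit_interval f"
proof -
  assume "f \<in> fns (besov_01 r)"
  then obtain F where F: "F \<in> besov_R r" "f = zero_ext unit_interval F" by (auto simp: besov_01_def)
  have "continuous_on unit_interval F" using F(1) by (auto simp: besov_R_def intro: continuous_on_subset)
  then show ?thesis by (rule continuous_on_eq) (simp add: F(2) zero_ext_def)
qed

lemma trig_weight_besov:
  assumes \<kappa>: "rkhs_of_kernel unit_interval \<kappa> (besov_01 r)" and A: "A \<subseteq> unit_interval"
    and u: "u = (\<lambda>y. \<Sum>x\<in>A. c x * kernel_section unit_interval \<kappa> x y)"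
    and dict: "\<And>\<phi>. zero_ext unit_interval (\<lambda>x. cos (\<xi> * x + \<phi>)) \<in> fns (besov_01 r)"
  shows "trig_weight s A c \<xi> = ((ip (besov_01 r) (zero_ext unit_interval (\<lambda>x. cos (\<xi> * x + 0))) u)\<^sup>2
     + (ip (besov_01 r) (zero_ext unit_interval (\<lambda>x. cos (\<xi> * x + - pi/2))) u)\<^sup>2) * (1 + \<xi>\<^sup>2) powr (- s)"
proof -
  have e: "ip (besov_01 r) (zero_ext unit_interval (\<lambda>x. cos (\<xi> * x + \<phi>))) u = (\<Sum>x\<in>A. c x * cos (\<xi> * x + \<phi>))" for \<phi>
    unfolding u ip_kernel_combination[OF \<kappa> A dict]
    by (intro sum.cong refl) (use A in \<open>auto simp: zero_ext_def\<close>)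
  have sn: "cos (\<xi> * x + - pi / 2) = sin (\<xi> * x)" for x by (simp add: cos_diff)
  show ?thesis unfolding e unfolding sn trig_weight_def by simp
qed

lemma weighted_dictionary_integrable:
  "r < s - 1/2 \<Longrightarrow> integrable lborel (\<lambda>\<xi>::real. K * (1 + \<xi>\<^sup>2) powr r * (1 + \<xi>\<^sup>2) powr (- s))"
proof -
  assume "r < s - 1/2"
  then have "integrable lborel (\<lambda>\<xi>::real. K * (1 + \<xi>\<^sup>2) powr (- (s - r)))"
    by (intro integrable_mult_right integrable_bessel_weight) simp
  moreover have "(1 + \<xi>\<^sup>2) powr r * (1 + \<xi>\<^sup>2) powr (- s) = (1 + \<xi>\<^sup>2) powr (- (s - r))" for \<xi> :: real
    by (simp add: powr_add[symmetric])
  ultimately show ?thesis by (simp add: mult.assoc)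
qed

text \<open>The basis \<open>g\<close> comes from Gram--Schmidt applied to the sections of the Besov kernel at the rationals \<open>q i\<close>, and \<open>b n\<close> are the weights at the points
\<open>A (Suc n)\<close> that represent \<open>\<langle>\<cdot>, g n\<rangle>\<close> by point evaluations; the orthonormality of \<open>g\<close> is the biorthogonality of \<open>b\<close> and \<open>g\<close>. The same weights with
sections of \<open>k0\<close> have square summable norms: by the preceding domination the sum is at most the integral over \<open>\<xi>\<close> of
\<open>(1 + \<xi>\<^sup>2)\<^sup>-\<^sup>s \<Sum>n \<langle>e\<^sub>\<xi>, g n\<rangle>\<^sup>2\<close> for waves \<open>e\<^sub>\<xi>\<close>, and Bessel's inequality bounds the inner sum by \<open>\<parallel>e\<^sub>\<xi>\<parallel>\<^sup>2\<close>, which is of order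
\<open>(1 + \<xi>\<^sup>2)\<^sup>r\<close>. The last clause says that the expansion of a section of \<open>k0\<close> converges in \<open>H\<^sub>0\<close>; it follows from Parseval's identity in the Besov space.\<close>

theorem hilbert_schmidt_system:
  assumes s: "s > 1/2" and r: "r > 1/2" "r < s - 1/2"
    and k0: "rkhs_of_kernel unit_interval k0 H0" and H0: "fns H0 = sobolev_01 s"
  shows "\<exists>\<kappa> A b g V B. rkhs_of_kernel unit_interval \<kappa> (besov_01 r) \<and>
    (\<forall>n. finite (A n) \<and> A n \<subseteq> unit_interval) \<and> (\<forall>m n. m \<le> n \<longrightarrow> A m \<subseteq> A n) \<and>
    (\<forall>n x. x \<notin> A (Suc n) \<longrightarrow> b n x = 0) \<and>
    (\<forall>m n. (\<Sum>x\<in>A (Suc n). b n x * g m x) = (if m = n \<and> g n \<noteq> (\<lambda>t. 0) then 1 else 0)) \<and>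
    (\<forall>n. g n \<in> fns (besov_01 r)) \<and>
    (\<forall>N t. t \<in> unit_interval \<longrightarrow> (\<Sum>n<N. (g n t)\<^sup>2) \<le> B) \<and>
    (\<forall>t t'. t \<in> unit_interval \<longrightarrow> t' \<in> unit_interval \<longrightarrow> (\<lambda>n. g n t * g n t') sums \<kappa> t t') \<and>
    (\<forall>N. (\<Sum>n<N. (fnorm H0 (\<lambda>y. \<Sum>x\<in>A N. b n x * kernel_section unit_interval k0 x y))\<^sup>2) \<le> V) \<and>
    (\<forall>t\<in>unit_interval. (\<lambda>N. fnorm H0 (\<lambda>y. (\<Sum>x\<in>A N. (\<Sum>n<N. g n t * b n x) * kernel_section unit_interval k0 x y)
        - kernel_section unit_interval k0 t y)) \<longlonglongrightarrow> 0)"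
proof -
  let ?T = "unit_interval"
  interpret G: function_rkhs ?T "besov_01 r" by (rule function_rkhs.intro[OF besov_01_rkhs(1)[OF r(1)]])
  interpret H: function_rkhs ?T H0 by (rule rkhs_of_kernelD(1)[OF k0])
  obtain \<kappa> where \<kappa>: "rkhs_of_kernel ?T \<kappa> (besov_01 r)" by (rule G.kernel_exists)
  let ?kG = "kernel_section ?T \<kappa>" and ?kH = "kernel_section ?T k0"
  have kin: "t \<in> ?T \<Longrightarrow> ?kG t \<in> fns (besov_01 r)" for t by (rule rkhs_of_kernelD(2)[OF \<kappa>])
  have krep: "t \<in> ?T \<Longrightarrow> f \<in> fns (besov_01 r) \<Longrightarrow> ip (besov_01 r) f (?kG t) = f t" for t f
    by (rule rkhs_of_kernelD(3)[OF \<kappa>])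
  obtain K where K: "K \<ge> 0" "\<And>\<xi> \<phi>. zero_ext ?T (\<lambda>x. cos (\<xi> * x + \<phi>)) \<in> fns (besov_01 r)"
     "\<And>\<xi> \<phi>. (fnorm (besov_01 r) (zero_ext ?T (\<lambda>x. cos (\<xi> * x + \<phi>))))\<^sup>2 \<le> K * (1 + \<xi>\<^sup>2) powr r"
    using besov_01_cos[OF r(1)] by blast
  obtain C where C: "C \<ge> 0" "\<And>A c. finite A \<Longrightarrow> A \<subseteq> ?T \<Longrightarrow>
     fnorm H0 (\<lambda>y. \<Sum>x\<in>A. c x * ?kH x y) \<le> C * sqrt (\<integral>\<xi>. trig_weight s A c \<xi> \<partial>lborel)"
    using sobolev_kernel_domination[OF s k0 H0] by blast
  obtain Cb where Cb: "Cb \<ge> 0" "\<And>h t. h \<in> fns (besov_01 r) \<Longrightarrow> t \<in> ?T \<Longrightarrow> \<bar>h t\<bar> \<le> Cb * fnorm (besov_01 r) h"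
    using besov_01_rkhs(2)[OF r(1)] by blast
  define I where "I = (\<integral>\<xi>. 2 * K * (1 + \<xi>\<^sup>2) powr r * (1 + \<xi>\<^sup>2) powr (- s) \<partial>(lborel :: real measure))"
  have Ii: "integrable lborel (\<lambda>\<xi>::real. 2 * K * (1 + \<xi>\<^sup>2) powr r * (1 + \<xi>\<^sup>2) powr (- s))"
    by (rule weighted_dictionary_integrable[OF r(2)])
  have I0: "0 \<le> I" unfolding I_def using K(1) by simp

  let ?Q = "\<rat> \<inter> ?T"
  have "(1/2::real) \<in> ?Q" by (auto intro: Rats_divide)
  then have Qne: "?Q \<noteq> {}" by blast
  have Qc: "countable ?Q" by (intro countable_Int1 countable_rat)
  define q where "q = from_nat_into ?Q"
  have q: "range q = ?Q" unfolding q_def by (rule range_from_nat_into[OF Qne Qc])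
  have qT: "q i \<in> ?T" for i using q by blast
  obtain g \<beta> where g: "G.orthonormal_or_zero g" and g\<beta>: "\<And>n. g n = (\<lambda>t. \<Sum>i\<le>n. \<beta> n i * ?kG (q i) t)"
    and gx: "\<And>n. ?kG (q n) = (\<lambda>t. \<Sum>i\<le>n. ip (besov_01 r) (?kG (q n)) (g i) * g i t)"
    using G.gram_schmidt[of "\<lambda>n. ?kG (q n)"] kin[OF qT] by blast
  have gH: "g n \<in> fns (besov_01 r)" for n by (rule G.orthonormal_or_zeroD(1)[OF g])
  have total: "h = (\<lambda>t. 0)" if h: "h \<in> fns (besov_01 r)" and orth: "\<And>n. ip (besov_01 r) h (g n) = 0" for h
  proof -
    have hq: "h (q n) = 0" for n
    proof -
      have "h (q n) = ip (besov_01 r) (?kG (q n)) h" using krep[OF qT h] G.ip_sym[OF h kin[OF qT]] by simp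
      also have "\<dots> = ip (besov_01 r) (\<lambda>t. \<Sum>i\<le>n. ip (besov_01 r) (?kG (q n)) (g i) * g i t) h"
        using gx[of n] by (rule arg_cong)
      also have "\<dots> = (\<Sum>i\<le>n. ip (besov_01 r) (?kG (q n)) (g i) * ip (besov_01 r) (g i) h)"
        by (rule G.ip_sum[OF gH h])
      also have "\<dots> = 0" using orth G.ip_sym[OF gH h] by simp
      finally show ?thesis .
    qed
    have "h t = 0" for t
    proof (cases "t \<in> ?T")
      case False then show ?thesis using G.outside[OF h] by blast
    next
      case True
      have cl: "closed_in (top_of_set ?T) {x \<in> ?T. h x = 0}" if "closed_in = closedin" for closed_in
        unfolding that by (intro continuous_closedin_preimage_constant besov_01_continuous[OF h])
      have "t \<in> closure ?Q"
      proof (rule closure_approachable[THEN iffD2], intro allI impI)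
        fix e :: real assume e: "e > 0"
        have "max 0 (t - e) < t" using True e by auto
        then obtain y where "y \<in> \<rat>" "max 0 (t - e) < y" "y < t" using Rats_dense_in_real by blast
        then show "\<exists>y\<in>?Q. dist y t < e" using True by (intro bexI[of _ y]) (auto simp: dist_real_def)
      qed
      moreover have "\<And>x. x \<in> ?Q \<Longrightarrow> h x = 0" using hq q by (metis rangeE)
      ultimately show ?thesis
      proof -
        assume tc: "t \<in> closure ?Q" and z: "\<And>x. x \<in> ?Q \<Longrightarrow> h x = 0"
        obtain x where x: "\<And>n. x n \<in> ?Q" "x \<longlonglongrightarrow> t" using tc unfolding closure_sequential by blast
        have "(\<lambda>n. h (x n)) \<longlonglongrightarrow> h t"
          using besov_01_continuous[OF h] True x unfolding continuous_on_sequentially by (auto simp: o_def)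
        moreover have "(\<lambda>n. h (x n)) = (\<lambda>n. 0)" using z[OF x(1)] by auto
        ultimately show "h t = 0" using LIMSEQ_unique tendsto_const by metis
      qed
    qed
    then show ?thesis by auto
  qed

  define A where "A N = q ` {..<N}" for N
  define b where "b n x = (\<Sum>i\<le>n. if q i = x then \<beta> n i else 0)" for n x
  have A: "finite (A n)" "A n \<subseteq> ?T" "m \<le> n \<Longrightarrow> A m \<subseteq> A n" for m n
    using qT unfolding A_def by auto
  have b0: "b n x = 0" if "x \<notin> A (Suc n)" for n x
    unfolding b_def using that by (intro sum.neutral) (auto simp: A_def)
  have b_sum: "(\<Sum>x\<in>A N. b n x * F x) = (\<Sum>i\<le>n. \<beta> n i * F (q i))" if "n < N" for N n and F :: "real \<Rightarrow> real"
  proof -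
    have "(\<Sum>x\<in>A N. b n x * F x) = (\<Sum>x\<in>A N. \<Sum>i\<le>n. (if q i = x then \<beta> n i * F x else 0))"
      unfolding b_def by (intro sum.cong refl) (simp add: sum_distrib_right if_distrib[of "\<lambda>z. z * _"] cong: if_cong)
    also have "\<dots> = (\<Sum>i\<le>n. \<Sum>x\<in>A N. (if q i = x then \<beta> n i * F x else 0))" by (rule sum.swap)
    also have "\<dots> = (\<Sum>i\<le>n. \<beta> n i * F (q i))"
      using that by (intro sum.cong refl) (auto simp: A_def)
    finally show ?thesis .
  qed
  have gA: "g n = (\<lambda>t. \<Sum>x\<in>A N. b n x * ?kG x t)" if "n < N" for n N
    unfolding b_sum[OF that, of "\<lambda>x. ?kG x t" for t] by (rule g\<beta>)
  have ip_g: "ip (besov_01 r) f (g n) = (\<Sum>x\<in>A N. b n x * f x)" if "n < N" "f \<in> fns (besov_01 r)" for f n N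
  proof -
    have "ip (besov_01 r) f (g n) = ip (besov_01 r) f (\<lambda>t. \<Sum>x\<in>A N. b n x * ?kG x t)"
      using gA[OF that(1)] by (rule arg_cong)
    then show ?thesis using ip_kernel_combination[OF \<kappa> A(2) that(2)] by simp
  qed
  have p1: "(\<Sum>x\<in>A (Suc n). b n x * g m x) = (if m = n \<and> g n \<noteq> (\<lambda>t. 0) then 1 else 0)" for m n
  proof -
    have "(\<Sum>x\<in>A (Suc n). b n x * g m x) = ip (besov_01 r) (g m) (g n)"
      by (rule ip_g[symmetric]) (simp_all add: gH)
    then show ?thesis using G.orthonormal_or_zeroD(2)[OF g, of m n] by (cases "m = n") simp_all
  qed
  have g_eval: "ip (besov_01 r) (?kG t) (g n) = g n t" if "t \<in> ?T" for n t
    using G.ip_sym[OF kin[OF that] gH] krep[OF that gH] by simp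
  have pars: "(\<lambda>N. fnorm (besov_01 r) (\<lambda>y. (\<Sum>n<N. g n t * g n y) - ?kG t y)) \<longlonglongrightarrow> 0" if t: "t \<in> ?T" for t
    using G.parseval[OF g kin[OF t] total] unfolding g_eval[OF t] .
  have p2: "(\<Sum>n<N. (g n t)\<^sup>2) \<le> Cb * Cb" if t: "t \<in> ?T" for N t
  proof -
    have "(\<Sum>n<N. (g n t)\<^sup>2) \<le> ip (besov_01 r) (?kG t) (?kG t)"
      using G.bessel[OF g kin[OF t], of "{..<N}"] unfolding g_eval[OF t] by simp
    also have "\<dots> \<le> Cb * Cb"
    proof -
      let ?n = "fnorm (besov_01 r) (?kG t)"
      have "ip (besov_01 r) (?kG t) (?kG t) = ?kG t t" by (rule krep[OF t kin[OF t]])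
      then have "?n\<^sup>2 \<le> Cb * ?n" using Cb(2)[OF kin[OF t] t] by (simp add: G.fnorm_sq[OF kin[OF t]])
      then have "?n \<le> Cb" using G.fnorm_nonneg[OF kin[OF t]] Cb(1)
        by (cases "?n = 0") (auto simp: power2_eq_square)
      then have "?n\<^sup>2 \<le> Cb\<^sup>2" using G.fnorm_nonneg[OF kin[OF t]] by (rule power_mono)
      then show ?thesis unfolding G.fnorm_sq[OF kin[OF t]] by (simp only: power2_eq_square)
    qed
    finally show ?thesis .
  qed
  have p3: "(\<lambda>n. g n t * g n t') sums \<kappa> t t'" if t: "t \<in> ?T" "t' \<in> ?T" for t t'
  proof -
    have "(\<lambda>y. \<Sum>n<N. g n t * g n y) \<in> fns (besov_01 r)" for N by (rule G.sum_in[OF gH])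
    from G.norm_limit_pointwise[of "\<lambda>N y. \<Sum>n<N. g n t * g n y", OF this kin[OF t(1)] pars[OF t(1)], of t']
    show ?thesis using t by (simp add: sums_def zero_ext_def)
  qed
  have tw_g: "trig_weight s (A N) (b n) \<xi> = ((ip (besov_01 r) (zero_ext ?T (\<lambda>x. cos (\<xi> * x + 0))) (g n))\<^sup>2
     + (ip (besov_01 r) (zero_ext ?T (\<lambda>x. cos (\<xi> * x + - pi/2))) (g n))\<^sup>2) * (1 + \<xi>\<^sup>2) powr (- s)" if "n < N" for n N \<xi>
    by (rule trig_weight_besov[OF \<kappa> A(2) gA[OF that] K(2)])
  have cosn: "ip (besov_01 r) (zero_ext ?T (\<lambda>x. cos (\<xi> * x + \<phi>))) (zero_ext ?T (\<lambda>x. cos (\<xi> * x + \<phi>))) \<le> K * (1 + \<xi>\<^sup>2) powr r" for \<xi> \<phi>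
    using K(3)[of \<xi> \<phi>] by (simp add: G.fnorm_sq[OF K(2)])
  have p4: "(\<Sum>n<N. (fnorm H0 (\<lambda>y. \<Sum>x\<in>A N. b n x * ?kH x y))\<^sup>2) \<le> C\<^sup>2 * I" for N
  proof -
    have "(\<Sum>n<N. (fnorm H0 (\<lambda>y. \<Sum>x\<in>A N. b n x * ?kH x y))\<^sup>2) \<le> (\<Sum>n<N. C\<^sup>2 * (\<integral>\<xi>. trig_weight s (A N) (b n) \<xi> \<partial>lborel))"
    proof (intro sum_mono)
      fix n
      have hin: "(\<lambda>y. \<Sum>x\<in>A N. b n x * ?kH x y) \<in> fns H0"
        by (intro H.sum_in rkhs_of_kernelD(2)[OF k0] subsetD[OF A(2)])
      have "(fnorm H0 (\<lambda>y. \<Sum>x\<in>A N. b n x * ?kH x y))\<^sup>2 \<le> (C * sqrt (\<integral>\<xi>. trig_weight s (A N) (b n) \<xi> \<partial>lborel))\<^sup>2"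
        by (intro power_mono C(2) A H.fnorm_nonneg hin)
      also have "\<dots> = C\<^sup>2 * (\<integral>\<xi>. trig_weight s (A N) (b n) \<xi> \<partial>lborel)"
        by (simp add: power_mult_distrib trig_weight_nonneg)
      finally show "(fnorm H0 (\<lambda>y. \<Sum>x\<in>A N. b n x * ?kH x y))\<^sup>2 \<le> C\<^sup>2 * (\<integral>\<xi>. trig_weight s (A N) (b n) \<xi> \<partial>lborel)" .
    qed
    also have "\<dots> = C\<^sup>2 * (\<integral>\<xi>. (\<Sum>n<N. trig_weight s (A N) (b n) \<xi>) \<partial>lborel)"
      by (simp add: sum_distrib_left[symmetric] integrable_trig_weight[OF s])
    also have "\<dots> \<le> C\<^sup>2 * I"
    proof (intro mult_left_mono)
      show "(\<integral>\<xi>. (\<Sum>n<N. trig_weight s (A N) (b n) \<xi>) \<partial>lborel) \<le> I"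
        unfolding I_def
      proof (intro integral_mono Ii Bochner_Integration.integrable_sum integrable_trig_weight[OF s])
        fix \<xi> :: real
        have "(\<Sum>n<N. trig_weight s (A N) (b n) \<xi>) = ((\<Sum>n<N. (ip (besov_01 r) (zero_ext ?T (\<lambda>x. cos (\<xi> * x + 0))) (g n))\<^sup>2)
           + (\<Sum>n<N. (ip (besov_01 r) (zero_ext ?T (\<lambda>x. cos (\<xi> * x + - pi/2))) (g n))\<^sup>2)) * (1 + \<xi>\<^sup>2) powr (- s)"
          unfolding sum.distrib[symmetric] sum_distrib_right by (intro sum.cong refl tw_g) simp
        also have "\<dots> \<le> (K * (1 + \<xi>\<^sup>2) powr r + K * (1 + \<xi>\<^sup>2) powr r) * (1 + \<xi>\<^sup>2) powr (- s)"
          by (intro mult_right_mono add_mono order_trans[OF G.bessel[OF g K(2)] cosn]) auto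
        finally show "(\<Sum>n<N. trig_weight s (A N) (b n) \<xi>) \<le> 2 * K * (1 + \<xi>\<^sup>2) powr r * (1 + \<xi>\<^sup>2) powr (- s)"
          by (simp add: algebra_simps)
      qed
    qed simp
    finally show ?thesis .
  qed
  \<comment> \<open>the embedding of the Besov space: norms of combinations in \<open>H0\<close> are controlled by those with the Besov kernel\<close>
  have dom: "fnorm H0 (\<lambda>y. \<Sum>x\<in>A'. c x * ?kH x y) \<le> C * sqrt I * fnorm (besov_01 r) (\<lambda>y. \<Sum>x\<in>A'. c x * ?kG x y)"
    if A': "finite A'" "A' \<subseteq> ?T" for A' c
  proof -
    define u where "u = (\<lambda>y. \<Sum>x\<in>A'. c x * ?kG x y)"
    have uG: "u \<in> fns (besov_01 r)" unfolding u_def by (intro G.sum_in kin) (use A'(2) in auto)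
    have "(\<integral>\<xi>. trig_weight s A' c \<xi> \<partial>lborel) \<le> (\<integral>\<xi>. ip (besov_01 r) u u * (2 * K * (1 + \<xi>\<^sup>2) powr r * (1 + \<xi>\<^sup>2) powr (- s)) \<partial>lborel)"
    proof (intro integral_mono integrable_mult_right Ii integrable_trig_weight[OF s])
      fix \<xi> :: real
      have c2: "(ip (besov_01 r) (zero_ext ?T (\<lambda>x. cos (\<xi> * x + \<phi>))) u)\<^sup>2 \<le> K * (1 + \<xi>\<^sup>2) powr r * ip (besov_01 r) u u" for \<phi>
      proof -
        have "\<bar>ip (besov_01 r) (zero_ext ?T (\<lambda>x. cos (\<xi> * x + \<phi>))) u\<bar>\<^sup>2 \<le> (fnorm (besov_01 r) (zero_ext ?T (\<lambda>x. cos (\<xi> * x + \<phi>))) * fnorm (besov_01 r) u)\<^sup>2"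
          by (intro power_mono G.cauchy_schwarz K(2) uG) simp
        also have "\<dots> \<le> K * (1 + \<xi>\<^sup>2) powr r * ip (besov_01 r) u u"
          unfolding power_mult_distrib G.fnorm_sq[OF uG] by (intro mult_right_mono K(3) G.ip_nonneg[OF uG])
        finally show ?thesis by simp
      qed
      have "trig_weight s A' c \<xi> \<le> (K * (1 + \<xi>\<^sup>2) powr r * ip (besov_01 r) u u + K * (1 + \<xi>\<^sup>2) powr r * ip (besov_01 r) u u) * (1 + \<xi>\<^sup>2) powr (- s)"
        unfolding trig_weight_besov[OF \<kappa> A'(2) u_def K(2)] by (intro mult_right_mono add_mono c2) auto
      then show "trig_weight s A' c \<xi> \<le> ip (besov_01 r) u u * (2 * K * (1 + \<xi>\<^sup>2) powr r * (1 + \<xi>\<^sup>2) powr (- s))"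
        by (simp add: algebra_simps)
    qed
    also have "\<dots> = ip (besov_01 r) u u * I" unfolding I_def by simp
    finally have "sqrt (\<integral>\<xi>. trig_weight s A' c \<xi> \<partial>lborel) \<le> sqrt (ip (besov_01 r) u u * I)" by (rule real_sqrt_le_mono)
    also have "\<dots> = sqrt I * fnorm (besov_01 r) u" by (simp add: real_sqrt_mult fnorm_def)
    finally have "C * sqrt (\<integral>\<xi>. trig_weight s A' c \<xi> \<partial>lborel) \<le> C * (sqrt I * fnorm (besov_01 r) u)"
      using C(1) by (rule mult_left_mono)
    then show ?thesis using C(2)[OF A', of c] unfolding u_def by (simp add: mult.assoc)
  qed
  have p5: "(\<lambda>N. fnorm H0 (\<lambda>y. (\<Sum>x\<in>A N. (\<Sum>n<N. g n t * b n x) * ?kH x y) - ?kH t y)) \<longlonglongrightarrow> 0" if t: "t \<in> ?T" for t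
  proof (rule Lim_null_comparison)
    show "(\<lambda>N. C * sqrt I * fnorm (besov_01 r) (\<lambda>y. (\<Sum>n<N. g n t * g n y) - ?kG t y)) \<longlonglongrightarrow> 0"
      by (rule tendsto_mult_right_zero[OF pars[OF t]])
    have "norm (fnorm H0 (\<lambda>y. (\<Sum>x\<in>A N. (\<Sum>n<N. g n t * b n x) * ?kH x y) - ?kH t y)) \<le> C * sqrt I * fnorm (besov_01 r) (\<lambda>y. (\<Sum>n<N. g n t * g n y) - ?kG t y)" for N
    proof -
      define A' where "A' = insert t (A N)"
      define c where "c x = (\<Sum>n<N. g n t * b n x) - (if x = t then 1 else 0)" for x
      have A': "finite A'" "A' \<subseteq> ?T" "A N \<subseteq> A'" using A t by (auto simp: A'_def)
      have z: "(\<Sum>n<N. g n t * b n x) = 0" if "x \<notin> A N" for x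
      proof (intro sum.neutral ballI)
        fix n assume "n \<in> {..<N}"
        then have "x \<notin> A (Suc n)" using that A(3)[of "Suc n" N] by auto
        then show "g n t * b n x = 0" by (simp add: b0)
      qed
      have comb: "(\<Sum>x\<in>A'. c x * F x) = (\<Sum>x\<in>A N. (\<Sum>n<N. g n t * b n x) * F x) - F t" for F :: "real \<Rightarrow> real"
      proof -
        have "(\<Sum>x\<in>A'. c x * F x) = (\<Sum>x\<in>A'. (\<Sum>n<N. g n t * b n x) * F x) - (\<Sum>x\<in>A'. if x = t then F x else 0)"
          unfolding sum_subtractf[symmetric] c_def by (intro sum.cong refl) (simp add: left_diff_distrib)
        also have "(\<Sum>x\<in>A'. if x = t then F x else 0) = F t" using A'(1) by (simp add: A'_def)
        also have "(\<Sum>x\<in>A'. (\<Sum>n<N. g n t * b n x) * F x) = (\<Sum>x\<in>A N. (\<Sum>n<N. g n t * b n x) * F x)"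
          by (rule sum.mono_neutral_right) (use A' z in auto)
        finally show ?thesis .
      qed
      have Gc: "(\<Sum>x\<in>A N. (\<Sum>n<N. g n t * b n x) * ?kG x y) = (\<Sum>n<N. g n t * g n y)" for y
      proof -
        have "(\<Sum>x\<in>A N. (\<Sum>n<N. g n t * b n x) * ?kG x y) = (\<Sum>n<N. g n t * (\<Sum>x\<in>A N. b n x * ?kG x y))"
          unfolding sum_distrib_right sum_distrib_left by (subst sum.swap) (simp add: mult.assoc)
        also have "\<dots> = (\<Sum>n<N. g n t * g n y)"
        proof (intro sum.cong refl)
          fix n assume "n \<in> {..<N}"
          then have "g n y = (\<Sum>x\<in>A N. b n x * ?kG x y)" using fun_cong[OF gA[of n N], of y] by simp
          then show "g n t * (\<Sum>x\<in>A N. b n x * ?kG x y) = g n t * g n y" by simp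
        qed
        finally show ?thesis .
      qed
      have hin: "(\<lambda>y. \<Sum>x\<in>A'. c x * ?kH x y) \<in> fns H0"
        by (intro H.sum_in rkhs_of_kernelD(2)[OF k0]) (use A'(2) in auto)
      have "fnorm H0 (\<lambda>y. \<Sum>x\<in>A'. c x * ?kH x y) \<le> C * sqrt I * fnorm (besov_01 r) (\<lambda>y. \<Sum>x\<in>A'. c x * ?kG x y)"
        by (rule dom[OF A'(1,2)])
      then show ?thesis using H.fnorm_nonneg[OF hin] unfolding comb Gc by simp
    qed
    then show "\<forall>\<^sub>F N in sequentially. norm (fnorm H0 (\<lambda>y. (\<Sum>x\<in>A N. (\<Sum>n<N. g n t * b n x) * ?kH x y) - ?kH t y)) \<le> C * sqrt I * fnorm (besov_01 r) (\<lambda>y. (\<Sum>n<N. g n t * g n y) - ?kG t y)"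
      by simp
  qed
  show ?thesis
    by (rule exI[of _ \<kappa>], rule exI[of _ A], rule exI[of _ b], rule exI[of _ g], rule exI[of _ "C\<^sup>2 * I"], rule exI[of _ "Cb * Cb"])
       (intro conjI allI impI ballI \<kappa> A b0 p1 gH p2 p3 p4 p5)
qed


section \<open>A version with paths in the tensor power\<close>

lemma vec_box_eq: "{t :: 'b ^ 'd. \<forall>i. t $ i \<in> B i} = vec_lambda ` PiE UNIV B"
proof (intro equalityI subsetI)
  fix t :: "'b ^ 'd" assume "t \<in> {t. \<forall>i. t $ i \<in> B i}"
  then have "vec_nth t \<in> PiE UNIV B" by auto
  then show "t \<in> vec_lambda ` PiE UNIV B" by (intro image_eqI[of _ _ "vec_nth t"]) auto
qed auto

lemma finite_vec_box: "(\<And>i. finite (B i)) \<Longrightarrow> finite {t :: 'b ^ 'd. \<forall>i. t $ i \<in> B i}"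
  unfolding vec_box_eq by (intro finite_imageI finite_PiE) auto

lemma sum_prod_vec:
  fixes f :: "'d::finite \<Rightarrow> 'b \<Rightarrow> 'c::comm_semiring_1"
  assumes "\<And>i. finite (B i)"
  shows "(\<Sum>t\<in>{t :: 'b ^ 'd. \<forall>i. t $ i \<in> B i}. \<Prod>i\<in>UNIV. f i (t $ i)) = (\<Prod>i\<in>UNIV. \<Sum>x\<in>B i. f i x)"
proof -
  have "(\<Prod>i\<in>UNIV. \<Sum>x\<in>B i. f i x) = (\<Sum>g\<in>PiE UNIV B. \<Prod>i\<in>UNIV. f i (g i))"
    by (rule prod_sum_PiE) (use assms in auto)
  also have "\<dots> = (\<Sum>t\<in>{t :: 'b ^ 'd. \<forall>i. t $ i \<in> B i}. \<Prod>i\<in>UNIV. f i (t $ i))"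
    by (rule sum.reindex_bij_witness[of _ vec_nth vec_lambda]) auto
  finally show ?thesis by simp
qed

definition index_box :: "nat \<Rightarrow> ('d::finite \<Rightarrow> nat) set" where
  "index_box N = {\<alpha>. \<forall>i. \<alpha> i < N}"

lemma index_box_PiE: "index_box N = PiE UNIV (\<lambda>_. {..<N})"
  by (auto simp: index_box_def)

lemma finite_index_box: "finite (index_box N)"
  unfolding index_box_PiE by (intro finite_PiE) auto

lemma index_box_mono: "M \<le> N \<Longrightarrow> index_box M \<subseteq> index_box N"
  by (auto simp: index_box_def intro: less_le_trans)

lemma sum_prod_index_box:
  "(\<Sum>\<alpha>\<in>index_box N. \<Prod>i\<in>UNIV. f i (\<alpha> i)) = (\<Prod>i\<in>UNIV. \<Sum>n<N. f i n :: real)"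
  unfolding index_box_PiE by (rule prod_sum_PiE[symmetric]) auto

lemma finite_subset_index_box:
  assumes "finite F" shows "\<exists>N. F \<subseteq> index_box N"
proof -
  have "finite (\<Union>\<alpha>\<in>F. range \<alpha>)" using assms by auto
  then obtain N where "\<forall>n\<in>(\<Union>\<alpha>\<in>F. range \<alpha>). n < N" by (auto simp: finite_nat_set_iff_bounded)
  then show ?thesis by (intro exI[of _ N]) (auto simp: index_box_def)
qed

lemma filterlim_index_box:
  fixes I :: "('d::finite \<Rightarrow> nat) set"
  shows "filterlim (\<lambda>N. index_box N \<inter> I) (finite_subsets_at_top I) sequentially"
  unfolding filterlim_finite_subsets_at_top
proof (intro allI impI)
  fix X :: "('d \<Rightarrow> nat) set" assume X: "finite X \<and> X \<subseteq> I"
  then obtain N where "X \<subseteq> index_box N" using finite_subset_index_box by blast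
  then have "\<forall>n\<ge>N. finite (index_box n \<inter> I) \<and> X \<subseteq> index_box n \<inter> I \<and> index_box n \<inter> I \<subseteq> I"
    using X index_box_mono[of N] finite_index_box by fastforce
  then show "\<forall>\<^sub>F n in sequentially. finite (index_box n \<inter> I) \<and> X \<subseteq> index_box n \<inter> I \<and> index_box n \<inter> I \<subseteq> I"
    by (auto simp: eventually_sequentially)
qed

lemma index_box_sums_tendsto:
  assumes "f summable_on I" and "\<And>\<alpha>. \<alpha> \<notin> I \<Longrightarrow> f \<alpha> = (0::real)"
  shows "(\<lambda>N. \<Sum>\<alpha>\<in>index_box N. f \<alpha>) \<longlonglongrightarrow> infsum f I"
proof -
  have "(\<lambda>N. \<Sum>\<alpha>\<in>index_box N \<inter> I. f \<alpha>) \<longlonglongrightarrow> infsum f I"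
    by (rule filterlim_compose[OF infsum_tendsto[OF assms(1)] filterlim_index_box])
  moreover have "(\<Sum>\<alpha>\<in>index_box N \<inter> I. f \<alpha>) = (\<Sum>\<alpha>\<in>index_box N. f \<alpha>)" for N
    by (rule sum.mono_neutral_left) (use assms(2) finite_index_box in auto)
  ultimately show ?thesis by simp
qed

lemma (in function_rkhs) tendsto_ip:
  assumes u: "\<And>n. u n \<in> fns H" and f: "f \<in> fns H" and lim: "(\<lambda>n. fnorm H (\<lambda>t. u n t - f t)) \<longlonglongrightarrow> 0"
  shows "(\<lambda>n. ip H f (u n)) \<longlonglongrightarrow> ip H f f" "(\<lambda>n. ip H (u n) (u n)) \<longlonglongrightarrow> ip H f f"
proof -
  have "(\<lambda>n. ip H f (u n) - ip H f f) \<longlonglongrightarrow> 0"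
  proof (rule Lim_null_comparison)
    have "norm (ip H f (u n) - ip H f f) \<le> fnorm H (\<lambda>t. u n t - f t) * fnorm H f" for n
      using cauchy_schwarz[OF diff_in[OF u f] f, of n] ip_diff[OF u f f, of n] ip_sym[OF f u, of n] by simp
    then show "\<forall>\<^sub>F n in sequentially. norm (ip H f (u n) - ip H f f) \<le> fnorm H (\<lambda>t. u n t - f t) * fnorm H f" by simp
    show "(\<lambda>n. fnorm H (\<lambda>t. u n t - f t) * fnorm H f) \<longlonglongrightarrow> 0" by (rule tendsto_mult_left_zero[OF lim])
  qed
  then show 1: "(\<lambda>n. ip H f (u n)) \<longlonglongrightarrow> ip H f f" by (simp add: LIM_zero_iff)
  have "(\<lambda>n. (fnorm H (\<lambda>t. u n t - f t))\<^sup>2 + 2 * ip H f (u n) - ip H f f) \<longlonglongrightarrow> 0\<^sup>2 + 2 * ip H f f - ip H f f"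
    by (intro tendsto_intros lim 1)
  moreover have "(fnorm H (\<lambda>t. u n t - f t))\<^sup>2 + 2 * ip H f (u n) - ip H f f = ip H (u n) (u n)" for n
    using ip_diff_sq[OF u f, of n] ip_sym[OF f u, of n] by (simp add: fnorm_sq diff_in u f)
  ultimately show "(\<lambda>n. ip H (u n) (u n)) \<longlonglongrightarrow> ip H f f" by simp
qed

definition elementary_functional :: "real set \<Rightarrow> ('d::finite \<Rightarrow> real \<Rightarrow> real) \<Rightarrow> (real ^ 'd \<Rightarrow> real) \<Rightarrow> real" where
  "elementary_functional A w f = (\<Sum>t\<in>{t. \<forall>i. t $ i \<in> A}. (\<Prod>i\<in>UNIV. w i (t $ i)) * f t)"

abbreviation kernel_comb :: "(real \<Rightarrow> real \<Rightarrow> real) \<Rightarrow> real set \<Rightarrow> (real \<Rightarrow> real) \<Rightarrow> real \<Rightarrow> real" where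
  "kernel_comb k0 A w \<equiv> (\<lambda>y. \<Sum>x\<in>A. w x * kernel_section unit_interval k0 x y)"

text \<open>For a product kernel the covariance of product functionals is the product of the one-dimensional inner products. All functionals are taken over one grid, since the
weights may vanish at superfluous points.\<close>

lemma elementary_functional_covariance:
  fixes X :: "real ^ 'd \<Rightarrow> 'w \<Rightarrow> real"
  assumes int: "\<And>t t'. t \<in> unit_cube \<Longrightarrow> t' \<in> unit_cube \<Longrightarrow> integrable M (\<lambda>\<omega>. X t \<omega> * X t' \<omega>)"
    and cov: "\<And>t t'. t \<in> unit_cube \<Longrightarrow> t' \<in> unit_cube \<Longrightarrow>
      (\<integral>\<omega>. X t \<omega> * X t' \<omega> \<partial>M) = (\<Prod>i\<in>UNIV. k0 (t $ i) (t' $ i))"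
    and k0: "rkhs_of_kernel unit_interval k0 H0"
    and A: "finite A" "A \<subseteq> unit_interval"
  shows "integrable M (\<lambda>\<omega>. elementary_functional A w (\<lambda>t. X t \<omega>) * elementary_functional A v (\<lambda>t. X t \<omega>))"
    and "(\<integral>\<omega>. elementary_functional A w (\<lambda>t. X t \<omega>) * elementary_functional A v (\<lambda>t. X t \<omega>) \<partial>M)
      = (\<Prod>i\<in>UNIV. ip H0 (kernel_comb k0 A (w i)) (kernel_comb k0 A (v i)))"
proof -
  interpret H: function_rkhs unit_interval H0 by (rule rkhs_of_kernelD(1)[OF k0])
  let ?A = "{t :: real ^ 'd. \<forall>i. t $ i \<in> A}"
  let ?w = "\<lambda>w t. \<Prod>i\<in>UNIV. w i (t $ i) :: real"
  have cube: "t \<in> unit_cube" if "t \<in> ?A" for t using that A(2) by (auto simp: unit_cube_def)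
  have eq: "elementary_functional A w (\<lambda>t. X t \<omega>) * elementary_functional A v (\<lambda>t. X t \<omega>)
      = (\<Sum>t\<in>?A. \<Sum>t'\<in>?A. (?w w t * ?w v t') * (X t \<omega> * X t' \<omega>))" for \<omega>
    unfolding elementary_functional_def sum_product by (intro sum.cong refl) (simp add: mult_ac)
  show "integrable M (\<lambda>\<omega>. elementary_functional A w (\<lambda>t. X t \<omega>) * elementary_functional A v (\<lambda>t. X t \<omega>))"
    unfolding eq by (intro Bochner_Integration.integrable_sum integrable_mult_right int cube)
  have "(\<integral>\<omega>. elementary_functional A w (\<lambda>t. X t \<omega>) * elementary_functional A v (\<lambda>t. X t \<omega>) \<partial>M)
      = (\<Sum>t\<in>?A. \<Sum>t'\<in>?A. (?w w t * ?w v t') * (\<integral>\<omega>. X t \<omega> * X t' \<omega> \<partial>M))"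
    unfolding eq using int cube
    by (subst Bochner_Integration.integral_sum, intro Bochner_Integration.integrable_sum integrable_mult_right int cube)
       (auto intro!: sum.cong simp: Bochner_Integration.integral_sum)
  also have "\<dots> = (\<Sum>t\<in>?A. \<Sum>t'\<in>?A. \<Prod>i\<in>UNIV. w i (t $ i) * v i (t' $ i) * k0 (t $ i) (t' $ i))"
    by (intro sum.cong refl) (simp add: cov cube prod.distrib)
  also have "\<dots> = (\<Sum>t\<in>?A. \<Prod>i\<in>UNIV. \<Sum>y\<in>A. w i (t $ i) * v i y * k0 (t $ i) y)"
    by (intro sum.cong refl sum_prod_vec A)
  also have "\<dots> = (\<Prod>i\<in>UNIV. \<Sum>x\<in>A. \<Sum>y\<in>A. w i x * v i y * k0 x y)"
    by (intro sum_prod_vec A)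
  also have "\<dots> = (\<Prod>i\<in>UNIV. ip H0 (kernel_comb k0 A (w i)) (kernel_comb k0 A (v i)))"
  proof (intro prod.cong refl)
    fix i
    have kin: "x \<in> A \<Longrightarrow> kernel_section unit_interval k0 x \<in> fns H0" for x
      by (intro rkhs_of_kernelD(2)[OF k0] subsetD[OF A(2)])
    have "ip H0 (kernel_comb k0 A (w i)) (kernel_comb k0 A (v i)) = (\<Sum>x\<in>A. \<Sum>y\<in>A. w i x * v i y * ip H0 (kernel_section unit_interval k0 x) (kernel_section unit_interval k0 y))"
      by (intro H.ip_sum_sum kin)
    also have "\<dots> = (\<Sum>x\<in>A. \<Sum>y\<in>A. w i x * v i y * k0 x y)"
    proof (intro sum.cong refl)
      fix x y assume "x \<in> A" "y \<in> A"
      then have "y \<in> unit_interval" "x \<in> A" using A(2) by auto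
      then show "w i x * v i y * ip H0 (kernel_section unit_interval k0 x) (kernel_section unit_interval k0 y) = w i x * v i y * k0 x y"
        using rkhs_of_kernelD(3)[OF k0 _ kin, of y x] by (simp add: zero_ext_def)
    qed
    finally show "(\<Sum>x\<in>A. \<Sum>y\<in>A. w i x * v i y * k0 x y) = ip H0 (kernel_comb k0 A (w i)) (kernel_comb k0 A (v i))" by simp
  qed
  finally show "(\<integral>\<omega>. elementary_functional A w (\<lambda>t. X t \<omega>) * elementary_functional A v (\<lambda>t. X t \<omega>) \<partial>M)
      = (\<Prod>i\<in>UNIV. ip H0 (kernel_comb k0 A (w i)) (kernel_comb k0 A (v i)))" .
qed

text \<open>The data of the one-dimensional Hilbert--Schmidt system. Multi-indices with a vanishing factor are removed from the tensor basis, since they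
correspond to the zero vectors of Gram--Schmidt.\<close>

locale tensor_system =
  fixes A :: "nat \<Rightarrow> real set" and b g :: "nat \<Rightarrow> real \<Rightarrow> real" and B :: real and \<kappa> :: "real \<Rightarrow> real \<Rightarrow> real"
  assumes A_finite: "finite (A n)" and A_sub: "A n \<subseteq> unit_interval" and A_mono: "m \<le> n \<Longrightarrow> A m \<subseteq> A n"
    and b_outside: "x \<notin> A (Suc n) \<Longrightarrow> b n x = 0"
    and b_g: "(\<Sum>x\<in>A (Suc n). b n x * g m x) = (if m = n \<and> g n \<noteq> (\<lambda>t. 0) then 1 else 0)"
    and g_sq: "t \<in> unit_interval \<Longrightarrow> (\<Sum>n<N. (g n t)\<^sup>2) \<le> B"
    and g_sums: "t \<in> unit_interval \<Longrightarrow> t' \<in> unit_interval \<Longrightarrow> (\<lambda>n. g n t * g n t') sums \<kappa> t t'"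
    and g_cont: "continuous_on unit_interval (g n)"
begin

definition tens :: "('d::finite \<Rightarrow> nat) \<Rightarrow> real ^ 'd \<Rightarrow> real" where
  "tens \<alpha> t = (\<Prod>i\<in>UNIV. g (\<alpha> i) (t $ i))"

definition idx :: "('d::finite \<Rightarrow> nat) set" where
  "idx = {\<alpha>. \<forall>i. g (\<alpha> i) \<noteq> (\<lambda>t. 0)}"

definition nodes :: "('d::finite \<Rightarrow> nat) \<Rightarrow> (real ^ 'd) set" where
  "nodes \<alpha> = {t. \<forall>i. t $ i \<in> A (Suc (\<alpha> i))}"

definition wts :: "('d::finite \<Rightarrow> nat) \<Rightarrow> real ^ 'd \<Rightarrow> real" where
  "wts \<alpha> t = (\<Prod>i\<in>UNIV. b (\<alpha> i) (t $ i))"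

lemma tens_outside: "\<alpha> \<notin> idx \<Longrightarrow> tens \<alpha> t = 0"
  by (auto simp: idx_def tens_def prod_zero_iff fun_eq_iff)

lemma tens_sq_bound:
  fixes t :: "real ^ 'd::finite"
  assumes t: "t \<in> unit_cube" and F: "finite F"
  shows "(\<Sum>\<alpha>\<in>F. (tens \<alpha> t)\<^sup>2) \<le> B ^ CARD('d)"
proof -
  obtain N where N: "F \<subseteq> index_box N" using finite_subset_index_box[OF F] by blast
  have "(\<Sum>\<alpha>\<in>F. (tens \<alpha> t)\<^sup>2) \<le> (\<Sum>\<alpha>\<in>index_box N. (tens \<alpha> t)\<^sup>2)"
    by (intro sum_mono2 finite_index_box N) auto
  also have "\<dots> = (\<Prod>i\<in>UNIV. \<Sum>n<N. (g n (t $ i))\<^sup>2)"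
    unfolding tens_def prod_power_distrib by (rule sum_prod_index_box)
  also have "\<dots> \<le> (\<Prod>i\<in>(UNIV :: 'd set). B)"
    using t by (intro prod_mono conjI g_sq sum_nonneg) (auto simp: unit_cube_def)
  finally show ?thesis by simp
qed

lemma tens_summable:
  assumes t: "t \<in> unit_cube" shows "(\<lambda>\<alpha>. (tens \<alpha> t)\<^sup>2) summable_on I"
  by (rule nonneg_bdd_above_summable_on) (auto intro!: bdd_aboveI tens_sq_bound[OF t])

lemma biorthogonal_tens: "biorthogonal_system (unit_cube :: (real ^ 'd::finite) set) tens idx nodes wts"
proof
  fix \<alpha> \<alpha>' :: "'d \<Rightarrow> nat"
  show "finite (nodes \<alpha>)" unfolding nodes_def by (intro finite_vec_box A_finite)
  show "nodes \<alpha> \<subseteq> unit_cube" unfolding nodes_def unit_cube_def using A_sub by blast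
  show "(\<lambda>\<alpha>. (tens \<alpha> t)\<^sup>2) summable_on idx" if "t \<in> unit_cube" for t :: "real ^ 'd" by (rule tens_summable[OF that])
  assume i: "\<alpha> \<in> idx" "\<alpha>' \<in> idx"
  have "(\<Sum>t\<in>nodes \<alpha>. wts \<alpha> t * tens \<alpha>' t) = (\<Prod>i\<in>UNIV. \<Sum>x\<in>A (Suc (\<alpha> i)). b (\<alpha> i) x * g (\<alpha>' i) x)"
    unfolding nodes_def wts_def tens_def prod.distrib[symmetric] by (intro sum_prod_vec A_finite)
  also have "\<dots> = (\<Prod>i\<in>UNIV. if \<alpha>' i = \<alpha> i then 1 else 0)"
    unfolding b_g using i by (intro prod.cong refl) (auto simp: idx_def)
  also have "\<dots> = (if \<alpha> = \<alpha>' then 1 else 0)"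
  proof (cases "\<alpha> = \<alpha>'")
    case False
    then obtain i where "\<alpha>' i \<noteq> \<alpha> i" by (auto simp: fun_eq_iff eq_commute)
    then show ?thesis using False by (auto simp: prod_zero_iff)
  qed simp
  finally show "(\<Sum>t\<in>nodes \<alpha>. wts \<alpha> t * tens \<alpha>' t) = (if \<alpha> = \<alpha>' then 1 else 0)" .
qed

lemma tensor_kernel:
  fixes t t' :: "real ^ 'd::finite"
  assumes t: "t \<in> unit_cube" "t' \<in> unit_cube"
  shows "(\<Prod>i\<in>UNIV. \<kappa> (t $ i) (t' $ i)) = (\<Sum>\<^sub>\<infinity>\<alpha>\<in>idx. tens \<alpha> t * tens \<alpha> t')"
proof -
  have ti: "t $ i \<in> unit_interval" "t' $ i \<in> unit_interval" for i using t by (auto simp: unit_cube_def)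
  have sq: "(\<lambda>n. (g n x)\<^sup>2) summable_on UNIV" if "x \<in> unit_interval" for x
  proof (rule nonneg_bdd_above_summable_on)
    show "bdd_above (sum (\<lambda>n. (g n x)\<^sup>2) ` {F. F \<subseteq> UNIV \<and> finite F})"
    proof (rule bdd_aboveI, clarsimp)
      fix F :: "nat set" assume "finite F"
      then obtain N where "F \<subseteq> {..<N}" using finite_nat_set_iff_bounded by auto
      then have "(\<Sum>n\<in>F. (g n x)\<^sup>2) \<le> (\<Sum>n<N. (g n x)\<^sup>2)" by (intro sum_mono2) auto
      then show "(\<Sum>n\<in>F. (g n x)\<^sup>2) \<le> B" using g_sq[OF that, of N] by linarith
    qed
  qed auto
  have s: "(\<lambda>n. g n (t $ i) * g n (t' $ i)) summable_on UNIV" for i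
    by (rule square_sum_product_summable[OF sq[OF ti(1)] sq[OF ti(2)]])
  have "(\<Prod>i\<in>UNIV. \<kappa> (t $ i) (t' $ i)) = (\<Prod>i\<in>UNIV. \<Sum>\<^sub>\<infinity>n\<in>UNIV. g n (t $ i) * g n (t' $ i))"
  proof (intro prod.cong refl)
    fix i
    have "(\<lambda>n. g n (t $ i) * g n (t' $ i)) sums (\<Sum>\<^sub>\<infinity>n\<in>UNIV. g n (t $ i) * g n (t' $ i))"
      by (rule has_sum_imp_sums[OF has_sum_infsum[OF s]])
    then show "\<kappa> (t $ i) (t' $ i) = (\<Sum>\<^sub>\<infinity>n\<in>UNIV. g n (t $ i) * g n (t' $ i))"
      using g_sums[OF ti(1)[of i] ti(2)[of i]] sums_unique2 by blast
  qed
  also have "\<dots> = (\<Sum>\<^sub>\<infinity>\<alpha>\<in>PiE UNIV (\<lambda>_. UNIV). \<Prod>i\<in>UNIV. g (\<alpha> i) (t $ i) * g (\<alpha> i) (t' $ i))"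
    by (rule infsum_prod_PiE_abs[symmetric]) (simp, rule iffD1[OF summable_on_iff_abs_summable_on_real s])
  also have "\<dots> = (\<Sum>\<^sub>\<infinity>\<alpha>\<in>UNIV. tens \<alpha> t * tens \<alpha> t')"
    by (rule infsum_cong_neutral) (auto simp: tens_def prod.distrib)
  also have "\<dots> = (\<Sum>\<^sub>\<infinity>\<alpha>\<in>idx. tens \<alpha> t * tens \<alpha> t')"
    by (rule infsum_cong_neutral) (auto simp: tens_outside)
  finally show ?thesis .
qed

lemma tens_measurable: "tens \<alpha> \<in> borel_measurable (restrict_space borel (unit_cube :: (real ^ 'd::finite) set))"
proof -
  have "continuous_on (unit_cube :: (real ^ 'd) set) (tens \<alpha>)"
    unfolding tens_def by (intro continuous_intros continuous_on_compose2[OF g_cont]) (auto simp: unit_cube_def)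
  then show ?thesis by (rule borel_measurable_continuous_on_restrict)
qed

lemma expansion_space_bounded_borel:
  "fns (biorthogonal_system.expansion_space (unit_cube :: (real ^ 'd::finite) set) tens idx nodes wts) \<subseteq> bounded_borel_functions unit_cube"
proof
  interpret E: biorthogonal_system "unit_cube :: (real ^ 'd) set" tens idx nodes wts by (rule biorthogonal_tens)
  fix f assume f: "f \<in> fns E.expansion_space"
  note fD = E.expansion_spaceD[OF f]
  have s: "(\<lambda>\<alpha>. E.coef \<alpha> f * tens \<alpha> t) summable_on idx" if "t \<in> unit_cube" for t
    by (rule E.expansion_summable[OF that fD(1)])
  have m: "f \<in> borel_measurable (restrict_space borel unit_cube)"
  proof (rule borel_measurable_LIMSEQ_real)
    show "(\<lambda>N. \<Sum>\<alpha>\<in>index_box N. E.coef \<alpha> f * tens \<alpha> t) \<longlonglongrightarrow> f t" if "t \<in> space (restrict_space borel unit_cube)" for t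
    proof -
      have t: "t \<in> unit_cube" using that by (simp add: space_restrict_space)
      show ?thesis unfolding fD(3)[OF t] by (rule index_box_sums_tendsto[OF s[OF t]]) (simp add: tens_outside)
    qed
    show "(\<lambda>t. \<Sum>\<alpha>\<in>index_box N. E.coef \<alpha> f * tens \<alpha> t) \<in> borel_measurable (restrict_space borel unit_cube)" for N
      by (intro borel_measurable_sum borel_measurable_times tens_measurable) simp
  qed
  have "\<bar>f t\<bar> \<le> sqrt (B ^ CARD('d)) * fnorm E.expansion_space f" if t: "t \<in> unit_cube" for t
  proof -
    have "(\<Sum>\<^sub>\<infinity>\<alpha>\<in>idx. (tens \<alpha> t)\<^sup>2) \<le> B ^ CARD('d)"
      by (rule infsum_le_finite_sums[OF tens_summable[OF t]]) (rule tens_sq_bound[OF t])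
    then have "sqrt (\<Sum>\<^sub>\<infinity>\<alpha>\<in>idx. (tens \<alpha> t)\<^sup>2) * fnorm E.expansion_space f \<le> sqrt (B ^ CARD('d)) * fnorm E.expansion_space f"
      by (intro mult_right_mono real_sqrt_le_mono) (simp_all add: E.fnorm_expansion infsum_nonneg)
    then show ?thesis using E.expansion_space_eval_bound[OF t f] by linarith
  qed
  then have "bounded (f ` unit_cube)" by (auto simp: bounded_iff)
  then show "f \<in> bounded_borel_functions unit_cube"
    using m fD(2) by (auto simp: bounded_borel_functions_def)
qed

text \<open>The variances of the coefficients \<open>c \<alpha>\<close> of the process sum to at most \<open>V\<^sup>d\<close>, so almost every path has square summable coefficients, and \<open>Y\<close> is their
synthesis (and \<open>0\<close> on the exceptional event). The partial sums over boxes of multi-indices converge to \<open>X t\<close> in \<open>L\<^sub>2\<close>, because the one-dimensional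
expansions of the sections of \<open>k0\<close> converge; hence \<open>Y\<close> is a version.\<close>

theorem process_version:
  fixes M :: "'w measure" and X :: "real ^ 'd::finite \<Rightarrow> 'w \<Rightarrow> real"
  assumes M: "prob_space M"
    and meas: "\<And>t. t \<in> unit_cube \<Longrightarrow> X t \<in> borel_measurable M"
    and int: "\<And>t t'. t \<in> unit_cube \<Longrightarrow> t' \<in> unit_cube \<Longrightarrow> integrable M (\<lambda>\<omega>. X t \<omega> * X t' \<omega>)"
    and cov: "\<And>t t'. t \<in> unit_cube \<Longrightarrow> t' \<in> unit_cube \<Longrightarrow>
      (\<integral>\<omega>. X t \<omega> * X t' \<omega> \<partial>M) = (\<Prod>i\<in>UNIV. k0 (t $ i) (t' $ i))"
    and k0: "rkhs_of_kernel unit_interval k0 H0"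
    and hs: "\<And>N. (\<Sum>n<N. (fnorm H0 (kernel_comb k0 (A N) (b n)))\<^sup>2) \<le> V"
    and approx: "\<And>t. t \<in> unit_interval \<Longrightarrow> (\<lambda>N. fnorm H0 (\<lambda>y. kernel_comb k0 (A N) (\<lambda>x. \<Sum>n<N. g n t * b n x) y
        - kernel_section unit_interval k0 t y)) \<longlonglongrightarrow> 0"
  shows "\<exists>Y. version_of M unit_cube X Y \<and>
    paths_in M unit_cube Y (biorthogonal_system.expansion_space unit_cube tens idx nodes wts)"
proof -
  interpret prob_space M by (rule M)
  interpret E: biorthogonal_system "unit_cube :: (real ^ 'd) set" tens idx nodes wts by (rule biorthogonal_tens)
  interpret H: function_rkhs unit_interval H0 by (rule rkhs_of_kernelD(1)[OF k0])
  define c where "c \<alpha> \<omega> = E.coef \<alpha> (\<lambda>t. X t \<omega>)" for \<alpha> \<omega>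
  have nodes_cube: "nodes \<alpha> \<subseteq> unit_cube" for \<alpha> :: "'d \<Rightarrow> nat" unfolding nodes_def unit_cube_def using A_sub by blast
  have cm[measurable]: "c \<alpha> \<in> borel_measurable M" for \<alpha>
    unfolding c_def E.coef_def by (intro borel_measurable_sum borel_measurable_times meas subsetD[OF nodes_cube]) auto
  have kin: "x \<in> unit_interval \<Longrightarrow> kernel_section unit_interval k0 x \<in> fns H0" for x by (rule rkhs_of_kernelD(2)[OF k0])
  have combin: "A' \<subseteq> unit_interval \<Longrightarrow> kernel_comb k0 A' w \<in> fns H0" for A' w by (intro H.sum_in kin) auto
  have coef_ext: "c \<alpha> \<omega> = elementary_functional A' (\<lambda>i. b (\<alpha> i)) (\<lambda>t. X t \<omega>)"
    if \<alpha>: "\<alpha> \<in> index_box N" and A': "A N \<subseteq> A'" "finite A'" for \<alpha> :: "'d \<Rightarrow> nat" and N A' \<omega>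
  proof -
    have sub: "nodes \<alpha> \<subseteq> {t. \<forall>i. t $ i \<in> A'}"
      using A' A_mono[of "Suc (\<alpha> i)" N for i] \<alpha> unfolding nodes_def index_box_def by (fastforce simp: Suc_le_eq)
    have z: "wts \<alpha> t = 0" if nt: "t \<notin> nodes \<alpha>" for t
    proof -
      obtain i where "t $ i \<notin> A (Suc (\<alpha> i))" using nt by (auto simp: nodes_def)
      then show ?thesis unfolding wts_def using b_outside by (auto simp: prod_zero_iff)
    qed
    have "(\<Sum>t\<in>nodes \<alpha>. wts \<alpha> t * X t \<omega>) = (\<Sum>t\<in>{t. \<forall>i. t $ i \<in> A'}. wts \<alpha> t * X t \<omega>)"
      by (rule sum.mono_neutral_left[OF finite_vec_box sub]) (use A' z in auto)
    then show ?thesis by (simp add: c_def E.coef_def elementary_functional_def wts_def)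
  qed
  define Q where "Q N \<omega> = (\<Sum>\<alpha>\<in>index_box N. (c \<alpha> \<omega>)\<^sup>2)" for N \<omega>
  have Qm[measurable]: "Q N \<in> borel_measurable M" for N unfolding Q_def by measurable
  have Q0: "0 \<le> Q N \<omega>" for N \<omega> unfolding Q_def by (intro sum_nonneg) simp
  have Qmono: "Q N \<omega> \<le> Q N' \<omega>" if "N \<le> N'" for N N' \<omega>
    unfolding Q_def by (intro sum_mono2 finite_index_box index_box_mono that) auto
  have V0: "0 \<le> V" using hs[of 0] by simp
  have EQ: "(\<integral>\<^sup>+\<omega>. ennreal (Q N \<omega>) \<partial>M) \<le> ennreal (V ^ CARD('d))" for N
  proof -
    have ci: "integrable M (\<lambda>\<omega>. (c \<alpha> \<omega>)\<^sup>2)"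
      and ce: "(\<integral>\<omega>. (c \<alpha> \<omega>)\<^sup>2 \<partial>M) = (\<Prod>i\<in>UNIV. (fnorm H0 (kernel_comb k0 (A N) (b (\<alpha> i))))\<^sup>2)"
      if "\<alpha> \<in> index_box N" for \<alpha>
      using elementary_functional_covariance[OF int cov k0 A_finite[of N] A_sub[of N], of "\<lambda>i. b (\<alpha> i)" "\<lambda>i. b (\<alpha> i)"]
      unfolding coef_ext[OF that subset_refl A_finite, symmetric]
      by (simp_all add: power2_eq_square[symmetric] H.fnorm_sq combin A_sub)
    have "integrable M (Q N)" unfolding Q_def[abs_def] by (intro Bochner_Integration.integrable_sum ci)
    then have "(\<integral>\<^sup>+\<omega>. ennreal (Q N \<omega>) \<partial>M) = ennreal (\<integral>\<omega>. Q N \<omega> \<partial>M)"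
      by (intro nn_integral_eq_integral) (auto simp: Q0)
    also have "(\<integral>\<omega>. Q N \<omega> \<partial>M) = (\<Sum>\<alpha>\<in>(index_box N :: ('d \<Rightarrow> nat) set). \<Prod>i\<in>UNIV. (fnorm H0 (kernel_comb k0 (A N) (b (\<alpha> i))))\<^sup>2)"
      unfolding Q_def by (simp add: Bochner_Integration.integral_sum ci ce)
    also have "\<dots> = (\<Prod>i\<in>(UNIV :: 'd set). \<Sum>n<N. (fnorm H0 (kernel_comb k0 (A N) (b n)))\<^sup>2)"
      by (rule sum_prod_index_box)
    also have "\<dots> \<le> (\<Prod>i\<in>(UNIV :: 'd set). V)"
      by (intro prod_mono conjI hs sum_nonneg) auto
    finally show ?thesis by (simp add: ennreal_leI)
  qed
  define S where "S \<omega> = (SUP N. ennreal (Q N \<omega>))" for \<omega>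
  have [measurable]: "S \<in> borel_measurable M" unfolding S_def by measurable
  have "(\<integral>\<^sup>+\<omega>. S \<omega> \<partial>M) = (SUP N. \<integral>\<^sup>+\<omega>. ennreal (Q N \<omega>) \<partial>M)"
    unfolding S_def by (rule nn_integral_monotone_convergence_SUP) (auto simp: incseq_def le_fun_def intro!: ennreal_leI Qmono)
  also have "\<dots> \<le> ennreal (V ^ CARD('d))" by (rule SUP_least) (rule EQ)
  also have "\<dots> < \<infinity>" by simp
  finally have good: "AE \<omega> in M. S \<omega> \<noteq> \<infinity>" by (intro nn_integral_PInf_AE) auto
  have c_summable: "(\<lambda>\<alpha>. (c \<alpha> \<omega>)\<^sup>2) summable_on I" if S: "S \<omega> \<noteq> \<infinity>" for \<omega> I
  proof (rule nonneg_bdd_above_summable_on)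
    have "(\<Sum>\<alpha>\<in>F. (c \<alpha> \<omega>)\<^sup>2) \<le> enn2real (S \<omega>)" if F: "finite F" for F
    proof -
      obtain N where N: "F \<subseteq> index_box N" using finite_subset_index_box[OF F] by blast
      have "(\<Sum>\<alpha>\<in>F. (c \<alpha> \<omega>)\<^sup>2) \<le> Q N \<omega>" unfolding Q_def by (intro sum_mono2 finite_index_box N) auto
      also have "\<dots> = enn2real (ennreal (Q N \<omega>))" using Q0 by simp
      also have "\<dots> \<le> enn2real (S \<omega>)"
      proof (rule enn2real_mono)
        show "ennreal (Q N \<omega>) \<le> S \<omega>" unfolding S_def by (rule SUP_upper) simp
        show "S \<omega> < \<top>" using S by (simp add: less_top)
      qed
      finally show ?thesis .
    qed
    then show "bdd_above (sum (\<lambda>\<alpha>. (c \<alpha> \<omega>)\<^sup>2) ` {F. F \<subseteq> I \<and> finite F})" by (auto intro!: bdd_aboveI)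
  qed auto
  define Y where "Y t \<omega> = (if S \<omega> \<noteq> \<infinity> then E.synthesis (\<lambda>\<alpha>. c \<alpha> \<omega>) t else 0)" for t \<omega>
  define P where "P N t \<omega> = (\<Sum>\<alpha>\<in>index_box N. c \<alpha> \<omega> * tens \<alpha> t)" for N t \<omega>
  have Pm[measurable]: "P N t \<in> borel_measurable M" for N t unfolding P_def by measurable
  have PY: "(\<lambda>N. P N t \<omega>) \<longlonglongrightarrow> Y t \<omega>" if "S \<omega> \<noteq> \<infinity>" "t \<in> unit_cube" for t \<omega>
  proof -
    have "Y t \<omega> = (\<Sum>\<^sub>\<infinity>\<alpha>\<in>idx. c \<alpha> \<omega> * tens \<alpha> t)"
      using that by (simp add: Y_def E.synthesis_def zero_ext_def)
    then show ?thesis unfolding P_def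
      by (simp only:) (rule index_box_sums_tendsto[OF E.expansion_summable[OF that(2) c_summable[OF that(1)]]]; simp add: tens_outside)
  qed
  have Ym: "Y t \<in> borel_measurable M" if t: "t \<in> unit_cube" for t
  proof (rule borel_measurable_LIMSEQ_real)
    show "(\<lambda>N. if S \<omega> \<noteq> \<infinity> then P N t \<omega> else 0) \<longlonglongrightarrow> Y t \<omega>" for \<omega>
      using PY[OF _ t, of \<omega>] by (cases "S \<omega> \<noteq> \<infinity>") (auto simp: Y_def)
    show "(\<lambda>\<omega>. if S \<omega> \<noteq> \<infinity> then P N t \<omega> else 0) \<in> borel_measurable M" for N by measurable
  qed
  have lim0: "(\<lambda>N. \<integral>\<^sup>+\<omega>. ennreal ((X t \<omega> - P N t \<omega>)\<^sup>2) \<partial>M) \<longlonglongrightarrow> 0" if t: "t \<in> unit_cube" for t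
  proof -
    have ti: "t $ i \<in> unit_interval" for i using t by (auto simp: unit_cube_def)
    let ?k = "\<lambda>i. kernel_section unit_interval k0 (t $ i)"
    let ?p = "\<lambda>N i. kernel_comb k0 (A N) (\<lambda>x. \<Sum>n<N. g n (t $ i) * b n x)"
    have eqN: "(\<integral>\<^sup>+\<omega>. ennreal ((X t \<omega> - P N t \<omega>)\<^sup>2) \<partial>M) = ennreal ((\<Prod>i\<in>UNIV. ip H0 (?k i) (?k i)) - 2 * (\<Prod>i\<in>UNIV. ip H0 (?k i) (?p N i)) + (\<Prod>i\<in>UNIV. ip H0 (?p N i) (?p N i)))" for N
    proof -
      define A' where "A' = A N \<union> range (($) t)"
      have A': "finite A'" "A' \<subseteq> unit_interval" "A N \<subseteq> A'" "\<And>i. t $ i \<in> A'" using A_finite A_sub ti by (auto simp: A'_def)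
      define v where "v i x = (\<Sum>n<N. g n (t $ i) * b n x)" for i x
      define \<delta> where "\<delta> i x = (if x = t $ i then 1 else (0::real))" for i x
      have v0: "v i x = 0" if "x \<notin> A N" for i x
        unfolding v_def
      proof (intro sum.neutral ballI)
        fix n assume "n \<in> {..<N}"
        then have "x \<notin> A (Suc n)" using that A_mono[of "Suc n" N] by auto
        then show "g n (t $ i) * b n x = 0" by (simp add: b_outside)
      qed
      have X: "X t \<omega> = elementary_functional A' \<delta> (\<lambda>t. X t \<omega>)" for \<omega>
      proof -
        have "(\<Prod>i\<in>UNIV. \<delta> i (t' $ i)) = (if t' = t then 1 else 0)" for t'
          by (auto simp: \<delta>_def prod_zero_iff vec_eq_iff)
        then have "elementary_functional A' \<delta> (\<lambda>t. X t \<omega>) = (\<Sum>t'\<in>{t. \<forall>i. t $ i \<in> A'}. if t' = t then X t' \<omega> else 0)"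
          unfolding elementary_functional_def by (intro sum.cong refl) simp
        also have "\<dots> = X t \<omega>"
        proof -
          have "finite {t :: real ^ 'd. \<forall>i. t $ i \<in> A'}" by (rule finite_vec_box) (simp add: A')
          then show ?thesis using A'(4) by simp
        qed
        finally show ?thesis by simp
      qed
      have P: "P N t \<omega> = elementary_functional A' v (\<lambda>t. X t \<omega>)" for \<omega>
      proof -
        have "P N t \<omega> = (\<Sum>\<alpha>\<in>index_box N. \<Sum>t'\<in>{t. \<forall>i. t $ i \<in> A'}. (\<Prod>i\<in>UNIV. g (\<alpha> i) (t $ i) * b (\<alpha> i) (t' $ i)) * X t' \<omega>)"
          unfolding P_def
        proof (intro sum.cong refl)
          fix \<alpha> :: "'d \<Rightarrow> nat" assume \<alpha>: "\<alpha> \<in> index_box N"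
          show "c \<alpha> \<omega> * tens \<alpha> t = (\<Sum>t'\<in>{t. \<forall>i. t $ i \<in> A'}. (\<Prod>i\<in>UNIV. g (\<alpha> i) (t $ i) * b (\<alpha> i) (t' $ i)) * X t' \<omega>)"
            unfolding coef_ext[OF \<alpha> A'(3,1)] elementary_functional_def tens_def sum_distrib_right prod.distrib
            by (intro sum.cong refl) (simp add: mult_ac)
        qed
        also have "\<dots> = (\<Sum>t'\<in>{t. \<forall>i. t $ i \<in> A'}. (\<Sum>\<alpha>\<in>index_box N. \<Prod>i\<in>UNIV. g (\<alpha> i) (t $ i) * b (\<alpha> i) (t' $ i)) * X t' \<omega>)"
          by (subst sum.swap) (simp add: sum_distrib_right)
        also have "\<dots> = elementary_functional A' v (\<lambda>t. X t \<omega>)"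
          unfolding elementary_functional_def v_def
          by (intro sum.cong refl arg_cong2[where f = "(*)"] sum_prod_index_box)
        finally show ?thesis .
      qed
      have k\<delta>: "kernel_comb k0 A' (\<delta> i) = ?k i" for i
      proof
        fix y
        have "(\<Sum>x\<in>A'. \<delta> i x * kernel_section unit_interval k0 x y) = (\<Sum>x\<in>A'. if x = t $ i then kernel_section unit_interval k0 x y else 0)"
          by (intro sum.cong refl) (simp add: \<delta>_def)
        then show "kernel_comb k0 A' (\<delta> i) y = ?k i y" using A' by simp
      qed
      have kv: "kernel_comb k0 A' (v i) = ?p N i" for i
      proof
        fix y
        have "kernel_comb k0 A' (v i) y = kernel_comb k0 (A N) (v i) y"
          by (rule sum.mono_neutral_right) (use A' v0 in auto)
        then show "kernel_comb k0 A' (v i) y = ?p N i y" by (simp add: v_def)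
      qed
      note cv = elementary_functional_covariance[OF int cov k0 A'(1,2)]
      have i: "integrable M (\<lambda>\<omega>. X t \<omega> * X t \<omega>)" "integrable M (\<lambda>\<omega>. X t \<omega> * P N t \<omega>)" "integrable M (\<lambda>\<omega>. P N t \<omega> * P N t \<omega>)"
        using cv(1)[of \<delta> \<delta>] cv(1)[of \<delta> v] cv(1)[of v v] unfolding X[symmetric] P[symmetric] by simp_all
      have e: "(\<integral>\<omega>. X t \<omega> * X t \<omega> \<partial>M) = (\<Prod>i\<in>UNIV. ip H0 (?k i) (?k i))"
        "(\<integral>\<omega>. X t \<omega> * P N t \<omega> \<partial>M) = (\<Prod>i\<in>UNIV. ip H0 (?k i) (?p N i))"
        "(\<integral>\<omega>. P N t \<omega> * P N t \<omega> \<partial>M) = (\<Prod>i\<in>UNIV. ip H0 (?p N i) (?p N i))"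
        using cv(2)[of \<delta> \<delta>] cv(2)[of \<delta> v] cv(2)[of v v] unfolding X[symmetric] P[symmetric] k\<delta> kv by simp_all
      have sq: "(X t \<omega> - P N t \<omega>)\<^sup>2 = X t \<omega> * X t \<omega> - 2 * (X t \<omega> * P N t \<omega>) + P N t \<omega> * P N t \<omega>" for \<omega>
        by (simp add: power2_eq_square algebra_simps)
      have isq: "integrable M (\<lambda>\<omega>. (X t \<omega> - P N t \<omega>)\<^sup>2)" unfolding sq using i by simp
      have "(\<integral>\<^sup>+\<omega>. ennreal ((X t \<omega> - P N t \<omega>)\<^sup>2) \<partial>M) = ennreal (\<integral>\<omega>. (X t \<omega> - P N t \<omega>)\<^sup>2 \<partial>M)"
        by (rule nn_integral_eq_integral[OF isq]) simp
      also have "(\<integral>\<omega>. (X t \<omega> - P N t \<omega>)\<^sup>2 \<partial>M) = (\<Prod>i\<in>UNIV. ip H0 (?k i) (?k i)) - 2 * (\<Prod>i\<in>UNIV. ip H0 (?k i) (?p N i)) + (\<Prod>i\<in>UNIV. ip H0 (?p N i) (?p N i))"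
        unfolding sq using i e by simp
      finally show ?thesis .
    qed
    have l: "(\<lambda>N. ip H0 (?k i) (?p N i)) \<longlonglongrightarrow> ip H0 (?k i) (?k i)" "(\<lambda>N. ip H0 (?p N i) (?p N i)) \<longlonglongrightarrow> ip H0 (?k i) (?k i)" for i
      by (rule H.tendsto_ip[OF combin[OF A_sub] kin[OF ti] approx[OF ti]])+
    have "(\<lambda>N. ennreal ((\<Prod>i\<in>UNIV. ip H0 (?k i) (?k i)) - 2 * (\<Prod>i\<in>UNIV. ip H0 (?k i) (?p N i)) + (\<Prod>i\<in>UNIV. ip H0 (?p N i) (?p N i))))
      \<longlonglongrightarrow> ennreal ((\<Prod>i\<in>UNIV. ip H0 (?k i) (?k i)) - 2 * (\<Prod>i\<in>UNIV. ip H0 (?k i) (?k i)) + (\<Prod>i\<in>UNIV. ip H0 (?k i) (?k i)))"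
      by (intro tendsto_ennrealI tendsto_intros l)
    then show ?thesis unfolding eqN by simp
  qed
  have XY: "AE \<omega> in M. X t \<omega> = Y t \<omega>" if t: "t \<in> unit_cube" for t
  proof -
    note [measurable] = meas[OF t] Ym[OF t]
    have "(\<integral>\<^sup>+\<omega>. ennreal ((X t \<omega> - Y t \<omega>)\<^sup>2) \<partial>M) = (\<integral>\<^sup>+\<omega>. liminf (\<lambda>N. ennreal ((X t \<omega> - P N t \<omega>)\<^sup>2)) \<partial>M)"
    proof (rule nn_integral_cong_AE)
      show "AE \<omega> in M. ennreal ((X t \<omega> - Y t \<omega>)\<^sup>2) = liminf (\<lambda>N. ennreal ((X t \<omega> - P N t \<omega>)\<^sup>2))"
        using good
      proof eventually_elim
        case (elim \<omega>)
        have "(\<lambda>N. ennreal ((X t \<omega> - P N t \<omega>)\<^sup>2)) \<longlonglongrightarrow> ennreal ((X t \<omega> - Y t \<omega>)\<^sup>2)"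
          by (intro tendsto_ennrealI tendsto_intros PY elim t)
        from lim_imp_Liminf[OF _ this] show ?case by simp
      qed
    qed
    also have "\<dots> \<le> liminf (\<lambda>N. \<integral>\<^sup>+\<omega>. ennreal ((X t \<omega> - P N t \<omega>)\<^sup>2) \<partial>M)"
      by (rule nn_integral_liminf) measurable
    also have "\<dots> = 0" using lim_imp_Liminf[OF _ lim0[OF t]] by simp
    finally have "(\<integral>\<^sup>+\<omega>. ennreal ((X t \<omega> - Y t \<omega>)\<^sup>2) \<partial>M) = 0" by simp
    then have "AE \<omega> in M. ennreal ((X t \<omega> - Y t \<omega>)\<^sup>2) = 0" by (subst (asm) nn_integral_0_iff_AE) auto
    then show ?thesis by eventually_elim (simp add: ennreal_eq_0_iff)
  qed
  have "version_of M unit_cube X Y"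
    unfolding version_of_def
  proof (intro conjI ballI Ym)
    fix t :: "real ^ 'd" assume t: "t \<in> unit_cube"
    note [measurable] = meas[OF t] Ym[OF t]
    have "{\<omega> \<in> space M. X t \<omega> = Y t \<omega>} \<in> sets M" by measurable
    from prob_Collect_eq_1[OF this] show "prob {\<omega> \<in> space M. X t \<omega> = Y t \<omega>} = 1" using XY[OF t] by simp
  qed
  moreover have "paths_in M unit_cube Y E.expansion_space"
  proof -
    have "sample_path unit_cube Y \<omega> \<in> fns E.expansion_space" for \<omega>
    proof (cases "S \<omega> \<noteq> \<infinity>")
      case True
      then have "sample_path unit_cube Y \<omega> = E.synthesis (\<lambda>\<alpha>. c \<alpha> \<omega>)"
        by (auto simp: sample_path_def Y_def zero_ext_def E.synthesis_def)
      then show ?thesis using E.synthesis_in[OF c_summable[OF True]] by simp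
    next
      case False
      then have "sample_path unit_cube Y \<omega> = (\<lambda>t. 0)" by (auto simp: sample_path_def Y_def zero_ext_def)
      then show ?thesis using function_rkhs.zero_in[OF function_rkhs.intro[OF E.rkhs_expansion_space]] by simp
    qed
    then have "{\<omega> \<in> space M. sample_path unit_cube Y \<omega> \<in> fns E.expansion_space} = space M" by auto
    then show ?thesis unfolding paths_in_def using prob_space by simp
  qed
  ultimately show ?thesis by blast
qed

end


section \<open>Sine series in rough Sobolev spaces\<close>

lemma gauss_kernel_integral:
  assumes e: "\<epsilon> > 0"
  shows "(\<integral>\<^sup>+y. ennreal (exp (- (((x - y) / \<epsilon>)\<^sup>2) / 2) / \<epsilon>) \<partial>lborel) = ennreal (sqrt (2 * pi))"
proof -
  have ge: "integrable lborel (\<lambda>z. exp (- ((z::real)\<^sup>2) / 2))"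
    using integrable_norm[OF gauss_fourier(1)[of 0]] by simp
  have "complex_of_real (\<integral>z. exp (- ((z::real)\<^sup>2) / 2) \<partial>lborel) = (\<integral>z. complex_of_real (exp (- ((z::real)\<^sup>2) / 2)) \<partial>lborel)"
    by (rule integral_complex_of_real[symmetric])
  also have "\<dots> = complex_of_real (sqrt (2 * pi))" using gauss_fourier(2)[of 0] by simp
  finally have g: "(\<integral>z. exp (- ((z::real)\<^sup>2) / 2) \<partial>lborel) = sqrt (2 * pi)" by (simp only: of_real_eq_iff)
  have "(\<integral>\<^sup>+y. ennreal (exp (- (((x - y) / \<epsilon>)\<^sup>2) / 2) / \<epsilon>) \<partial>lborel) = ennreal \<bar>\<epsilon>\<bar> * (\<integral>\<^sup>+z. ennreal (exp (- (((x - (x + \<epsilon> * z)) / \<epsilon>)\<^sup>2) / 2) / \<epsilon>) \<partial>lborel)"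
    using e by (intro nn_integral_real_affine) auto
  also have "\<dots> = (\<integral>\<^sup>+z. ennreal \<bar>\<epsilon>\<bar> * ennreal (exp (- (((x - (x + \<epsilon> * z)) / \<epsilon>)\<^sup>2) / 2) / \<epsilon>) \<partial>lborel)"
    by (rule nn_integral_cmult[symmetric]) measurable
  also have "\<dots> = (\<integral>\<^sup>+z. ennreal (exp (- (z\<^sup>2) / 2)) \<partial>lborel)"
    using e by (intro nn_integral_cong) (simp add: ennreal_mult[symmetric])
  also have "\<dots> = ennreal (\<integral>z. exp (- ((z::real)\<^sup>2) / 2) \<partial>lborel)"
    by (rule nn_integral_eq_integral[OF ge]) simp
  also have "\<dots> = ennreal (sqrt (2 * pi))" unfolding g ..
  finally show ?thesis .
qed

text \<open>One half of Plancherel's theorem. With a Gaussian weight the energy of the transform is \<open>\<integral>\<integral> h(x) h(y) k(x - y)\<close> for a Gaussian \<open>k\<close>, and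
\<open>2 \<bar>h(x) h(y)\<bar> \<le> h(x)\<^sup>2 + h(y)\<^sup>2\<close> reduces this to the total mass of \<open>k\<close>.\<close>

lemma truncated_fourier_smoothed_energy:
  assumes h: "continuous_on UNIV h" and e: "\<epsilon> > 0"
  shows "(\<integral>\<^sup>+\<xi>. ennreal (exp (- ((\<epsilon> * \<xi>)\<^sup>2) / 2) * (cmod (truncated_fourier h R \<xi>))\<^sup>2) \<partial>lborel)
     \<le> (\<integral>\<^sup>+x. ennreal (indicator {-R..R} x * (h x)\<^sup>2) \<partial>lborel)"
proof -
  have hm[measurable]: "h \<in> borel_measurable borel" by (rule borel_measurable_continuous_onI[OF h])
  define H where "H x = indicator {-R..R} x * h x" for x
  have [measurable]: "H \<in> borel_measurable borel" unfolding H_def by measurable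
  have Hi: "integrable lborel H"
    unfolding H_def using borel_integrable_compact[of "{-R..R}" h] continuous_on_subset[OF h] by (auto simp: indicator_def if_distrib cong: if_cong)
  define w where "w \<xi> = exp (- ((\<epsilon> * \<xi>)\<^sup>2) / 2)" for \<xi> :: real
  have [measurable]: "w \<in> borel_measurable borel" unfolding w_def by measurable
  have w0: "0 \<le> w \<xi>" for \<xi> by (simp add: w_def)
  have wi: "integrable lborel w"
    using integrable_norm[OF gauss_fourier_scaled(1)[OF e, of 0]] by (simp add: w_def[abs_def])
  define k where "k x y = exp (- (((x - y) / \<epsilon>)\<^sup>2) / 2) / \<epsilon>" for x y :: real
  have [measurable]: "(\<lambda>(x, y). k x y) \<in> borel_measurable (borel \<Otimes>\<^sub>M borel)" unfolding k_def by measurable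
  have [measurable]: "k x \<in> borel_measurable borel" for x unfolding k_def by measurable
  have k0: "0 \<le> k x y" for x y unfolding k_def using e by simp
  have ksym: "k x y = k y x" for x y unfolding k_def by (simp add: power2_commute power_divide)
  have kint: "(\<integral>\<^sup>+y. ennreal (k x y) \<partial>lborel) = ennreal (sqrt (2 * pi))" for x
    unfolding k_def by (rule gauss_kernel_integral[OF e])
  have kint': "(\<integral>\<^sup>+x. ennreal (k x y) \<partial>lborel) = ennreal (sqrt (2 * pi))" for y
  proof -
    have "(\<integral>\<^sup>+x. ennreal (k x y) \<partial>lborel) = (\<integral>\<^sup>+x. ennreal (k y x) \<partial>lborel)"
      by (intro nn_integral_cong arg_cong[where f = ennreal] ksym)
    then show ?thesis unfolding kint .
  qed
  let ?c = "1 / sqrt (2 * pi)"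
  define T where "T = truncated_fourier h R"
  have [measurable]: "T \<in> borel_measurable borel" unfolding T_def by measurable
  have Tdef: "T \<xi> = complex_of_real ?c * (\<integral>x. complex_of_real (H x) * cis (- (x * \<xi>)) \<partial>lborel)" for \<xi>
    unfolding T_def truncated_fourier_def set_lebesgue_integral_def H_def
    by (intro arg_cong2[where f = "(*)"] refl Bochner_Integration.integral_cong) (simp add: scaleR_conv_of_real)
  have cnjT: "cnj (T \<xi>) = complex_of_real ?c * (\<integral>x. complex_of_real (H x) * cis (x * \<xi>) \<partial>lborel)" for \<xi>
  proof -
    have "(\<integral>x. complex_of_real (H x) * cis (x * \<xi>) \<partial>lborel) = (\<integral>x. cnj (complex_of_real (H x) * cis (- (x * \<xi>))) \<partial>lborel)"
      by (intro Bochner_Integration.integral_cong refl) (simp add: cis_cnj)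
    also have "\<dots> = cnj (\<integral>x. complex_of_real (H x) * cis (- (x * \<xi>)) \<partial>lborel)" by (rule Bochner_Integration.integral_cnj)
    finally show ?thesis unfolding Tdef complex_cnj_mult by simp
  qed
  have Tb: "cmod (T \<xi>) \<le> ?c * (\<integral>x. \<bar>H x\<bar> \<partial>lborel)" for \<xi>
  proof -
    have "cmod (\<integral>x. complex_of_real (H x) * cis (- (x * \<xi>)) \<partial>lborel) \<le> (\<integral>x. cmod (complex_of_real (H x) * cis (- (x * \<xi>))) \<partial>lborel)"
      by (rule integral_norm_bound)
    then have "cmod (\<integral>x. complex_of_real (H x) * cis (- (x * \<xi>)) \<partial>lborel) \<le> (\<integral>x. \<bar>H x\<bar> \<partial>lborel)" by simp
    then show ?thesis unfolding Tdef norm_mult by (simp add: divide_right_mono norm_divide)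
  qed
  let ?B = "?c * (\<integral>x. \<bar>H x\<bar> \<partial>lborel)"
  have wTi: "integrable lborel (\<lambda>\<xi>. complex_of_real (w \<xi>) * T \<xi>)"
  proof (rule Bochner_Integration.integrable_bound)
    show "integrable lborel (\<lambda>\<xi>. w \<xi> * ?B)" using wi by simp
    show "AE \<xi> in lborel. norm (complex_of_real (w \<xi>) * T \<xi>) \<le> norm (w \<xi> * ?B)"
    proof (intro AE_I2)
      fix \<xi>
      have "norm (complex_of_real (w \<xi>) * T \<xi>) = w \<xi> * cmod (T \<xi>)" using w0 by (simp add: norm_mult)
      also have "\<dots> \<le> w \<xi> * ?B" by (rule mult_left_mono[OF Tb w0])
      also have "\<dots> \<le> norm (w \<xi> * ?B)" unfolding real_norm_def by (rule abs_ge_self)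
      finally show "norm (complex_of_real (w \<xi>) * T \<xi>) \<le> norm (w \<xi> * ?B)" .
    qed
  qed simp
  have int: "integrable (lborel \<Otimes>\<^sub>M lborel) (\<lambda>(x, \<xi>). complex_of_real (H x) * (complex_of_real (w \<xi>) * cis (x * \<xi>) * T \<xi>))"
  proof (rule lborel_pair.Fubini_integrable)
    show "integrable lborel (\<lambda>x. \<integral>\<xi>. norm (case (x, \<xi>) of (x, \<xi>) \<Rightarrow> complex_of_real (H x) * (complex_of_real (w \<xi>) * cis (x * \<xi>) * T \<xi>)) \<partial>lborel)"
      using Hi by (simp add: norm_mult)
    show "AE x in lborel. integrable lborel (\<lambda>\<xi>. case (x, \<xi>) of (x, \<xi>) \<Rightarrow> complex_of_real (H x) * (complex_of_real (w \<xi>) * cis (x * \<xi>) * T \<xi>))"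
      by (intro AE_I2) (simp, intro integrable_mult_right Bochner_Integration.integrable_bound[OF wTi], auto simp: norm_mult)
  qed measurable
  have E1: "(\<integral>\<xi>. complex_of_real (w \<xi> * (cmod (T \<xi>))\<^sup>2) \<partial>lborel) = complex_of_real (?c * (\<integral>x. H x * (\<integral>y. H y * k x y \<partial>lborel) \<partial>lborel))"
  proof -
    have "(\<integral>\<xi>. complex_of_real (w \<xi> * (cmod (T \<xi>))\<^sup>2) \<partial>lborel) = (\<integral>\<xi>. complex_of_real ?c * (\<integral>x. complex_of_real (H x) * (complex_of_real (w \<xi>) * cis (x * \<xi>) * T \<xi>) \<partial>lborel) \<partial>lborel)"
    proof (intro Bochner_Integration.integral_cong refl)
      fix \<xi>
      have "complex_of_real (w \<xi> * (cmod (T \<xi>))\<^sup>2) = (complex_of_real (w \<xi>) * T \<xi>) * cnj (T \<xi>)"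
        unfolding of_real_mult complex_norm_square by (simp add: mult.assoc)
      also have "\<dots> = complex_of_real ?c * (\<integral>x. (complex_of_real (w \<xi>) * T \<xi>) * (complex_of_real (H x) * cis (x * \<xi>)) \<partial>lborel)"
        unfolding cnjT integral_mult_right_zero by (simp only: mult.left_commute)
      finally show "complex_of_real (w \<xi> * (cmod (T \<xi>))\<^sup>2) = complex_of_real ?c * (\<integral>x. complex_of_real (H x) * (complex_of_real (w \<xi>) * cis (x * \<xi>) * T \<xi>) \<partial>lborel)"
        by (simp only: mult_ac)
    qed
    also have "\<dots> = complex_of_real ?c * (\<integral>\<xi>. \<integral>x. complex_of_real (H x) * (complex_of_real (w \<xi>) * cis (x * \<xi>) * T \<xi>) \<partial>lborel \<partial>lborel)"
      by (rule integral_mult_right_zero)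
    also have "(\<integral>\<xi>. \<integral>x. complex_of_real (H x) * (complex_of_real (w \<xi>) * cis (x * \<xi>) * T \<xi>) \<partial>lborel \<partial>lborel) = (\<integral>x. \<integral>\<xi>. complex_of_real (H x) * (complex_of_real (w \<xi>) * cis (x * \<xi>) * T \<xi>) \<partial>lborel \<partial>lborel)"
      by (rule lborel_pair.Fubini_integral) (use int in simp)
    also have "\<dots> = (\<integral>x. complex_of_real (H x * (\<integral>y. H y * k x y \<partial>lborel)) \<partial>lborel)"
      unfolding integral_mult_right_zero
      using smoothed_truncated_fourier[OF h e, of _ R] by (simp add: w_def T_def H_def k_def)
    also have "\<dots> = complex_of_real (\<integral>x. H x * (\<integral>y. H y * k x y \<partial>lborel) \<partial>lborel)"
      by (rule integral_complex_of_real)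
    finally show ?thesis by (simp only: of_real_mult)
  qed
  have wTi2: "integrable lborel (\<lambda>\<xi>. w \<xi> * (cmod (T \<xi>))\<^sup>2)"
  proof (rule Bochner_Integration.integrable_bound)
    show "integrable lborel (\<lambda>\<xi>. w \<xi> * ?B\<^sup>2)" using wi by simp
    show "AE \<xi> in lborel. norm (w \<xi> * (cmod (T \<xi>))\<^sup>2) \<le> norm (w \<xi> * ?B\<^sup>2)"
    proof (intro AE_I2)
      fix \<xi>
      have "norm (w \<xi> * (cmod (T \<xi>))\<^sup>2) = w \<xi> * (cmod (T \<xi>))\<^sup>2" using w0 by (simp add: abs_mult)
      also have "\<dots> \<le> w \<xi> * ?B\<^sup>2" by (intro mult_left_mono power_mono Tb w0) simp
      also have "\<dots> \<le> norm (w \<xi> * ?B\<^sup>2)" unfolding real_norm_def by (rule abs_ge_self)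
      finally show "norm (w \<xi> * (cmod (T \<xi>))\<^sup>2) \<le> norm (w \<xi> * ?B\<^sup>2)" .
    qed
  qed simp
  define N2 where "N2 = (\<integral>\<^sup>+x. ennreal ((H x)\<^sup>2) \<partial>lborel)"
  have "(\<integral>\<^sup>+\<xi>. ennreal (w \<xi> * (cmod (T \<xi>))\<^sup>2) \<partial>lborel) = ennreal (\<integral>\<xi>. w \<xi> * (cmod (T \<xi>))\<^sup>2 \<partial>lborel)"
    using w0 by (intro nn_integral_eq_integral wTi2) auto
  also have "(\<integral>\<xi>. w \<xi> * (cmod (T \<xi>))\<^sup>2 \<partial>lborel) = ?c * (\<integral>x. H x * (\<integral>y. H y * k x y \<partial>lborel) \<partial>lborel)"
    using E1 unfolding integral_complex_of_real of_real_eq_iff .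
  also have "ennreal \<dots> \<le> ennreal ?c * (\<integral>\<^sup>+x. \<integral>\<^sup>+y. ennreal (\<bar>H x\<bar> * \<bar>H y\<bar> * k x y) \<partial>lborel \<partial>lborel)"
  proof -
    have "ennreal (?c * (\<integral>x. H x * (\<integral>y. H y * k x y \<partial>lborel) \<partial>lborel)) \<le> ennreal ?c * ennreal \<bar>\<integral>x. H x * (\<integral>y. H y * k x y \<partial>lborel) \<partial>lborel\<bar>"
      by (subst ennreal_mult[symmetric]) (auto intro!: ennreal_leI divide_right_mono)
    also have "ennreal \<bar>\<integral>x. H x * (\<integral>y. H y * k x y \<partial>lborel) \<partial>lborel\<bar> \<le> (\<integral>\<^sup>+x. ennreal (norm (H x * (\<integral>y. H y * k x y \<partial>lborel))) \<partial>lborel)"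
    proof (cases "integrable lborel (\<lambda>x. H x * (\<integral>y. H y * k x y \<partial>lborel))")
      case True
      show ?thesis using integral_norm_bound_ennreal[OF True] by simp
    qed (simp add: not_integrable_integral_eq)
    also have "\<dots> \<le> (\<integral>\<^sup>+x. \<integral>\<^sup>+y. ennreal (\<bar>H x\<bar> * \<bar>H y\<bar> * k x y) \<partial>lborel \<partial>lborel)"
    proof (intro nn_integral_mono)
      fix x
      have "ennreal (norm (\<integral>y. H y * k x y \<partial>lborel)) \<le> (\<integral>\<^sup>+y. ennreal (norm (H y * k x y)) \<partial>lborel)"
      proof (cases "integrable lborel (\<lambda>y. H y * k x y)")
        case True
        show ?thesis using integral_norm_bound_ennreal[OF True] by simp
      qed (simp add: not_integrable_integral_eq)
      then have "ennreal \<bar>H x\<bar> * ennreal (norm (\<integral>y. H y * k x y \<partial>lborel)) \<le> ennreal \<bar>H x\<bar> * (\<integral>\<^sup>+y. ennreal (norm (H y * k x y)) \<partial>lborel)"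
        by (rule mult_left_mono) simp
      also have "\<dots> = (\<integral>\<^sup>+y. ennreal \<bar>H x\<bar> * ennreal (norm (H y * k x y)) \<partial>lborel)"
        by (rule nn_integral_cmult[symmetric]) measurable
      also have "\<dots> = (\<integral>\<^sup>+y. ennreal (\<bar>H x\<bar> * \<bar>H y\<bar> * k x y) \<partial>lborel)"
        using k0 by (intro nn_integral_cong) (simp add: ennreal_mult[symmetric] abs_mult mult.assoc)
      finally show "ennreal (norm (H x * (\<integral>y. H y * k x y \<partial>lborel))) \<le> (\<integral>\<^sup>+y. ennreal (\<bar>H x\<bar> * \<bar>H y\<bar> * k x y) \<partial>lborel)"
        by (simp add: abs_mult ennreal_mult)
    qed
    finally show ?thesis by (simp add: mult_left_mono)
  qed
  also have "\<dots> \<le> ennreal ?c * (ennreal (1/2) * (ennreal (sqrt (2 * pi)) * N2) + ennreal (1/2) * (ennreal (sqrt (2 * pi)) * N2))"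
  proof (intro mult_left_mono)
    have "(\<integral>\<^sup>+x. \<integral>\<^sup>+y. ennreal (\<bar>H x\<bar> * \<bar>H y\<bar> * k x y) \<partial>lborel \<partial>lborel)
       \<le> (\<integral>\<^sup>+x. \<integral>\<^sup>+y. ennreal (1/2) * (ennreal ((H x)\<^sup>2) * ennreal (k x y)) + ennreal (1/2) * (ennreal ((H y)\<^sup>2) * ennreal (k x y)) \<partial>lborel \<partial>lborel)"
    proof (intro nn_integral_mono)
      fix x y
      have "0 \<le> (\<bar>H x\<bar> - \<bar>H y\<bar>)\<^sup>2" by simp
      then have "\<bar>H x\<bar> * \<bar>H y\<bar> \<le> 1/2 * (H x)\<^sup>2 + 1/2 * (H y)\<^sup>2" by (simp add: power2_diff)
      then have "\<bar>H x\<bar> * \<bar>H y\<bar> * k x y \<le> (1/2 * (H x)\<^sup>2 + 1/2 * (H y)\<^sup>2) * k x y" using k0 by (rule mult_right_mono)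
      then have "ennreal (\<bar>H x\<bar> * \<bar>H y\<bar> * k x y) \<le> ennreal (1/2 * ((H x)\<^sup>2 * k x y) + 1/2 * ((H y)\<^sup>2 * k x y))"
        by (intro ennreal_leI) (simp add: algebra_simps)
      also have "\<dots> = ennreal (1/2 * ((H x)\<^sup>2 * k x y)) + ennreal (1/2 * ((H y)\<^sup>2 * k x y))"
        using k0 by (intro ennreal_plus) auto
      also have "\<dots> = ennreal (1/2) * (ennreal ((H x)\<^sup>2) * ennreal (k x y)) + ennreal (1/2) * (ennreal ((H y)\<^sup>2) * ennreal (k x y))"
      proof -
        have p: "ennreal (1/2 * (a * b)) = ennreal (1/2) * (ennreal a * ennreal b)" if "0 \<le> a" "0 \<le> b" for a b
          using that ennreal_mult[of "1/2" "a * b"] ennreal_mult[of a b] by simp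
        show ?thesis by (simp only: p[OF zero_le_power2 k0])
      qed
      finally show "ennreal (\<bar>H x\<bar> * \<bar>H y\<bar> * k x y) \<le> ennreal (1/2) * (ennreal ((H x)\<^sup>2) * ennreal (k x y)) + ennreal (1/2) * (ennreal ((H y)\<^sup>2) * ennreal (k x y))" .
    qed
    also have "\<dots> = ennreal (1/2) * (\<integral>\<^sup>+x. \<integral>\<^sup>+y. ennreal ((H x)\<^sup>2) * ennreal (k x y) \<partial>lborel \<partial>lborel) + ennreal (1/2) * (\<integral>\<^sup>+x. \<integral>\<^sup>+y. ennreal ((H y)\<^sup>2) * ennreal (k x y) \<partial>lborel \<partial>lborel)"
      by (simp add: nn_integral_add nn_integral_cmult)
    also have "(\<integral>\<^sup>+x. \<integral>\<^sup>+y. ennreal ((H y)\<^sup>2) * ennreal (k x y) \<partial>lborel \<partial>lborel) = (\<integral>\<^sup>+y. \<integral>\<^sup>+x. ennreal ((H y)\<^sup>2) * ennreal (k x y) \<partial>lborel \<partial>lborel)"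
      by (rule lborel_pair.Fubini') measurable
    also have "(\<integral>\<^sup>+y. \<integral>\<^sup>+x. ennreal ((H y)\<^sup>2) * ennreal (k x y) \<partial>lborel \<partial>lborel) = ennreal (sqrt (2 * pi)) * N2"
      by (simp add: nn_integral_cmult kint' nn_integral_multc N2_def mult.commute)
    also have "(\<integral>\<^sup>+x. \<integral>\<^sup>+y. ennreal ((H x)\<^sup>2) * ennreal (k x y) \<partial>lborel \<partial>lborel) = ennreal (sqrt (2 * pi)) * N2"
      by (simp add: nn_integral_cmult kint nn_integral_multc N2_def mult.commute)
    finally show "(\<integral>\<^sup>+x. \<integral>\<^sup>+y. ennreal (\<bar>H x\<bar> * \<bar>H y\<bar> * k x y) \<partial>lborel \<partial>lborel) \<le> ennreal (1/2) * (ennreal (sqrt (2 * pi)) * N2) + ennreal (1/2) * (ennreal (sqrt (2 * pi)) * N2)" .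
  qed simp
  also have "\<dots> = N2"
  proof -
    have "ennreal (1/2) * (ennreal (sqrt (2 * pi)) * N2) + ennreal (1/2) * (ennreal (sqrt (2 * pi)) * N2) = (ennreal (1/2) + ennreal (1/2)) * (ennreal (sqrt (2 * pi)) * N2)"
      by (rule distrib_right[symmetric])
    also have "ennreal (1/2) + ennreal (1/2) = 1" by (subst ennreal_plus[symmetric]) simp_all
    finally have "ennreal ?c * (ennreal (1/2) * (ennreal (sqrt (2 * pi)) * N2) + ennreal (1/2) * (ennreal (sqrt (2 * pi)) * N2)) = (ennreal ?c * ennreal (sqrt (2 * pi))) * N2"
      by (simp add: mult.assoc)
    also have "ennreal ?c * ennreal (sqrt (2 * pi)) = 1" by (subst ennreal_mult[symmetric]) auto
    finally show ?thesis by simp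
  qed
  also have "N2 = (\<integral>\<^sup>+x. ennreal (indicator {-R..R} x * (h x)\<^sup>2) \<partial>lborel)"
    unfolding N2_def H_def by (intro nn_integral_cong) (auto simp: indicator_def)
  finally show ?thesis by (simp add: w_def T_def)
qed

lemma truncated_fourier_energy:
  assumes h: "continuous_on UNIV h"
  shows "(\<integral>\<^sup>+\<xi>. ennreal ((cmod (truncated_fourier h R \<xi>))\<^sup>2) \<partial>lborel)
     \<le> (\<integral>\<^sup>+x. ennreal (indicator {-R..R} x * (h x)\<^sup>2) \<partial>lborel)"
proof -
  have hm[measurable]: "h \<in> borel_measurable borel" by (rule borel_measurable_continuous_onI[OF h])
  define e where "e n = inverse (real (Suc n))" for n
  have e0: "e \<longlonglongrightarrow> 0" unfolding e_def by (rule LIMSEQ_inverse_real_of_nat)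
  have epos: "e n > 0" for n by (simp add: e_def)
  let ?f = "\<lambda>n \<xi>. ennreal (exp (- ((e n * \<xi>)\<^sup>2) / 2) * (cmod (truncated_fourier h R \<xi>))\<^sup>2)"
  have "(\<integral>\<^sup>+\<xi>. ennreal ((cmod (truncated_fourier h R \<xi>))\<^sup>2) \<partial>lborel) = (\<integral>\<^sup>+\<xi>. liminf (\<lambda>n. ?f n \<xi>) \<partial>lborel)"
  proof (intro nn_integral_cong)
    fix \<xi>
    have "(\<lambda>n. ?f n \<xi>) \<longlonglongrightarrow> ennreal (exp (- ((0 * \<xi>)\<^sup>2) / 2) * (cmod (truncated_fourier h R \<xi>))\<^sup>2)"
      by (intro tendsto_ennrealI tendsto_intros e0) auto
    from lim_imp_Liminf[OF _ this]
    show "ennreal ((cmod (truncated_fourier h R \<xi>))\<^sup>2) = liminf (\<lambda>n. ?f n \<xi>)" by simp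
  qed
  also have "\<dots> \<le> liminf (\<lambda>n. \<integral>\<^sup>+\<xi>. ?f n \<xi> \<partial>lborel)" by (rule nn_integral_liminf) measurable
  also have "\<dots> \<le> (\<integral>\<^sup>+x. ennreal (indicator {-R..R} x * (h x)\<^sup>2) \<partial>lborel)"
    by (intro Liminf_le eventuallyI truncated_fourier_smoothed_energy[OF h epos] sequentially_bot)
  finally show ?thesis .
qed

lemma truncated_fourier_derivative:
  assumes h: "\<And>x. (h has_real_derivative h' x) (at x)" and h': "continuous_on UNIV h'"
    and R: "0 \<le> R" and b: "h R = 0" "h (-R) = 0"
  shows "truncated_fourier h' R \<xi> = \<i> * complex_of_real \<xi> * truncated_fourier h R \<xi>"
proof -
  have hc: "continuous_on UNIV h" by (intro continuous_at_imp_continuous_on ballI) (use h DERIV_isCont in blast)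
  let ?I = "\<lambda>g. \<integral>x. indicator {-R..R} x *\<^sub>R (complex_of_real (g x) * cis (- (x * \<xi>))) \<partial>lborel"
  have i: "integrable lborel (\<lambda>x. indicator {-R..R} x *\<^sub>R (complex_of_real (g x) * cis (- (x * \<xi>))))" if "continuous_on UNIV g" for g
    by (rule borel_integrable_compact) (auto intro!: continuous_intros continuous_on_subset[OF that])
  have "(\<integral>x. indicator {-R..R} x *\<^sub>R (complex_of_real (h' x) * cis (- (x * \<xi>)) - \<i> * complex_of_real \<xi> * (complex_of_real (h x) * cis (- (x * \<xi>)))) \<partial>lborel)
     = complex_of_real (h R) * cis (- (R * \<xi>)) - complex_of_real (h (-R)) * cis (- (- R * \<xi>))"
  proof (rule integral_FTC_Icc)
    fix x
    have c: "((\<lambda>x. cis (- (x * \<xi>))) has_vector_derivative (- \<xi>) *\<^sub>R (\<i> * cis (- (x * \<xi>)))) (at x within {-R..R})"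
    proof -
      have "((\<lambda>x. cis x) has_vector_derivative \<i> * cis (- (x * \<xi>))) (at (- (x * \<xi>)))" for x
        using has_derivative_cis[of "\<lambda>x. x" "\<lambda>x. x" "- (x * \<xi>)" UNIV]
        by (simp add: has_vector_derivative_def scaleR_conv_of_real mult_ac)
      moreover have "((\<lambda>x. - (x * \<xi>)) has_vector_derivative - \<xi>) (at x within {-R..R})"
        by (auto intro!: derivative_eq_intros simp: has_real_derivative_iff_has_vector_derivative[symmetric])
      ultimately show ?thesis
        using vector_diff_chain_within[of "\<lambda>x. - (x * \<xi>)" "- \<xi>" x "{-R..R}" cis "\<i> * cis (- (x * \<xi>))"]
        by (auto simp: o_def intro: has_vector_derivative_at_within)
    qed
    have d: "((\<lambda>x. complex_of_real (h x)) has_vector_derivative complex_of_real (h' x)) (at x within {-R..R})"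
      using has_vector_derivative_of_real[OF h[of x]]
      by (auto intro: has_vector_derivative_at_within)
    have "((\<lambda>x. complex_of_real (h x) * cis (- (x * \<xi>))) has_vector_derivative
       complex_of_real (h x) * ((- \<xi>) *\<^sub>R (\<i> * cis (- (x * \<xi>)))) + complex_of_real (h' x) * cis (- (x * \<xi>))) (at x within {-R..R})"
      by (rule has_vector_derivative_mult[OF d c])
    then show "((\<lambda>x. complex_of_real (h x) * cis (- (x * \<xi>))) has_vector_derivative
       complex_of_real (h' x) * cis (- (x * \<xi>)) - \<i> * complex_of_real \<xi> * (complex_of_real (h x) * cis (- (x * \<xi>)))) (at x within {-R..R})"
      by (simp add: scaleR_conv_of_real algebra_simps)
  qed (use R in \<open>auto intro!: continuous_intros continuous_on_subset[OF hc] continuous_on_subset[OF h']\<close>)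
  also have "\<dots> = 0" using b by simp
  finally have z: "(\<integral>x. indicator {-R..R} x *\<^sub>R (complex_of_real (h' x) * cis (- (x * \<xi>)) - \<i> * complex_of_real \<xi> * (complex_of_real (h x) * cis (- (x * \<xi>)))) \<partial>lborel) = 0" .
  have "(\<integral>x. indicator {-R..R} x *\<^sub>R (complex_of_real (h' x) * cis (- (x * \<xi>)) - \<i> * complex_of_real \<xi> * (complex_of_real (h x) * cis (- (x * \<xi>)))) \<partial>lborel)
    = (\<integral>x. indicator {-R..R} x *\<^sub>R (complex_of_real (h' x) * cis (- (x * \<xi>))) - (\<i> * complex_of_real \<xi>) * (indicator {-R..R} x *\<^sub>R (complex_of_real (h x) * cis (- (x * \<xi>)))) \<partial>lborel)"
    by (intro Bochner_Integration.integral_cong refl) (simp add: scaleR_conv_of_real algebra_simps)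
  also have "\<dots> = ?I h' - (\<integral>x. (\<i> * complex_of_real \<xi>) * (indicator {-R..R} x *\<^sub>R (complex_of_real (h x) * cis (- (x * \<xi>)))) \<partial>lborel)"
    by (rule Bochner_Integration.integral_diff[OF i[OF h'] integrable_mult_right[OF i[OF hc]]])
  also have "(\<integral>x. (\<i> * complex_of_real \<xi>) * (indicator {-R..R} x *\<^sub>R (complex_of_real (h x) * cis (- (x * \<xi>)))) \<partial>lborel) = (\<i> * complex_of_real \<xi>) * ?I h"
    by (rule integral_mult_right_zero)
  finally have "?I h' = (\<i> * complex_of_real \<xi>) * ?I h" using z by simp
  then show ?thesis by (simp add: truncated_fourier_def set_lebesgue_integral_def mult.left_commute)
qed

definition sine_sum :: "(nat \<Rightarrow> real) \<Rightarrow> nat \<Rightarrow> real \<Rightarrow> real" where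
  "sine_sum c n x = (\<Sum>k<n. c k / real (Suc k) * sin (pi * real (Suc k) * x))"

definition sine_series :: "(nat \<Rightarrow> real) \<Rightarrow> real \<Rightarrow> real" where
  "sine_series c x = (\<Sum>k. c k / real (Suc k) * sin (pi * real (Suc k) * x))"

lemma cos_orthogonal:
  "(\<integral>x. indicator {-1..1} x *\<^sub>R (cos (pi * real (Suc j) * x) * cos (pi * real (Suc k) * x)) \<partial>lborel) = (if j = k then 1 else 0)"
proof -
  have c: "(\<integral>x. indicator {-1..1} x *\<^sub>R cos (pi * of_int m * x) \<partial>lborel) = (if m = 0 then 2 else 0)" for m :: int
  proof (cases "m = 0")
    case False
    have "(\<integral>x. indicator {-1..1} x *\<^sub>R cos (pi * of_int m * x) \<partial>lborel) = sin (pi * of_int m * 1) / (pi * of_int m) - sin (pi * of_int m * (-1)) / (pi * of_int m)"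
    proof (rule integral_FTC_Icc)
      fix x
      show "((\<lambda>x. sin (pi * of_int m * x) / (pi * of_int m)) has_vector_derivative cos (pi * of_int m * x)) (at x within {-1..1})"
        unfolding has_real_derivative_iff_has_vector_derivative[symmetric]
        using False by (auto intro!: derivative_eq_intros)
    qed (auto intro!: continuous_intros)
    also have "\<dots> = 0" by simp
    finally show ?thesis using False by simp
  qed simp
  have i: "integrable lborel (\<lambda>x. indicator {-1..1} x *\<^sub>R cos (pi * of_int m * x))" for m :: int
    by (rule borel_integrable_compact) (auto intro!: continuous_intros)
  have "cos (pi * real (Suc j) * x) * cos (pi * real (Suc k) * x) = (cos (pi * of_int (int j - int k) * x) + cos (pi * of_int (int j + int k + 2) * x)) / 2" for x
    unfolding cos_times_cos by (simp add: algebra_simps)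
  then have eq: "indicator {-1..1} x *\<^sub>R (cos (pi * real (Suc j) * x) * cos (pi * real (Suc k) * x)) = (indicator {-1..1} x *\<^sub>R cos (pi * of_int (int j - int k) * x) + indicator {-1..1} x *\<^sub>R cos (pi * of_int (int j + int k + 2) * x)) / 2" for x :: real
    by (simp only: real_scaleR_def distrib_left times_divide_eq_right)
  have "(\<integral>x. indicator {-1..1} x *\<^sub>R (cos (pi * real (Suc j) * x) * cos (pi * real (Suc k) * x)) \<partial>lborel)
     = (\<integral>x. (indicator {-1..1} x *\<^sub>R cos (pi * of_int (int j - int k) * x) + indicator {-1..1} x *\<^sub>R cos (pi * of_int (int j + int k + 2) * x)) / 2 \<partial>lborel)"
    by (simp only: eq)
  also have "\<dots> = ((if int j - int k = 0 then 2 else 0) + (if int j + int k + 2 = 0 then 2 else 0)) / 2"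
    by (simp only: integral_divide_zero Bochner_Integration.integral_add[OF i i] c)
  finally show ?thesis by auto
qed


context
  fixes c :: "nat \<Rightarrow> real"
  assumes c: "(\<lambda>k. (c k)\<^sup>2) summable_on UNIV"
begin

lemma sine_coefficients_summable: "summable (\<lambda>k. \<bar>c k\<bar> / real (Suc k))"
proof (rule summable_comparison_test')
  have "summable (\<lambda>k. inverse (real (Suc k) ^ 2))" using inverse_power_summable[of 2, where 'a = real] summable_Suc_iff[of "\<lambda>k. inverse (real k ^ 2)"] by simp
  moreover have "summable (\<lambda>k. (c k)\<^sup>2)" using c summable_on_UNIV_nonneg_real_iff[of "\<lambda>k. (c k)\<^sup>2"] by simp
  ultimately show "summable (\<lambda>k. ((c k)\<^sup>2 + inverse (real (Suc k) ^ 2)) / 2)" by (intro summable_divide summable_add)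
  fix k :: nat
  have "0 \<le> (\<bar>c k\<bar> - inverse (real (Suc k)))\<^sup>2" by simp
  then have "2 * (\<bar>c k\<bar> * inverse (real (Suc k))) \<le> (c k)\<^sup>2 + (inverse (real (Suc k)))\<^sup>2" unfolding power2_diff power2_abs by linarith
  then show "norm (\<bar>c k\<bar> / real (Suc k)) \<le> ((c k)\<^sup>2 + inverse (real (Suc k) ^ 2)) / 2"
    by (simp only: divide_inverse power_inverse real_norm_def abs_mult abs_abs abs_inverse) simp
qed

lemma sine_term_bound: "\<bar>c k / real (Suc k) * sin (pi * real (Suc k) * x)\<bar> \<le> \<bar>c k\<bar> / real (Suc k)"
proof -
  have "\<bar>c k / real (Suc k)\<bar> * \<bar>sin (pi * real (Suc k) * x)\<bar> \<le> \<bar>c k / real (Suc k)\<bar> * 1"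
    by (intro mult_left_mono) auto
  then show ?thesis unfolding abs_mult by simp
qed

lemma sine_sum_bound: "\<bar>sine_sum c n x\<bar> \<le> (\<Sum>k. \<bar>c k\<bar> / real (Suc k))"
proof -
  have "\<bar>sine_sum c n x\<bar> \<le> (\<Sum>k<n. \<bar>c k\<bar> / real (Suc k))" unfolding sine_sum_def
    by (rule order_trans[OF sum_abs sum_mono[OF sine_term_bound]])
  also have "\<dots> \<le> (\<Sum>k. \<bar>c k\<bar> / real (Suc k))" by (intro sum_le_suminf sine_coefficients_summable) auto
  finally show ?thesis .
qed

lemma sine_series_uniform_limit: "uniform_limit UNIV (sine_sum c) (sine_series c) sequentially"
  unfolding sine_sum_def[abs_def] sine_series_def[abs_def]
  by (rule Weierstrass_m_test[OF _ sine_coefficients_summable]) (use sine_term_bound in simp)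

lemma sine_sum_tendsto: "(\<lambda>n. sine_sum c n x) \<longlonglongrightarrow> sine_series c x"
  using tendsto_uniform_limitI[OF sine_series_uniform_limit, of x] by simp

lemma sine_series_bound: "\<bar>sine_series c x\<bar> \<le> (\<Sum>k. \<bar>c k\<bar> / real (Suc k))"
  by (rule LIMSEQ_le_const2[OF tendsto_rabs[OF sine_sum_tendsto]]) (use sine_sum_bound in auto)

lemma continuous_sine_sum: "continuous_on A (sine_sum c n)"
  unfolding sine_sum_def by (intro continuous_intros)

lemma continuous_sine_series: "continuous_on UNIV (sine_series c)"
  by (rule uniform_limit_theorem[OF _ sine_series_uniform_limit]) (simp_all add: continuous_sine_sum always_eventually)

text \<open>The partial sums vanish at \<open>\<plusminus>1\<close>, so truncation to \<open>[-1,1]\<close> commutes with differentiation and \<open>\<xi>\<^sup>2\<close> times the energy density is that of the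
derivative, a cosine sum with coefficients \<open>\<pi> c k\<close>. The bound does not depend on \<open>n\<close>.\<close>

lemma sine_sum_energy:
  "(\<integral>\<^sup>+\<xi>. ennreal ((1 + \<xi>\<^sup>2) * (cmod (truncated_fourier (sine_sum c n) 1 \<xi>))\<^sup>2) \<partial>lborel)
     \<le> ennreal (2 * (\<Sum>k. \<bar>c k\<bar> / real (Suc k))\<^sup>2) + ennreal (pi\<^sup>2 * (\<Sum>\<^sub>\<infinity>k. (c k)\<^sup>2))"
proof -
  define h' where "h' x = (\<Sum>k<n. (pi * c k) * cos (pi * real (Suc k) * x))" for x
  have h'c: "continuous_on A h'" for A unfolding h'_def by (intro continuous_intros)
  have d: "(sine_sum c n has_real_derivative h' x) (at x)" for x
  proof -
    have "((\<lambda>x. c k / a * sin (pi * a * x)) has_real_derivative (pi * c k) * cos (pi * a * x)) (at x)" if "a \<noteq> 0" for k and a :: real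
      using that by (auto intro!: derivative_eq_intros)
    then show ?thesis unfolding sine_sum_def h'_def by (intro DERIV_sum) simp
  qed
  have b: "sine_sum c n 1 = 0" "sine_sum c n (-1) = 0"
    unfolding sine_sum_def by (auto intro!: sum.neutral simp: sin_npi2 simp del: of_nat_Suc)
  have FT: "truncated_fourier h' 1 \<xi> = \<i> * complex_of_real \<xi> * truncated_fourier (sine_sum c n) 1 \<xi>" for \<xi>
    by (rule truncated_fourier_derivative[OF d h'c _ b]) simp
  have [measurable]: "truncated_fourier (sine_sum c n) 1 \<in> borel_measurable borel" "truncated_fourier h' 1 \<in> borel_measurable borel"
    using borel_measurable_continuous_onI[OF h'c[of UNIV]] borel_measurable_continuous_onI[OF continuous_sine_sum[of UNIV n]] by measurable
  have "(\<integral>\<^sup>+\<xi>. ennreal ((1 + \<xi>\<^sup>2) * (cmod (truncated_fourier (sine_sum c n) 1 \<xi>))\<^sup>2) \<partial>lborel)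
     = (\<integral>\<^sup>+\<xi>. ennreal ((cmod (truncated_fourier (sine_sum c n) 1 \<xi>))\<^sup>2) + ennreal ((cmod (truncated_fourier h' 1 \<xi>))\<^sup>2) \<partial>lborel)"
    by (intro nn_integral_cong, subst ennreal_plus[symmetric]) (auto simp: FT norm_mult power_mult_distrib algebra_simps)
  also have "\<dots> = (\<integral>\<^sup>+\<xi>. ennreal ((cmod (truncated_fourier (sine_sum c n) 1 \<xi>))\<^sup>2) \<partial>lborel) + (\<integral>\<^sup>+\<xi>. ennreal ((cmod (truncated_fourier h' 1 \<xi>))\<^sup>2) \<partial>lborel)"
    by (intro nn_integral_add) measurable
  also have "\<dots> \<le> ennreal (2 * (\<Sum>k. \<bar>c k\<bar> / real (Suc k))\<^sup>2) + ennreal (pi\<^sup>2 * (\<Sum>\<^sub>\<infinity>k. (c k)\<^sup>2))"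
  proof (intro add_mono)
    let ?M = "\<Sum>k. \<bar>c k\<bar> / real (Suc k)"
    have "(\<integral>\<^sup>+\<xi>. ennreal ((cmod (truncated_fourier (sine_sum c n) 1 \<xi>))\<^sup>2) \<partial>lborel) \<le> (\<integral>\<^sup>+x. ennreal (indicator {-1..1} x * (sine_sum c n x)\<^sup>2) \<partial>lborel)"
      by (rule truncated_fourier_energy[OF continuous_sine_sum])
    also have "\<dots> \<le> (\<integral>\<^sup>+x. ennreal (?M\<^sup>2) * indicator {-1..1::real} x \<partial>lborel)"
    proof (intro nn_integral_mono)
      fix x
      have "(sine_sum c n x)\<^sup>2 \<le> ?M\<^sup>2" using power_mono[OF sine_sum_bound[of n x], of 2] by simp
      then show "ennreal (indicator {-1..1} x * (sine_sum c n x)\<^sup>2) \<le> ennreal (?M\<^sup>2) * indicator {-1..1} x"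
        by (cases "x \<in> {-1..1}") (auto intro: ennreal_leI)
    qed
    also have "\<dots> = ennreal (?M\<^sup>2) * ennreal 2" by (subst nn_integral_cmult_indicator) (auto simp: emeasure_lborel_Icc)
    also have "\<dots> = ennreal (2 * ?M\<^sup>2)" by (subst ennreal_mult[symmetric]) (auto simp: mult.commute)
    finally show "(\<integral>\<^sup>+\<xi>. ennreal ((cmod (truncated_fourier (sine_sum c n) 1 \<xi>))\<^sup>2) \<partial>lborel) \<le> ennreal (2 * ?M\<^sup>2)" .
    have cc: "integrable lborel (\<lambda>x. indicator {-1..1} x *\<^sub>R (cos (pi * real (Suc j) * x) * cos (pi * real (Suc k) * x)))" for j k
      by (rule borel_integrable_compact) (auto intro!: continuous_intros)
    have e: "indicator {-1..1} x * (h' x)\<^sup>2 = (\<Sum>j<n. \<Sum>k<n. (pi * c j * (pi * c k)) * (indicator {-1..1} x *\<^sub>R (cos (pi * real (Suc j) * x) * cos (pi * real (Suc k) * x))))" for x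
      by (simp only: h'_def power2_eq_square sum_product, simp only: sum_distrib_left, intro sum.cong refl)
        (simp only: real_scaleR_def mult_ac)
    have hi: "integrable lborel (\<lambda>x. indicator {-1..1} x * (h' x)\<^sup>2)"
      unfolding e by (intro Bochner_Integration.integrable_sum integrable_mult_right cc)
    have "(\<integral>\<^sup>+\<xi>. ennreal ((cmod (truncated_fourier h' 1 \<xi>))\<^sup>2) \<partial>lborel) \<le> (\<integral>\<^sup>+x. ennreal (indicator {-1..1} x * (h' x)\<^sup>2) \<partial>lborel)"
      by (rule truncated_fourier_energy[OF h'c])
    also have "\<dots> = ennreal (\<integral>x. indicator {-1..1} x * (h' x)\<^sup>2 \<partial>lborel)"
      by (rule nn_integral_eq_integral[OF hi]) auto
    also have "(\<integral>x. indicator {-1..1} x * (h' x)\<^sup>2 \<partial>lborel)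
        = (\<Sum>j<n. \<Sum>k<n. (pi * c j * (pi * c k)) * (if j = k then 1 else 0))"
    proof -
      have "(\<integral>x. indicator {-1..1} x * (h' x)\<^sup>2 \<partial>lborel) = (\<Sum>j<n. \<integral>x. (\<Sum>k<n. (pi * c j * (pi * c k)) * (indicator {-1..1} x *\<^sub>R (cos (pi * real (Suc j) * x) * cos (pi * real (Suc k) * x)))) \<partial>lborel)"
        unfolding e by (intro Bochner_Integration.integral_sum Bochner_Integration.integrable_sum integrable_mult_right cc)
      also have "\<dots> = (\<Sum>j<n. \<Sum>k<n. \<integral>x. (pi * c j * (pi * c k)) * (indicator {-1..1} x *\<^sub>R (cos (pi * real (Suc j) * x) * cos (pi * real (Suc k) * x))) \<partial>lborel)"
        by (intro sum.cong refl Bochner_Integration.integral_sum integrable_mult_right cc)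
      also have "\<dots> = (\<Sum>j<n. \<Sum>k<n. (pi * c j * (pi * c k)) * (if j = k then 1 else 0))"
        unfolding integral_mult_right_zero cos_orthogonal ..
      finally show ?thesis .
    qed
    also have "\<dots> = (\<Sum>j<n. (pi * c j)\<^sup>2)"
      by (intro sum.cong refl) (simp add: if_distrib[of "\<lambda>x. _ * x"] power2_eq_square cong: if_cong)
    also have "\<dots> = pi\<^sup>2 * (\<Sum>j<n. (c j)\<^sup>2)" by (simp add: sum_distrib_left power_mult_distrib)
    finally have "(\<integral>\<^sup>+\<xi>. ennreal ((cmod (truncated_fourier h' 1 \<xi>))\<^sup>2) \<partial>lborel) \<le> ennreal (pi\<^sup>2 * (\<Sum>j<n. (c j)\<^sup>2))" .
    also have "\<dots> \<le> ennreal (pi\<^sup>2 * (\<Sum>\<^sub>\<infinity>k. (c k)\<^sup>2))"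
      by (intro ennreal_leI mult_left_mono finite_sum_le_infsum c) auto
    finally show "(\<integral>\<^sup>+\<xi>. ennreal ((cmod (truncated_fourier h' 1 \<xi>))\<^sup>2) \<partial>lborel) \<le> ennreal (pi\<^sup>2 * (\<Sum>\<^sub>\<infinity>k. (c k)\<^sup>2))" .
  qed
  finally show ?thesis .
qed

lemma sine_series_energy:
  "(\<integral>\<^sup>+\<xi>. ennreal ((1 + \<xi>\<^sup>2) * (cmod (truncated_fourier (sine_series c) 1 \<xi>))\<^sup>2) \<partial>lborel) < \<infinity>"
proof -
  have [measurable]: "sine_sum c n \<in> borel_measurable borel" "sine_series c \<in> borel_measurable borel" for n
    by (rule borel_measurable_continuous_onI[OF continuous_sine_sum], rule borel_measurable_continuous_onI[OF continuous_sine_series])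
  let ?M = "\<Sum>k. \<bar>c k\<bar> / real (Suc k)"
  have lim: "(\<lambda>n. truncated_fourier (sine_sum c n) 1 \<xi>) \<longlonglongrightarrow> truncated_fourier (sine_series c) 1 \<xi>" for \<xi>
    unfolding truncated_fourier_def set_lebesgue_integral_def
  proof (intro tendsto_mult tendsto_const integral_dominated_convergence)
    show "integrable lborel (\<lambda>x::real. indicator {-1..1} x *\<^sub>R ?M)"
      by (rule borel_integrable_compact) auto
    show "AE x in lborel. (\<lambda>n. indicator {- 1..1} x *\<^sub>R (complex_of_real (sine_sum c n x) * cis (- (x * \<xi>)))) \<longlonglongrightarrow> indicator {- 1..1} x *\<^sub>R (complex_of_real (sine_series c x) * cis (- (x * \<xi>)))"
      by (intro AE_I2 tendsto_intros sine_sum_tendsto)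
    show "AE x in lborel. norm (indicator {- 1..1} x *\<^sub>R (complex_of_real (sine_sum c n x) * cis (- (x * \<xi>)))) \<le> indicator {-1..1} x *\<^sub>R ?M" for n
      using sine_sum_bound[of n] by (intro AE_I2) (auto simp: indicator_def norm_mult)
  qed measurable
  have "(\<integral>\<^sup>+\<xi>. ennreal ((1 + \<xi>\<^sup>2) * (cmod (truncated_fourier (sine_series c) 1 \<xi>))\<^sup>2) \<partial>lborel)
     = (\<integral>\<^sup>+\<xi>. liminf (\<lambda>n. ennreal ((1 + \<xi>\<^sup>2) * (cmod (truncated_fourier (sine_sum c n) 1 \<xi>))\<^sup>2)) \<partial>lborel)"
  proof (intro nn_integral_cong)
    fix \<xi>
    have "(\<lambda>n. ennreal ((1 + \<xi>\<^sup>2) * (cmod (truncated_fourier (sine_sum c n) 1 \<xi>))\<^sup>2)) \<longlonglongrightarrow> ennreal ((1 + \<xi>\<^sup>2) * (cmod (truncated_fourier (sine_series c) 1 \<xi>))\<^sup>2)"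
      by (intro tendsto_ennrealI tendsto_intros lim)
    from lim_imp_Liminf[OF _ this]
    show "ennreal ((1 + \<xi>\<^sup>2) * (cmod (truncated_fourier (sine_series c) 1 \<xi>))\<^sup>2) = liminf (\<lambda>n. ennreal ((1 + \<xi>\<^sup>2) * (cmod (truncated_fourier (sine_sum c n) 1 \<xi>))\<^sup>2))" by simp
  qed
  also have "\<dots> \<le> liminf (\<lambda>n. \<integral>\<^sup>+\<xi>. ennreal ((1 + \<xi>\<^sup>2) * (cmod (truncated_fourier (sine_sum c n) 1 \<xi>))\<^sup>2) \<partial>lborel)"
    by (rule nn_integral_liminf) measurable
  also have "\<dots> \<le> ennreal (2 * ?M\<^sup>2) + ennreal (pi\<^sup>2 * (\<Sum>\<^sub>\<infinity>k. (c k)\<^sup>2))"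
    by (intro Liminf_le eventuallyI sine_sum_energy sequentially_bot)
  also have "\<dots> < \<infinity>" by simp
  finally show ?thesis .
qed

text \<open>The function, cut off outside \<open>[-1,1]\<close>, lies in \<open>H\<^sup>1(\<real>)\<close>, and \<open>s \<le> 1\<close>.\<close>

lemma sine_series_sobolev:
  assumes s: "s \<le> 1"
  shows "zero_ext unit_interval (sine_series c) \<in> sobolev_01 s"
proof -
  have [measurable]: "sine_series c \<in> borel_measurable borel"
    by (rule borel_measurable_continuous_onI[OF continuous_sine_series])
  have b: "sine_series c 1 = 0" "sine_series c (-1) = 0"
    unfolding sine_series_def by (simp_all add: sin_npi2 del: of_nat_Suc)
  \<comment> \<open>the series is odd and vanishes at the end points, so that cutting it off outside \<open>[-1,1]\<close> preserves continuity\<close>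
  define f where "f x = indicator {-1..1} x * sine_series c x" for x
  define g where "g = truncated_fourier (sine_series c) 1"
  have [measurable]: "f \<in> borel_measurable borel" "g \<in> borel_measurable borel" unfolding f_def g_def by measurable
  have "f = (\<lambda>x. sine_series c (max (-1) (min 1 x)))"
    using b by (auto simp: f_def fun_eq_iff indicator_def max_def min_def)
  moreover have "continuous_on UNIV (\<lambda>x. sine_series c (max (-1) (min 1 x)))"
    by (rule continuous_on_compose2[OF continuous_sine_series]) (auto intro!: continuous_intros)
  ultimately have fc: "continuous_on UNIV f" by simp
  have "\<bar>f x\<bar> \<le> (\<Sum>k. \<bar>c k\<bar> / real (Suc k))" for x
    using sine_series_bound[of x] by (auto simp: f_def indicator_def)
  then have fb: "bounded (range f)" by (auto simp: bounded_iff)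
  have fi: "integrable lborel (\<lambda>x. (norm (f x))\<^sup>2)"
  proof -
    have "integrable lborel (\<lambda>x. indicator {-1..1} x *\<^sub>R (sine_series c x)\<^sup>2)"
      by (rule borel_integrable_compact) (auto intro!: continuous_intros continuous_on_subset[OF continuous_sine_series])
    moreover have "(norm (f x))\<^sup>2 = indicator {-1..1} x *\<^sub>R (sine_series c x)\<^sup>2" for x by (auto simp: f_def indicator_def)
    ultimately show ?thesis by simp
  qed
  have sq: "integrable lborel (\<lambda>\<xi>. (1 + \<xi>\<^sup>2) * (cmod (g \<xi>))\<^sup>2)"
    by (rule integrableI_bounded) (use sine_series_energy in \<open>auto simp: g_def abs_mult\<close>)
  have gi: "integrable lborel (\<lambda>\<xi>. (norm (g \<xi>))\<^sup>2)"
    by (rule Bochner_Integration.integrable_bound[OF sq]) (auto simp: mult_le_cancel_right1)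
  have trunc: "truncated_fourier f R = g" if "R \<ge> 1" for R
  proof
    fix \<xi>
    show "truncated_fourier f R \<xi> = g \<xi>"
      unfolding truncated_fourier_def g_def set_lebesgue_integral_def
      by (intro arg_cong2[where f = "(*)"] refl Bochner_Integration.integral_cong) (use that in \<open>auto simp: f_def indicator_def\<close>)
  qed
  have "L2_fourier f g"
    unfolding L2_fourier_def square_integrable_def
  proof (intro conjI fi gi)
    have "\<forall>\<^sub>F R in at_top. (\<integral>\<^sup>+\<xi>. ennreal ((cmod (truncated_fourier f R \<xi> - g \<xi>))\<^sup>2) \<partial>lborel) = 0"
      using eventually_ge_at_top[of 1] by eventually_elim (simp add: trunc)
    then show "((\<lambda>R. \<integral>\<^sup>+\<xi>. ennreal ((cmod (truncated_fourier f R \<xi> - g \<xi>))\<^sup>2) \<partial>lborel) \<longlongrightarrow> 0) at_top"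
      by (rule tendsto_eventually)
  qed measurable
  moreover have "square_integrable (\<lambda>\<xi>. ((1 + \<xi>\<^sup>2) powr (s / 2)) *\<^sub>R g \<xi>)"
    unfolding square_integrable_def
  proof (intro conjI)
    show "integrable lborel (\<lambda>\<xi>. (norm (((1 + \<xi>\<^sup>2) powr (s / 2)) *\<^sub>R g \<xi>))\<^sup>2)"
    proof (rule Bochner_Integration.integrable_bound[OF sq])
      show "AE \<xi> in lborel. norm ((norm (((1 + \<xi>\<^sup>2) powr (s / 2)) *\<^sub>R g \<xi>))\<^sup>2) \<le> norm ((1 + \<xi>\<^sup>2) * (cmod (g \<xi>))\<^sup>2)"
      proof (intro AE_I2)
        fix \<xi> :: real
        have "((1 + \<xi>\<^sup>2) powr (s / 2))\<^sup>2 = (1 + \<xi>\<^sup>2) powr s" by (simp add: power2_eq_square powr_add[symmetric])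
        also have "\<dots> \<le> (1 + \<xi>\<^sup>2) powr 1" using s by (intro powr_mono) auto
        also have "\<dots> = 1 + \<xi>\<^sup>2" by (simp add: powr_one_gt_zero_iff add_pos_nonneg)
        finally have "((1 + \<xi>\<^sup>2) powr (s / 2))\<^sup>2 * (cmod (g \<xi>))\<^sup>2 \<le> (1 + \<xi>\<^sup>2) * (cmod (g \<xi>))\<^sup>2" by (rule mult_right_mono) simp
        then show "norm ((norm (((1 + \<xi>\<^sup>2) powr (s / 2)) *\<^sub>R g \<xi>))\<^sup>2) \<le> norm ((1 + \<xi>\<^sup>2) * (cmod (g \<xi>))\<^sup>2)"
          by (simp add: power_mult_distrib abs_mult)
      qed
    qed measurable
  qed measurable
  ultimately have "f \<in> sobolev_R s"
    using fc fb fi unfolding sobolev_R_def square_integrable_def by auto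
  moreover have "zero_ext unit_interval (sine_series c) = zero_ext unit_interval f"
    by (auto simp: zero_ext_def f_def fun_eq_iff)
  ultimately show ?thesis unfolding sobolev_01_def by blast
qed

end


section \<open>Comparison with the sine system\<close>

text \<open>The coefficients \<open>e k\<close> on the left represent the functional \<open>c \<mapsto> \<Sum>i w i * f\<^sub>c(p i)\<close> on \<open>\<ell>\<^sub>2\<close>, where \<open>f\<^sub>c \<in> H\<^sub>0\<close> is the sine series of \<open>c\<close>. As \<open>f\<^sub>c\<close> is
fixed and the combination of kernel sections has norm at most one, these functionals are pointwise bounded; uniform boundedness in \<open>\<ell>\<^sub>2\<close> gives the constant.\<close>

lemma sine_bessel:
  assumes k0: "rkhs_of_kernel unit_interval k0 H0" and H0: "fns H0 = sobolev_01 s" and s: "s \<le> 1"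
  shows "\<exists>C\<ge>0. \<forall>(I :: nat set) p w n. finite I \<longrightarrow> p ` I \<subseteq> unit_interval \<longrightarrow>
    (\<Sum>k<n. (\<Sum>i\<in>I. w i * (sin (pi * real (Suc k) * p i) / real (Suc k)))\<^sup>2)
      \<le> C * ip H0 (\<lambda>y. \<Sum>i\<in>I. w i * kernel_section unit_interval k0 (p i) y) (\<lambda>y. \<Sum>i\<in>I. w i * kernel_section unit_interval k0 (p i) y)"
proof -
  interpret H: function_rkhs unit_interval H0 by (rule rkhs_of_kernelD(1)[OF k0])
  interpret E: function_rkhs UNIV ell2 by (rule function_rkhs.intro[OF rkhs_ell2])
  define h where "h I p w = (\<lambda>y. \<Sum>i\<in>I. w i * kernel_section unit_interval k0 (p i) y)" for I :: "nat set" and p w :: "nat \<Rightarrow> real"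
  define e where "e I p w k = (\<Sum>i\<in>I. w i * (sin (pi * real (Suc k) * p i) / real (Suc k)))" for I :: "nat set" and p w :: "nat \<Rightarrow> real" and k :: nat
  have kin: "i \<in> I \<Longrightarrow> kernel_section unit_interval k0 (p i) \<in> fns H0" if "p ` I \<subseteq> unit_interval" for I :: "nat set" and p i
    using that by (intro rkhs_of_kernelD(2)[OF k0]) auto
  have hin: "h I p w \<in> fns H0" if "p ` I \<subseteq> unit_interval" for I p w
    unfolding h_def by (rule H.sum_in[OF kin[OF that]])
  have iph: "ip H0 f (h I p w) = (\<Sum>i\<in>I. w i * f (p i))" if p: "p ` I \<subseteq> unit_interval" and f: "f \<in> fns H0" for I p w f
  proof -
    have "ip H0 f (h I p w) = ip H0 (h I p w) f" by (rule H.ip_sym[OF f hin[OF p]])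
    also have "\<dots> = (\<Sum>i\<in>I. w i * ip H0 (kernel_section unit_interval k0 (p i)) f)"
      unfolding h_def by (rule H.ip_sum[OF kin[OF p] f])
    also have "\<dots> = (\<Sum>i\<in>I. w i * f (p i))"
    proof (intro sum.cong refl)
      fix i assume i: "i \<in> I"
      then have "p i \<in> unit_interval" using p by auto
      from rkhs_of_kernelD(3)[OF k0 this f] H.ip_sym[OF f kin[OF p i]]
      show "w i * ip H0 (kernel_section unit_interval k0 (p i)) f = w i * f (p i)" by simp
    qed
    finally show ?thesis .
  qed
  have ein: "e I p w \<in> fns ell2" for I p w
  proof -
    let ?W = "\<Sum>i\<in>I. \<bar>w i\<bar>"
    have "\<bar>e I p w k\<bar> \<le> ?W / real (Suc k)" for k
      unfolding e_def sum_divide_distrib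
      by (rule order_trans[OF sum_abs sum_mono]) (auto simp: abs_mult intro!: divide_right_mono mult_left_le)
    then have "(e I p w k)\<^sup>2 \<le> (?W / real (Suc k))\<^sup>2" for k
      using power_mono[of "\<bar>e I p w k\<bar>" "?W / real (Suc k)" 2] by simp
    then have b: "(e I p w k)\<^sup>2 \<le> ?W\<^sup>2 * inverse (real (Suc k) ^ 2)" for k
      by (simp only: divide_inverse power_mult_distrib power_inverse)
    have "summable (\<lambda>k. inverse (real (Suc k) ^ 2))" using inverse_power_summable[of 2, where 'a = real] summable_Suc_iff[of "\<lambda>k. inverse (real k ^ 2)"] by simp
    then have "summable (\<lambda>k. ?W\<^sup>2 * inverse (real (Suc k) ^ 2))" by (rule summable_mult)
    then have "summable (\<lambda>k. (e I p w k)\<^sup>2)"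
      by (rule summable_comparison_test'[where N = 0]) (use b in auto)
    then show ?thesis using summable_on_UNIV_nonneg_real_iff[of "\<lambda>k. (e I p w k)\<^sup>2"] by (simp add: ell2_def)
  qed
  have dual: "ip ell2 c (e I p w) = ip H0 (zero_ext unit_interval (sine_series c)) (h I p w)"
    if c: "c \<in> fns ell2" and p: "p ` I \<subseteq> unit_interval" and I: "finite I" for c I p w
  proof -
    have c2: "(\<lambda>k. (c k)\<^sup>2) summable_on UNIV" using c by (simp add: ell2_def)
    have f: "zero_ext unit_interval (sine_series c) \<in> fns H0" unfolding H0 by (rule sine_series_sobolev[OF c2 s])
    have "(\<lambda>n. sine_sum c n x) = (\<lambda>n. \<Sum>k<n. c k / real (Suc k) * sin (pi * real (Suc k) * x))" for x by (simp add: sine_sum_def)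
    then have "(\<lambda>k. c k / real (Suc k) * sin (pi * real (Suc k) * x)) sums sine_series c x" for x
      using sine_sum_tendsto[OF c2, of x] unfolding sums_def by simp
    then have "(\<lambda>k. \<Sum>i\<in>I. w i * (c k / real (Suc k) * sin (pi * real (Suc k) * p i))) sums (\<Sum>i\<in>I. w i * sine_series c (p i))"
      by (intro sums_sum sums_mult)
    moreover have "(\<Sum>i\<in>I. w i * (c k / real (Suc k) * sin (pi * real (Suc k) * p i))) = c k * e I p w k" for k
      unfolding e_def sum_distrib_left by (intro sum.cong refl) simp
    ultimately have "(\<lambda>k. c k * e I p w k) sums (\<Sum>i\<in>I. w i * sine_series c (p i))" by simp
    moreover have "(\<lambda>k. c k * e I p w k) sums (\<Sum>\<^sub>\<infinity>k. c k * e I p w k)"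
      using square_sum_product_summable[OF c2, of "e I p w"] ein[of I p w] by (intro has_sum_imp_sums has_sum_infsum) (simp add: ell2_def)
    ultimately have "(\<Sum>\<^sub>\<infinity>k. c k * e I p w k) = (\<Sum>i\<in>I. w i * sine_series c (p i))" by (rule sums_unique2[symmetric])
    also have "\<dots> = (\<Sum>i\<in>I. w i * zero_ext unit_interval (sine_series c) (p i))"
      using p by (intro sum.cong refl) (auto simp: zero_ext_def)
    also have "\<dots> = ip H0 (zero_ext unit_interval (sine_series c)) (h I p w)" by (rule iph[OF p f, symmetric])
    finally show ?thesis by (simp add: ell2_def)
  qed
  define L where "L = {e I p w | I p w. finite I \<and> p ` I \<subseteq> unit_interval \<and> fnorm H0 (h I p w) \<le> 1}"
  have "\<exists>C. \<forall>a\<in>L. fnorm ell2 a \<le> C"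
  proof (rule E.uniform_boundedness)
    show "L \<subseteq> fns ell2" unfolding L_def using ein by auto
    fix c assume c: "c \<in> fns ell2"
    let ?f = "zero_ext unit_interval (sine_series c)"
    have f: "?f \<in> fns H0" unfolding H0 using c by (intro sine_series_sobolev s) (simp add: ell2_def)
    show "\<exists>C. \<forall>a\<in>L. \<bar>ip ell2 c a\<bar> \<le> C"
    proof (intro exI ballI)
      fix a assume "a \<in> L"
      then obtain I p w where a: "a = e I p w" and I: "finite I" "p ` I \<subseteq> unit_interval" "fnorm H0 (h I p w) \<le> 1"
        unfolding L_def by blast
      have "\<bar>ip ell2 c a\<bar> \<le> fnorm H0 ?f * fnorm H0 (h I p w)"
        unfolding a dual[OF c I(2,1)] by (rule H.cauchy_schwarz[OF f hin[OF I(2)]])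
      also have "\<dots> \<le> fnorm H0 ?f * 1" by (intro mult_left_mono I H.fnorm_nonneg f)
      finally show "\<bar>ip ell2 c a\<bar> \<le> fnorm H0 ?f * 1" .
    qed
  qed
  then obtain C where C: "\<And>a. a \<in> L \<Longrightarrow> fnorm ell2 a \<le> C" by blast
  \<comment> \<open>scaling by \<open>1 / (\<parallel>h\<parallel> + t)\<close> with \<open>t > 0\<close> includes the case \<open>h = 0\<close>\<close>
  have main: "fnorm ell2 (e I p w) \<le> C * fnorm H0 (h I p w)" if I: "finite I" "p ` I \<subseteq> unit_interval" for I p w
  proof -
    let ?x = "fnorm H0 (h I p w)"
    have x0: "0 \<le> ?x" by (rule H.fnorm_nonneg[OF hin[OF I(2)]])
    have "fnorm ell2 (e I p w) \<le> C * (?x + t)" if t: "t > 0" for t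
    proof -
      let ?t = "1 / (?x + t)"
      have tp: "?t > 0" using x0 t by simp
      have hs: "h I p (\<lambda>i. ?t * w i) = (\<lambda>y. ?t * h I p w y)" and es: "e I p (\<lambda>i. ?t * w i) = (\<lambda>y. ?t * e I p w y)"
        unfolding h_def e_def by (auto simp: fun_eq_iff sum_distrib_left mult.assoc simp del: of_nat_Suc)
      have "fnorm H0 (h I p (\<lambda>i. ?t * w i)) \<le> 1"
        unfolding hs H.fnorm_scale[OF hin[OF I(2)]] using x0 t by simp
      then have "e I p (\<lambda>i. ?t * w i) \<in> L" unfolding L_def using I by blast
      from C[OF this] have "?t * fnorm ell2 (e I p w) \<le> C"
        unfolding es E.fnorm_scale[OF ein] using tp by simp
      then show ?thesis using x0 t by (simp add: field_simps)
    qed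
    note * = this
    have "((\<lambda>t. C * (?x + t)) \<longlongrightarrow> C * (?x + 0)) (at_right 0)" by (intro tendsto_intros)
    then show ?thesis
      by (intro tendsto_lowerbound[where F = "at_right 0" and f = "\<lambda>t. C * (?x + t)"]) (auto simp: eventually_at_right_less intro!: eventually_mono[OF eventually_at_right_less[of 0]] *)
  qed
  have ex: "(\<Sum>k<n. (e I p w k)\<^sup>2) \<le> C\<^sup>2 * ip H0 (h I p w) (h I p w)" if I: "finite I" "p ` I \<subseteq> unit_interval" for I p w n
  proof -
    have "(\<Sum>k<n. (e I p w k)\<^sup>2) \<le> (\<Sum>\<^sub>\<infinity>k. (e I p w k)\<^sup>2)"
      using ein[of I p w] by (intro finite_sum_le_infsum) (auto simp: ell2_def)
    also have "\<dots> = ip ell2 (e I p w) (e I p w)" by (simp add: ell2_def power2_eq_square)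
    also have "\<dots> = (fnorm ell2 (e I p w))\<^sup>2" by (rule E.fnorm_sq[OF ein, symmetric])
    also have "\<dots> \<le> (C * fnorm H0 (h I p w))\<^sup>2" by (intro power_mono main I E.fnorm_nonneg ein)
    also have "\<dots> = C\<^sup>2 * ip H0 (h I p w) (h I p w)" by (simp add: power_mult_distrib H.fnorm_sq[OF hin[OF I(2)]])
    finally show ?thesis .
  qed
  show ?thesis
    by (rule exI[of _ "C\<^sup>2"]) (use ex in \<open>auto simp: e_def h_def\<close>)
qed

lemma sum_cos_equispaced:
  assumes m: "0 < m" "m < 2 * N"
  shows "(\<Sum>i<N. cos (real i * (pi * real m / real N))) = (1 - (-1) ^ m) / 2"
proof -
  define t where "t = pi * real m / real N"
  have N: "N > 0" using m by simp
  have st: "sin (t / 2) > 0"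
  proof (rule sin_gt_zero)
    show "0 < t / 2" using m N by (simp add: t_def)
    show "t / 2 < pi" using m N by (simp add: t_def divide_simps)
  qed
  have tel: "2 * sin (t / 2) * (\<Sum>i<n. cos (real i * t)) = sin ((real n - 1/2) * t) + sin (t / 2)" for n
  proof (induction n)
    case (Suc n)
    have "2 * sin (t / 2) * cos (real n * t) = sin ((real (Suc n) - 1/2) * t) - sin ((real n - 1/2) * t)"
      unfolding sin_diff_sin by (simp add: algebra_simps add_divide_distrib diff_divide_distrib)
    then show ?case using Suc by (simp add: distrib_left)
  qed simp
  have "(real N - 1/2) * t = pi * real m - t / 2" using N by (simp add: t_def field_simps)
  then have "sin ((real N - 1/2) * t) = - ((-1) ^ m * sin (t / 2))"
    by (simp add: sin_diff cos_npi2 sin_npi2)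
  with tel[of N] have "2 * sin (t / 2) * (\<Sum>i<N. cos (real i * t)) = (1 - (-1) ^ m) * sin (t / 2)"
    by (simp add: algebra_simps)
  then have "sin (t / 2) * (2 * (\<Sum>i<N. cos (real i * t))) = sin (t / 2) * (1 - (-1) ^ m)"
    by (simp add: mult_ac)
  then have "2 * (\<Sum>i<N. cos (real i * t)) = 1 - (-1) ^ m" using st by (simp del: mult_cancel_left add: mult_left_cancel)
  then show ?thesis by (simp add: t_def)
qed

lemma discrete_sine_orthogonal:
  assumes i: "i < N - 1" and k: "k < N - 1"
  shows "(\<Sum>j<N - 1. sin (pi * real (Suc j) * (real (Suc i) / real N)) * sin (pi * real (Suc j) * (real (Suc k) / real N)))
     = (if i = k then real N / 2 else 0)"
proof -
  have N: "N = Suc (N - 1)" using i by simp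
  define a b where "a = Suc i" and "b = Suc k"
  define d where "d = (if a \<le> b then b - a else a - b)"
  have "(\<Sum>j<N - 1. sin (pi * real (Suc j) * (real (Suc i) / real N)) * sin (pi * real (Suc j) * (real (Suc k) / real N)))
     = (\<Sum>j<N. sin (pi * real j * (real a / real N)) * sin (pi * real j * (real b / real N)))"
    by (subst (3) N, subst sum.lessThan_Suc_shift) (simp add: a_def b_def)
  also have "\<dots> = (\<Sum>j<N. (cos (real j * (pi * real d / real N)) - cos (real j * (pi * real (a + b) / real N))) / 2)"
  proof (intro sum.cong refl)
    fix j
    have "sin (pi * real j * (real a / real N)) * sin (pi * real j * (real b / real N))
      = (cos (real j * (pi * (real a - real b) / real N)) - cos (real j * (pi * real (a + b) / real N))) / 2"
      unfolding sin_times_sin by (simp add: algebra_simps diff_divide_distrib add_divide_distrib)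
    also have "cos (real j * (pi * (real a - real b) / real N)) = cos (real j * (pi * real d / real N))"
    proof (cases "a \<le> b")
      case True
      then have "real j * (pi * (real a - real b) / real N) = - (real j * (pi * real d / real N))"
        by (simp add: d_def of_nat_diff algebra_simps diff_divide_distrib)
      then show ?thesis by (simp only: cos_minus)
    qed (simp add: d_def of_nat_diff)
    finally show "sin (pi * real j * (real a / real N)) * sin (pi * real j * (real b / real N))
      = (cos (real j * (pi * real d / real N)) - cos (real j * (pi * real (a + b) / real N))) / 2" .
  qed
  also have "\<dots> = ((\<Sum>j<N. cos (real j * (pi * real d / real N))) - (\<Sum>j<N. cos (real j * (pi * real (a + b) / real N)))) / 2"
    by (simp add: sum_subtractf sum_divide_distrib diff_divide_distrib)
  also have "(\<Sum>j<N. cos (real j * (pi * real (a + b) / real N))) = (1 - (-1) ^ (a + b)) / 2"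
    by (rule sum_cos_equispaced) (use i k in \<open>auto simp: a_def b_def\<close>)
  also have "((\<Sum>j<N. cos (real j * (pi * real d / real N))) - (1 - (-1) ^ (a + b)) / 2) / 2 = (if i = k then real N / 2 else 0)"
  proof (cases "i = k")
    case True
    then show ?thesis by (simp add: d_def a_def b_def mult_2[symmetric])
  next
    case False
    have d: "(\<Sum>j<N. cos (real j * (pi * real d / real N))) = (1 - (-1) ^ d) / 2"
      by (rule sum_cos_equispaced) (use i k False in \<open>auto simp: a_def b_def d_def\<close>)
    have "even d = even (a + b)" by (auto simp: d_def)
    then have "(-1::real) ^ d = (-1) ^ (a + b)" by (cases "even d") auto
    then show ?thesis using False d by simp
  qed
  finally show ?thesis .
qed

text \<open>Pair the matrix on the left with the discrete sine matrix \<open>S\<close>. By orthogonality this yields \<open>(N/2) \<Sum>j 1/(j+1)\<close>, while the factorisation and the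
Cauchy--Schwarz inequality bound it by the Hilbert--Schmidt norms of \<open>Z\<close> and of \<open>S W\<close>; the square of the latter is \<open>(N/2) \<parallel>W\<parallel>\<^sup>2 \<le> (N/2) N D\<close>.\<close>

lemma harmonic_factorization_bound:
  fixes W Z :: "nat \<Rightarrow> nat \<Rightarrow> real"
  assumes fac: "\<And>i j. i < N - 1 \<Longrightarrow> j < N - 1 \<Longrightarrow>
      sin (pi * real (Suc j) * (real (Suc i) / real N)) / real (Suc j) = (\<Sum>l<N - 1. W i l * Z l j)"
    and Z: "(\<Sum>l<N - 1. \<Sum>j<N - 1. (Z l j)\<^sup>2) \<le> a"
    and W: "\<And>i. i < N - 1 \<Longrightarrow> (\<Sum>l<N - 1. (W i l)\<^sup>2) \<le> D"
    and D: "0 \<le> D" and N: "N > 0"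
  shows "(\<Sum>j<N - 1. 1 / real (Suc j))\<^sup>2 \<le> 2 * a * D"
proof -
  let ?n = "N - 1"
  define S where "S j i = sin (pi * real (Suc j) * (real (Suc i) / real N))" for j i
  have sym: "S j i = S i j" for i j by (simp add: S_def mult_ac)
  have orth: "(\<Sum>j<?n. S j i * S j k) = (if i = k then real N / 2 else 0)" if "i < ?n" "k < ?n" for i k
    unfolding S_def by (rule discrete_sine_orthogonal[OF that])
  have a0: "0 \<le> a" by (rule order_trans[OF _ Z]) (intro sum_nonneg, simp)
  let ?h = "\<Sum>j<?n. 1 / real (Suc j)"
  define Q where "Q l j = (\<Sum>i<?n. S j i * W i l)" for l j
  \<comment> \<open>the trace of the product with \<open>S\<close>\<close>
  have "real N / 2 * ?h = (\<Sum>j<?n. \<Sum>i<?n. S j i * (\<Sum>l<?n. W i l * Z l j))"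
  proof -
    have "(\<Sum>i<?n. S j i * (\<Sum>l<?n. W i l * Z l j)) = real N / 2 * (1 / real (Suc j))" if j: "j < ?n" for j
    proof -
      have "(\<Sum>i<?n. S j i * (\<Sum>l<?n. W i l * Z l j)) = (\<Sum>i<?n. S i j * S i j / real (Suc j))"
      proof (intro sum.cong refl)
        fix i assume "i \<in> {..<?n}"
        then have "S j i / real (Suc j) = (\<Sum>l<?n. W i l * Z l j)" using fac[of i j] j by (simp add: S_def)
        then show "S j i * (\<Sum>l<?n. W i l * Z l j) = S i j * S i j / real (Suc j)" using sym[of i j] by (metis times_divide_eq_right)
      qed
      also have "\<dots> = real N / 2 * (1 / real (Suc j))" unfolding sum_divide_distrib[symmetric] orth[OF j j] by simp
      finally show ?thesis .
    qed
    then show ?thesis by (simp add: sum_distrib_left)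
  qed
  also have "\<dots> = (\<Sum>j<?n. \<Sum>l<?n. Z l j * Q l j)"
  proof (rule sum.cong[OF refl])
    fix j
    have "(\<Sum>i<?n. S j i * (\<Sum>l<?n. W i l * Z l j)) = (\<Sum>i<?n. \<Sum>l<?n. Z l j * (S j i * W i l))"
      by (simp add: sum_distrib_left mult_ac)
    also have "\<dots> = (\<Sum>l<?n. \<Sum>i<?n. Z l j * (S j i * W i l))" by (rule sum.swap)
    finally show "(\<Sum>i<?n. S j i * (\<Sum>l<?n. W i l * Z l j)) = (\<Sum>l<?n. Z l j * Q l j)" by (simp add: Q_def sum_distrib_left)
  qed
  also have "\<dots> = (\<Sum>x\<in>{..<?n} \<times> {..<?n}. (case x of (j, l) \<Rightarrow> Z l j) * (case x of (j, l) \<Rightarrow> Q l j))"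
    by (simp add: sum.cartesian_product case_prod_beta)
  finally have "(real N / 2 * ?h)\<^sup>2 = (\<Sum>x\<in>{..<?n} \<times> {..<?n}. (case x of (j, l) \<Rightarrow> Z l j) * (case x of (j, l) \<Rightarrow> Q l j))\<^sup>2"
    by simp
  also have "\<dots> \<le> (\<Sum>x\<in>{..<?n} \<times> {..<?n}. (case x of (j, l) \<Rightarrow> Z l j)\<^sup>2) * (\<Sum>x\<in>{..<?n} \<times> {..<?n}. (case x of (j, l) \<Rightarrow> Q l j)\<^sup>2)"
    by (rule Cauchy_Schwarz_ineq_sum)
  also have "\<dots> = (\<Sum>j<?n. \<Sum>l<?n. (Z l j)\<^sup>2) * (\<Sum>j<?n. \<Sum>l<?n. (Q l j)\<^sup>2)"
    by (simp add: sum.cartesian_product case_prod_beta)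
  also have "\<dots> \<le> a * (real N / 2 * (real N * D))"
  proof (rule mult_mono)
    show "(\<Sum>j<?n. \<Sum>l<?n. (Z l j)\<^sup>2) \<le> a" by (subst sum.swap) (rule Z)
    have "(\<Sum>j<?n. (Q l j)\<^sup>2) = real N / 2 * (\<Sum>i<?n. (W i l)\<^sup>2)" for l
    proof -
      have "(\<Sum>j<?n. (Q l j)\<^sup>2) = (\<Sum>j<?n. \<Sum>i<?n. \<Sum>k<?n. (W i l * W k l) * (S j i * S j k))"
        unfolding Q_def power2_eq_square sum_product by (intro sum.cong refl) (simp only: mult_ac)
      also have "\<dots> = (\<Sum>i<?n. \<Sum>j<?n. \<Sum>k<?n. (W i l * W k l) * (S j i * S j k))" by (rule sum.swap)
      also have "\<dots> = (\<Sum>i<?n. \<Sum>k<?n. \<Sum>j<?n. (W i l * W k l) * (S j i * S j k))"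
        by (rule sum.cong[OF refl], rule sum.swap)
      also have "\<dots> = (\<Sum>i<?n. \<Sum>k<?n. (W i l * W k l) * (if i = k then real N / 2 else 0))"
        unfolding sum_distrib_left[symmetric] by (intro sum.cong refl arg_cong2[where f = "(*)"] orth) auto
      also have "\<dots> = (\<Sum>i<?n. (W i l * W i l) * (real N / 2))"
        by (intro sum.cong refl) (simp add: if_distrib[of "\<lambda>x. _ * x"] cong: if_cong)
      finally show ?thesis by (simp add: sum_distrib_left power2_eq_square mult_ac)
    qed
    then have "(\<Sum>j<?n. \<Sum>l<?n. (Q l j)\<^sup>2) = real N / 2 * (\<Sum>i<?n. \<Sum>l<?n. (W i l)\<^sup>2)"
      by (subst (1 2) sum.swap) (simp only: sum_distrib_left)
    also have "\<dots> \<le> real N / 2 * (\<Sum>i<?n. D)" by (intro mult_left_mono sum_mono W) auto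
    also have "\<dots> \<le> real N / 2 * (real N * D)" using D by (auto intro!: mult_left_mono mult_right_mono)
    finally show "(\<Sum>j<?n. \<Sum>l<?n. (Q l j)\<^sup>2) \<le> real N / 2 * (real N * D)" .
  qed (use a0 in \<open>auto intro!: sum_nonneg\<close>)
  finally have "(real N)\<^sup>2 * ?h\<^sup>2 \<le> (real N)\<^sup>2 * (2 * a * D)"
    by (simp only: power_mult_distrib power_divide) (simp add: power2_eq_square algebra_simps)
  then show ?thesis using N by (simp add: mult_le_cancel_left)
qed


section \<open>Gaussian quadratic forms\<close>

lemma centered_gaussian_moments:
  assumes M: "prob_space M" and Z: "centered_gaussian M Z"
  shows "integrable M (\<lambda>\<omega>. (Z \<omega>)\<^sup>2)" "integrable M (\<lambda>\<omega>. (Z \<omega>) ^ 4)"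
    "(\<integral>\<omega>. (Z \<omega>) ^ 4 \<partial>M) = 3 * (\<integral>\<omega>. (Z \<omega>)\<^sup>2 \<partial>M)\<^sup>2"
proof -
  interpret prob_space M by (rule M)
  have [measurable]: "Z \<in> borel_measurable M" using Z by (simp add: centered_gaussian_def)
  have "integrable M (\<lambda>\<omega>. (Z \<omega>)\<^sup>2) \<and> integrable M (\<lambda>\<omega>. (Z \<omega>) ^ 4) \<and> (\<integral>\<omega>. (Z \<omega>) ^ 4 \<partial>M) = 3 * (\<integral>\<omega>. (Z \<omega>)\<^sup>2 \<partial>M)\<^sup>2"
  proof (cases "AE \<omega> in M. Z \<omega> = 0")
    case True
    then have "AE \<omega> in M. (Z \<omega>)\<^sup>2 = 0" "AE \<omega> in M. (Z \<omega>) ^ 4 = 0" by (auto elim!: eventually_mono)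
    then have "integrable M (\<lambda>\<omega>. (Z \<omega>)\<^sup>2) \<longleftrightarrow> integrable M (\<lambda>\<omega>. 0 :: real)" "integrable M (\<lambda>\<omega>. (Z \<omega>) ^ 4) \<longleftrightarrow> integrable M (\<lambda>\<omega>. 0 :: real)"
      "(\<integral>\<omega>. (Z \<omega>)\<^sup>2 \<partial>M) = (\<integral>\<omega>. (0::real) \<partial>M)" "(\<integral>\<omega>. (Z \<omega>) ^ 4 \<partial>M) = (\<integral>\<omega>. (0::real) \<partial>M)"
      by (intro integrable_cong_AE integral_cong_AE; simp)+
    then show ?thesis by simp
  next
    case False
    then obtain \<sigma> where \<sigma>: "\<sigma> > 0" and d: "distributed M lborel Z (normal_density 0 \<sigma>)"
      using Z by (auto simp: centered_gaussian_def)
    have m: "integrable M (\<lambda>\<omega>. (Z \<omega>) ^ (2 * k))" "(\<integral>\<omega>. (Z \<omega>) ^ (2 * k) \<partial>M) = fact (2 * k) / ((2 / \<sigma>\<^sup>2) ^ k * fact k)" for k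
    proof -
      have e1: "integrable lborel (\<lambda>x. normal_density 0 \<sigma> x * x ^ (2 * k)) \<longleftrightarrow> integrable M (\<lambda>\<omega>. (Z \<omega>) ^ (2 * k))"
        by (rule distributed_integrable[OF d]) auto
      have e2: "(\<integral>x. normal_density 0 \<sigma> x * x ^ (2 * k) \<partial>lborel) = (\<integral>\<omega>. (Z \<omega>) ^ (2 * k) \<partial>M)"
        by (rule distributed_integral[OF d]) auto
      show "integrable M (\<lambda>\<omega>. (Z \<omega>) ^ (2 * k))" "(\<integral>\<omega>. (Z \<omega>) ^ (2 * k) \<partial>M) = fact (2 * k) / ((2 / \<sigma>\<^sup>2) ^ k * fact k)"
        using normal_moment_even[OF \<sigma>, of 0 k] unfolding has_bochner_integral_iff diff_zero e1 e2 by blast+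
    qed
    show ?thesis
      using m[of 1] m[of 2] \<sigma> by (simp add: fact_numeral field_simps power2_eq_square power4_eq_xxxx)
  qed
  then show "integrable M (\<lambda>\<omega>. (Z \<omega>)\<^sup>2)" "integrable M (\<lambda>\<omega>. (Z \<omega>) ^ 4)"
    "(\<integral>\<omega>. (Z \<omega>) ^ 4 \<partial>M) = 3 * (\<integral>\<omega>. (Z \<omega>)\<^sup>2 \<partial>M)\<^sup>2" by auto
qed

text \<open>The mixed moments \<open>E Z\<^sub>l\<^sup>2 Z\<^sub>m\<^sup>2\<close> are at most \<open>3 E Z\<^sub>l\<^sup>2 E Z\<^sub>m\<^sup>2\<close>, by the Cauchy--Schwarz inequality and \<open>E Z\<^sup>4 = 3 (E Z\<^sup>2)\<^sup>2\<close>.\<close>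

lemma gaussian_quadratic_second_moment:
  fixes Z :: "nat \<Rightarrow> 'w \<Rightarrow> real"
  assumes M: "prob_space M" and Z: "\<And>l. l < n \<Longrightarrow> centered_gaussian M (Z l)"
  shows "integrable M (\<lambda>\<omega>. \<Sum>l<n. (Z l \<omega>)\<^sup>2)" "integrable M (\<lambda>\<omega>. (\<Sum>l<n. (Z l \<omega>)\<^sup>2)\<^sup>2)"
    "(\<integral>\<omega>. (\<Sum>l<n. (Z l \<omega>)\<^sup>2)\<^sup>2 \<partial>M) \<le> 3 * (\<integral>\<omega>. (\<Sum>l<n. (Z l \<omega>)\<^sup>2) \<partial>M)\<^sup>2"
proof -
  note mom = centered_gaussian_moments[OF M Z]
  have meas: "(\<lambda>\<omega>. (Z l \<omega>)\<^sup>2) \<in> borel_measurable M" if "l < n" for l using Z[OF that] by (auto simp: centered_gaussian_def)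
  have four: "((Z l \<omega>)\<^sup>2)\<^sup>2 = (Z l \<omega>) ^ 4" for l \<omega> by (simp add: power_mult[symmetric])
  let ?v = "\<lambda>l. \<integral>\<omega>. (Z l \<omega>)\<^sup>2 \<partial>M"
  have v0: "0 \<le> ?v l" for l by simp
  have pair: "integrable M (\<lambda>\<omega>. (Z l \<omega>)\<^sup>2 * (Z m \<omega>)\<^sup>2)" "(\<integral>\<omega>. (Z l \<omega>)\<^sup>2 * (Z m \<omega>)\<^sup>2 \<partial>M) \<le> 3 * (?v l * ?v m)"
    if l: "l < n" and m: "m < n" for l m
  proof -
    have i: "integrable M (\<lambda>\<omega>. ((Z l \<omega>)\<^sup>2)\<^sup>2)" "integrable M (\<lambda>\<omega>. ((Z m \<omega>)\<^sup>2)\<^sup>2)"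
      unfolding four by (rule mom(2)[OF l], rule mom(2)[OF m])
    show "integrable M (\<lambda>\<omega>. (Z l \<omega>)\<^sup>2 * (Z m \<omega>)\<^sup>2)"
      by (rule integral_cauchy_schwarz(1)[OF meas[OF l] meas[OF m] i])
    have "(\<integral>\<omega>. (Z l \<omega>)\<^sup>2 * (Z m \<omega>)\<^sup>2 \<partial>M) \<le> sqrt (3 * (?v l)\<^sup>2) * sqrt (3 * (?v m)\<^sup>2)"
      using integral_cauchy_schwarz(2)[OF meas[OF l] meas[OF m] i] unfolding four mom(3)[OF l] mom(3)[OF m] by (rule abs_le_D1)
    also have "\<dots> = (sqrt 3 * sqrt 3) * (?v l * ?v m)" by (simp add: real_sqrt_mult)
    finally show "(\<integral>\<omega>. (Z l \<omega>)\<^sup>2 * (Z m \<omega>)\<^sup>2 \<partial>M) \<le> 3 * (?v l * ?v m)" by simp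
  qed
  show i1: "integrable M (\<lambda>\<omega>. \<Sum>l<n. (Z l \<omega>)\<^sup>2)" by (intro Bochner_Integration.integrable_sum mom(1)) auto
  have sq: "(\<Sum>l<n. (Z l \<omega>)\<^sup>2)\<^sup>2 = (\<Sum>l<n. \<Sum>m<n. (Z l \<omega>)\<^sup>2 * (Z m \<omega>)\<^sup>2)" for \<omega>
    unfolding power2_eq_square[of "\<Sum>l<n. (Z l \<omega>)\<^sup>2"] sum_product ..
  show "integrable M (\<lambda>\<omega>. (\<Sum>l<n. (Z l \<omega>)\<^sup>2)\<^sup>2)"
    unfolding sq by (intro Bochner_Integration.integrable_sum pair(1)) auto
  have "(\<integral>\<omega>. (\<Sum>l<n. (Z l \<omega>)\<^sup>2)\<^sup>2 \<partial>M) = (\<Sum>l<n. \<integral>\<omega>. (\<Sum>m<n. (Z l \<omega>)\<^sup>2 * (Z m \<omega>)\<^sup>2) \<partial>M)"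
    unfolding sq by (intro Bochner_Integration.integral_sum Bochner_Integration.integrable_sum pair(1)) auto
  also have "\<dots> = (\<Sum>l<n. \<Sum>m<n. \<integral>\<omega>. (Z l \<omega>)\<^sup>2 * (Z m \<omega>)\<^sup>2 \<partial>M)"
    by (rule sum.cong[OF refl], rule Bochner_Integration.integral_sum, rule pair(1)) auto
  also have "\<dots> \<le> (\<Sum>l<n. \<Sum>m<n. 3 * (?v l * ?v m))" by (intro sum_mono pair(2)) auto
  also have "\<dots> = 3 * (\<Sum>l<n. ?v l)\<^sup>2" unfolding power2_eq_square[of "\<Sum>l<n. ?v l"] sum_product by (simp only: sum_distrib_left)
  also have "(\<Sum>l<n. ?v l) = (\<integral>\<omega>. (\<Sum>l<n. (Z l \<omega>)\<^sup>2) \<partial>M)"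
    by (rule Bochner_Integration.integral_sum[symmetric], rule mom(1)) auto
  finally show "(\<integral>\<omega>. (\<Sum>l<n. (Z l \<omega>)\<^sup>2)\<^sup>2 \<partial>M) \<le> 3 * (\<integral>\<omega>. (\<Sum>l<n. (Z l \<omega>)\<^sup>2) \<partial>M)\<^sup>2" .
qed

text \<open>The Paley--Zygmund inequality in contrapositive form: a variable with \<open>E q\<^sup>2 \<le> 3 (E q)\<^sup>2\<close> exceeds any number below half its mean with probability greater than \<open>1/12\<close>.\<close>

lemma expectation_le_of_small_tail:
  fixes q :: "'w \<Rightarrow> real"
  assumes M: "prob_space M" and q: "integrable M q" "\<And>\<omega>. 0 \<le> q \<omega>" "integrable M (\<lambda>\<omega>. (q \<omega>)\<^sup>2)"
    and mom: "(\<integral>\<omega>. (q \<omega>)\<^sup>2 \<partial>M) \<le> 3 * (\<integral>\<omega>. q \<omega> \<partial>M)\<^sup>2"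
    and R: "0 \<le> R" and tail: "measure M {\<omega> \<in> space M. q \<omega> > R} \<le> 1 / 12"
  shows "(\<integral>\<omega>. q \<omega> \<partial>M) \<le> 2 * R"
proof -
  interpret prob_space M by (rule M)
  have [measurable]: "q \<in> borel_measurable M" using q(1) by simp
  let ?E = "\<integral>\<omega>. q \<omega> \<partial>M" and ?B = "{\<omega> \<in> space M. q \<omega> > R}"
  show ?thesis
  proof (cases "?E > 0")
    case True
    \<comment> \<open>on the event \<open>q > R\<close> use \<open>q \<le> \<lambda> q\<^sup>2 + 1/(4\<lambda>)\<close> with \<open>\<lambda> = 1/(12 E q)\<close>\<close>
    have "?E \<le> (\<integral>\<omega>. R + ((q \<omega>)\<^sup>2 / (12 * ?E) + 3 * ?E * indicator ?B \<omega>) \<partial>M)"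
    proof (rule integral_mono)
      fix \<omega> assume w: "\<omega> \<in> space M"
      have "0 \<le> (q \<omega> - 6 * ?E)\<^sup>2" by simp
      then have "12 * ?E * q \<omega> \<le> (q \<omega>)\<^sup>2 + 36 * ?E\<^sup>2" by (simp add: power2_diff power_mult_distrib mult_ac)
      then have b: "q \<omega> \<le> (q \<omega>)\<^sup>2 / (12 * ?E) + 3 * ?E" using True by (simp add: field_simps power2_eq_square)
      have n: "0 \<le> (q \<omega>)\<^sup>2 / (12 * ?E)" using True by simp
      show "q \<omega> \<le> R + ((q \<omega>)\<^sup>2 / (12 * ?E) + 3 * ?E * indicator ?B \<omega>)"
      proof (cases "q \<omega> > R")
        case True
        then have "3 * ?E * indicator ?B \<omega> = 3 * ?E" using w by (simp add: indicator_def)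
        then show ?thesis using b R by linarith
      next
        case False
        then have "3 * ?E * indicator ?B \<omega> = 0" by (simp add: indicator_def)
        then show ?thesis using n False by linarith
      qed
    qed (use q in \<open>auto intro!: Bochner_Integration.integrable_add integrable_real_indicator integrable_mult_right simp: emeasure_eq_measure\<close>)
    also have "\<dots> = R + ((\<integral>\<omega>. (q \<omega>)\<^sup>2 \<partial>M) / (12 * ?E) + 3 * ?E * measure M ?B)"
    proof -
      have i2: "integrable M (\<lambda>\<omega>. (q \<omega>)\<^sup>2 / (12 * ?E))" using q(3) by simp
      have i3: "integrable M (\<lambda>\<omega>. 3 * ?E * indicator ?B \<omega>)" by (intro integrable_mult_right integrable_real_indicator) (auto simp: emeasure_eq_measure)
      have "(\<integral>\<omega>. R + ((q \<omega>)\<^sup>2 / (12 * ?E) + 3 * ?E * indicator ?B \<omega>) \<partial>M) = (\<integral>\<omega>. R \<partial>M) + ((\<integral>\<omega>. (q \<omega>)\<^sup>2 / (12 * ?E) \<partial>M) + (\<integral>\<omega>. 3 * ?E * indicator ?B \<omega> \<partial>M))"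
        using i2 i3 by (subst Bochner_Integration.integral_add, simp, simp, subst Bochner_Integration.integral_add) auto
      then show ?thesis by (simp add: prob_space Int_absorb1 Collect_conj_eq Int_commute)
    qed
    also have "\<dots> \<le> R + (?E / 4 + ?E / 4)"
    proof (intro add_left_mono add_mono)
      have "(\<integral>\<omega>. (q \<omega>)\<^sup>2 \<partial>M) / (12 * ?E) \<le> (3 * ?E\<^sup>2) / (12 * ?E)" using True by (intro divide_right_mono mom) auto
      also have "\<dots> = ?E / 4" using True by (simp add: power2_eq_square)
      finally show "(\<integral>\<omega>. (q \<omega>)\<^sup>2 \<partial>M) / (12 * ?E) \<le> ?E / 4" .
      have "3 * ?E * measure M ?B \<le> 3 * ?E * (1 / 12)" using True by (intro mult_left_mono tail) auto
      then show "3 * ?E * measure M ?B \<le> ?E / 4" by simp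
    qed
    finally show ?thesis by simp
  qed (use R in simp)
qed

text \<open>The bound \<open>K\<close> may depend on the path in a non-measurable way, e.g. as the norm of the path; the events \<open>\<exists>N. q N > m\<close> are measurable and decrease to a null set.\<close>

lemma uniform_tail_of_pathwise_bound:
  fixes q :: "nat \<Rightarrow> 'w \<Rightarrow> real"
  assumes M: "prob_space M" and q[measurable]: "\<And>N. q N \<in> borel_measurable M"
    and b: "AE \<omega> in M. \<exists>K. \<forall>N. q N \<omega> \<le> K" and e: "\<epsilon> > 0"
  shows "\<exists>R\<ge>0. \<forall>N. measure M {\<omega> \<in> space M. q N \<omega> > R} \<le> \<epsilon>"
proof -
  interpret prob_space M by (rule M)
  define A where "A m = {\<omega> \<in> space M. \<exists>N. q N \<omega> > real m}" for m
  have [measurable]: "A m \<in> sets M" for m unfolding A_def by measurable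
  have "(\<lambda>m. measure M (A m)) \<longlonglongrightarrow> measure M (\<Inter>m. A m)"
    by (rule finite_Lim_measure_decseq) (auto simp: decseq_def A_def, meson less_eq_real_def of_nat_mono order_le_less_trans)
  moreover have "measure M (\<Inter>m. A m) = 0"
  proof -
    have "AE \<omega> in M. \<omega> \<notin> (\<Inter>m. A m)"
      using b
    proof eventually_elim
      case (elim \<omega>)
      then obtain K where K: "\<And>N. q N \<omega> \<le> K" by blast
      obtain m :: nat where "K \<le> real m" using real_arch_simple by blast
      then have "\<not> q N \<omega> > real m" for N using K[of N] by linarith
      then have "\<omega> \<notin> A m" by (simp add: A_def)
      then show ?case by blast
    qed
    moreover have eq: "{\<omega> \<in> space M. \<not> \<omega> \<notin> (\<Inter>m. A m)} = (\<Inter>m. A m)" by (auto simp: A_def)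
    moreover have "(\<Inter>m. A m) \<in> sets M" by measurable
    ultimately have "emeasure M (\<Inter>m. A m) = 0" using AE_iff_measurable[OF _ eq] by simp
    then show ?thesis by (simp add: measure_def)
  qed
  ultimately have "eventually (\<lambda>m. measure M (A m) < \<epsilon>) sequentially" using e by (auto dest: order_tendstoD)
  then obtain m where m: "measure M (A m) < \<epsilon>" by (auto simp: eventually_sequentially)
  show ?thesis
  proof (intro exI[of _ "real m"] conjI allI)
    fix N
    have "measure M {\<omega> \<in> space M. q N \<omega> > real m} \<le> measure M (A m)" by (rule finite_measure_mono) (auto simp: A_def)
    then show "measure M {\<omega> \<in> space M. q N \<omega> > real m} \<le> \<epsilon>" using m by simp
  qed simp
qed

lemma gaussian_process_combination:
  assumes X: "centered_gaussian_process M T X" and I: "finite I" "p ` I \<subseteq> T"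
  shows "centered_gaussian M (\<lambda>\<omega>. \<Sum>i\<in>I. a i * X (p i) \<omega>)"
proof -
  have "(\<Sum>i\<in>I. a i * X (p i) \<omega>) = (\<Sum>t\<in>p ` I. (\<Sum>i\<in>{i \<in> I. p i = t}. a i) * X t \<omega>)" for \<omega>
    unfolding sum_distrib_right by (subst sum.image_gen[OF I(1), of _ p]) (auto intro!: sum.cong)
  then show ?thesis using X I unfolding centered_gaussian_process_def by simp
qed

lemma gaussian_process_integrable:
  assumes M: "prob_space M" and X: "centered_gaussian_process M T X" and t: "t \<in> T" "t' \<in> T"
  shows "integrable M (\<lambda>\<omega>. X t \<omega> * X t' \<omega>)"
proof -
  have g: "centered_gaussian M (X t)" if "t \<in> T" for t
    using gaussian_process_combination[OF X, of "{()}" "\<lambda>_. t" "\<lambda>_. 1"] that by simp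
  show ?thesis
    using t X by (intro integral_cauchy_schwarz(1) centered_gaussian_moments(1)[OF M] g) (auto simp: centered_gaussian_process_def)
qed

text \<open>The process restricted to this line has the covariance \<open>k0\<close> up to the constant \<open>k0(1/2,1/2)\<^sup>d\<^sup>-\<^sup>1\<close>.\<close>

definition axis_line :: "'d \<Rightarrow> real \<Rightarrow> real ^ 'd" where
  "axis_line i0 x = (\<chi> i. if i = i0 then x else 1 / 2)"

lemma axis_line_in: "x \<in> unit_interval \<Longrightarrow> axis_line i0 x \<in> unit_cube"
  by (simp add: axis_line_def unit_cube_def)

lemma prod_axis_line:
  fixes i0 :: "'d::finite"
  shows "(\<Prod>i\<in>UNIV. k (axis_line i0 x $ i) (axis_line i0 y $ i)) = k x y * (k (1/2) (1/2) :: real) ^ (CARD('d) - 1)"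
proof -
  have "(\<Prod>i\<in>UNIV. k (axis_line i0 x $ i) (axis_line i0 y $ i)) = k x y * (\<Prod>i\<in>UNIV - {i0}. k (axis_line i0 x $ i) (axis_line i0 y $ i))"
    by (subst prod.remove[of UNIV i0]) (auto simp: axis_line_def)
  also have "(\<Prod>i\<in>UNIV - {i0}. k (axis_line i0 x $ i) (axis_line i0 y $ i)) = (\<Prod>i\<in>UNIV - {i0}. k (1/2) (1/2))"
    by (intro prod.cong) (auto simp: axis_line_def)
  finally show ?thesis by (simp add: card_Diff_singleton)
qed

lemma axis_line_second_moment:
  fixes X :: "real ^ 'd \<Rightarrow> 'w \<Rightarrow> real" and i0 :: 'd
  assumes int: "\<And>t t'. t \<in> unit_cube \<Longrightarrow> t' \<in> unit_cube \<Longrightarrow> integrable M (\<lambda>\<omega>. X t \<omega> * X t' \<omega>)"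
    and cov: "\<And>t t'. t \<in> unit_cube \<Longrightarrow> t' \<in> unit_cube \<Longrightarrow>
      (\<integral>\<omega>. X t \<omega> * X t' \<omega> \<partial>M) = (\<Prod>i\<in>UNIV. k0 (t $ i) (t' $ i))"
    and k0: "rkhs_of_kernel unit_interval k0 H0" and p: "p ` I \<subseteq> unit_interval"
  shows "(\<integral>\<omega>. (\<Sum>i\<in>I. w i * X (axis_line i0 (p i)) \<omega>)\<^sup>2 \<partial>M) = (k0 (1/2) (1/2)) ^ (CARD('d) - 1) *
    ip H0 (\<lambda>y. \<Sum>i\<in>I. w i * kernel_section unit_interval k0 (p i) y) (\<lambda>y. \<Sum>i\<in>I. w i * kernel_section unit_interval k0 (p i) y)"
proof -
  interpret H: function_rkhs unit_interval H0 by (rule rkhs_of_kernelD(1)[OF k0])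
  let ?k = "(k0 (1/2) (1/2)) ^ (CARD('d) - 1)"
  have pin: "p i \<in> unit_interval" if "i \<in> I" for i using p that by auto
  note t = axis_line_in[OF pin, of _ i0]
  have "(\<integral>\<omega>. (\<Sum>i\<in>I. w i * X (axis_line i0 (p i)) \<omega>)\<^sup>2 \<partial>M)
    = (\<integral>\<omega>. (\<Sum>i\<in>I. \<Sum>j\<in>I. (w i * w j) * (X (axis_line i0 (p i)) \<omega> * X (axis_line i0 (p j)) \<omega>)) \<partial>M)"
    by (simp add: power2_eq_square sum_product mult_ac)
  also have "\<dots> = (\<Sum>i\<in>I. \<integral>\<omega>. (\<Sum>j\<in>I. (w i * w j) * (X (axis_line i0 (p i)) \<omega> * X (axis_line i0 (p j)) \<omega>)) \<partial>M)"
    by (intro Bochner_Integration.integral_sum Bochner_Integration.integrable_sum integrable_mult_right int t)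
  also have "\<dots> = (\<Sum>i\<in>I. \<Sum>j\<in>I. \<integral>\<omega>. (w i * w j) * (X (axis_line i0 (p i)) \<omega> * X (axis_line i0 (p j)) \<omega>) \<partial>M)"
    by (rule sum.cong[OF refl], rule Bochner_Integration.integral_sum) (intro integrable_mult_right int t)
  also have "\<dots> = (\<Sum>i\<in>I. \<Sum>j\<in>I. ?k * (w i * w j * ip H0 (kernel_section unit_interval k0 (p i)) (kernel_section unit_interval k0 (p j))))"
  proof (intro sum.cong refl)
    fix i j assume i: "i \<in> I" and j: "j \<in> I"
    have "ip H0 (kernel_section unit_interval k0 (p i)) (kernel_section unit_interval k0 (p j)) = k0 (p i) (p j)"
      using rkhs_of_kernelD(3)[OF k0 pin[OF j] rkhs_of_kernelD(2)[OF k0 pin[OF i]]] pin[OF j] by (simp add: zero_ext_def)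
    then show "(\<integral>\<omega>. (w i * w j) * (X (axis_line i0 (p i)) \<omega> * X (axis_line i0 (p j)) \<omega>) \<partial>M)
      = ?k * (w i * w j * ip H0 (kernel_section unit_interval k0 (p i)) (kernel_section unit_interval k0 (p j)))"
      unfolding integral_mult_right_zero cov[OF t[OF i] t[OF j]] prod_axis_line by simp
  qed
  also have "\<dots> = ?k * (\<Sum>i\<in>I. \<Sum>j\<in>I. w i * w j * ip H0 (kernel_section unit_interval k0 (p i)) (kernel_section unit_interval k0 (p j)))"
    by (simp only: sum_distrib_left)
  also have "(\<Sum>i\<in>I. \<Sum>j\<in>I. w i * w j * ip H0 (kernel_section unit_interval k0 (p i)) (kernel_section unit_interval k0 (p j)))
    = ip H0 (\<lambda>y. \<Sum>i\<in>I. w i * kernel_section unit_interval k0 (p i) y) (\<lambda>y. \<Sum>i\<in>I. w i * kernel_section unit_interval k0 (p i) y)"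
    by (rule H.ip_sum_sum[symmetric]; intro rkhs_of_kernelD(2)[OF k0] pin)
  finally show ?thesis .
qed


section \<open>The dichotomy\<close>

lemma paths_in_imp_AE:
  assumes M: "prob_space M" and v: "version_of M T X Y" and p: "paths_in M T Y H" and t: "\<And>i::nat. t i \<in> T"
  shows "AE \<omega> in M. sample_path T Y \<omega> \<in> fns H \<and> (\<forall>i. X (t i) \<omega> = sample_path T Y \<omega> (t i))"
proof -
  interpret prob_space M by (rule M)
  have ae: "AE \<omega> in M. P \<omega>" if "prob {\<omega> \<in> space M. P \<omega>} = 1" for P
  proof -
    have "{\<omega> \<in> space M. P \<omega>} \<in> sets M" using that measure_notin_sets by fastforce
    from prob_Collect_eq_1[OF this] that show ?thesis by simp
  qed
  have "AE \<omega> in M. sample_path T Y \<omega> \<in> fns H" by (rule ae) (use p in \<open>simp add: paths_in_def\<close>)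
  moreover have "AE \<omega> in M. X (t i) \<omega> = Y (t i) \<omega>" for i by (rule ae) (use v t in \<open>simp add: version_of_def\<close>)
  then have "AE \<omega> in M. \<forall>i. X (t i) \<omega> = Y (t i) \<omega>" by (simp add: AE_all_countable)
  ultimately show ?thesis by eventually_elim (simp add: sample_path_def zero_ext_def t)
qed

lemma (in function_rkhs) bounded_functions_kernel_bound:
  assumes b: "\<And>f. f \<in> fns H \<Longrightarrow> bounded (f ` T)"
    and h: "\<And>t. t \<in> T \<Longrightarrow> h t \<in> fns H" "\<And>t f. t \<in> T \<Longrightarrow> f \<in> fns H \<Longrightarrow> ip H f (h t) = f t"
  shows "\<exists>D. \<forall>t\<in>T. ip H (h t) (h t) \<le> D\<^sup>2"
proof -
  have "\<exists>D. \<forall>g\<in>h ` T. fnorm H g \<le> D"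
  proof (rule uniform_boundedness)
    fix f assume f: "f \<in> fns H"
    obtain C where "\<And>t. t \<in> T \<Longrightarrow> \<bar>f t\<bar> \<le> C" using b[OF f] by (auto simp: bounded_iff)
    then show "\<exists>C. \<forall>g\<in>h ` T. \<bar>ip H f g\<bar> \<le> C" using h(2)[OF _ f] by auto
  qed (use h(1) in auto)
  then obtain D where D: "\<And>t. t \<in> T \<Longrightarrow> fnorm H (h t) \<le> D" by blast
  have "ip H (h t) (h t) \<le> D\<^sup>2" if t: "t \<in> T" for t
    using power_mono[OF D[OF t] fnorm_nonneg[OF h(1)[OF t]], of 2] fnorm_sq[OF h(1)[OF t]] by simp
  then show ?thesis by blast
qed

lemma harmonic_sums_unbounded: "\<exists>N>0. K < (\<Sum>j<N - 1. 1 / real (Suc j))\<^sup>2"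
proof -
  have "eventually (\<lambda>n. \<bar>K\<bar> + 1 \<le> (harm n :: real)) sequentially" using harm_at_top by (simp add: filterlim_at_top)
  then obtain n where n: "\<bar>K\<bar> + 1 \<le> (harm n :: real)" by (auto simp: eventually_sequentially)
  have "harm n = (\<Sum>j<n. 1 / real (Suc j))"
    unfolding harm_def One_nat_def sum.atLeast1_atMost_eq by (simp add: inverse_eq_divide)
  moreover have "K < (harm n :: real)\<^sup>2"
  proof -
    have "\<bar>K\<bar> + 1 \<le> (harm n :: real) * 1" using n by simp
    also have "\<dots> \<le> harm n * harm n" using n by (intro mult_left_mono) auto
    finally show ?thesis by (simp add: power2_eq_square)
  qed
  ultimately show ?thesis by (intro exI[of _ "Suc n"]) simp
qed

text \<open>The points \<open>p N i = (i+1)/N\<close>, \<open>i < N - 1\<close>, vary with \<open>N\<close>, but the Gram--Schmidt functionals of any of these systems satisfy Bessel's inequality for the same path,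
so the bound of their variances is uniform in \<open>N\<close>. A linear relation among kernel sections of \<open>H\<close> holds for almost all paths, hence it annihilates the combination of
sections of \<open>k0\<close>, and by the comparison with the sine system also the functions \<open>\<psi> k\<close>. This transfers the Gram--Schmidt expansion from \<open>H\<close> to \<open>\<psi> k\<close> and provides
the factorisation.\<close>

theorem rough_process_has_no_rkhs_version:
  fixes X :: "real ^ 'd \<Rightarrow> 'w \<Rightarrow> real" and H :: "(real ^ 'd) fun_space"
  assumes M: "prob_space M" and X: "centered_gaussian_process M unit_cube X"
    and cov: "\<And>t t'. t \<in> unit_cube \<Longrightarrow> t' \<in> unit_cube \<Longrightarrow>
      (\<integral>\<omega>. X t \<omega> * X t' \<omega> \<partial>M) = (\<Prod>i\<in>UNIV. k0 (t $ i) (t' $ i))"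
    and k0: "rkhs_of_kernel unit_interval k0 H0" and H0: "fns H0 = sobolev_01 s" and s: "s \<le> 1"
    and H: "rkhs unit_cube H" "fns H \<subseteq> bounded_borel_functions unit_cube"
    and Y: "version_of M unit_cube X Y" "paths_in M unit_cube Y H"
  shows False
proof -
  interpret prob_space M by (rule M)
  interpret H: function_rkhs "unit_cube :: (real ^ 'd) set" H by (rule function_rkhs.intro[OF H(1)])
  define i0 :: 'd where "i0 = undefined"
  note int = gaussian_process_integrable[OF M X]
  define comb where "comb I p w = (\<lambda>y. \<Sum>i\<in>I. w i * kernel_section unit_interval k0 (p i) y)" for I :: "nat set" and p w :: "nat \<Rightarrow> real"
  define \<psi> where "\<psi> k x = sin (pi * real (Suc k) * x) / real (Suc k)" for k :: nat and x :: real
  obtain C where C: "C \<ge> 0" and bes: "\<And>I p w n. finite I \<Longrightarrow> p ` I \<subseteq> unit_interval \<Longrightarrow>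
      (\<Sum>k<n. (\<Sum>i\<in>I. w i * \<psi> k (p i))\<^sup>2) \<le> C * ip H0 (comb I p w) (comb I p w)"
    using sine_bessel[OF k0 H0 s] unfolding comb_def \<psi>_def by blast
  define \<kappa> where "\<kappa> = (k0 (1/2) (1/2)) ^ (CARD('d) - 1)"
  \<comment> \<open>the first sine function does not vanish at \<open>1/2\<close>\<close>
  have "0 < k0 (1/2) (1/2)"
  proof (rule ccontr)
    assume n: "\<not> 0 < k0 (1/2) (1/2)"
    have h: "(1/2 :: real) \<in> unit_interval" by simp
    have "ip H0 (kernel_section unit_interval k0 (1/2)) (kernel_section unit_interval k0 (1/2)) = k0 (1/2) (1/2)"
      using rkhs_of_kernelD(3)[OF k0 h rkhs_of_kernelD(2)[OF k0 h]] by (simp add: zero_ext_def)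
    then have "ip H0 (comb {0} (\<lambda>_. 1/2) (\<lambda>_. 1)) (comb {0} (\<lambda>_. 1/2) (\<lambda>_. 1)) = k0 (1/2) (1/2)"
      by (simp add: comb_def)
    then have "1 \<le> C * k0 (1/2) (1/2)" using bes[of "{0}" "\<lambda>_. 1/2" "\<lambda>_. 1" 1] by (simp add: \<psi>_def)
    moreover have "C * k0 (1/2) (1/2) \<le> 0" using C n by (simp add: mult_nonneg_nonpos)
    ultimately show False by simp
  qed
  then have \<kappa>: "\<kappa> > 0" by (simp add: \<kappa>_def)
  have "\<exists>h. (\<forall>t::real ^ 'd. t \<in> unit_cube \<longrightarrow> h t \<in> fns H) \<and> (\<forall>t f. t \<in> unit_cube \<longrightarrow> f \<in> fns H \<longrightarrow> ip H f (h t) = f t)"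
    by (rule H.kernel_exists) blast
  then obtain h where h: "\<And>t::real ^ 'd. t \<in> unit_cube \<Longrightarrow> h t \<in> fns H" "\<And>t f. t \<in> unit_cube \<Longrightarrow> f \<in> fns H \<Longrightarrow> ip H f (h t) = f t"
    by blast
  obtain D where D: "\<And>t. t \<in> unit_cube \<Longrightarrow> ip H (h t) (h t) \<le> D\<^sup>2"
    using H.bounded_functions_kernel_bound[OF _ h] H(2) by (force simp: bounded_borel_functions_def)
  define p where "p N i = (if i < N - 1 then real (Suc i) / real N else 1 / 2)" for N i :: nat
  have p: "p N i \<in> unit_interval" for N i by (auto simp: p_def)
  define t where "t N i = axis_line i0 (p N i)" for N i
  have t: "t N i \<in> unit_cube" for N i unfolding t_def by (rule axis_line_in[OF p])
  define v where "v N i = h (t N i)" for N i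
  have v: "v N i \<in> fns H" for N i unfolding v_def by (rule h(1)[OF t])
  define GS where "GS N g \<beta> \<longleftrightarrow> H.orthonormal_or_zero g \<and> (\<forall>n. g n = (\<lambda>x. \<Sum>i\<le>n. \<beta> n i * v N i x)) \<and>
     (\<forall>n. v N n = (\<lambda>x. \<Sum>i\<le>n. ip H (v N n) (g i) * g i x))" for N g and \<beta> :: "nat \<Rightarrow> nat \<Rightarrow> real"
  have "\<exists>g \<beta>. GS N g \<beta>" for N unfolding GS_def by (rule H.gram_schmidt[OF v])
  then obtain g \<beta> where GS: "\<And>N. GS N (g N) (\<beta> N)" by metis
  have g: "H.orthonormal_or_zero (g N)" for N using GS[of N] unfolding GS_def by (elim conjE)
  have g\<beta>: "g N n = (\<lambda>x. \<Sum>i\<le>n. \<beta> N n i * v N i x)" for N n using GS[of N] unfolding GS_def by (elim conjE allE)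
  have vg: "v N n = (\<lambda>x. \<Sum>i\<le>n. ip H (v N n) (g N i) * g N i x)" for N n using GS[of N] unfolding GS_def by (elim conjE) (erule allE)
  define z where "z N l \<omega> = (\<Sum>i\<le>l. \<beta> N l i * X (t N i) \<omega>)" for N l \<omega>
  define q where "q N \<omega> = (\<Sum>l<N - 1. (z N l \<omega>)\<^sup>2)" for N \<omega>
  have zg: "centered_gaussian M (z N l)" for N l
    unfolding z_def using t by (intro gaussian_process_combination[OF X]) auto
  have qm: "q N \<in> borel_measurable M" for N
    unfolding q_def using zg by (intro borel_measurable_sum borel_measurable_power) (simp add: centered_gaussian_def)
  have ipv: "ip H y (\<lambda>x. \<Sum>i\<in>I. a i * v N i x) = (\<Sum>i\<in>I. a i * y (t N i))" if y: "y \<in> fns H" for y I a N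
  proof -
    have "ip H y (\<lambda>x. \<Sum>i\<in>I. a i * v N i x) = ip H (\<lambda>x. \<Sum>i\<in>I. a i * v N i x) y" by (rule H.ip_sym[OF y H.sum_in[OF v]])
    also have "\<dots> = (\<Sum>i\<in>I. a i * ip H (v N i) y)" by (rule H.ip_sum[OF v y])
    also have "\<dots> = (\<Sum>i\<in>I. a i * y (t N i))" using H.ip_sym[OF v y] h(2)[OF t y] by (simp add: v_def)
    finally show ?thesis .
  qed
  let ?y = "sample_path unit_cube Y"
  have good: "AE \<omega> in M. ?y \<omega> \<in> fns H \<and> (\<forall>i. X (t N i) \<omega> = ?y \<omega> (t N i))" for N
    by (rule paths_in_imp_AE[OF M Y t])
  then have goodN: "AE \<omega> in M. \<forall>N. ?y \<omega> \<in> fns H \<and> (\<forall>i. X (t N i) \<omega> = ?y \<omega> (t N i))" by (simp only: AE_all_countable) blast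
  have "AE \<omega> in M. \<exists>K. \<forall>N. q N \<omega> \<le> K"
    using goodN
  proof eventually_elim
    case (elim \<omega>)
    then have y: "?y \<omega> \<in> fns H" by blast
    have "z N l \<omega> = ip H (?y \<omega>) (g N l)" for N l
      unfolding g\<beta> ipv[OF y] z_def using elim by simp
    then have "q N \<omega> \<le> ip H (?y \<omega>) (?y \<omega>)" for N
      unfolding q_def using H.bessel[OF g y, of "{..<N - 1}"] by simp
    then show ?case by blast
  qed
  from uniform_tail_of_pathwise_bound[OF M qm this, of "1/12"]
  obtain R where R: "R \<ge> 0" "\<And>N. prob {\<omega> \<in> space M. q N \<omega> > R} \<le> 1/12" by auto
  have Eq: "(\<integral>\<omega>. q N \<omega> \<partial>M) \<le> 2 * R" for N
  proof (rule expectation_le_of_small_tail[OF M _ _ _ _ R(1) R(2)])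
    show "0 \<le> q N \<omega>" for \<omega> by (simp add: q_def sum_nonneg)
    show "integrable M (q N)" "integrable M (\<lambda>\<omega>. (q N \<omega>)\<^sup>2)" "(\<integral>\<omega>. (q N \<omega>)\<^sup>2 \<partial>M) \<le> 3 * (\<integral>\<omega>. q N \<omega> \<partial>M)\<^sup>2"
      unfolding q_def by (rule gaussian_quadratic_second_moment[OF M zg])+
  qed
  have second: "(\<integral>\<omega>. (\<Sum>i\<in>I. w i * X (t N i) \<omega>)\<^sup>2 \<partial>M) = \<kappa> * ip H0 (comb I (p N) w) (comb I (p N) w)" for I w N
    unfolding t_def \<kappa>_def comb_def using p by (intro axis_line_second_moment[OF int cov k0]) auto
  define Z where "Z N l j = (\<Sum>i\<le>l. \<beta> N l i * \<psi> j (p N i))" for N l j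
  have Zb: "(\<Sum>l<N - 1. \<Sum>j<N - 1. (Z N l j)\<^sup>2) \<le> C * (2 * R / \<kappa>)" for N
  proof -
    have "(\<Sum>l<N - 1. \<Sum>j<N - 1. (Z N l j)\<^sup>2) \<le> (\<Sum>l<N - 1. C * ((\<integral>\<omega>. (z N l \<omega>)\<^sup>2 \<partial>M) / \<kappa>))"
    proof (intro sum_mono)
      fix l
      have "(\<Sum>j<N - 1. (Z N l j)\<^sup>2) \<le> C * ip H0 (comb {..l} (p N) (\<beta> N l)) (comb {..l} (p N) (\<beta> N l))"
        unfolding Z_def using p by (intro bes) auto
      also have "ip H0 (comb {..l} (p N) (\<beta> N l)) (comb {..l} (p N) (\<beta> N l)) = (\<integral>\<omega>. (z N l \<omega>)\<^sup>2 \<partial>M) / \<kappa>"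
        unfolding z_def second using \<kappa> by simp
      finally show "(\<Sum>j<N - 1. (Z N l j)\<^sup>2) \<le> C * ((\<integral>\<omega>. (z N l \<omega>)\<^sup>2 \<partial>M) / \<kappa>)" .
    qed
    also have "\<dots> = C * ((\<integral>\<omega>. q N \<omega> \<partial>M) / \<kappa>)"
      unfolding q_def by (subst Bochner_Integration.integral_sum) (auto simp: sum_distrib_left sum_divide_distrib intro: centered_gaussian_moments(1)[OF M zg])
    also have "\<dots> \<le> C * (2 * R / \<kappa>)" using \<kappa> by (intro mult_left_mono divide_right_mono Eq C) auto
    finally show ?thesis .
  qed
  have fac: "\<psi> j (p N i) = (\<Sum>l\<le>i. ip H (v N i) (g N l) * Z N l j)" for N i j
  proof -
    \<comment> \<open>the linear relation expressing \<open>v i\<close> through the Gram--Schmidt vectors is a relation among \<open>v 0, \<dots>, v i\<close>\<close>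
    define a where "a m = (if m = i then 1 else 0) - (\<Sum>l\<le>i. if m \<le> l then ip H (v N i) (g N l) * \<beta> N l m else 0)" for m
    have rel: "(\<Sum>m\<le>i. a m * F m) = F i - (\<Sum>l\<le>i. ip H (v N i) (g N l) * (\<Sum>m\<le>l. \<beta> N l m * F m))" for F :: "nat \<Rightarrow> real"
    proof -
      have "(\<Sum>m\<le>i. (\<Sum>l\<le>i. if m \<le> l then ip H (v N i) (g N l) * \<beta> N l m else 0) * F m)
        = (\<Sum>m\<le>i. \<Sum>l\<le>i. (if m \<le> l then ip H (v N i) (g N l) * \<beta> N l m * F m else 0))"
        unfolding sum_distrib_right by (intro sum.cong refl) simp
      also have "\<dots> = (\<Sum>l\<le>i. \<Sum>m\<le>i. (if m \<le> l then ip H (v N i) (g N l) * \<beta> N l m * F m else 0))" by (rule sum.swap)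
      also have "\<dots> = (\<Sum>l\<le>i. ip H (v N i) (g N l) * (\<Sum>m\<le>l. \<beta> N l m * F m))"
      proof (rule sum.cong[OF refl])
        fix l assume "l \<in> {..i}"
        then have "(\<Sum>m\<le>i. (if m \<le> l then ip H (v N i) (g N l) * \<beta> N l m * F m else 0)) = (\<Sum>m\<le>l. ip H (v N i) (g N l) * \<beta> N l m * F m)"
          by (intro sum.mono_neutral_cong_right) auto
        then show "(\<Sum>m\<le>i. (if m \<le> l then ip H (v N i) (g N l) * \<beta> N l m * F m else 0)) = ip H (v N i) (g N l) * (\<Sum>m\<le>l. \<beta> N l m * F m)"
          by (simp add: sum_distrib_left mult.assoc)
      qed
      finally have "(\<Sum>m\<le>i. (\<Sum>l\<le>i. if m \<le> l then ip H (v N i) (g N l) * \<beta> N l m else 0) * F m) = (\<Sum>l\<le>i. ip H (v N i) (g N l) * (\<Sum>m\<le>l. \<beta> N l m * F m))" .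
      moreover have "(\<Sum>m\<le>i. (if m = i then 1 else 0) * F m) = F i"
        by (simp add: if_distrib[of "\<lambda>x. x * _"] cong: if_cong)
      ultimately show ?thesis unfolding a_def left_diff_distrib sum_subtractf by simp
    qed
    have null: "(\<lambda>x. \<Sum>m\<le>i. a m * v N m x) = (\<lambda>x. 0)"
    proof
      fix x
      have "(\<Sum>m\<le>i. a m * v N m x) = v N i x - (\<Sum>l\<le>i. ip H (v N i) (g N l) * g N l x)"
        unfolding rel g\<beta> ..
      also have "\<dots> = 0" using fun_cong[OF vg[of N i], of x] by simp
      finally show "(\<Sum>m\<le>i. a m * v N m x) = 0" .
    qed
    have "AE \<omega> in M. (\<Sum>m\<le>i. a m * X (t N m) \<omega>)\<^sup>2 = 0"
      using good[of N]
    proof eventually_elim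
      case (elim \<omega>)
      then have y: "?y \<omega> \<in> fns H" by blast
      have "(\<Sum>m\<le>i. a m * X (t N m) \<omega>) = ip H (?y \<omega>) (\<lambda>x. \<Sum>m\<le>i. a m * v N m x)"
        unfolding ipv[OF y] using elim by simp
      also have "\<dots> = 0" unfolding null by (rule H.ip_zero_right[OF y])
      finally show ?case by simp
    qed
    then have "(\<integral>\<omega>. (\<Sum>m\<le>i. a m * X (t N m) \<omega>)\<^sup>2 \<partial>M) = 0" by (rule integral_eq_zero_AE)
    then have zero: "ip H0 (comb {..i} (p N) a) (comb {..i} (p N) a) = 0" unfolding second using \<kappa> by simp
    have "(\<Sum>m\<le>i. a m * \<psi> j (p N m))\<^sup>2 \<le> (\<Sum>k<Suc j. (\<Sum>m\<le>i. a m * \<psi> k (p N m))\<^sup>2)"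
      by (rule member_le_sum) auto
    also have "\<dots> \<le> C * ip H0 (comb {..i} (p N) a) (comb {..i} (p N) a)"
      using p by (intro bes) auto
    finally have "(\<Sum>m\<le>i. a m * \<psi> j (p N m))\<^sup>2 \<le> 0" unfolding zero mult_zero_right .
    then have "(\<Sum>m\<le>i. a m * \<psi> j (p N m)) = 0" by simp
    then show ?thesis unfolding rel Z_def by simp
  qed
  have bound: "(\<Sum>j<N - 1. 1 / real (Suc j))\<^sup>2 \<le> 2 * (C * (2 * R / \<kappa>)) * D\<^sup>2" if N: "N > 0" for N
  proof (rule harmonic_factorization_bound[where W = "\<lambda>i l. if l \<le> i then ip H (v N i) (g N l) else 0" and Z = "Z N", OF _ Zb _ _ N])
    fix i j assume i: "i < N - 1"
    have "(\<Sum>l<N - 1. (if l \<le> i then ip H (v N i) (g N l) else 0) * Z N l j) = (\<Sum>l\<le>i. ip H (v N i) (g N l) * Z N l j)"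
      using i by (intro sum.mono_neutral_cong_right) auto
    then show "sin (pi * real (Suc j) * (real (Suc i) / real N)) / real (Suc j) = (\<Sum>l<N - 1. (if l \<le> i then ip H (v N i) (g N l) else 0) * Z N l j)"
      using fac[of j N i] i by (simp add: \<psi>_def p_def)
  next
    fix i assume "i < N - 1"
    have "(\<Sum>l<N - 1. (if l \<le> i then ip H (v N i) (g N l) else 0)\<^sup>2) \<le> (\<Sum>l<N - 1. (ip H (v N i) (g N l))\<^sup>2)"
      by (intro sum_mono) auto
    also have "\<dots> \<le> ip H (v N i) (v N i)" by (rule H.bessel[OF g v]) simp
    also have "\<dots> \<le> D\<^sup>2" unfolding v_def by (rule D[OF t])
    finally show "(\<Sum>l<N - 1. (if l \<le> i then ip H (v N i) (g N l) else 0)\<^sup>2) \<le> D\<^sup>2" .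
  qed simp
  obtain N where "N > 0" "2 * (C * (2 * R / \<kappa>)) * D\<^sup>2 < (\<Sum>j<N - 1. 1 / real (Suc j))\<^sup>2"
    using harmonic_sums_unbounded by blast
  then show False using bound[of N] by linarith
qed

text \<open>The expansion space of the tensor system has the kernel \<open>\<Sum>\<alpha> g\<^sub>\<alpha>(t) g\<^sub>\<alpha>(t')\<close>, which is the product of the Besov kernels, so it is itself the tensor power.\<close>

theorem smooth_process_has_rkhs_version:
  fixes X :: "real ^ 'd \<Rightarrow> 'w \<Rightarrow> real"
  assumes M: "prob_space M" and X: "centered_gaussian_process M unit_cube X"
    and cov: "\<And>t t'. t \<in> unit_cube \<Longrightarrow> t' \<in> unit_cube \<Longrightarrow>
      (\<integral>\<omega>. X t \<omega> * X t' \<omega> \<partial>M) = (\<Prod>i\<in>UNIV. k0 (t $ i) (t' $ i))"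
    and k0: "rkhs_of_kernel unit_interval k0 H0" and H0: "fns H0 = sobolev_01 s" and s: "s > 1/2"
    and r: "r > 1/2" "r < s - 1/2"
  shows "\<exists>(F :: (real ^ 'd) fun_space) Y. tensor_power (besov_01 r) F \<and> rkhs unit_cube F \<and>
    fns F \<subseteq> bounded_borel_functions unit_cube \<and> version_of M unit_cube X Y \<and> paths_in M unit_cube Y F"
proof -
  obtain \<kappa> A b g V B where \<kappa>: "rkhs_of_kernel unit_interval \<kappa> (besov_01 r)"
    and sys: "\<forall>n. finite (A n) \<and> A n \<subseteq> unit_interval" "\<forall>m n. m \<le> n \<longrightarrow> A m \<subseteq> A n"
      "\<forall>n x. x \<notin> A (Suc n) \<longrightarrow> b n x = 0"
      "\<forall>m n. (\<Sum>x\<in>A (Suc n). b n x * g m x) = (if m = n \<and> g n \<noteq> (\<lambda>t. 0) then 1 else 0)"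
      "\<forall>n. g n \<in> fns (besov_01 r)"
      "\<forall>N t. t \<in> unit_interval \<longrightarrow> (\<Sum>n<N. (g n t)\<^sup>2) \<le> B"
      "\<forall>t t'. t \<in> unit_interval \<longrightarrow> t' \<in> unit_interval \<longrightarrow> (\<lambda>n. g n t * g n t') sums \<kappa> t t'"
    and hs: "\<forall>N. (\<Sum>n<N. (fnorm H0 (kernel_comb k0 (A N) (b n)))\<^sup>2) \<le> V"
    and approx: "\<forall>t\<in>unit_interval. (\<lambda>N. fnorm H0 (\<lambda>y. kernel_comb k0 (A N) (\<lambda>x. \<Sum>n<N. g n t * b n x) y
        - kernel_section unit_interval k0 t y)) \<longlonglongrightarrow> 0"
    using hilbert_schmidt_system[OF s r k0 H0] by auto
  interpret S: tensor_system A b g B \<kappa>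
    by standard (use sys besov_01_continuous[of _ r] in auto)
  let ?F = "biorthogonal_system.expansion_space (unit_cube :: (real ^ 'd) set) S.tens S.idx S.nodes S.wts"
  have F: "rkhs_of_kernel unit_cube (\<lambda>t t'. \<Prod>i\<in>UNIV. \<kappa> (t $ i) (t' $ i)) ?F"
    by (intro biorthogonal_system.rkhs_of_kernel_expansion_space S.biorthogonal_tens S.tensor_kernel)
  obtain Y where Y: "version_of M unit_cube X Y" "paths_in M unit_cube Y ?F"
    using S.process_version[OF M _ gaussian_process_integrable[OF M X] cov k0, of V] hs approx X
    by (auto simp: centered_gaussian_process_def)
  have "tensor_power (besov_01 r) ?F" unfolding tensor_power_def using \<kappa> F by blast
  moreover have "rkhs unit_cube ?F" using F by (simp add: rkhs_of_kernel_def)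
  ultimately show ?thesis using S.expansion_space_bounded_borel Y by blast
qed

lemma norm_equivalent_refl: "H \<cong>\<^sub>n H"
  unfolding norm_equivalent_def by (intro conjI refl exI[of _ 1]) auto

theorem theorem4p2:
  fixes M :: "'w measure"
    and X :: "real ^ 'd \<Rightarrow> 'w \<Rightarrow> real"
    and k0 :: "real \<Rightarrow> real \<Rightarrow> real"
    and H0 :: "real fun_space"
    and s :: real
  assumes "prob_space M" and "complete_measure M"
    and "centered_gaussian_process M (unit_cube :: (real ^ 'd) set) X"
    and "\<forall>t\<in>unit_cube. \<forall>t'\<in>unit_cube.
           prob_space.expectation M (\<lambda>\<omega>. X t \<omega> * X t' \<omega>) = (\<Prod>i\<in>UNIV. k0 (t $ i) (t' $ i))"
    and "rkhs_of_kernel unit_interval k0 H0"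
    and "s > 1/2" and "fns H0 = sobolev_01 s"
  shows "(s > 1 \<longleftrightarrow>
            (\<exists>(H :: (real ^ 'd) fun_space) Y. rkhs unit_cube H \<and>
               fns H \<subseteq> bounded_borel_functions unit_cube \<and>
               version_of M unit_cube X Y \<and> paths_in M unit_cube Y H)) \<and>
         (s > 1 \<longrightarrow> (\<forall>r. 1/2 < r \<and> r < s - 1/2 \<longrightarrow>
            (\<exists>(H :: (real ^ 'd) fun_space) Y. rkhs unit_cube H \<and>
               fns H \<subseteq> bounded_borel_functions unit_cube \<and>
               version_of M unit_cube X Y \<and> paths_in M unit_cube Y H \<and>
               (\<exists>F. tensor_power (besov_01 r) F \<and> H \<cong>\<^sub>n F))))"
proof -
  have cov: "(\<integral>\<omega>. X t \<omega> * X t' \<omega> \<partial>M) = (\<Prod>i\<in>UNIV. k0 (t $ i) (t' $ i))" if "t \<in> unit_cube" "t' \<in> unit_cube" for t t'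
    using assms(4) that by blast
  have smooth: "\<exists>(F :: (real ^ 'd) fun_space) Y. tensor_power (besov_01 r) F \<and> rkhs unit_cube F \<and>
    fns F \<subseteq> bounded_borel_functions unit_cube \<and> version_of M unit_cube X Y \<and> paths_in M unit_cube Y F"
    if "1/2 < r" "r < s - 1/2" for r
    by (rule smooth_process_has_rkhs_version[OF assms(1,3) cov assms(5,7,6) that])
  have "s > 1" if "rkhs unit_cube H" "fns H \<subseteq> bounded_borel_functions unit_cube" "version_of M unit_cube X Y" "paths_in M unit_cube Y H"
    for H :: "(real ^ 'd) fun_space" and Y
    using rough_process_has_no_rkhs_version[OF assms(1,3) cov assms(5,7) _ that] by force
  moreover have "\<exists>(H :: (real ^ 'd) fun_space) Y. rkhs unit_cube H \<and> fns H \<subseteq> bounded_borel_functions unit_cube \<and>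
      version_of M unit_cube X Y \<and> paths_in M unit_cube Y H" if s1: "s > 1"
  proof -
    obtain r where "1/2 < r" "r < s - 1/2" using dense[of "1/2" "s - 1/2"] s1 by auto
    from smooth[OF this] show ?thesis by blast
  qed
  moreover have "\<exists>(H :: (real ^ 'd) fun_space) Y. rkhs unit_cube H \<and> fns H \<subseteq> bounded_borel_functions unit_cube \<and>
      version_of M unit_cube X Y \<and> paths_in M unit_cube Y H \<and> (\<exists>F. tensor_power (besov_01 r) F \<and> H \<cong>\<^sub>n F)"
    if "1/2 < r" "r < s - 1/2" for r
    using smooth[OF that] norm_equivalent_refl by blast
  ultimately show ?thesis by blast
qed

end
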